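(* Let $\Omega\subset\mathbb{R}^N$ ($N>2$) be a domain, let $\vec p=(p_1,\dots,p_N)$ with $p_i>1$ for every $i$, and let $\mathcal A_i,\mathcal B_i$ ($i=1,\dots,N$) satisfy the structure assumptions listed in the context, with coefficients $b_i\in L^{\frac{Np_i'}{\bar p},\infty}(\Omega)$. Let $1<\bar p<N$, $\bar p^*>p_{\max}$, and suppose $b_i\in L^{\frac{r_i}{p_i-1}}_{loc}(\Omega)$ and $\mathcal F_i\in L^{r_i}_{loc}(\Omega)$ for $i=1,\dots,N$, with $r_1,\dots,r_N$ satisfying $$\mu=\min_i\left\{\frac{r_i}{p_i}\right\}>\frac N{\bar p}.$$ Then any local solution $u\in W^{1,\vec p}_{loc}(\Omega)$ to the equation $$\sum_{i=1}^N\partial_{x_i}\big(\mathcal A_i(x,\nabla u)+\mathcal B_i(x,u)\big)=\sum_{i=1}^N\partial_{x_i}\big(|\mathcal F_i|^{p_i-2}\mathcal F_i\big)\quad\text{in }\Omega$$ is locally bounded.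
   Context: Notation: $\bar p$ is the harmonic mean, $\frac1{\bar p}=\frac1N\sum_{i=1}^N\frac1{p_i}$; $p_{\max}=\max_i p_i$; $p'=\frac{p}{p-1}$; $\bar p^*=\frac{N\bar p}{N-\bar p}$. Structure assumptions, for every $i=1,\dots,N$: (1) $\mathcal A_i:\Omega\times\mathbb R^N\to\mathbb R$ is a Carathéodory function with $|\mathcal A_i(x,\xi)|\le\beta_i|\xi_i|^{p_i-1}$ and $\alpha\sum_{i=1}^N|\xi_i|^{p_i}\le\sum_{i=1}^N\mathcal A_i(x,\xi)\,\xi_i$ for a.e. $x\in\Omega$ and every $\xi\in\mathbb R^N$, where $0<\alpha\le\beta_i$ are constants. (2) $\mathcal B_i:\Omega\times\mathbb R\to\mathbb R$ is a Carathéodory function with $|\mathcal B_i(x,s)|\le b_i(x)|s|^{\bar p/p_i'}$ for a.e. $x\in\Omega$ and every $s\in\mathbb R$, where $b_i\ge0$ belongs to the Marcinkiewicz space $L^{\frac{Np_i'}{\bar p},\infty}(\Omega)$. Marcinkiewicz spaces: for measurable $v$ on $\Omega$, $\mu_v(\lambda)=|\{x\in\Omega:|v(x)|>\lambda\}|$ and $v^*(s)=\sup\{t\ge0:\mu_v(t)\ge s\}$; $L^{p,\infty}(\Omega)$ is the set of $v$ with $\sup_{t\in(0,|\Omega|)}t^{1/p}v^*(t)<\infty$. Anisotropic Sobolev spaces: $W^{1,\vec p}(\Omega)=\{u\in W^{1,1}(\Omega):\partial_{x_i}u\in L^{p_i}(\Omega),\ i=1,\dots,N\}$ and $W^{1,\vec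 p}_{loc}(\Omega)$ is the set of $u$ with $u\in W^{1,\vec p}(\Omega')$ for every open $\Omega'\subset\subset\Omega$. Local solution: if $\mathcal F_i\in L^{p_i}_{loc}(\Omega)$ for $i=1,\dots,N$, $u\in W^{1,\vec p}_{loc}(\Omega)$ is a local solution of the equation if for every $\varphi\in C_0^\infty(\Omega)$ $$\sum_{i=1}^N\int_\Omega\big(\mathcal A_i(x,\nabla u)+\mathcal B_i(x,u)\big)\partial_{x_i}\varphi\,dx=\sum_{i=1}^N\int_\Omega|\mathcal F_i|^{p_i-2}\mathcal F_i\,\partial_{x_i}\varphi\,dx.$$ *)

theory Defs
  imports "HOL-Analysis.Analysis"
begin

section \<open>Exponents\<close>

definition harmonic_mean :: "('n::finite \<Rightarrow> real) \<Rightarrow> real"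
  where "harmonic_mean p = 1 / ((1 / real CARD('n)) * (\<Sum>i\<in>UNIV. 1 / p i))"

definition sobolev_conj :: "('n::finite \<Rightarrow> real) \<Rightarrow> real"
  where "sobolev_conj p =
    real CARD('n) * harmonic_mean p / (real CARD('n) - harmonic_mean p)"

definition conj_exp :: "real \<Rightarrow> real"
  where "conj_exp q = q / (q - 1)"


section \<open>Function spaces\<close>

text \<open>
  Functions on an open set \<open>\<Omega>\<close> are represented by total functions; their values outside \<open>\<Omega>\<close>
  are irrelevant. Functions are not identified when they agree almost everywhere.
\<close>

definition compactly_inside :: "(real^'n) set \<Rightarrow> (real^'n) set \<Rightarrow> bool"  (infix \<open>\<subset>\<subset>\<close> 50)
  where "U \<subset>\<subset> \<Omega> \<longleftrightarrow> compact (closure U) \<and> closure U \<subseteq> \<Omega>"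

definition Leb :: "(real^'n) set \<Rightarrow> real \<Rightarrow> (real^'n \<Rightarrow> real) set"
  where "Leb \<Omega> q = {v. v \<in> borel_measurable (lebesgue_on \<Omega>) \<and>
                        integrable (lebesgue_on \<Omega>) (\<lambda>x. \<bar>v x\<bar> powr q)}"

definition Leb_loc :: "(real^'n) set \<Rightarrow> real \<Rightarrow> (real^'n \<Rightarrow> real) set"
  where "Leb_loc \<Omega> q = {v. \<forall>U. open U \<and> U \<subset>\<subset> \<Omega> \<longrightarrow> v \<in> Leb U q}"

definition loc_bounded :: "(real^'n) set \<Rightarrow> (real^'n \<Rightarrow> real) \<Rightarrow> bool"
  where "loc_bounded \<Omega> v \<longleftrightarrow>
    (\<forall>U. open U \<and> U \<subset>\<subset> \<Omega> \<longrightarrow> (\<exists>M. AE x in lebesgue_on U. \<bar>v x\<bar> \<le> M))"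

text \<open>
  Distribution function, decreasing rearrangement and Marcinkiewicz space. Everything is
  \<open>ennreal\<close>-valued because \<open>\<Omega>\<close> may have infinite measure and the rearrangement may be infinite.
\<close>

definition distr_fun :: "(real^'n) set \<Rightarrow> (real^'n \<Rightarrow> real) \<Rightarrow> real \<Rightarrow> ennreal"
  where "distr_fun \<Omega> v t = emeasure lebesgue {x \<in> \<Omega>. \<bar>v x\<bar> > t}"

definition rearr :: "(real^'n) set \<Rightarrow> (real^'n \<Rightarrow> real) \<Rightarrow> real \<Rightarrow> ennreal"
  where "rearr \<Omega> v s = Sup {ennreal t |t. 0 \<le> t \<and> distr_fun \<Omega> v t \<ge> ennreal s}"

definition marcinkiewicz :: "(real^'n) set \<Rightarrow> real \<Rightarrow> (real^'n \<Rightarrow> real) set"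
  where "marcinkiewicz \<Omega> q = {v. v \<in> borel_measurable (lebesgue_on \<Omega>) \<and>
    (SUP t\<in>{t. 0 < t \<and> ennreal t < emeasure lebesgue \<Omega>}.
        ennreal (t powr (1 / q)) * rearr \<Omega> v t) < \<infinity>}"


section \<open>Test functions, weak gradients, anisotropic Sobolev spaces\<close>

definition partial_deriv :: "'n \<Rightarrow> (real^'n \<Rightarrow> real) \<Rightarrow> real^'n \<Rightarrow> real"
  where "partial_deriv i f x = frechet_derivative f (at x) (axis i 1)"

primrec Ck :: "nat \<Rightarrow> (real^'n \<Rightarrow> real) \<Rightarrow> bool"
  where
    "Ck 0 f \<longleftrightarrow> continuous_on UNIV f"
  | "Ck (Suc k) f \<longleftrightarrow> (\<forall>x. f differentiable (at x)) \<and> (\<forall>i. Ck k (partial_deriv i f))"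

text \<open>Test functions on \<open>\<Omega>\<close> are extended by zero to the whole space.\<close>

definition test_funs :: "(real^'n) set \<Rightarrow> (real^'n \<Rightarrow> real) set"
  where "test_funs \<Omega> = {\<phi>. (\<forall>k. Ck k \<phi>) \<and>
    compact (closure {x. \<phi> x \<noteq> 0}) \<and> closure {x. \<phi> x \<noteq> 0} \<subseteq> \<Omega>}"

text \<open>
  \<open>G\<close> is a version of the distributional gradient of \<open>u\<close> on \<open>\<Omega>\<close>; it is determined up to null sets.
\<close>

definition weak_gradient :: "(real^'n) set \<Rightarrow> (real^'n \<Rightarrow> real) \<Rightarrow> (real^'n \<Rightarrow> real^'n) \<Rightarrow> bool"
  where "weak_gradient \<Omega> u G \<longleftrightarrow>
    u \<in> Leb_loc \<Omega> 1 \<and> (\<forall>i. (\<lambda>x. G x $ i) \<in> Leb_loc \<Omega> 1) \<and>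
    (\<forall>i. \<forall>\<phi>\<in>test_funs \<Omega>.
      (LINT x|lebesgue_on \<Omega>. u x * partial_deriv i \<phi> x) = - (LINT x|lebesgue_on \<Omega>. G x $ i * \<phi> x))"

definition sobolev_W11 :: "(real^'n) set \<Rightarrow> (real^'n \<Rightarrow> real) set"
  where "sobolev_W11 \<Omega> = {u. u \<in> Leb \<Omega> 1 \<and>
    (\<exists>G. weak_gradient \<Omega> u G \<and> (\<forall>i. (\<lambda>x. G x $ i) \<in> Leb \<Omega> 1))}"

definition aniso_sobolev :: "(real^'n) set \<Rightarrow> ('n \<Rightarrow> real) \<Rightarrow> (real^'n \<Rightarrow> real) set"
  where "aniso_sobolev \<Omega> p = {u. u \<in> sobolev_W11 \<Omega> \<and>
    (\<exists>G. weak_gradient \<Omega> u G \<and> (\<forall>i. (\<lambda>x. G x $ i) \<in> Leb \<Omega> (p i)))}"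

definition aniso_sobolev_loc :: "(real^'n) set \<Rightarrow> ('n \<Rightarrow> real) \<Rightarrow> (real^'n \<Rightarrow> real) set"
  where "aniso_sobolev_loc \<Omega> p = {u. \<forall>U. open U \<and> U \<subset>\<subset> \<Omega> \<longrightarrow> u \<in> aniso_sobolev U p}"


section \<open>Structure assumptions and local solutions\<close>

definition caratheodory :: "(real^'n) set \<Rightarrow> (real^'n \<Rightarrow> 'b::topological_space \<Rightarrow> real) \<Rightarrow> bool"
  where "caratheodory \<Omega> f \<longleftrightarrow>
    (\<forall>\<xi>. (\<lambda>x. f x \<xi>) \<in> borel_measurable (lebesgue_on \<Omega>)) \<and>
    (AE x in lebesgue_on \<Omega>. continuous_on UNIV (f x))"

definition structure_A ::
  "(real^'n) set \<Rightarrow> ('n \<Rightarrow> real) \<Rightarrow> real \<Rightarrow> ('n \<Rightarrow> real) \<Rightarrow> ('n \<Rightarrow> real^'n \<Rightarrow> real^'n \<Rightarrow> real) \<Rightarrow> bool"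
  where "structure_A \<Omega> p \<alpha> \<beta> A \<longleftrightarrow>
    0 < \<alpha> \<and> (\<forall>i. \<alpha> \<le> \<beta> i) \<and> (\<forall>i. caratheodory \<Omega> (A i)) \<and>
    (\<forall>i. AE x in lebesgue_on \<Omega>. \<forall>\<xi>. \<bar>A i x \<xi>\<bar> \<le> \<beta> i * \<bar>\<xi> $ i\<bar> powr (p i - 1)) \<and>
    (AE x in lebesgue_on \<Omega>. \<forall>\<xi>.
        \<alpha> * (\<Sum>i\<in>UNIV. \<bar>\<xi> $ i\<bar> powr p i) \<le> (\<Sum>i\<in>UNIV. A i x \<xi> * \<xi> $ i))"

definition structure_B ::
  "(real^'n) set \<Rightarrow> ('n \<Rightarrow> real) \<Rightarrow> ('n \<Rightarrow> real^'n \<Rightarrow> real) \<Rightarrow> ('n \<Rightarrow> real^'n \<Rightarrow> real \<Rightarrow> real) \<Rightarrow> bool"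
  where "structure_B \<Omega> p b B \<longleftrightarrow>
    (\<forall>i. caratheodory \<Omega> (B i)) \<and>
    (\<forall>i. AE x in lebesgue_on \<Omega>. \<forall>s.
        \<bar>B i x s\<bar> \<le> b i x * \<bar>s\<bar> powr (harmonic_mean p / conj_exp (p i))) \<and>
    (\<forall>i. AE x in lebesgue_on \<Omega>. 0 \<le> b i x) \<and>
    (\<forall>i. b i \<in> marcinkiewicz \<Omega> (real CARD('n) * conj_exp (p i) / harmonic_mean p))"

definition local_solution ::
  "(real^'n) set \<Rightarrow> ('n \<Rightarrow> real) \<Rightarrow> ('n \<Rightarrow> real^'n \<Rightarrow> real^'n \<Rightarrow> real) \<Rightarrow>
   ('n \<Rightarrow> real^'n \<Rightarrow> real \<Rightarrow> real) \<Rightarrow> ('n \<Rightarrow> real^'n \<Rightarrow> real) \<Rightarrow> (real^'n \<Rightarrow> real) \<Rightarrow> bool"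
  where "local_solution \<Omega> p A B F u \<longleftrightarrow>
    (\<forall>i. F i \<in> Leb_loc \<Omega> (p i)) \<and> u \<in> aniso_sobolev_loc \<Omega> p \<and>
    (\<exists>G. weak_gradient \<Omega> u G \<and>
      (\<forall>\<phi>\<in>test_funs \<Omega>.
        (\<Sum>i\<in>UNIV. LINT x|lebesgue_on \<Omega>. (A i x (G x) + B i x (u x)) * partial_deriv i \<phi> x) =
        (\<Sum>i\<in>UNIV. LINT x|lebesgue_on \<Omega>.
            \<bar>F i x\<bar> powr (p i - 2) * F i x * partial_deriv i \<phi> x)))"

end

theory Submission
  imports Defs
begin

text \<open>
  The theorem is an instance of De Giorgi's method for an equation whose natural energy is
  \<open>\<Sum>\<^sub>i |\<partial>\<^sub>i u|^p\<^sub>i\<close>. Throughout, \<open>P\<close> is the harmonic mean of the exponents and \<open>q\<close> its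
  Sobolev conjugate, \<open>1 / q = 1 / P - 1 / N\<close>.

  The first ingredient is the anisotropic Sobolev inequality of Troisi (\<open>sobolev_weak\<close>):
  for a weakly differentiable \<open>v\<close> with compact support, the \<open>L^q\<close> norm of \<open>v\<close> is at most a
  constant times the geometric mean of the \<open>L^p\<^sub>i\<close> norms of the \<open>\<partial>\<^sub>i v\<close>. For smooth \<open>v\<close> a
  power of \<open>|v|\<close> is bounded, for each \<open>i\<close>, by an integral over the line in direction \<open>i\<close>;
  the product of these bounds is integrated by the Loomis-Whitney inequality, and
  Hoelder's inequality does the rest. Mollification and Fatou's lemma give the general
  case.

  The second ingredient is the energy estimate (\<open>energy_estimate\<close>). The equation is tested
  with \<open>\<zeta> (u - k)\<^sup>+\<close>, where \<open>\<zeta>\<close> is a cut-off function; coercivity, the growth conditions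
  and Young's inequality bound the energy of \<open>(u - k)\<^sup>+\<close> by powers of \<open>(u - k)\<^sup>+\<close> itself
  and by the integral of \<open>g (1 + |u|^P)\<close> over the set where \<open>u > k\<close>. Here \<open>g\<close> collects the
  functions \<open>b\<^sub>i\<close>, raised to the power conjugate to \<open>p\<^sub>i\<close>, and \<open>|F\<^sub>i|^p\<^sub>i\<close>; the
  assumptions on the \<open>r\<^sub>i\<close> say that \<open>g\<close> is locally in \<open>L^\<mu>\<close> with \<open>\<mu> > N / P\<close>.

  In the third step (\<open>locally_bounded_above\<close>) both are combined on balls of shrinking
  radii \<open>\<rho> j\<close> at the growing levels \<open>k j = K (2 - (1/2)^j)\<close>. The integrals \<open>J j\<close> of
  \<open>((u - k j)\<^sup>+)^q\<close> over these balls satisfy \<open>J (j + 1) \<le> A \<Lambda>^j (J j)^(1 + \<gamma>)\<close> with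
  \<open>1 + \<gamma> = (1 - 1 / \<mu>) q / P\<close>, and \<open>\<gamma> > 0\<close> is precisely the condition \<open>\<mu> > N / P\<close>. The
  constants do not depend on \<open>K \<ge> 1\<close>, while \<open>J 0\<close> tends to \<open>0\<close> as \<open>K\<close> grows. For large \<open>K\<close>
  therefore \<open>J j\<close> tends to \<open>0\<close>, that is, \<open>u \<le> 2 K\<close> on the limit ball. The same argument
  applies to \<open>- u\<close>, and a compact set is covered by finitely many balls.

  Some preparation is needed before the iteration can start. A local solution is only
  known to be locally integrable with \<open>\<partial>\<^sub>i u\<close> in \<open>L^p\<^sub>i\<close>, and \<open>local_Lq\<close> improves this to
  \<open>L^q\<close>. The equation is given for smooth test functions, and \<open>weak_equation_extends\<close>
  admits weakly differentiable ones. Finally the data are Lebesgue measurable and the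
  structure conditions hold almost everywhere; on a small ball they are replaced by Borel
  functions for which the conditions hold at every point.
\<close>

section \<open>Smooth functions\<close>

lemma partial_deriv_eq:
  assumes "(f has_derivative f') (at x)"
  shows "partial_deriv i f x = f' (axis i 1)"
  using frechet_derivative_at[OF assms] by (simp add: partial_deriv_def)

lemma Ck_Suc_D: "Ck (Suc k) f \<Longrightarrow> Ck k f"
proof (induction k arbitrary: f)
  case 0
  then show ?case
    by (auto simp: continuous_on_eq_continuous_at differentiable_imp_continuous_within)
next
  case (Suc k)
  then show ?case by (metis Ck.simps(2))
qed

lemma Ck_continuous: "Ck k f \<Longrightarrow> continuous_on UNIV f"
  by (induction k arbitrary: f) (auto simp: continuous_on_eq_continuous_at differentiable_imp_continuous_within)

lemma Ck_const: "Ck k (\<lambda>_. c)"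
proof (induction k arbitrary: c)
  case (Suc k)
  have "partial_deriv i (\<lambda>_. c) = (\<lambda>_. 0)" for i :: 'a
    by (rule ext, subst partial_deriv_eq[OF has_derivative_const]) simp
  then show ?case using Suc by simp
qed simp

lemma partial_deriv_add:
  assumes "f differentiable (at x)" "g differentiable (at x)"
  shows "partial_deriv i (\<lambda>x. f x + g x) x = partial_deriv i f x + partial_deriv i g x"
  using partial_deriv_eq[OF has_derivative_add[OF frechet_derivative_works[THEN iffD1, OF assms(1)] frechet_derivative_works[THEN iffD1, OF assms(2)]]]
  by (simp add: partial_deriv_def)

lemma partial_deriv_mult:
  assumes "f differentiable (at x)" "g differentiable (at x)"
  shows "partial_deriv i (\<lambda>x. f x * g x) x = partial_deriv i f x * g x + f x * partial_deriv i g x"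
  using partial_deriv_eq[OF has_derivative_mult[OF frechet_derivative_works[THEN iffD1, OF assms(1)] frechet_derivative_works[THEN iffD1, OF assms(2)]]]
  by (simp add: partial_deriv_def)

lemma Ck_add: "Ck k f \<Longrightarrow> Ck k g \<Longrightarrow> Ck k (\<lambda>x. f x + g x)"
proof (induction k arbitrary: f g)
  case 0 then show ?case by (auto intro: continuous_intros)
next
  case (Suc k)
  then have "partial_deriv i (\<lambda>x. f x + g x) = (\<lambda>x. partial_deriv i f x + partial_deriv i g x)" for i
    by (intro ext partial_deriv_add) auto
  then show ?case using Suc by auto
qed

lemma Ck_mult: "Ck k f \<Longrightarrow> Ck k g \<Longrightarrow> Ck k (\<lambda>x. f x * g x)"
proof (induction k arbitrary: f g)
  case 0 then show ?case by (auto intro: continuous_intros)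
next
  case (Suc k)
  then have "partial_deriv i (\<lambda>x. f x * g x) = (\<lambda>x. partial_deriv i f x * g x + f x * partial_deriv i g x)" for i
    by (intro ext partial_deriv_mult) auto
  moreover have "Ck k (\<lambda>x. partial_deriv i f x * g x + f x * partial_deriv i g x)" for i
    using Suc.prems by (intro Ck_add Suc.IH Ck_Suc_D[of k f] Ck_Suc_D[of k g]) simp_all
  moreover have "(\<lambda>x. f x * g x) differentiable at x" for x
    using Suc.prems by (intro differentiable_mult) auto
  ultimately show ?case by simp
qed

lemma Ck_coord: "Ck k (\<lambda>x. x $ j)"
proof (cases k)
  case (Suc k)
  have d: "((\<lambda>x. x $ j) has_derivative (\<lambda>h. h $ j)) (at x)" for x :: "real^'a"
    by (rule bounded_linear_imp_has_derivative[OF bounded_linear_vec_nth])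
  have "partial_deriv i (\<lambda>x. x $ j) = (\<lambda>x. axis i 1 $ j)" for i
    by (rule ext, rule partial_deriv_eq[OF d])
  then show ?thesis using d Suc by (auto simp: differentiable_def intro!: Ck_const)
qed (auto intro: continuous_intros)

lemma has_derivative_affine_comp:
  assumes "f differentiable (at (a + c *\<^sub>R x))"
  shows "((\<lambda>x. f (a + c *\<^sub>R x)) has_derivative (\<lambda>h. frechet_derivative f (at (a + c *\<^sub>R x)) (c *\<^sub>R h))) (at x)"
proof -
  have "((\<lambda>x. a + c *\<^sub>R x) has_derivative (\<lambda>h. c *\<^sub>R h)) (at x)"
    by (auto intro!: derivative_eq_intros)
  from diff_chain_at[OF this frechet_derivative_works[THEN iffD1, OF assms]] show ?thesis
    by (simp add: o_def)
qed

lemma partial_deriv_affine: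
  assumes "f differentiable (at (a + c *\<^sub>R x))"
  shows "partial_deriv i (\<lambda>x. f (a + c *\<^sub>R x)) x = c * partial_deriv i f (a + c *\<^sub>R x)"
proof -
  have "linear (frechet_derivative f (at (a + c *\<^sub>R x)))"
    using assms by (rule linear_frechet_derivative)
  from partial_deriv_eq[OF has_derivative_affine_comp[OF assms]] linear_scale[OF this] show ?thesis
    by (simp add: partial_deriv_def)
qed

lemma Ck_affine: "Ck k f \<Longrightarrow> Ck k (\<lambda>x. f (a + c *\<^sub>R x))"
proof (induction k arbitrary: f)
  case 0
  then show ?case by (auto intro!: continuous_intros intro: continuous_on_compose2[of UNIV f])
next
  case (Suc k)
  then have "partial_deriv i (\<lambda>x. f (a + c *\<^sub>R x)) = (\<lambda>x. c * partial_deriv i f (a + c *\<^sub>R x))" for i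
    by (intro ext partial_deriv_affine) auto
  moreover have "(\<lambda>x. f (a + c *\<^sub>R x)) differentiable at x" for x
    using has_derivative_affine_comp[of f a c x] Suc.prems by (auto simp: differentiable_def)
  ultimately show ?case using Suc by (auto intro!: Ck_mult Ck_const)
qed

lemma Ck_power: "Ck k f \<Longrightarrow> Ck k (\<lambda>x. f x ^ m)"
  by (induction m) (auto intro: Ck_const Ck_mult)

text \<open>
  The classical flat function is the case \<open>m = 0\<close>. The negative powers of \<open>t\<close> make the
  family closed under differentiation up to linear combinations, so that smoothness of all
  orders is one induction with \<open>m\<close> arbitrary.
\<close>

definition flat_exp :: "nat \<Rightarrow> real \<Rightarrow> real"
  where "flat_exp m t = (if t > 0 then exp (- (1 / t)) / t ^ m else 0)"

lemma power_div_fact_le_exp: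
  fixes x :: real
  assumes "0 \<le> x"
  shows "x ^ n / fact n \<le> exp x"
proof -
  have "(\<Sum>i\<in>{n}. x ^ i /\<^sub>R fact i) \<le> (\<Sum>i. x ^ i /\<^sub>R fact i)"
    using assms by (intro sum_le_suminf summable_exp_generic) auto
  then show ?thesis by (simp add: exp_def divide_inverse mult.commute)
qed

text \<open>
  The exponential dominates the term of order \<open>m + 2\<close> of its power series at \<open>1 / t\<close>. A
  bound of second order at \<open>0\<close> yields differentiability there.
\<close>

lemma flat_exp_bound: "\<bar>flat_exp m t\<bar> \<le> fact (m + 2) * t\<^sup>2"
proof (cases "t > 0")
  case True
  have "(1 / t) ^ (m + 2) / fact (m + 2) \<le> exp (1 / t)"
    using True by (intro power_div_fact_le_exp) auto
  then have "1 / (t ^ (m + 2) * fact (m + 2)) \<le> exp (1 / t)"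
    by (simp add: power_divide)
  then have "exp (- (1 / t)) \<le> fact (m + 2) * t ^ (m + 2)"
    using True unfolding exp_minus
    by (metis (no_types, lifting) exp_gt_zero inverse_eq_divide le_imp_inverse_le mult.commute
        fact_gt_zero inverse_inverse_eq zero_less_mult_iff zero_less_power zero_less_divide_1_iff)
  then have "exp (- (1 / t)) / t ^ m \<le> fact (m + 2) * t ^ (m + 2) / t ^ m"
    using True by (intro divide_right_mono) auto
  also have "\<dots> = fact (m + 2) * t\<^sup>2"
    using True by (simp only: power_add) simp
  finally show ?thesis using True by (simp add: flat_exp_def)
qed (simp add: flat_exp_def)

lemma flat_exp_deriv:
  "(flat_exp m has_real_derivative (flat_exp (m + 2) t - real m * flat_exp (m + 1) t)) (at t)"
proof -
  consider "t > 0" | "t < 0" | "t = 0" by linarith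
  then show ?thesis
  proof cases
    case 1
    have d: "((\<lambda>t. exp (- (1 / t)) * inverse (t ^ m)) has_real_derivative
        (exp (- (1 / t)) * (1 / t\<^sup>2)) * inverse (t ^ m)
          + exp (- (1 / t)) * (- (real m * t ^ (m - 1) / (t ^ m)\<^sup>2))) (at t)"
      using 1 by (auto intro!: derivative_eq_intros simp: field_simps power2_eq_square)
    have "(exp (- (1 / t)) * (1 / t\<^sup>2)) * inverse (t ^ m)
          + exp (- (1 / t)) * (- (real m * t ^ (m - 1) / (t ^ m)\<^sup>2)) =
          flat_exp (m + 2) t - real m * flat_exp (m + 1) t"
      using 1 by (cases m) (simp_all add: flat_exp_def field_simps power2_eq_square power_add)
    with d have "((\<lambda>t. exp (- (1 / t)) * inverse (t ^ m)) has_real_derivative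
        (flat_exp (m + 2) t - real m * flat_exp (m + 1) t)) (at t)" by simp
    then show ?thesis
      by (rule has_field_derivative_transform_within_open[where S="{0<..}"])
        (use 1 in \<open>auto simp: flat_exp_def divide_inverse\<close>)
  next
    case 2
    have "((\<lambda>t. 0) has_real_derivative 0) (at t)" by simp
    then have "(flat_exp m has_real_derivative 0) (at t)"
      by (rule has_field_derivative_transform_within_open[where S="{..<0}"])
        (use 2 in \<open>auto simp: flat_exp_def\<close>)
    then show ?thesis using 2 by (simp add: flat_exp_def)
  next
    case 3
    have "((\<lambda>h. flat_exp m h / h) \<longlongrightarrow> 0) (at 0)"
    proof (rule Lim_null_comparison)
      have "norm (flat_exp m h / h) \<le> fact (m + 2) * \<bar>h\<bar>" for h
      proof (cases "h = 0")
        case False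
        have "\<bar>flat_exp m h\<bar> \<le> (fact (m + 2) * \<bar>h\<bar>) * \<bar>h\<bar>"
          using flat_exp_bound[of m h] by (simp add: power2_eq_square mult.assoc)
        then show ?thesis using False by (simp add: abs_divide divide_le_eq)
      qed (simp add: flat_exp_def)
      then show "\<forall>\<^sub>F h in at 0. norm (flat_exp m h / h) \<le> fact (m + 2) * \<bar>h\<bar>" by simp
      show "((\<lambda>h. fact (m + 2) * \<bar>h\<bar>) \<longlongrightarrow> 0) (at (0::real))"
        by (auto intro!: tendsto_eq_intros)
    qed
    then show ?thesis using 3 by (simp add: DERIV_def flat_exp_def)
  qed
qed

definition bump :: "nat \<Rightarrow> real^'n \<Rightarrow> real"
  where "bump m x = flat_exp m (1 - x \<bullet> x)"

lemma bump_has_derivative: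
  "(bump m has_derivative (\<lambda>h. (flat_exp (m + 2) (1 - x \<bullet> x) - real m * flat_exp (m + 1) (1 - x \<bullet> x)) * (- 2 * (x \<bullet> h)))) (at x)"
proof -
  have "((\<lambda>x. 1 - x \<bullet> x) has_derivative (\<lambda>h. - 2 * (x \<bullet> h))) (at x)"
    by (auto intro!: derivative_eq_intros simp: inner_commute)
  from diff_chain_at[OF this flat_exp_deriv[unfolded has_field_derivative_def]]
  show ?thesis by (simp add: o_def bump_def[abs_def])
qed

lemma Ck_bump: "Ck k (bump m :: real^'n \<Rightarrow> real)"
proof (induction k arbitrary: m)
  case 0
  have "bump m differentiable (at x)" for x
    using bump_has_derivative differentiable_def by blast
  then show ?case
    using differentiable_imp_continuous_within by (fastforce simp: continuous_on_eq_continuous_at)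
next
  case (Suc k)
  have b: "Ck k (bump n :: real^'n \<Rightarrow> real)" for n by (rule Suc)
  have "partial_deriv i (bump m) = (\<lambda>x. (bump (m + 2) x + (- real m) * bump (m + 1) x) * (- 2 * (x $ i)))" for i :: 'n
    by (rule ext, subst partial_deriv_eq[OF bump_has_derivative])
      (simp add: bump_def inner_axis)
  moreover have "Ck k (\<lambda>x. (bump (m + 2) x + (- real m) * bump (m + 1) x) * (- 2 * (x $ i)))" for i :: 'n
    by (intro Ck_mult Ck_add Ck_const Ck_coord b)
  moreover have "bump m differentiable (at x)" for x :: "real^'n"
    using bump_has_derivative differentiable_def by blast
  ultimately show ?case by simp
qed

lemma bump_pos: "norm x < 1 \<Longrightarrow> bump m x > 0" and bump_nonneg: "bump m x \<ge> 0"
  and bump_zero: "norm x \<ge> 1 \<Longrightarrow> bump m x = 0"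
  by (auto simp: bump_def flat_exp_def dot_square_norm power_le_one_iff abs_square_less_1 linorder_not_less)

subsection \<open>Test functions\<close>

lemma test_funsI:
  assumes "\<And>k. Ck k \<phi>" "compact K" "K \<subseteq> \<Omega>" "\<And>x. x \<notin> K \<Longrightarrow> \<phi> x = 0"
  shows "\<phi> \<in> test_funs \<Omega>"
proof -
  have "closure {x. \<phi> x \<noteq> 0} \<subseteq> K"
    using assms by (intro closure_minimal) (auto simp: compact_imp_closed)
  moreover have "compact (closure {x. \<phi> x \<noteq> 0})"
    using calculation assms(2) closed_closure compact_closure
    by (metis bounded_subset closure_closure compact_imp_bounded)
  ultimately show ?thesis using assms by (auto simp: test_funs_def)
qed

lemma test_funsE:
  assumes "\<phi> \<in> test_funs \<Omega>"
  obtains K where "\<And>k. Ck k \<phi>" "compact K" "K \<subseteq> \<Omega>" "\<And>x. x \<notin> K \<Longrightarrow> \<phi> x = 0"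
    "\<And>x i. x \<notin> K \<Longrightarrow> partial_deriv i \<phi> x = 0"
proof
  let ?K = "closure {x. \<phi> x \<noteq> 0}"
  show "\<And>k. Ck k \<phi>" "compact ?K" "?K \<subseteq> \<Omega>"
    using assms unfolding test_funs_def by blast+
  show z: "\<phi> x = 0" if "x \<notin> ?K" for x
    using that closure_subset[of "{x. \<phi> x \<noteq> 0}"] by blast
  show "partial_deriv i \<phi> x = 0" if "x \<notin> ?K" for x i
  proof -
    have "((\<lambda>_. 0) has_derivative (\<lambda>_. 0)) (at x)" by simp
    moreover have "open (- ?K)" by (simp add: open_Compl)
    moreover have "x \<in> - ?K" using that by blast
    moreover have "0 = \<phi> y" if "y \<in> - ?K" for y
      using z[of y] that by simp
    ultimately have "(\<phi> has_derivative (\<lambda>_. 0)) (at x)"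
      by (rule has_derivative_transform_within_open)
    from partial_deriv_eq[OF this] show ?thesis by simp
  qed
qed

lemma test_funs_mono: "\<Omega> \<subseteq> \<Omega>' \<Longrightarrow> \<phi> \<in> test_funs \<Omega> \<Longrightarrow> \<phi> \<in> test_funs \<Omega>'"
  by (auto simp: test_funs_def)

lemma test_funs_diff: "\<phi> \<in> test_funs \<Omega> \<Longrightarrow> \<phi> differentiable (at x)"
  unfolding test_funs_def using Ck.simps(2)[of 0 \<phi>] by blast

lemma test_funs_continuous: "\<phi> \<in> test_funs \<Omega> \<Longrightarrow> continuous_on UNIV \<phi>"
  unfolding test_funs_def using Ck_continuous[of 0] by blast

lemma test_funs_pd: assumes "\<phi> \<in> test_funs \<Omega>" shows "partial_deriv i \<phi> \<in> test_funs \<Omega>"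
proof (rule test_funsE[OF assms])
  fix K assume K: "\<And>k. Ck k \<phi>" "compact K" "K \<subseteq> \<Omega>" "\<And>x i. x \<notin> K \<Longrightarrow> partial_deriv i \<phi> x = 0"
  have "Ck k (partial_deriv i \<phi>)" for k
    using K(1)[of "Suc k"] by simp
  with K show ?thesis by (intro test_funsI[of _ K]) auto
qed

lemma test_funs_mult:
  assumes "\<And>k. Ck k f" "\<phi> \<in> test_funs \<Omega>" shows "(\<lambda>x. f x * \<phi> x) \<in> test_funs \<Omega>"
proof (rule test_funsE[OF assms(2)])
  fix K assume "\<And>k. Ck k \<phi>" "compact K" "K \<subseteq> \<Omega>" "\<And>x. x \<notin> K \<Longrightarrow> \<phi> x = 0"
  with assms(1) show ?thesis by (intro test_funsI[of _ K] Ck_mult) auto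
qed

lemma continuous_compact_support_bounded:
  fixes f :: "real^'n \<Rightarrow> real"
  assumes "continuous_on UNIV f" "compact K" "\<And>x. x \<notin> K \<Longrightarrow> f x = 0"
  obtains M where "M > 0" "\<And>x. \<bar>f x\<bar> \<le> M"
proof -
  have "compact (f ` K)"
    using assms continuous_on_subset[OF assms(1)] by (intro compact_continuous_image) auto
  then obtain M where "M > 0" "\<And>y. y \<in> f ` K \<Longrightarrow> \<bar>y\<bar> \<le> M"
    using compact_imp_bounded bounded_pos by (metis real_norm_def)
  then show thesis using assms(3) by (intro that[of M]) (metis abs_zero image_eqI less_eq_real_def)+
qed

lemma continuous_compact_support_integrable:
  fixes f :: "real^'n \<Rightarrow> real"
  assumes "continuous_on UNIV f" "compact K" "\<And>x. x \<notin> K \<Longrightarrow> f x = 0"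
  shows "integrable lborel f"
proof -
  have "set_integrable lborel K f"
    using assms continuous_on_subset[OF assms(1)] by (intro borel_integrable_compact[unfolded set_integrable_def[symmetric]]) auto
  moreover have "(\<lambda>x. indicator K x *\<^sub>R f x) = f"
    using assms(3) by (auto simp: fun_eq_iff indicator_def)
  ultimately show ?thesis by (simp add: set_integrable_def)
qed

lemma test_funs_bounded:
  assumes "\<phi> \<in> test_funs \<Omega>" obtains M where "M > 0" "\<And>x. \<bar>\<phi> x\<bar> \<le> M"
proof (rule test_funsE[OF assms])
  fix K assume "compact K" "\<And>x. x \<notin> K \<Longrightarrow> \<phi> x = 0"
  then show thesis
    using continuous_compact_support_bounded[OF test_funs_continuous[OF assms]] that by metis
qed

lemma test_funs_integrable: assumes "\<phi> \<in> test_funs \<Omega>" shows "integrable lborel \<phi>"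
proof (rule test_funsE[OF assms])
  fix K assume "compact K" "\<And>x. x \<notin> K \<Longrightarrow> \<phi> x = 0"
  then show ?thesis
    by (rule continuous_compact_support_integrable[OF test_funs_continuous[OF assms]])
qed

lemma test_funs_borel: assumes "\<phi> \<in> test_funs \<Omega>" shows "\<phi> \<in> borel_measurable borel"
  using test_funs_continuous[OF assms] borel_measurable_continuous_onI by blast

section \<open>Translations and Hoelder's inequality\<close>

lemma nn_integral_translate:
  fixes f :: "'a::euclidean_space \<Rightarrow> ennreal"
  assumes "f \<in> borel_measurable borel"
  shows "(\<integral>\<^sup>+x. f (a + x) \<partial>lborel) = (\<integral>\<^sup>+x. f x \<partial>lborel)"
proof -
  have "(\<integral>\<^sup>+x. f x \<partial>lborel) = (\<integral>\<^sup>+x. f x \<partial>(distr lborel borel ((+) a)))"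
    by (simp add: lborel_distr_plus)
  also have "\<dots> = (\<integral>\<^sup>+x. f (a + x) \<partial>lborel)"
    using assms by (intro nn_integral_distr) auto
  finally show ?thesis by simp
qed

lemma lborel_distr_reflect: "distr lborel borel (\<lambda>x. a - x) = (lborel :: 'a::euclidean_space measure)"
  using lborel_affine[of "-1 :: real" a] by (simp add: density_1)

lemma integral_translate:
  fixes f :: "'a::euclidean_space \<Rightarrow> real"
  assumes "f \<in> borel_measurable borel"
  shows "(\<integral>x. f (a + x) \<partial>lborel) = (\<integral>x. f x \<partial>lborel)"
proof -
  have "(\<integral>x. f x \<partial>lborel) = (\<integral>x. f x \<partial>(distr lborel borel ((+) a)))"
    by (simp add: lborel_distr_plus)
  also have "\<dots> = (\<integral>x. f (a + x) \<partial>lborel)"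
    using assms by (intro integral_distr) auto
  finally show ?thesis by simp
qed

lemma integral_reflect:
  fixes f :: "'a::euclidean_space \<Rightarrow> real"
  assumes "f \<in> borel_measurable borel"
  shows "(\<integral>x. f (a - x) \<partial>lborel) = (\<integral>x. f x \<partial>lborel)"
proof -
  have "(\<integral>x. f x \<partial>lborel) = (\<integral>x. f x \<partial>(distr lborel borel (\<lambda>x. a - x)))"
    by (simp add: lborel_distr_reflect)
  also have "\<dots> = (\<integral>x. f (a - x) \<partial>lborel)"
    using assms by (intro integral_distr) auto
  finally show ?thesis by simp
qed

lemma integrable_translate:
  fixes f :: "'a::euclidean_space \<Rightarrow> real"
  assumes "integrable lborel f" shows "integrable lborel (\<lambda>x. f (a + x))"
proof -
  have "integrable (distr lborel borel ((+) a)) f"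
    using assms by (simp add: lborel_distr_plus)
  then show ?thesis
    by (rule integrable_distr[rotated]) auto
qed

lemma integrable_reflect:
  fixes f :: "'a::euclidean_space \<Rightarrow> real"
  assumes "integrable lborel f" shows "integrable lborel (\<lambda>x. f (a - x))"
proof -
  have "integrable (distr lborel borel (\<lambda>x. a - x)) f"
    using assms by (simp add: lborel_distr_reflect)
  then show ?thesis
    by (rule integrable_distr[rotated]) auto
qed

subsection \<open>Continuity of translations in the mean\<close>

definition shift_dist :: "('a::euclidean_space \<Rightarrow> real) \<Rightarrow> 'a \<Rightarrow> real"
  where "shift_dist f y = (\<integral>x. \<bar>f (y + x) - f x\<bar> \<partial>lborel)"

lemma shift_dist_approx:
  assumes f: "integrable lborel f" and g: "integrable lborel g"
  shows "shift_dist f y \<le> shift_dist g y + 2 * (\<integral>x. \<bar>f x - g x\<bar> \<partial>lborel)"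
proof -
  have fg: "integrable lborel (\<lambda>x. \<bar>f x - g x\<bar>)" using f g by auto
  note s = integrable_translate[OF f, of y] integrable_translate[OF g, of y] integrable_translate[OF fg, of y]
  have "shift_dist f y \<le> (\<integral>x. \<bar>g (y + x) - g x\<bar> + \<bar>f (y + x) - g (y + x)\<bar> + \<bar>f x - g x\<bar> \<partial>lborel)"
    unfolding shift_dist_def
    using s f g fg by (intro integral_mono Bochner_Integration.integrable_add integrable_abs Bochner_Integration.integrable_diff) auto
  also have "\<dots> = shift_dist g y + (\<integral>x. \<bar>f (y + x) - g (y + x)\<bar> \<partial>lborel) + (\<integral>x. \<bar>f x - g x\<bar> \<partial>lborel)"
    unfolding shift_dist_def using s f g fg by simp
  also have "(\<integral>x. \<bar>f (y + x) - g (y + x)\<bar> \<partial>lborel) = (\<integral>x. \<bar>f x - g x\<bar> \<partial>lborel)"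
    using fg by (intro integral_translate[where f="\<lambda>x. \<bar>f x - g x\<bar>"]) auto
  finally show ?thesis by simp
qed

lemma shift_dist_add:
  assumes f: "integrable lborel f" and g: "integrable lborel g"
  shows "shift_dist (\<lambda>x. f x + g x) y \<le> shift_dist f y + shift_dist g y"
proof -
  note s = integrable_translate[OF f, of y] integrable_translate[OF g, of y]
  have "shift_dist (\<lambda>x. f x + g x) y \<le> (\<integral>x. \<bar>f (y + x) - f x\<bar> + \<bar>g (y + x) - g x\<bar> \<partial>lborel)"
    unfolding shift_dist_def
    using s f g by (intro integral_mono Bochner_Integration.integrable_add integrable_abs Bochner_Integration.integrable_diff) auto
  also have "\<dots> = shift_dist f y + shift_dist g y"
    unfolding shift_dist_def using s f g by simp
  finally show ?thesis .
qed

text \<open>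
  As \<open>U\<close> and its translate have the same measure, the distance is twice the integral of
  the positive part of the difference of the indicators. That function is at most the
  indicator of \<open>U\<close>, and at each point of the open set it vanishes for small shifts, so
  dominated convergence applies.
\<close>

lemma shift_dist_open:
  fixes U :: "'a::euclidean_space set"
  assumes U: "open U" "emeasure lborel U < \<infinity>"
  shows "(shift_dist (indicator U) \<longlongrightarrow> 0) (at 0)"
  unfolding tendsto_at_iff_sequentially
proof (intro allI impI)
  fix Y :: "nat \<Rightarrow> 'a"
  assume Y: "Y \<longlonglongrightarrow> 0"
  let ?I = "indicator U :: 'a \<Rightarrow> real"
  have [measurable]: "U \<in> sets borel" using U by auto
  have I: "integrable lborel ?I" using U by (simp add: integrable_indicator_iff)
  have "shift_dist ?I y = 2 * (\<integral>x. max 0 (?I x - ?I (y + x)) \<partial>lborel)" for y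
  proof -
    note s = integrable_translate[OF I, of y]
    have "\<bar>?I (y + x) - ?I x\<bar> = 2 * max 0 (?I x - ?I (y + x)) + (?I (y + x) - ?I x)" for x
      by (simp add: max_def abs_if)
    then have "shift_dist ?I y = (\<integral>x. 2 * max 0 (?I x - ?I (y + x)) + (?I (y + x) - ?I x) \<partial>lborel)"
      unfolding shift_dist_def by presburger
    also have "\<dots> = 2 * (\<integral>x. max 0 (?I x - ?I (y + x)) \<partial>lborel) + ((\<integral>x. ?I (y + x) \<partial>lborel) - (\<integral>x. ?I x \<partial>lborel))"
      using s I by (subst Bochner_Integration.integral_add) (auto intro!: integrable_max)
    also have "(\<integral>x. ?I (y + x) \<partial>lborel) = (\<integral>x. ?I x \<partial>lborel)"
      by (rule integral_translate) auto
    finally show ?thesis by simp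
  qed
  moreover have "(\<lambda>n. \<integral>x. max 0 (?I x - ?I (Y n + x)) \<partial>lborel) \<longlonglongrightarrow> (\<integral>x. 0 \<partial>(lborel :: 'a measure))"
  proof (rule integral_dominated_convergence[where w="?I"])
    show "AE x in lborel. (\<lambda>n. max 0 (?I x - ?I (Y n + x))) \<longlonglongrightarrow> 0"
    proof (rule AE_I2)
      fix x
      have "\<forall>\<^sub>F n in sequentially. max 0 (?I x - ?I (Y n + x)) = 0"
      proof (cases "x \<in> U")
        case True
        have "(\<lambda>n. Y n + x) \<longlonglongrightarrow> x" using Y by (auto intro!: tendsto_eq_intros)
        then have "\<forall>\<^sub>F n in sequentially. Y n + x \<in> U"
          using topological_tendstoD U(1) True by blast
        then show ?thesis by eventually_elim auto
      qed auto
      then show "(\<lambda>n. max 0 (?I x - ?I (Y n + x))) \<longlonglongrightarrow> 0"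
        by (rule tendsto_eventually)
    qed
  qed (use I in \<open>auto simp: indicator_def\<close>)
  ultimately show "((shift_dist ?I) \<circ> Y) \<longlonglongrightarrow> 0"
    using tendsto_mult_right_zero by (fastforce simp: o_def)
qed

text \<open>
  The property is stable under approximation in \<open>L^1\<close>; outer regularity of Lebesgue
  measure reduces indicators of Borel sets to the open sets treated above.
\<close>

lemma shift_dist_tendsto:
  fixes f :: "'a::euclidean_space \<Rightarrow> real"
  assumes "integrable lborel f"
  shows "(shift_dist f \<longlongrightarrow> 0) (at 0)"
proof -
  have nonneg: "shift_dist f y \<ge> 0" for f :: "'a \<Rightarrow> real" and y by (simp add: shift_dist_def)
  have approx: "(shift_dist f \<longlongrightarrow> 0) (at 0)"
    if f: "integrable lborel f"
      and ap: "\<And>e. e > 0 \<Longrightarrow> \<exists>g. integrable lborel g \<and> (shift_dist g \<longlongrightarrow> 0) (at 0) \<and> (\<integral>x. \<bar>f x - g x\<bar> \<partial>lborel) < e"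
    for f :: "'a \<Rightarrow> real"
  proof (rule tendstoI)
    fix e :: real assume "e > 0"
    then obtain g where g: "integrable lborel g" "(shift_dist g \<longlongrightarrow> 0) (at 0)" "(\<integral>x. \<bar>f x - g x\<bar> \<partial>lborel) < e/4"
      using ap[of "e/4"] by auto
    have "\<forall>\<^sub>F y in at 0. dist (shift_dist g y) 0 < e/2"
      using g(2) \<open>e > 0\<close> by (intro tendstoD) auto
    then show "\<forall>\<^sub>F y in at 0. dist (shift_dist f y) 0 < e"
    proof eventually_elim
      case (elim y)
      then show ?case using shift_dist_approx[OF f g(1), of y] g(3) nonneg[of f y] nonneg[of g y] by auto
    qed
  qed
  show ?thesis using assms
  proof (induction rule: integrable_induct)
    case (base A c)
    then have A[measurable]: "A \<in> sets borel" and fin: "emeasure lborel A < \<infinity>" by auto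
    have iA: "integrable lborel (indicator A :: 'a \<Rightarrow> real)"
      using fin by (simp add: integrable_indicator_iff)
    have "(shift_dist (indicator A) \<longlongrightarrow> 0) (at 0)"
    proof (rule approx[OF iA])
      fix e :: real assume "e > 0"
      obtain U where U: "open U" "A \<subseteq> U" "emeasure lborel (U - A) < ennreal e"
        using outer_regular_lborel[OF A \<open>e > 0\<close>] by blast
      have [measurable]: "U \<in> sets borel" using U by auto
      have "emeasure lborel U = emeasure lborel A + emeasure lborel (U - A)"
        using U(2) by (subst plus_emeasure) (auto intro!: arg_cong[where f="emeasure lborel"])
      then have fU: "emeasure lborel U < \<infinity>" using fin U(3) by (auto simp: less_top[symmetric])
      then have iU: "integrable lborel (indicator U :: 'a \<Rightarrow> real)"
        by (simp add: integrable_indicator_iff)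
      have "(\<integral>x. \<bar>indicator A x - indicator U x :: real\<bar> \<partial>lborel) = (\<integral>x. indicator (U - A) x \<partial>(lborel :: 'a measure))"
        using U(2) by (intro Bochner_Integration.integral_cong) (auto simp: indicator_def)
      also have "\<dots> = measure lborel (U - A)" by simp
      also have "\<dots> < e" using U(3) \<open>e > 0\<close>
        by (metis emeasure_eq_ennreal_measure ennreal_less_iff measure_nonneg not_less_iff_gr_or_eq top.not_eq_extremum ennreal_neq_top)
      finally show "\<exists>g. integrable lborel g \<and> (shift_dist g \<longlongrightarrow> 0) (at 0) \<and> (\<integral>x. \<bar>indicator A x - g x\<bar> \<partial>lborel) < e"
        using shift_dist_open[OF U(1) fU] iU by blast
    qed
    then have "((\<lambda>y. shift_dist (indicator A) y * \<bar>c\<bar>) \<longlongrightarrow> 0) (at 0)"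
      by (rule tendsto_mult_left_zero)
    moreover have "shift_dist (\<lambda>x. indicator A x *\<^sub>R c) y = shift_dist (indicator A) y * \<bar>c\<bar>" for y
      unfolding shift_dist_def by (simp add: abs_mult flip: left_diff_distrib)
    ultimately show ?case by simp
  next
    case (add f g)
    have "((\<lambda>y. shift_dist f y + shift_dist g y) \<longlongrightarrow> 0) (at 0)"
      using tendsto_add[OF add(3,4)] by simp
    then show ?case
      by (rule Lim_null_comparison[rotated]) (use shift_dist_add[OF add(1,2)] nonneg in \<open>auto intro!: always_eventually\<close>)
  next
    case (lim f s)
    show ?case
    proof (rule approx[OF lim(4)])
      fix e :: real assume "e > 0"
      have "(\<lambda>i. \<integral>x. \<bar>f x - s i x\<bar> \<partial>lborel) \<longlonglongrightarrow> (\<integral>x. 0 \<partial>(lborel :: 'a measure))"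
      proof (rule integral_dominated_convergence[where w="\<lambda>x. 3 * \<bar>f x\<bar>"])
        show "AE x in lborel. (\<lambda>i. \<bar>f x - s i x\<bar>) \<longlonglongrightarrow> 0"
          proof (rule AE_I2)
          fix x
          have "(\<lambda>i. \<bar>f x - s i x\<bar>) \<longlonglongrightarrow> \<bar>f x - f x\<bar>"
            by (intro tendsto_intros lim(2)) simp
          then show "(\<lambda>i. \<bar>f x - s i x\<bar>) \<longlonglongrightarrow> 0" by simp
        qed
        show "AE x in lborel. norm \<bar>f x - s i x\<bar> \<le> 3 * \<bar>f x\<bar>" for i
        proof (rule AE_I2)
          fix x
          have "\<bar>s i x\<bar> \<le> 2 * \<bar>f x\<bar>" using lim(3)[of x i] by simp
          then show "norm \<bar>f x - s i x\<bar> \<le> 3 * \<bar>f x\<bar>" by simp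
        qed
      qed (use lim in auto)
      then have "\<forall>\<^sub>F i in sequentially. (\<integral>x. \<bar>f x - s i x\<bar> \<partial>lborel) < e"
        using \<open>e > 0\<close> by (intro order_tendstoD) auto
      then obtain i where "(\<integral>x. \<bar>f x - s i x\<bar> \<partial>lborel) < e"
        using eventually_sequentially by auto
      then show "\<exists>g. integrable lborel g \<and> (shift_dist g \<longlongrightarrow> 0) (at 0) \<and> (\<integral>x. \<bar>f x - g x\<bar> \<partial>lborel) < e"
        using lim by blast
    qed
  qed
qed

subsection \<open>Hoelder's inequality\<close>

lemma weighted_geo_le_arith:
  fixes a b :: real
  assumes "0 < l" "l < 1" "0 \<le> a" "0 \<le> b"
  shows "a powr l * b powr (1 - l) \<le> l * a + (1 - l) * b"
proof (cases "a = 0 \<or> b = 0")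
  case False
  then show ?thesis using assms by (intro Youngs_inequality_0) auto
qed (use assms in auto)

text \<open>
  Hoelder's inequality for the exponents \<open>1 / l\<close> and \<open>1 / (1 - l)\<close>, stated for the powers
  of the two factors. This form suits the interpolation arguments below, where \<open>l\<close> is the
  quantity that is computed. After division by the integrals it is the weighted inequality
  between geometric and arithmetic mean.
\<close>

lemma Hoelder_geometric:
  fixes f g :: "'a \<Rightarrow> real"
  assumes f: "integrable M f" "\<And>x. 0 \<le> f x" and g: "integrable M g" "\<And>x. 0 \<le> g x"
    and l: "0 < l" "l < 1"
  shows "integrable M (\<lambda>x. f x powr l * g x powr (1 - l))"
    and "(\<integral>x. f x powr l * g x powr (1 - l) \<partial>M) \<le> (\<integral>x. f x \<partial>M) powr l * (\<integral>x. g x \<partial>M) powr (1 - l)"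
proof -
  have [measurable]: "f \<in> borel_measurable M" "g \<in> borel_measurable M" using f g by auto
  show int: "integrable M (\<lambda>x. f x powr l * g x powr (1 - l))"
  proof (rule Bochner_Integration.integrable_bound)
    show "integrable M (\<lambda>x. l * f x + (1 - l) * g x)" using f g by auto
    show "AE x in M. norm (f x powr l * g x powr (1 - l)) \<le> norm (l * f x + (1 - l) * g x)"
      using weighted_geo_le_arith[OF l f(2) g(2)] by (intro AE_I2) (smt (verit) mult_nonneg_nonneg powr_ge_zero real_norm_def)
  qed auto
  let ?a = "\<integral>x. f x \<partial>M" and ?b = "\<integral>x. g x \<partial>M"
  have ab: "?a \<ge> 0" "?b \<ge> 0" using f g by auto
  show "(\<integral>x. f x powr l * g x powr (1 - l) \<partial>M) \<le> ?a powr l * ?b powr (1 - l)"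
  proof (cases "?a = 0 \<or> ?b = 0")
    case True
    then have "(AE x in M. f x = 0) \<or> (AE x in M. g x = 0)"
      using integral_nonneg_eq_0_iff_AE[OF f(1)] integral_nonneg_eq_0_iff_AE[OF g(1)] f(2) g(2) by auto
    then have "AE x in M. f x powr l * g x powr (1 - l) = 0" by auto
    then have "(\<integral>x. f x powr l * g x powr (1 - l) \<partial>M) = 0"
      by (rule integral_eq_zero_AE)
    then show ?thesis by simp
  next
    case False
    then have pos: "?a > 0" "?b > 0" using ab by auto
    have "(\<integral>x. f x powr l * g x powr (1 - l) \<partial>M) \<le>
      (\<integral>x. (?a powr l * ?b powr (1 - l)) * (l / ?a * f x + (1 - l) / ?b * g x) \<partial>M)"
    proof (rule integral_mono[OF int])
      show "integrable M (\<lambda>x. (?a powr l * ?b powr (1 - l)) * (l / ?a * f x + (1 - l) / ?b * g x))"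
        using f g by auto
      fix x
      have "f x powr l * g x powr (1 - l) =
        (?a powr l * ?b powr (1 - l)) * ((f x / ?a) powr l * (g x / ?b) powr (1 - l))"
        using pos f(2) g(2) by (simp add: powr_divide)
      also have "\<dots> \<le> (?a powr l * ?b powr (1 - l)) * (l * (f x / ?a) + (1 - l) * (g x / ?b))"
        using pos f(2) g(2) l by (intro mult_left_mono weighted_geo_le_arith) auto
      finally show "f x powr l * g x powr (1 - l) \<le> (?a powr l * ?b powr (1 - l)) * (l / ?a * f x + (1 - l) / ?b * g x)"
        by simp
    qed
    also have "\<dots> = (?a powr l * ?b powr (1 - l)) * (l / ?a * ?a + (1 - l) / ?b * ?b)"
      using f g by simp
    also have "\<dots> = ?a powr l * ?b powr (1 - l)" using pos by simp
    finally show ?thesis .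
  qed
qed

section \<open>Mollification\<close>

lemma frechet_derivative_eq_sum:
  fixes f :: "real^'n \<Rightarrow> real"
  assumes "f differentiable (at x)"
  shows "frechet_derivative f (at x) h = (\<Sum>i\<in>UNIV. h $ i * partial_deriv i f x)"
proof -
  have lin: "linear (frechet_derivative f (at x))"
    using assms by (rule linear_frechet_derivative)
  have "frechet_derivative f (at x) h = frechet_derivative f (at x) (\<Sum>i\<in>UNIV. h $ i *\<^sub>R axis i 1)"
    by (simp add: basis_expansion scalar_mult_eq_scaleR[symmetric])
  also have "\<dots> = (\<Sum>i\<in>UNIV. h $ i * partial_deriv i f x)"
    by (simp add: linear_sum[OF lin] linear_scale[OF lin] partial_deriv_def)
  finally show ?thesis .
qed

lemma uniformly_continuous_compact_support:
  fixes f :: "real^'n \<Rightarrow> real"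
  assumes "continuous_on UNIV f" "compact K" "\<And>x. x \<notin> K \<Longrightarrow> f x = 0" "e > 0"
  obtains d where "d > 0" "\<And>x y. norm (y - x) < d \<Longrightarrow> \<bar>f y - f x\<bar> < e"
proof -
  let ?K = "{x + y |x y. x \<in> K \<and> y \<in> cball 0 1}"
  have "compact ?K" using assms(2) by (intro compact_sums) auto
  then have "uniformly_continuous_on ?K f"
    by (rule compact_uniformly_continuous[OF continuous_on_subset[OF assms(1) subset_UNIV]])
  then obtain d where d: "d > 0" "\<And>x y. x \<in> ?K \<Longrightarrow> y \<in> ?K \<Longrightarrow> dist y x < d \<Longrightarrow> dist (f y) (f x) < e"
    using \<open>e > 0\<close> unfolding uniformly_continuous_on_def by (elim allE[of _ e]) blast
  have near: "x \<in> ?K \<and> y \<in> ?K" if "x \<in> K" "norm (y - x) < 1" for x y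
  proof -
    have "x = x + 0 \<and> 0 \<in> cball (0::real^'n) 1" by simp
    moreover have "y = x + (y - x) \<and> y - x \<in> cball 0 1" using that by (auto simp: norm_minus_commute)
    ultimately show ?thesis using that(1) by blast
  qed
  have "\<bar>f y - f x\<bar> < e" if "norm (y - x) < min d 1" for x y
  proof -
    consider "x \<in> K" | "y \<in> K" | "x \<notin> K" "y \<notin> K" by blast
    then show ?thesis
    proof cases
      case 1
      with near[of x y] d(2)[of x y] that show ?thesis by (auto simp: dist_norm)
    next
      case 2
      with near[of y x] d(2)[of x y] that show ?thesis by (auto simp: dist_norm norm_minus_commute)
    next
      case 3
      then show ?thesis using assms by auto
    qed
  qed
  with d show thesis by (intro that[of "min d 1"]) auto
qed

text \<open>
  Mean value theorem on the segment from \<open>z\<close> to \<open>z + k\<close>, with the partial derivatives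
  uniformly continuous. The uniformity in \<open>z\<close> is what permits differentiation under the
  convolution integral.
\<close>

lemma test_funs_uniform_remainder:
  fixes \<rho> :: "real^'n \<Rightarrow> real"
  assumes \<rho>: "\<rho> \<in> test_funs UNIV" and "e > 0"
  obtains d where "d > 0"
    "\<And>z k. norm k < d \<Longrightarrow> \<bar>\<rho> (z + k) - \<rho> z - (\<Sum>i\<in>UNIV. k $ i * partial_deriv i \<rho> z)\<bar> \<le> e * norm k"
proof -
  define c where "c = e / real CARD('n)"
  have c: "c > 0" using \<open>e > 0\<close> by (simp add: c_def)
  have "\<forall>i. \<exists>d>0. \<forall>x y. norm (y - x) < d \<longrightarrow> \<bar>partial_deriv i \<rho> y - partial_deriv i \<rho> x\<bar> < c"
  proof
    fix i
    have t: "partial_deriv i \<rho> \<in> test_funs UNIV" using \<rho> by (rule test_funs_pd)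
    then obtain K where "compact K" "\<And>x. x \<notin> K \<Longrightarrow> partial_deriv i \<rho> x = 0" by (rule test_funsE) blast
    from uniformly_continuous_compact_support[OF test_funs_continuous[OF t] this c]
    show "\<exists>d>0. \<forall>x y. norm (y - x) < d \<longrightarrow> \<bar>partial_deriv i \<rho> y - partial_deriv i \<rho> x\<bar> < c" by metis
  qed
  then obtain d where d: "\<And>i. d i > 0"
    "\<And>i x y. norm (y - x) < d i \<Longrightarrow> \<bar>partial_deriv i \<rho> y - partial_deriv i \<rho> x\<bar> < c" by metis
  define D where "D = Min (range d)"
  have D: "D > 0" "\<And>i. D \<le> d i" using d(1) by (auto simp: D_def)
  show thesis
  proof (rule that[OF D(1)])
    fix z k :: "real^'n" assume k: "norm k < D"
    have deriv: "((\<lambda>t. \<rho> (z + t *\<^sub>R k)) has_derivative (\<lambda>t. frechet_derivative \<rho> (at (z + s *\<^sub>R k)) (t *\<^sub>R k))) (at s within {0..1})" for s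
    proof -
      have "((\<lambda>t. z + t *\<^sub>R k) has_derivative (\<lambda>t. t *\<^sub>R k)) (at s within {0..1})"
        by (auto intro!: derivative_eq_intros)
      from has_derivative_compose[OF this frechet_derivative_works[THEN iffD1, OF test_funs_diff[OF \<rho>]]]
      show ?thesis .
    qed
    obtain s where s: "s \<in> {0<..<1}" "\<rho> (z + 1 *\<^sub>R k) - \<rho> (z + 0 *\<^sub>R k) = frechet_derivative \<rho> (at (z + s *\<^sub>R k)) ((1 - 0) *\<^sub>R k)"
      using mvt_simple[of 0 1 "\<lambda>t. \<rho> (z + t *\<^sub>R k)", OF _ deriv] by auto
    have "\<bar>\<rho> (z + k) - \<rho> z - (\<Sum>i\<in>UNIV. k $ i * partial_deriv i \<rho> z)\<bar>
        = \<bar>\<Sum>i\<in>UNIV. k $ i * (partial_deriv i \<rho> (z + s *\<^sub>R k) - partial_deriv i \<rho> z)\<bar>"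
      using s by (simp add: frechet_derivative_eq_sum[OF test_funs_diff[OF \<rho>]] right_diff_distrib sum_subtractf)
    also have "\<dots> \<le> (\<Sum>i\<in>UNIV. \<bar>k $ i * (partial_deriv i \<rho> (z + s *\<^sub>R k) - partial_deriv i \<rho> z)\<bar>)"
      by (rule sum_abs)
    also have "\<dots> \<le> (\<Sum>i\<in>(UNIV::'n set). norm k * c)"
    proof (rule sum_mono)
      fix i
      have "norm (s *\<^sub>R k) \<le> norm k" using s by (simp add: mult_left_le_one_le)
      then have "norm (z + s *\<^sub>R k - z) < d i" using k D(2)[of i] by simp
      then show "\<bar>k $ i * (partial_deriv i \<rho> (z + s *\<^sub>R k) - partial_deriv i \<rho> z)\<bar> \<le> norm k * c"
        unfolding abs_mult using d(2)[of "z + s *\<^sub>R k" z i] component_le_norm_cart[of k i]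
        by (intro mult_mono) auto
    qed
    also have "\<dots> = e * norm k" by (simp add: c_def)
    finally show "\<bar>\<rho> (z + k) - \<rho> z - (\<Sum>i\<in>UNIV. k $ i * partial_deriv i \<rho> z)\<bar> \<le> e * norm k" .
  qed
qed

definition conv :: "(real^'n \<Rightarrow> real) \<Rightarrow> (real^'n \<Rightarrow> real) \<Rightarrow> real^'n \<Rightarrow> real"
  where "conv v \<rho> x = (\<integral>y. v y * \<rho> (x - y) \<partial>lborel)"

lemma test_funs_reflect:
  assumes "\<rho> \<in> test_funs (UNIV :: (real^'n) set)" shows "(\<lambda>y. \<rho> (x - y)) \<in> test_funs UNIV"
proof (rule test_funsE[OF assms])
  fix K assume K: "\<And>k. Ck k \<rho>" "compact K" "\<And>y. y \<notin> K \<Longrightarrow> \<rho> y = 0"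
  show ?thesis
  proof (rule test_funsI)
    show "Ck k (\<lambda>y. \<rho> (x - y))" for k using Ck_affine[OF K(1), of k x "-1"] by simp
    show "compact ((\<lambda>y. x - y) ` K)" using K(2) by (intro compact_continuous_image continuous_intros)
    show "\<rho> (x - y) = 0" if "y \<notin> (\<lambda>y. x - y) ` K" for y
      using that K(3) by (metis diff_diff_eq2 add_diff_cancel_left' image_eqI)
  qed auto
qed

lemma partial_deriv_reflect:
  assumes "\<rho> \<in> test_funs UNIV"
  shows "partial_deriv i (\<lambda>y. \<rho> (x - y)) y = - partial_deriv i \<rho> (x - y)"
  using partial_deriv_affine[of \<rho> x "-1" y i] test_funs_diff[OF assms] by simp

lemma integrable_mult_bounded:
  fixes f g :: "'a \<Rightarrow> real"
  assumes "integrable M f" "g \<in> borel_measurable M" "\<And>x. \<bar>g x\<bar> \<le> C"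
  shows "integrable M (\<lambda>x. f x * g x)"
proof (rule Bochner_Integration.integrable_bound)
  show "integrable M (\<lambda>x. C * f x)" using assms by simp
  have "\<bar>f x * g x\<bar> \<le> \<bar>C * f x\<bar>" for x
    using mult_left_mono[OF order_trans[OF assms(3)[of x] abs_ge_self] abs_ge_zero[of "f x"]]
    by (simp add: abs_mult mult.commute)
  then show "AE x in M. norm (f x * g x) \<le> norm (C * f x)" by simp
qed (use assms in auto)

lemma integrable_mult_test_funs:
  assumes "integrable lborel v" "\<rho> \<in> test_funs \<Omega>"
  shows "integrable lborel (\<lambda>y. v y * \<rho> y)"
  using assms test_funs_bounded[OF assms(2)] test_funs_borel[OF assms(2)]
  by (metis integrable_mult_bounded measurable_lborel2)

lemma conv_integrable:
  assumes "integrable lborel v" "\<rho> \<in> test_funs UNIV"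
  shows "integrable lborel (\<lambda>y. v y * \<rho> (x - y))"
  using integrable_mult_test_funs[OF assms(1) test_funs_reflect[OF assms(2)]] .

lemma conv_has_derivative:
  fixes v :: "real^'n \<Rightarrow> real"
  assumes v: "integrable lborel v" and \<rho>: "\<rho> \<in> test_funs UNIV"
  shows "(conv v \<rho> has_derivative (\<lambda>h. \<Sum>i\<in>UNIV. h $ i * conv v (partial_deriv i \<rho>) x)) (at x)"
  unfolding has_derivative_within_alt
proof (intro conjI allI impI)
  show "bounded_linear (\<lambda>h. \<Sum>i\<in>UNIV. h $ i * conv v (partial_deriv i \<rho>) x)"
    by (intro bounded_linear_sum bounded_linear_mult_const bounded_linear_vec_nth)
  fix e :: real assume "e > 0"
  define I where "I = (\<integral>y. \<bar>v y\<bar> \<partial>lborel)"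
  have I: "I \<ge> 0" by (simp add: I_def)
  obtain d where d: "d > 0" "\<And>z k. norm k < d \<Longrightarrow>
     \<bar>\<rho> (z + k) - \<rho> z - (\<Sum>i\<in>UNIV. k $ i * partial_deriv i \<rho> z)\<bar> \<le> (e / (I + 1)) * norm k"
    using test_funs_uniform_remainder[OF \<rho>, of "e / (I + 1)"] I \<open>e > 0\<close> by auto
  show "\<exists>d>0. \<forall>y\<in>UNIV. norm (y - x) < d \<longrightarrow>
     norm (conv v \<rho> y - conv v \<rho> x - (\<Sum>i\<in>UNIV. (y - x) $ i * conv v (partial_deriv i \<rho>) x)) \<le> e * norm (y - x)"
  proof (intro exI[of _ d] conjI d ballI impI)
    fix y assume y: "norm (y - x) < d"
    let ?R = "\<lambda>z. \<rho> (y - z) - \<rho> (x - z) - (\<Sum>i\<in>UNIV. (y - x) $ i * partial_deriv i \<rho> (x - z))"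
    have ints: "integrable lborel (\<lambda>z. v z * \<rho> (y - z))" "integrable lborel (\<lambda>z. v z * \<rho> (x - z))"
      "\<And>i. integrable lborel (\<lambda>z. v z * partial_deriv i \<rho> (x - z))"
      using v \<rho> by (auto intro!: conv_integrable test_funs_pd)
    have R: "\<bar>?R z\<bar> \<le> (e / (I + 1)) * norm (y - x)" for z
      using d(2)[OF y, of "x - z"] by simp
    have eq: "v z * ?R z = v z * \<rho> (y - z) - v z * \<rho> (x - z) - (\<Sum>i\<in>UNIV. (y - x) $ i * (v z * partial_deriv i \<rho> (x - z)))" for z
      by (simp add: algebra_simps sum_distrib_left)
    have iR: "integrable lborel (\<lambda>z. v z * ?R z)"
      unfolding eq using ints by (intro Bochner_Integration.integrable_diff Bochner_Integration.integrable_sum integrable_mult_right)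
    have E: "conv v \<rho> y - conv v \<rho> x - (\<Sum>i\<in>UNIV. (y - x) $ i * conv v (partial_deriv i \<rho>) x) = (\<integral>z. v z * ?R z \<partial>lborel)"
      unfolding eq conv_def using ints
      by (simp del: vector_minus_component)
    have "\<bar>\<integral>z. v z * ?R z \<partial>lborel\<bar> \<le> (\<integral>z. \<bar>v z * ?R z\<bar> \<partial>lborel)" by (rule integral_abs_bound)
    also have "\<dots> \<le> (\<integral>z. \<bar>v z\<bar> * ((e / (I + 1)) * norm (y - x)) \<partial>lborel)"
    proof (rule integral_mono[OF integrable_abs[OF iR]])
      show "integrable lborel (\<lambda>z. \<bar>v z\<bar> * ((e / (I + 1)) * norm (y - x)))" using v by simp
      show "\<bar>v z * ?R z\<bar> \<le> \<bar>v z\<bar> * ((e / (I + 1)) * norm (y - x))" for z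
        unfolding abs_mult by (intro mult_left_mono R) simp
    qed
    also have "\<dots> = I / (I + 1) * (e * norm (y - x))" by (simp add: I_def)
    also have "\<dots> \<le> 1 * (e * norm (y - x))"
      using I \<open>e > 0\<close> by (intro mult_right_mono) auto
    finally show "norm (conv v \<rho> y - conv v \<rho> x - (\<Sum>i\<in>UNIV. (y - x) $ i * conv v (partial_deriv i \<rho>) x)) \<le> e * norm (y - x)"
      unfolding E by simp
  qed
qed

lemma partial_deriv_conv:
  assumes "integrable lborel v" "\<rho> \<in> test_funs UNIV"
  shows "partial_deriv i (conv v \<rho>) = conv v (partial_deriv i \<rho>)"
proof
  fix x
  have "(\<Sum>j\<in>UNIV. axis i 1 $ j * conv v (partial_deriv j \<rho>) x) = (\<Sum>j\<in>UNIV. if j = i then conv v (partial_deriv j \<rho>) x else 0)"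
    by (intro sum.cong) (auto simp: axis_def)
  then show "partial_deriv i (conv v \<rho>) x = conv v (partial_deriv i \<rho>) x"
    by (simp add: partial_deriv_eq[OF conv_has_derivative[OF assms]])
qed

lemma Ck_conv:
  assumes "integrable lborel v" "\<rho> \<in> test_funs UNIV"
  shows "Ck k (conv v \<rho>)"
  using assms(2)
proof (induction k arbitrary: \<rho>)
  case 0
  have "conv v \<rho> differentiable (at x)" for x
    using conv_has_derivative[OF assms(1) 0] differentiable_def by blast
  then show ?case
    using differentiable_imp_continuous_within by (fastforce simp: continuous_on_eq_continuous_at)
next
  case (Suc k)
  have "conv v \<rho> differentiable (at x)" for x
    using conv_has_derivative[OF assms(1) Suc.prems] differentiable_def by blast
  moreover have "Ck k (partial_deriv i (conv v \<rho>))" for i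
    unfolding partial_deriv_conv[OF assms(1) Suc.prems] by (intro Suc.IH test_funs_pd Suc.prems)
  ultimately show ?case by simp
qed

lemma conv_zero:
  assumes "\<And>y. y \<notin> K \<Longrightarrow> v y = 0" "\<And>y. y \<notin> L \<Longrightarrow> \<rho> y = 0" "x \<notin> {a + b |a b. a \<in> K \<and> b \<in> L}"
  shows "conv v \<rho> x = 0"
proof -
  have "v y * \<rho> (x - y) = 0" for y
  proof (cases "y \<in> K")
    case True
    have "x = y + (x - y)" by simp
    with True have "x - y \<notin> L" using assms(3) by blast
    then show ?thesis using assms(2) by simp
  qed (use assms in auto)
  then have "(\<lambda>y. v y * \<rho> (x - y)) = (\<lambda>_. 0)" by blast
  then show ?thesis by (simp add: conv_def)
qed

lemma conv_test_funs:
  assumes "integrable lborel v" "\<rho> \<in> test_funs UNIV" "compact K" "\<And>y. y \<notin> K \<Longrightarrow> v y = 0"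
    and "compact L" "\<And>y. y \<notin> L \<Longrightarrow> \<rho> y = 0" "{a + b |a b. a \<in> K \<and> b \<in> L} \<subseteq> \<Omega>"
  shows "conv v \<rho> \<in> test_funs \<Omega>"
  using assms by (intro test_funsI[OF Ck_conv compact_sums[OF assms(3,5)]]) (auto intro!: conv_zero[of K v L \<rho>])

lemma conv_borel[measurable]:
  assumes "integrable lborel v" "\<rho> \<in> test_funs UNIV"
  shows "conv v \<rho> \<in> borel_measurable borel"
  using Ck_continuous[OF Ck_conv[OF assms, of 0]] by (rule borel_measurable_continuous_onI)

lemma pair_nn_integral_conv:
  fixes w \<rho> :: "'a::euclidean_space \<Rightarrow> real"
  assumes [measurable]: "w \<in> borel_measurable borel" "\<rho> \<in> borel_measurable borel"
  shows "(\<integral>\<^sup>+x. \<integral>\<^sup>+y. ennreal (\<bar>w y\<bar> * \<bar>\<rho> (x - y)\<bar>) \<partial>lborel \<partial>lborel) =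
     (\<integral>\<^sup>+y. \<bar>w y\<bar> \<partial>lborel) * (\<integral>\<^sup>+y. \<bar>\<rho> y\<bar> \<partial>lborel)"
proof -
  have "(\<integral>\<^sup>+x. \<integral>\<^sup>+y. ennreal (\<bar>w y\<bar> * \<bar>\<rho> (x - y)\<bar>) \<partial>lborel \<partial>lborel) =
     (\<integral>\<^sup>+y. \<integral>\<^sup>+x. ennreal (\<bar>w y\<bar> * \<bar>\<rho> (x - y)\<bar>) \<partial>lborel \<partial>lborel)"
    by (rule lborel_pair.Fubini') measurable
  also have "\<dots> = (\<integral>\<^sup>+y. ennreal \<bar>w y\<bar> * (\<integral>\<^sup>+x. ennreal \<bar>\<rho> (- y + x)\<bar> \<partial>lborel) \<partial>lborel)"
    by (intro nn_integral_cong) (subst nn_integral_cmult[symmetric], auto simp: ennreal_mult add.commute)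
  also have "\<dots> = (\<integral>\<^sup>+y. ennreal \<bar>w y\<bar> * (\<integral>\<^sup>+x. ennreal \<bar>\<rho> x\<bar> \<partial>lborel) \<partial>lborel)"
    by (subst nn_integral_translate[where f="\<lambda>x. ennreal \<bar>\<rho> x\<bar>"]) auto
  also have "\<dots> = (\<integral>\<^sup>+y. \<bar>w y\<bar> \<partial>lborel) * (\<integral>\<^sup>+y. \<bar>\<rho> y\<bar> \<partial>lborel)"
    by (rule nn_integral_multc) simp
  finally show ?thesis .
qed

lemma conv_L1_bound:
  assumes v: "integrable lborel v" and \<rho>: "\<rho> \<in> test_funs UNIV"
  shows "integrable lborel (conv v \<rho>)"
    and "(\<integral>x. \<bar>conv v \<rho> x\<bar> \<partial>lborel) \<le> (\<integral>x. \<bar>v x\<bar> \<partial>lborel) * (\<integral>x. \<bar>\<rho> x\<bar> \<partial>lborel)"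
proof -
  have i\<rho>: "integrable lborel \<rho>" using \<rho> by (rule test_funs_integrable)
  have [measurable]: "v \<in> borel_measurable borel" "\<rho> \<in> borel_measurable borel" "conv v \<rho> \<in> borel_measurable borel"
    using v i\<rho> conv_borel[OF v \<rho>] by auto
  have "(\<integral>\<^sup>+x. norm (conv v \<rho> x) \<partial>lborel) \<le> (\<integral>\<^sup>+x. \<integral>\<^sup>+y. ennreal (\<bar>v y\<bar> * \<bar>\<rho> (x - y)\<bar>) \<partial>lborel \<partial>lborel)"
  proof (rule nn_integral_mono)
    fix x
    show "ennreal (norm (conv v \<rho> x)) \<le> (\<integral>\<^sup>+y. ennreal (\<bar>v y\<bar> * \<bar>\<rho> (x - y)\<bar>) \<partial>lborel)"
      using integral_norm_bound_ennreal[OF conv_integrable[OF v \<rho>, of x]] by (simp add: conv_def abs_mult)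
  qed
  also have "\<dots> = (\<integral>\<^sup>+y. \<bar>v y\<bar> \<partial>lborel) * (\<integral>\<^sup>+y. \<bar>\<rho> y\<bar> \<partial>lborel)"
    by (rule pair_nn_integral_conv) auto
  also have "\<dots> = ennreal ((\<integral>x. \<bar>v x\<bar> \<partial>lborel) * (\<integral>x. \<bar>\<rho> x\<bar> \<partial>lborel))"
    using v i\<rho> by (simp add: nn_integral_eq_integral ennreal_mult)
  finally have b: "(\<integral>\<^sup>+x. norm (conv v \<rho> x) \<partial>lborel) \<le> ennreal ((\<integral>x. \<bar>v x\<bar> \<partial>lborel) * (\<integral>x. \<bar>\<rho> x\<bar> \<partial>lborel))" .
  show int: "integrable lborel (conv v \<rho>)"
    by (rule integrableI_bounded) (use le_less_trans[OF b ennreal_less_top] in auto)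
  show "(\<integral>x. \<bar>conv v \<rho> x\<bar> \<partial>lborel) \<le> (\<integral>x. \<bar>v x\<bar> \<partial>lborel) * (\<integral>x. \<bar>\<rho> x\<bar> \<partial>lborel)"
    using b int by (simp add: nn_integral_eq_integral)
qed

text \<open>
  Since \<open>\<rho>\<close> is a probability density, \<open>conv v \<rho> - v\<close> is the \<open>\<rho>\<close>-average of the differences
  between \<open>v\<close> and its translates, and Tonelli's theorem bounds its norm by the \<open>\<rho>\<close>-average
  of \<open>shift_dist\<close>.
\<close>

lemma conv_L1_dist:
  assumes v: "integrable lborel v" and \<rho>: "\<rho> \<in> test_funs UNIV"
    and nonneg: "\<And>x. \<rho> x \<ge> 0" and one: "(\<integral>x. \<rho> x \<partial>lborel) = 1"
    and e: "\<And>z. \<rho> z \<noteq> 0 \<Longrightarrow> shift_dist v (- z) \<le> e"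
  shows "(\<integral>x. \<bar>conv v \<rho> x - v x\<bar> \<partial>lborel) \<le> e"
proof -
  have i\<rho>: "integrable lborel \<rho>" using \<rho> by (rule test_funs_integrable)
  have vb[measurable]: "v \<in> borel_measurable borel" "\<rho> \<in> borel_measurable borel" "conv v \<rho> \<in> borel_measurable borel"
    using v i\<rho> conv_borel[OF v \<rho>] by auto
  have e0: "e \<ge> 0"
  proof (rule ccontr)
    assume "\<not> e \<ge> 0"
    moreover have "shift_dist v (- z) \<ge> 0" for z by (simp add: shift_dist_def)
    ultimately have "\<rho> z = 0" for z using e[of z] by (meson order_trans)
    then have "\<rho> = (\<lambda>_. 0)" by blast
    with one show False by simp
  qed
  have pt: "ennreal \<bar>conv v \<rho> x - v x\<bar> \<le> (\<integral>\<^sup>+z. ennreal (\<rho> z * \<bar>v (- z + x) - v x\<bar>) \<partial>lborel)" for x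
  proof -
    have "conv v \<rho> x = (\<integral>z. v (x - z) * \<rho> z \<partial>lborel)"
      unfolding conv_def by (subst integral_reflect[symmetric, where a=x]) auto
    moreover have "v x = (\<integral>z. v x * \<rho> z \<partial>lborel)" using one by simp
    moreover have i1: "integrable lborel (\<lambda>z. v (x - z) * \<rho> z)"
      using integrable_reflect[OF conv_integrable[OF v \<rho>, of x], of x] by simp
    moreover have i2: "integrable lborel (\<lambda>z. v x * \<rho> z)" using i\<rho> by simp
    ultimately have "conv v \<rho> x - v x = (\<integral>z. v (x - z) * \<rho> z - v x * \<rho> z \<partial>lborel)"
      by (simp only: Bochner_Integration.integral_diff)
    then have "ennreal \<bar>conv v \<rho> x - v x\<bar> \<le> (\<integral>\<^sup>+z. norm (v (x - z) * \<rho> z - v x * \<rho> z) \<partial>lborel)"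
      using integral_norm_bound_ennreal[OF Bochner_Integration.integrable_diff[OF i1 i2]] by simp
    also have "\<dots> = (\<integral>\<^sup>+z. ennreal (\<rho> z * \<bar>v (- z + x) - v x\<bar>) \<partial>lborel)"
    proof (rule nn_integral_cong)
      fix z
      have "v (x - z) * \<rho> z - v x * \<rho> z = \<rho> z * (v (- z + x) - v x)" by (simp add: algebra_simps)
      then show "ennreal (norm (v (x - z) * \<rho> z - v x * \<rho> z)) = ennreal (\<rho> z * \<bar>v (- z + x) - v x\<bar>)"
        using nonneg[of z] by (simp add: abs_mult)
    qed
    finally show ?thesis .
  qed
  have iv: "integrable lborel (\<lambda>x. conv v \<rho> x - v x)" using v conv_L1_bound(1)[OF v \<rho>] by auto
  have "ennreal (\<integral>x. \<bar>conv v \<rho> x - v x\<bar> \<partial>lborel) = (\<integral>\<^sup>+x. ennreal \<bar>conv v \<rho> x - v x\<bar> \<partial>lborel)"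
    using iv by (intro nn_integral_eq_integral[symmetric]) auto
  also have "\<dots> \<le> (\<integral>\<^sup>+x. \<integral>\<^sup>+z. ennreal (\<rho> z * \<bar>v (- z + x) - v x\<bar>) \<partial>lborel \<partial>lborel)"
    by (intro nn_integral_mono pt)
  also have "\<dots> = (\<integral>\<^sup>+z. \<integral>\<^sup>+x. ennreal (\<rho> z * \<bar>v (- z + x) - v x\<bar>) \<partial>lborel \<partial>lborel)"
    by (rule lborel_pair.Fubini') measurable
  also have "\<dots> = (\<integral>\<^sup>+z. ennreal (\<rho> z * shift_dist v (- z)) \<partial>lborel)"
  proof (rule nn_integral_cong)
    fix z
    have "integrable lborel (\<lambda>x. \<rho> z * \<bar>v (- z + x) - v x\<bar>)"
      using integrable_translate[OF v, of "- z"] v by (intro integrable_mult_right integrable_abs Bochner_Integration.integrable_diff)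
    then show "(\<integral>\<^sup>+x. ennreal (\<rho> z * \<bar>v (- z + x) - v x\<bar>) \<partial>lborel) = ennreal (\<rho> z * shift_dist v (- z))"
      using nonneg by (subst nn_integral_eq_integral) (auto simp: shift_dist_def)
  qed
  also have "\<dots> \<le> (\<integral>\<^sup>+z. ennreal (\<rho> z * e) \<partial>lborel)"
    using nonneg e by (intro nn_integral_mono ennreal_leI) (metis mult_eq_0_iff mult_left_mono order_refl)
  also have "\<dots> = ennreal e"
    using i\<rho> nonneg e0 one by (subst nn_integral_eq_integral) auto
  finally show ?thesis using e0 by (simp add: ennreal_le_iff)
qed

definition mollifier :: "nat \<Rightarrow> real^'n \<Rightarrow> real"
  where "mollifier n x = bump 0 (real (Suc n) *\<^sub>R x) / (\<integral>y. bump 0 (real (Suc n) *\<^sub>R (y::real^'n)) \<partial>lborel)"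

lemma
  shows mollifier_test: "(mollifier n :: real^'n \<Rightarrow> real) \<in> test_funs UNIV" (is ?A)
    and mollifier_nonneg: "mollifier n (x :: real^'n) \<ge> 0" (is ?B)
    and mollifier_integral: "(\<integral>x. mollifier n (x :: real^'n) \<partial>lborel) = 1" (is ?C)
    and mollifier_zero: "norm (x :: real^'n) \<ge> 1 / real (Suc n) \<Longrightarrow> mollifier n x = 0" (is "_ \<Longrightarrow> ?D")
proof -
  let ?b = "\<lambda>x :: real^'n. bump 0 (real (Suc n) *\<^sub>R x)"
  have Ck: "Ck k ?b" for k using Ck_affine[OF Ck_bump, of k 0 0 "real (Suc n)"] by simp
  have z: "?b x = 0" if "norm x \<ge> 1 / real (Suc n)" for x
    using that by (intro bump_zero) (simp add: field_simps del: of_nat_Suc)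
  have t: "?b \<in> test_funs UNIV"
    by (rule test_funsI[OF Ck compact_cball[of 0 "1 / real (Suc n)"]]) (auto intro!: z simp del: of_nat_Suc)
  have "(\<integral>y. ?b y \<partial>lborel) \<noteq> 0"
  proof
    assume "(\<integral>y. ?b y \<partial>lborel) = 0"
    then have "AE y in lborel. ?b y = 0"
      using integral_nonneg_eq_0_iff_AE[OF test_funs_integrable[OF t]] bump_nonneg by auto
    then have "AE y in lborel. y \<notin> ball (0::real^'n) (1 / real (Suc n))"
    proof eventually_elim
      case (elim y)
      then show ?case using bump_pos[of "real (Suc n) *\<^sub>R y" 0] by (auto simp: field_simps simp del: of_nat_Suc)
    qed
    then have "emeasure lborel (ball (0::real^'n) (1 / real (Suc n))) = 0"
      by (subst (asm) AE_iff_measurable[OF _ refl]) (auto simp: ball_def)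
    then show False
      using emeasure_lborel_ball_finite open_not_negligible[of "ball (0::real^'n) (1 / real (Suc n))"]
      by (auto simp: negligible_iff_null_sets null_sets_def)
  qed
  moreover have "(\<integral>y. ?b y \<partial>lborel) \<ge> 0" by (simp add: bump_nonneg)
  ultimately have I: "(\<integral>y. ?b y \<partial>lborel) > 0" by simp
  show ?A
    using test_funs_mult[OF Ck_const t, of "1 / (\<integral>y. ?b y \<partial>lborel)"] by (simp add: mollifier_def[abs_def])
  show ?B unfolding mollifier_def by (intro divide_nonneg_nonneg bump_nonneg less_imp_le[OF I])
  show ?C unfolding mollifier_def using I by simp
  show ?D if "norm x \<ge> 1 / real (Suc n)" using z[OF that] by (simp add: mollifier_def)
qed

lemma conv_mollifier_L1:
  fixes v :: "real^'n \<Rightarrow> real"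
  assumes v: "integrable lborel v"
  shows "(\<lambda>n. \<integral>x. \<bar>conv v (mollifier n) x - v x\<bar> \<partial>lborel) \<longlonglongrightarrow> 0"
proof (rule LIMSEQ_I)
  fix e :: real assume "e > 0"
  have "\<forall>\<^sub>F y in at 0. dist (shift_dist v y) 0 < e / 2"
    using shift_dist_tendsto[OF v] \<open>e > 0\<close> by (intro tendstoD) auto
  then obtain d where d: "d > 0" "\<And>y. y \<noteq> 0 \<Longrightarrow> norm y < d \<Longrightarrow> \<bar>shift_dist v y\<bar> < e / 2"
    unfolding eventually_at by (auto simp: dist_norm)
  obtain N where N: "1 / real (Suc N) < d" using d(1) nat_approx_posE by blast
  have "norm ((\<integral>x. \<bar>conv v (mollifier n) x - v x\<bar> \<partial>lborel) - 0) < e" if "n \<ge> N" for n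
  proof -
    have "(\<integral>x. \<bar>conv v (mollifier n) x - v x\<bar> \<partial>lborel) \<le> e / 2"
    proof (rule conv_L1_dist[OF v mollifier_test mollifier_nonneg mollifier_integral])
      fix z :: "real^'n" assume "mollifier n z \<noteq> 0"
      then have "norm z < 1 / real (Suc n)" using mollifier_zero[of n z] by linarith
      also have "\<dots> \<le> 1 / real (Suc N)" using that by (intro divide_left_mono) auto
      finally have "norm (- z) < d" using N by simp
      then show "shift_dist v (- z) \<le> e / 2"
        using d(2)[of "- z"] \<open>e > 0\<close> by (cases "z = 0") (auto simp: shift_dist_def)
    qed
    then show ?thesis using \<open>e > 0\<close> by (simp add: integral_nonneg_AE)
  qed
  then show "\<exists>N. \<forall>n\<ge>N. norm ((\<integral>x. \<bar>conv v (mollifier n) x - v x\<bar> \<partial>lborel) - 0) < e" by blast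
qed

lemma conv_mollifier_AE:
  fixes v :: "real^'n \<Rightarrow> real"
  assumes v: "integrable lborel v"
  obtains r :: "nat \<Rightarrow> nat" where "strict_mono r" "AE x in lborel. (\<lambda>n. conv v (mollifier (r n)) x) \<longlonglongrightarrow> v x"
proof -
  have "\<exists>r::nat\<Rightarrow>nat. strict_mono r \<and> (AE x in lborel. (\<lambda>n. conv v (mollifier (r n)) x - v x) \<longlonglongrightarrow> 0)"
    using conv_mollifier_L1[OF v] v conv_L1_bound(1)[OF v mollifier_test]
    by (intro tendsto_L1_AE_subseq) auto
  then show thesis using that by (auto simp: LIM_zero_iff)
qed

text \<open>
  Hoelder's inequality for the probability density \<open>\<rho> (x - y)\<close> bounds \<open>|conv v \<rho>|^p\<close>
  pointwise by \<open>conv (|v|^p) \<rho>\<close>, to which the case of \<open>L^1\<close> applies.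
\<close>

lemma conv_Lp_bound:
  fixes v :: "real^'n \<Rightarrow> real"
  assumes v: "integrable lborel v" and vp: "integrable lborel (\<lambda>x. \<bar>v x\<bar> powr p)" and p: "p > 1"
    and \<rho>: "\<rho> \<in> test_funs UNIV" "\<And>x. \<rho> x \<ge> 0" "(\<integral>x. \<rho> x \<partial>lborel) = 1"
  shows "integrable lborel (\<lambda>x. \<bar>conv v \<rho> x\<bar> powr p)"
    and "(\<integral>x. \<bar>conv v \<rho> x\<bar> powr p \<partial>lborel) \<le> (\<integral>x. \<bar>v x\<bar> powr p \<partial>lborel)"
proof -
  let ?w = "\<lambda>x. \<bar>v x\<bar> powr p"
  have i\<rho>: "integrable lborel \<rho>" using \<rho>(1) by (rule test_funs_integrable)
  have [measurable]: "v \<in> borel_measurable borel" "conv v \<rho> \<in> borel_measurable borel"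
    using v conv_borel[OF v \<rho>(1)] by auto
  have pt: "\<bar>conv v \<rho> x\<bar> powr p \<le> conv ?w \<rho> x" for x
  proof -
    have i1: "integrable lborel (\<lambda>y. ?w y * \<rho> (x - y))" by (rule conv_integrable[OF vp \<rho>(1)])
    have i2: "integrable lborel (\<lambda>y. \<rho> (x - y))" by (rule integrable_reflect[OF i\<rho>])
    have eq: "\<bar>v y * \<rho> (x - y)\<bar> = (?w y * \<rho> (x - y)) powr (1 / p) * \<rho> (x - y) powr (1 - 1 / p)" for y
    proof -
      have "(?w y * \<rho> (x - y)) powr (1 / p) * \<rho> (x - y) powr (1 - 1 / p) =
         \<bar>v y\<bar> * (\<rho> (x - y) powr (1 / p) * \<rho> (x - y) powr (1 - 1 / p))"
        using p \<rho>(2) by (simp add: powr_mult powr_powr)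
      also have "\<rho> (x - y) powr (1 / p) * \<rho> (x - y) powr (1 - 1 / p) = \<rho> (x - y)"
        using p \<rho>(2)[of "x - y"] by (simp add: powr_add[symmetric])
      finally show ?thesis using \<rho>(2) by (simp add: abs_mult)
    qed
    have "\<bar>conv v \<rho> x\<bar> \<le> (\<integral>y. \<bar>v y * \<rho> (x - y)\<bar> \<partial>lborel)" unfolding conv_def by (rule integral_abs_bound)
    also have "\<dots> \<le> (conv ?w \<rho> x) powr (1 / p) * (\<integral>y. \<rho> (x - y) \<partial>lborel) powr (1 - 1 / p)"
      unfolding eq conv_def by (rule Hoelder_geometric(2)[OF i1 _ i2]) (use \<rho>(2) p in auto)
    also have "(\<integral>y. \<rho> (x - y) \<partial>lborel) = 1" using i\<rho> \<rho>(3) by (subst integral_reflect) auto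
    finally have "\<bar>conv v \<rho> x\<bar> powr p \<le> ((conv ?w \<rho> x) powr (1 / p)) powr p"
      using p by (intro powr_mono2) auto
    also have "\<dots> = conv ?w \<rho> x"
    proof -
      have "conv ?w \<rho> x \<ge> 0" unfolding conv_def using \<rho>(2) by (intro integral_nonneg_AE) auto
      then show ?thesis using p by (simp add: powr_powr)
    qed
    finally show ?thesis .
  qed
  have ic: "integrable lborel (conv ?w \<rho>)" by (rule conv_L1_bound(1)[OF vp \<rho>(1)])
  show int: "integrable lborel (\<lambda>x. \<bar>conv v \<rho> x\<bar> powr p)"
    by (rule Bochner_Integration.integrable_bound[OF ic]) (use pt in \<open>auto intro!: order_trans[OF pt]\<close>)
  have "(\<integral>x. \<bar>conv v \<rho> x\<bar> powr p \<partial>lborel) \<le> (\<integral>x. \<bar>conv ?w \<rho> x\<bar> \<partial>lborel)"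
    using ic by (intro integral_mono int integrable_abs) (auto intro!: order_trans[OF pt])
  also have "\<dots> \<le> (\<integral>x. \<bar>?w x\<bar> \<partial>lborel) * (\<integral>x. \<bar>\<rho> x\<bar> \<partial>lborel)" by (rule conv_L1_bound(2)[OF vp \<rho>(1)])
  finally show "(\<integral>x. \<bar>conv v \<rho> x\<bar> powr p \<partial>lborel) \<le> (\<integral>x. \<bar>v x\<bar> powr p \<partial>lborel)" using \<rho> by simp
qed

section \<open>The Loomis-Whitney inequality\<close>

text \<open>
  The value at \<open>top\<close> is \<open>top\<close>, so that Hoelder's inequality and the Loomis-Whitney
  inequality can be stated for all nonnegative Borel functions.
\<close>

definition epow :: "real \<Rightarrow> ennreal \<Rightarrow> ennreal"
  where "epow a x = (if x = top then top else ennreal (enn2real x powr a))"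

lemma epow_0[simp]: "epow a 0 = 0" and epow_top[simp]: "epow a top = top"
  and epow_ennreal: "0 \<le> r \<Longrightarrow> epow a (ennreal r) = ennreal (r powr a)"
  by (auto simp: epow_def)

lemma epow_borel[measurable]: "epow a \<in> borel_measurable borel"
  unfolding epow_def by measurable

lemma epow_mono: "0 < a \<Longrightarrow> x \<le> y \<Longrightarrow> epow a x \<le> epow a y"
  by (cases x; cases y) (auto simp: epow_ennreal top_unique intro!: ennreal_leI powr_mono2)

lemma epow_eq_0: "x \<noteq> 0 \<Longrightarrow> epow a x \<noteq> 0"
  by (cases x) (auto simp: epow_ennreal ennreal_eq_0_iff)

text \<open>
  Hoelder's inequality for several factors with equal exponents. When all integrals are
  positive and finite, the factors are normalised to integral \<open>1\<close> and the inequality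
  between geometric and arithmetic mean is integrated; otherwise one side is \<open>0\<close> or \<open>top\<close>.
\<close>

lemma nn_integral_prod_le_prod_nn_integral:
  fixes f :: "'i \<Rightarrow> 'a \<Rightarrow> ennreal"
  assumes I: "finite I" "I \<noteq> {}" and [measurable]: "\<And>i. i \<in> I \<Longrightarrow> f i \<in> borel_measurable M"
  shows "(\<integral>\<^sup>+x. (\<Prod>i\<in>I. epow (1 / card I) (f i x)) \<partial>M) \<le> (\<Prod>i\<in>I. epow (1 / card I) (\<integral>\<^sup>+x. f i x \<partial>M))"
proof -
  let ?e = "epow (1 / card I)" and ?J = "\<lambda>i. \<integral>\<^sup>+x. f i x \<partial>M"
  have c: "card I > 0" using I by (simp add: card_gt_0_iff)
  consider "\<exists>i\<in>I. ?J i = 0" | "\<forall>i\<in>I. ?J i \<noteq> 0" "\<exists>i\<in>I. ?J i = top" | "\<forall>i\<in>I. ?J i \<noteq> 0 \<and> ?J i \<noteq> top"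
    by blast
  then show ?thesis
  proof cases
    case 1
    then obtain i where i: "i \<in> I" "?J i = 0" by blast
    then have "AE x in M. f i x = 0" by (simp add: nn_integral_0_iff_AE)
    then have "AE x in M. (\<Prod>i\<in>I. ?e (f i x)) = 0"
      by eventually_elim (use i I in \<open>auto intro!: prod_zero bexI[of _ i]\<close>)
    then have "(\<integral>\<^sup>+x. (\<Prod>i\<in>I. ?e (f i x)) \<partial>M) = 0"
      by (subst nn_integral_0_iff_AE) auto
    then show ?thesis by simp
  next
    case 2
    then obtain i where i: "i \<in> I" "?J i = top" by blast
    have "(\<Prod>i\<in>I. ?e (?J i)) = ?e (?J i) * (\<Prod>i\<in>I - {i}. ?e (?J i))"
      using I i by (simp add: prod.remove)
    moreover have "(\<Prod>i\<in>I - {i}. ?e (?J i)) \<noteq> 0"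
      using 2 I epow_eq_0 by (simp add: prod_zero_iff)
    ultimately have "(\<Prod>i\<in>I. ?e (?J i)) = top" using i I by (simp add: ennreal_top_mult)
    then show ?thesis by simp
  next
    case 3
    define a where "a i = enn2real (?J i)" for i
    have a: "?J i = ennreal (a i)" "a i > 0" if "i \<in> I" for i
      using 3 that by (auto simp: a_def enn2real_positive_iff top.not_eq_extremum zero_less_iff_neq_zero)
    have pt: "(\<Prod>i\<in>I. ?e (f i x)) \<le> (\<Prod>i\<in>I. ?e (?J i)) * (\<Sum>i\<in>I. f i x * ennreal (1 / (a i * card I)))"
      if fin: "\<forall>i\<in>I. f i x \<noteq> top" for x
    proof -
      define g where "g i = enn2real (f i x)" for i
      have g: "f i x = ennreal (g i)" "g i \<ge> 0" if "i \<in> I" for i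
        using fin that by (auto simp: g_def ennreal_enn2real_if)
      have "(\<Prod>i\<in>I. ?e (f i x)) = ennreal (\<Prod>i\<in>I. g i powr (1 / card I))"
        using g by (subst prod_ennreal[symmetric]) (auto simp: epow_ennreal intro!: prod.cong)
      also have "(\<Prod>i\<in>I. g i powr (1 / card I)) = (\<Prod>i\<in>I. a i powr (1 / card I)) * (\<Prod>i\<in>I. (g i / a i)) powr (1 / card I)"
        using a g by (subst prod_powr_distrib) (auto simp: prod.distrib[symmetric] powr_divide intro!: prod.cong, fastforce)
      also have "\<dots> \<le> (\<Prod>i\<in>I. a i powr (1 / card I)) * (\<Sum>i\<in>I. (g i / a i) / card I)"
        using a(2) g(2) I by (intro mult_left_mono arith_geom_mean prod_nonneg) (auto intro!: divide_nonneg_pos)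
      also have "ennreal \<dots> = (\<Prod>i\<in>I. ?e (?J i)) * (\<Sum>i\<in>I. f i x * ennreal (1 / (a i * card I)))"
      proof -
        have "ennreal (\<Prod>i\<in>I. a i powr (1 / card I)) = (\<Prod>i\<in>I. ?e (?J i))"
          using a by (subst prod_ennreal[symmetric]) (auto simp: epow_ennreal less_imp_le intro!: prod.cong)
        moreover have "ennreal (\<Sum>i\<in>I. (g i / a i) / card I) = (\<Sum>i\<in>I. f i x * ennreal (1 / (a i * card I)))"
          using a(2) g by (subst sum_ennreal[symmetric])
            (auto simp: ennreal_mult[symmetric] less_imp_le intro!: sum.cong divide_nonneg_pos divide_nonneg_nonneg)
        ultimately show ?thesis
          using a(2) g(2) by (subst ennreal_mult) (auto intro!: prod_nonneg sum_nonneg divide_nonneg_pos divide_nonneg_nonneg simp: less_imp_le)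
      qed
      finally show ?thesis by (simp add: ennreal_leI)
    qed
    have "AE x in M. \<forall>i\<in>I. f i x \<noteq> top"
    proof (rule AE_finite_allI[OF I(1)])
      fix i assume "i \<in> I"
      then show "AE x in M. f i x \<noteq> top"
        using nn_integral_PInf_AE[of "f i" M] a by simp
    qed
    then have "(\<integral>\<^sup>+x. (\<Prod>i\<in>I. ?e (f i x)) \<partial>M) \<le> (\<integral>\<^sup>+x. (\<Prod>i\<in>I. ?e (?J i)) * (\<Sum>i\<in>I. f i x * ennreal (1 / (a i * card I))) \<partial>M)"
      by (intro nn_integral_mono_AE) (auto elim!: eventually_mono intro!: pt)
    also have "\<dots> = (\<Prod>i\<in>I. ?e (?J i)) * (\<Sum>i\<in>I. ?J i * ennreal (1 / (a i * card I)))"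
      by (simp add: nn_integral_cmult nn_integral_sum nn_integral_multc)
    also have "(\<Sum>i\<in>I. ?J i * ennreal (1 / (a i * card I))) = (\<Sum>i\<in>I. ennreal (1 / card I))"
    proof (rule sum.cong[OF refl])
      fix i assume "i \<in> I"
      from a[OF this] show "?J i * ennreal (1 / (a i * card I)) = ennreal (1 / card I)"
        by (simp add: ennreal_mult[symmetric])
    qed
    also have "\<dots> = ennreal (\<Sum>i\<in>I. 1 / card I)" by (rule sum_ennreal) simp
    also have "(\<Sum>i\<in>I. 1 / card I) = (1::real)" using c by simp
    finally show ?thesis by simp
  qed
qed

text \<open>
  The result of integrating out the variable \<open>j\<close> is regarded as a function of all
  variables again. Iterated integrals over a list of coordinates are then folds, and no
  change of the underlying product space occurs in inductions.
\<close>

definition slice_int :: "'n \<Rightarrow> (('n \<Rightarrow> real) \<Rightarrow> ennreal) \<Rightarrow> ('n \<Rightarrow> real) \<Rightarrow> ennreal"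
  where "slice_int j f x = (\<integral>\<^sup>+t. f (x(j := t)) \<partial>lborel)"

abbreviation coord_measure :: "'n set \<Rightarrow> ('n \<Rightarrow> real) measure"
  where "coord_measure J \<equiv> PiM J (\<lambda>_. lborel)"

interpretation coords: product_sigma_finite "\<lambda>_::'n. lborel :: real measure" ..

lemma measurable_upd_UNIV:
  fixes f :: "('n::finite \<Rightarrow> real) \<Rightarrow> ennreal"
  assumes "f \<in> borel_measurable (coord_measure UNIV)"
  shows "(\<lambda>(x, t). f (x(j := t))) \<in> borel_measurable (coord_measure UNIV \<Otimes>\<^sub>M lborel)"
    and "(\<lambda>t. f (x(j := t))) \<in> borel_measurable lborel"
proof -
  have "(\<lambda>(x, t). x(j := t)) \<in> coord_measure UNIV \<Otimes>\<^sub>M lborel \<rightarrow>\<^sub>M coord_measure UNIV"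
    using measurable_add_dim[of j UNIV "\<lambda>_. lborel"] by simp
  from measurable_compose[OF this assms]
  show 1: "(\<lambda>(x, t). f (x(j := t))) \<in> borel_measurable (coord_measure UNIV \<Otimes>\<^sub>M lborel)"
    by (simp add: case_prod_unfold)
  have "x \<in> space (coord_measure UNIV)" by (simp add: space_PiM)
  from measurable_Pair2[OF 1 this] show "(\<lambda>t. f (x(j := t))) \<in> borel_measurable lborel" by simp
qed

lemma slice_int_borel:
  fixes f :: "('n::finite \<Rightarrow> real) \<Rightarrow> ennreal"
  assumes "f \<in> borel_measurable (coord_measure UNIV)"
  shows "slice_int j f \<in> borel_measurable (coord_measure UNIV)"
  using lborel.borel_measurable_nn_integral[OF measurable_upd_UNIV(1)[OF assms, of j]]
  by (simp add: slice_int_def[abs_def])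

lemma foldr_slice_int_borel:
  fixes f :: "('n::finite \<Rightarrow> real) \<Rightarrow> ennreal"
  assumes "f \<in> borel_measurable (coord_measure UNIV)"
  shows "foldr slice_int js f \<in> borel_measurable (coord_measure UNIV)"
  by (induction js) (auto simp: assms slice_int_borel)

lemma foldr_slice_int_indep:
  assumes "\<And>x t. f (x(i := t)) = f x" "i \<notin> set js"
  shows "foldr slice_int js f (x(i := t)) = foldr slice_int js f x"
  using assms(2)
proof (induction js arbitrary: x)
  case (Cons j js)
  have "foldr slice_int js f (x(i := t, j := s)) = foldr slice_int js f (x(j := s))" for s
  proof -
    have "x(i := t, j := s) = (x(j := s))(i := t)" using Cons.prems by (intro fun_upd_twist) auto
    with Cons.IH[of "x(j := s)"] Cons.prems show ?thesis by (simp only: list.set insert_iff) blast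
  qed
  then show ?case
    unfolding foldr.simps o_apply slice_int_def[of j] by (rule nn_integral_cong)
qed (simp add: assms)

text \<open>
  When the variable \<open>j\<close> is integrated out, the factor with index \<open>j\<close> is constant and
  leaves the integral, and Hoelder's inequality distributes the integral over the other
  \<open>n\<close> factors.
\<close>

lemma foldr_slice_int_prod_le:
  fixes f :: "'n::finite \<Rightarrow> ('n \<Rightarrow> real) \<Rightarrow> ennreal"
  assumes f: "\<And>i. f i \<in> borel_measurable (coord_measure UNIV)"
    and indep: "\<And>i x t. f i (x(i := t)) = f i x"
    and n: "n = CARD('n) - 1" "n > 0" and "distinct js"
  shows "foldr slice_int js (\<lambda>x. \<Prod>i\<in>UNIV. epow (1 / n) (f i x)) x
    \<le> (\<Prod>i\<in>UNIV. epow (1 / n) (foldr slice_int (filter (\<lambda>k. k \<noteq> i) js) (f i) x))"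
  using assms(5)
proof (induction js arbitrary: x)
  case (Cons j js)
  let ?g = "\<lambda>i. foldr slice_int (filter (\<lambda>k. k \<noteq> i) js) (f i)"
  let ?U = "UNIV - {j}"
  have "card ?U = n" using n by (simp add: card_Diff_singleton)
  moreover from this have "?U \<noteq> {}" using n(2) by (metis card.empty less_numeral_extra(3))
  ultimately have cU: "card ?U = n" "?U \<noteq> {}" by blast+
  have gm: "(\<lambda>t. ?g i (x(j := t))) \<in> borel_measurable lborel" for i
    by (intro measurable_upd_UNIV foldr_slice_int_borel f)
  have "foldr slice_int (j # js) (\<lambda>x. \<Prod>i\<in>UNIV. epow (1 / n) (f i x)) x
      \<le> (\<integral>\<^sup>+t. (\<Prod>i\<in>UNIV. epow (1 / n) (?g i (x(j := t)))) \<partial>lborel)"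
    unfolding foldr.simps o_def slice_int_def[of j] using Cons by (intro nn_integral_mono) auto
  also have "\<dots> = (\<integral>\<^sup>+t. epow (1 / n) (?g j x) * (\<Prod>i\<in>?U. epow (1 / n) (?g i (x(j := t)))) \<partial>lborel)"
  proof (rule nn_integral_cong)
    fix t
    have "?g j (x(j := t)) = ?g j x"
      by (rule foldr_slice_int_indep) (auto simp: indep)
    then show "(\<Prod>i\<in>UNIV. epow (1 / n) (?g i (x(j := t)))) = epow (1 / n) (?g j x) * (\<Prod>i\<in>?U. epow (1 / n) (?g i (x(j := t))))"
      by (subst prod.remove[of UNIV j]) auto
  qed
  also have "\<dots> = epow (1 / n) (?g j x) * (\<integral>\<^sup>+t. (\<Prod>i\<in>?U. epow (1 / n) (?g i (x(j := t)))) \<partial>lborel)"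
    by (intro nn_integral_cmult borel_measurable_prod_ennreal measurable_compose[OF gm epow_borel])
  also have "\<dots> \<le> epow (1 / n) (?g j x) * (\<Prod>i\<in>?U. epow (1 / n) (\<integral>\<^sup>+t. ?g i (x(j := t)) \<partial>lborel))"
    using nn_integral_prod_le_prod_nn_integral[OF _ cU(2), of "\<lambda>i t. ?g i (x(j := t))" lborel] gm cU(1)
    by (intro mult_left_mono) auto
  also have "\<dots> = (\<Prod>i\<in>UNIV. epow (1 / n) (foldr slice_int (filter (\<lambda>k. k \<noteq> i) (j # js)) (f i) x))"
    by (subst prod.remove[of UNIV j]) (auto simp: slice_int_def[of j] intro!: prod.cong)
  finally show ?case .
qed simp

lemma foldr_slice_int_eq:
  fixes f :: "('n::finite \<Rightarrow> real) \<Rightarrow> ennreal"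
  assumes f: "f \<in> borel_measurable (coord_measure UNIV)" and "distinct js"
  shows "foldr slice_int js f x = (\<integral>\<^sup>+y. f (\<lambda>i. if i \<in> set js then y i else x i) \<partial>coord_measure (set js))"
  using assms(2)
proof (induction js arbitrary: x)
  case Nil
  show ?case by (simp add: space_PiM)
next
  case (Cons j js)
  let ?J = "set js"
  let ?g = "\<lambda>y. f (\<lambda>i. if i \<in> insert j ?J then y i else x i)"
  have "(\<lambda>y i. if i \<in> insert j ?J then y i else x i) \<in> coord_measure (insert j ?J) \<rightarrow>\<^sub>M coord_measure UNIV"
  proof (rule measurable_PiM_single')
    fix i
    show "(\<lambda>y. if i \<in> insert j ?J then y i else x i) \<in> coord_measure (insert j ?J) \<rightarrow>\<^sub>M lborel"
      by (cases "i \<in> insert j ?J") (auto intro: measurable_component_singleton)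
  qed (auto simp: space_PiM)
  from measurable_compose[OF this f]
  have "(\<integral>\<^sup>+y. ?g y \<partial>coord_measure (insert j ?J)) = (\<integral>\<^sup>+t. (\<integral>\<^sup>+y. ?g (y(j := t)) \<partial>coord_measure ?J) \<partial>lborel)"
    using Cons by (intro coords.product_nn_integral_insert_rev) auto
  also have "\<dots> = (\<integral>\<^sup>+t. (\<integral>\<^sup>+y. f (\<lambda>i. if i \<in> ?J then y i else (x(j := t)) i) \<partial>coord_measure ?J) \<partial>lborel)"
    using Cons by (intro nn_integral_cong arg_cong[where f=f] ext) auto
  finally show ?case using Cons by (simp add: slice_int_def[of j])
qed

lemma foldr_slice_int_UNIV:
  fixes f :: "('n::finite \<Rightarrow> real) \<Rightarrow> ennreal"
  assumes "f \<in> borel_measurable (coord_measure UNIV)" "distinct js" "set js = UNIV"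
  shows "foldr slice_int js f x = (\<integral>\<^sup>+y. f y \<partial>coord_measure UNIV)"
  using foldr_slice_int_eq[OF assms(1,2), of x] assms(3) by simp

lemma measurable_vec_lambda: "(vec_lambda :: ('n::finite \<Rightarrow> real) \<Rightarrow> real^'n) \<in> coord_measure UNIV \<rightarrow>\<^sub>M borel"
proof (subst borel_measurable_euclidean_space, intro ballI)
  fix b :: "real^'n" assume "b \<in> Basis"
  then obtain i where b: "b = axis i 1" by (auto simp: Basis_vec_def)
  have "(\<lambda>x :: 'n \<Rightarrow> real. x i) \<in> coord_measure UNIV \<rightarrow>\<^sub>M lborel"
    by (rule measurable_component_singleton) simp
  then show "(\<lambda>x :: 'n \<Rightarrow> real. vec_lambda x \<bullet> b) \<in> borel_measurable (coord_measure UNIV)"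
    by (simp add: b inner_axis)
qed

lemma borel_measurable_vec_nth: "(\<lambda>x :: real^'n. x $ k) \<in> borel_measurable borel"
  by (intro borel_measurable_continuous_onI continuous_intros)

lemma prod_Basis_vec:
  fixes v :: "real^'n" shows "(\<Prod>b\<in>Basis. v \<bullet> b) = (\<Prod>i\<in>UNIV. v $ i)"
proof -
  have B: "(Basis :: (real^'n) set) = (\<lambda>i. axis i 1) ` UNIV" by (auto simp: Basis_vec_def)
  have "inj (\<lambda>i::'n. axis i (1::real))" by (auto simp: inj_on_def axis_eq_axis)
  then show ?thesis unfolding B by (subst prod.reindex) (auto simp: inner_axis)
qed

lemma lborel_eq_distr_vec_lambda:
  "(lborel :: (real^'n) measure) = distr (coord_measure UNIV) borel vec_lambda"
proof (rule lborel_eqI)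
  fix l u :: "real^'n" assume le: "\<And>b. b \<in> Basis \<Longrightarrow> l \<bullet> b \<le> u \<bullet> b"
  have le': "l $ i \<le> u $ i" for i using le[of "axis i 1"] by (simp add: inner_axis)
  have "vec_lambda -` box l u \<inter> space (coord_measure UNIV) = (\<Pi>\<^sub>E i\<in>UNIV. {l $ i<..<u $ i})"
    by (auto simp: mem_box_cart space_PiM PiE_UNIV_domain Pi_iff)
  then have "emeasure (distr (coord_measure UNIV) borel vec_lambda) (box l u)
     = emeasure (coord_measure UNIV) (\<Pi>\<^sub>E i\<in>UNIV. {l $ i<..<u $ i})"
    using measurable_vec_lambda by (subst emeasure_distr) auto
  also have "\<dots> = (\<Prod>i\<in>UNIV. emeasure lborel {l $ i<..<u $ i})"
    by (rule coords.emeasure_PiM) auto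
  also have "\<dots> = (\<Prod>i\<in>UNIV. ennreal ((u - l) $ i))"
    using le' by simp
  also have "\<dots> = ennreal (\<Prod>i\<in>UNIV. (u - l) $ i)" by (rule prod_ennreal) (use le' in auto)
  finally show "emeasure (distr (coord_measure UNIV) borel vec_lambda) (box l u) = (\<Prod>b\<in>Basis. (u - l) \<bullet> b)"
    by (simp only: prod_Basis_vec)
qed simp

text \<open>
  The factor with index \<open>i\<close> does not depend on \<open>x $ i\<close>. Integrating out all coordinates
  one by one as in the previous induction leaves, for each \<open>i\<close>, the integral of that
  factor over the remaining coordinates, which is the integral of \<open>h i\<close> over the whole
  space.
\<close>

lemma Loomis_Whitney:
  fixes h :: "'n \<Rightarrow> real^'n \<Rightarrow> ennreal"
  assumes h: "\<And>i. h i \<in> borel_measurable borel" and n: "n = CARD('n) - 1" "n > 0"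
  shows "(\<integral>\<^sup>+x. (\<Prod>i\<in>UNIV. epow (1 / n) (\<integral>\<^sup>+t. h i (\<chi> k. if k = i then t else x $ k) \<partial>lborel)) \<partial>lborel)
     \<le> (\<Prod>i\<in>UNIV. epow (1 / n) (\<integral>\<^sup>+x. h i x \<partial>lborel))"
proof -
  let ?H = "\<lambda>i. h i \<circ> vec_lambda"
  have H: "?H i \<in> borel_measurable (coord_measure UNIV)" for i
    using measurable_compose[OF measurable_vec_lambda h[of i]] by (simp add: o_def)
  let ?f = "\<lambda>i. slice_int i (?H i)"
  have f: "?f i \<in> borel_measurable (coord_measure UNIV)" for i by (rule slice_int_borel[OF H])
  have fi: "?f i (x(i := t)) = ?f i x" for i x t by (simp add: slice_int_def)
  obtain js :: "'n list" where js: "set js = UNIV" "distinct js"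
    using finite_distinct_list[of "UNIV :: 'n set"] by auto
  have LH: "(\<integral>\<^sup>+x. g x \<partial>lborel) = (\<integral>\<^sup>+y. g (vec_lambda y) \<partial>coord_measure UNIV)" if "g \<in> borel_measurable borel"
    for g :: "real^'n \<Rightarrow> ennreal"
    using that measurable_vec_lambda by (subst lborel_eq_distr_vec_lambda, intro nn_integral_distr) auto
  have hm: "(\<lambda>x. \<integral>\<^sup>+t. h i (\<chi> k. if k = i then t else x $ k) \<partial>lborel) \<in> borel_measurable borel" for i
  proof -
    have "(\<lambda>z. (\<chi> k. if k = i then snd z else fst z $ k) :: real^'n) \<in> borel_measurable (borel \<Otimes>\<^sub>M lborel)"
    proof (subst borel_measurable_euclidean_space, intro ballI)
      fix b :: "real^'n" assume "b \<in> Basis"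
      then obtain k where "b = axis k 1" by (auto simp: Basis_vec_def)
      moreover have "(\<lambda>z. if k = i then snd z else fst z $ k) \<in> borel_measurable ((borel :: (real^'n) measure) \<Otimes>\<^sub>M lborel)"
        by (cases "k = i") (auto intro: measurable_compose[OF measurable_fst borel_measurable_vec_nth])
      ultimately show "(\<lambda>z. (\<chi> k. if k = i then snd z else fst z $ k) \<bullet> b) \<in> borel_measurable ((borel :: (real^'n) measure) \<Otimes>\<^sub>M lborel)"
        by (simp add: inner_axis)
    qed
    from measurable_compose[OF this h[of i]]
    show ?thesis by (intro lborel.borel_measurable_nn_integral) (simp add: case_prod_unfold)
  qed
  have eq: "(\<integral>\<^sup>+t. h i (\<chi> k. if k = i then t else y k) \<partial>lborel) = ?f i y" for i y
    by (auto simp: slice_int_def fun_upd_def intro!: nn_integral_cong)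
  have "(\<integral>\<^sup>+x. (\<Prod>i\<in>UNIV. epow (1 / n) (\<integral>\<^sup>+t. h i (\<chi> k. if k = i then t else x $ k) \<partial>lborel)) \<partial>lborel)
     = (\<integral>\<^sup>+y. (\<Prod>i\<in>UNIV. epow (1 / n) (?f i y)) \<partial>coord_measure UNIV)"
  proof (subst LH)
    show "(\<lambda>x. \<Prod>i\<in>UNIV. epow (1 / n) (\<integral>\<^sup>+t. h i (\<chi> k. if k = i then t else x $ k) \<partial>lborel)) \<in> borel_measurable borel"
      by (intro borel_measurable_prod_ennreal measurable_compose[OF hm epow_borel])
  qed (simp add: eq)
  also have "\<dots> = foldr slice_int js (\<lambda>y. \<Prod>i\<in>UNIV. epow (1 / n) (?f i y)) (\<lambda>_. 0)"
    using js by (intro foldr_slice_int_UNIV[symmetric] borel_measurable_prod_ennreal measurable_compose[OF f epow_borel])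
  also have "\<dots> \<le> (\<Prod>i\<in>UNIV. epow (1 / n) (foldr slice_int (filter (\<lambda>k. k \<noteq> i) js) (?f i) (\<lambda>_. 0)))"
    by (rule foldr_slice_int_prod_le[OF f fi n js(2)])
  also have "\<dots> = (\<Prod>i\<in>UNIV. epow (1 / n) (\<integral>\<^sup>+x. h i x \<partial>lborel))"
  proof (intro prod.cong refl arg_cong[where f="epow (1 / n)"])
    fix i
    have "foldr slice_int (filter (\<lambda>k. k \<noteq> i) js) (?f i) (\<lambda>_. 0) = foldr slice_int (filter (\<lambda>k. k \<noteq> i) js @ [i]) (?H i) (\<lambda>_. 0)"
      by simp
    also have "\<dots> = (\<integral>\<^sup>+y. ?H i y \<partial>coord_measure UNIV)"
      using js by (intro foldr_slice_int_UNIV[OF H]) auto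
    also have "\<dots> = (\<integral>\<^sup>+x. h i x \<partial>lborel)" using LH[OF h] by simp
    finally show "foldr slice_int (filter (\<lambda>k. k \<noteq> i) js) (?f i) (\<lambda>_. 0) = (\<integral>\<^sup>+x. h i x \<partial>lborel)" .
  qed
  finally show ?thesis .
qed

section \<open>The anisotropic Sobolev inequality\<close>

lemma has_real_derivative_abs_powr:
  fixes y :: real
  assumes "s > 1"
  shows "((\<lambda>y. \<bar>y\<bar> powr s) has_real_derivative s * \<bar>y\<bar> powr (s - 1) * sgn y) (at y)"
proof -
  consider "y > 0" | "y < 0" | "y = 0" by linarith
  then show ?thesis
  proof cases
    case 1
    from has_real_derivative_powr[OF this, of s]
    have "((\<lambda>y. \<bar>y\<bar> powr s) has_real_derivative s * y powr (s - 1)) (at y)"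
      by (rule has_field_derivative_transform_within_open[where S="{0<..}"]) (use 1 in auto)
    then show ?thesis using 1 by simp
  next
    case 2
    have "((\<lambda>y. (- y) powr s) has_real_derivative (s * (- y) powr (s - 1)) * (- 1)) (at y)"
      by (rule DERIV_chain2[OF has_real_derivative_powr]) (use 2 in \<open>auto intro!: derivative_eq_intros\<close>)
    then have "((\<lambda>y. \<bar>y\<bar> powr s) has_real_derivative (s * (- y) powr (s - 1)) * (- 1)) (at y)"
      by (rule has_field_derivative_transform_within_open[where S="{..<0}"]) (use 2 in auto)
    then show ?thesis using 2 by simp
  next
    case 3
    have "((\<lambda>h. \<bar>h\<bar> powr s / h) \<longlongrightarrow> 0) (at 0)"
    proof (rule Lim_null_comparison)
      have "norm (\<bar>h\<bar> powr s / h) \<le> \<bar>h\<bar> powr (s - 1)" for h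
        by (cases "h = 0") (auto simp: abs_divide powr_diff)
      then show "\<forall>\<^sub>F h in at 0. norm (\<bar>h\<bar> powr s / h) \<le> \<bar>h\<bar> powr (s - 1)" by simp
      show "((\<lambda>h. \<bar>h\<bar> powr (s - 1)) \<longlongrightarrow> 0) (at (0::real))"
        using assms by (intro tendsto_zero_powrI[where b="s - 1"]) (auto intro!: tendsto_eq_intros)
    qed
    then show ?thesis using 3 by (simp add: DERIV_def)
  qed
qed

text \<open>
  Fundamental theorem of calculus for \<open>|\<phi>|^s\<close> on the line through \<open>x\<close> in direction \<open>i\<close>,
  starting from a point outside the support. The exponent exceeds \<open>1\<close>, which makes this
  power continuously differentiable.
\<close>

lemma test_funs_line_bound:
  fixes v :: "real^'n"
  assumes v: "\<phi> \<in> test_funs (UNIV :: (real^'n) set)" and s: "s > 1"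
  shows "ennreal (\<bar>\<phi> x\<bar> powr s) \<le>
    ennreal s * (\<integral>\<^sup>+t. ennreal (\<bar>\<phi> (\<chi> k. if k = i then t else x $ k)\<bar> powr (s - 1) *
       \<bar>partial_deriv i \<phi> (\<chi> k. if k = i then t else x $ k)\<bar>) \<partial>lborel)"
proof -
  let ?L = "\<lambda>t. (\<chi> k. if k = i then t else x $ k) :: real^'n"
  have L: "?L t = ?L 0 + t *\<^sub>R axis i 1" for t
    by (auto simp: vec_eq_iff axis_def)
  have Lc: "continuous_on UNIV ?L" by (subst L) (intro continuous_intros)
  have d0: "((\<lambda>t. \<phi> (?L t)) has_real_derivative partial_deriv i \<phi> (?L t)) (at t)" for t
  proof -
    have "(?L has_derivative (\<lambda>h. h *\<^sub>R axis i 1)) (at t)"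
      by (subst L) (auto intro!: derivative_eq_intros)
    from has_derivative_compose[OF this frechet_derivative_works[THEN iffD1, OF test_funs_diff[OF v]]]
    have "((\<lambda>t. \<phi> (?L t)) has_derivative (\<lambda>h. frechet_derivative \<phi> (at (?L t)) (h *\<^sub>R axis i 1))) (at t)" .
    then show ?thesis
      using linear_scale[OF linear_frechet_derivative[OF test_funs_diff[OF v]]]
      by (simp add: has_field_derivative_def partial_deriv_def mult_commute_abs)
  qed
  let ?g = "\<lambda>t. \<bar>\<phi> (?L t)\<bar> powr s" and ?d = "\<lambda>t. s * \<bar>\<phi> (?L t)\<bar> powr (s - 1) * sgn (\<phi> (?L t)) * partial_deriv i \<phi> (?L t)"
  have d: "(?g has_real_derivative ?d t) (at t)" for t
    by (rule DERIV_chain2[OF has_real_derivative_abs_powr[OF s] d0])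
  have cphi: "continuous_on UNIV (\<lambda>t. \<phi> (?L t))"
    by (rule continuous_on_compose2[OF test_funs_continuous[OF v] Lc]) auto
  have cpd: "continuous_on UNIV (\<lambda>t. partial_deriv i \<phi> (?L t))"
    by (rule continuous_on_compose2[OF test_funs_continuous[OF test_funs_pd[OF v]] Lc]) auto
  have "continuous_on UNIV (\<lambda>y::real. \<bar>y\<bar> powr (s - 1) * sgn y)"
  proof -
    have "isCont (\<lambda>y::real. \<bar>y\<bar> powr (s - 1) * sgn y) y" for y
    proof (cases "y = 0")
      case True
      have "((\<lambda>y. \<bar>y\<bar> powr (s - 1) * sgn y) \<longlongrightarrow> 0) (at (0::real))"
      proof (rule Lim_null_comparison)
        show "\<forall>\<^sub>F y in at 0. norm (\<bar>y\<bar> powr (s - 1) * sgn y) \<le> \<bar>y\<bar> powr (s - 1)"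
          by (auto simp: abs_mult sgn_if)
        show "((\<lambda>h. \<bar>h\<bar> powr (s - 1)) \<longlongrightarrow> 0) (at (0::real))"
          using s by (intro tendsto_zero_powrI[where b="s - 1"]) (auto intro!: tendsto_eq_intros)
      qed
      then show ?thesis using True by (simp add: isCont_def)
    next
      case False
      then show ?thesis by (intro continuous_intros isCont_sgn) auto
    qed
    then show ?thesis by (simp add: continuous_on_eq_continuous_at)
  qed
  from continuous_on_compose2[OF this cphi]
  have "continuous_on UNIV (\<lambda>t. \<bar>\<phi> (?L t)\<bar> powr (s - 1) * sgn (\<phi> (?L t)))" by simp
  from continuous_on_mult[OF continuous_on_mult[OF continuous_on_const[of _ s] this] cpd]
  have cd: "continuous_on UNIV ?d" by (simp add: mult.assoc)
  obtain K where K: "compact K" "\<And>x. x \<notin> K \<Longrightarrow> \<phi> x = 0" using v by (rule test_funsE) blast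
  obtain B where B: "\<And>x. x \<in> K \<Longrightarrow> norm x \<le> B" using compact_imp_bounded[OF K(1)] bounded_iff by metis
  define T where "T = - (\<bar>B\<bar> + \<bar>x $ i\<bar> + 1)"
  have T: "T \<le> x $ i" "\<phi> (?L T) = 0"
  proof -
    show "T \<le> x $ i" by (simp add: T_def)
    have "\<bar>T\<bar> \<le> norm (?L T)" using component_le_norm_cart[of "?L T" i] by simp
    then have "?L T \<notin> K" using B[of "?L T"] by (auto simp: T_def)
    then show "\<phi> (?L T) = 0" by (rule K(2))
  qed
  have "has_bochner_integral lborel (\<lambda>t. ?d t * indicator {T .. x $ i} t) (?g (x $ i) - ?g T)"
    by (rule has_bochner_integral_FTC_Icc_real[OF T(1) d]) (use cd in \<open>auto simp: continuous_on_eq_continuous_at\<close>)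
  moreover have "?L (x $ i) = x" by (simp add: vec_eq_iff)
  ultimately have hb: "has_bochner_integral lborel (\<lambda>t. ?d t * indicator {T .. x $ i} t) (\<bar>\<phi> x\<bar> powr s)"
    using T by simp
  have "ennreal (\<bar>\<phi> x\<bar> powr s) = ennreal (norm (\<integral>t. ?d t * indicator {T .. x $ i} t \<partial>lborel))"
    using hb by (simp add: has_bochner_integral_integral_eq)
  also have "\<dots> \<le> (\<integral>\<^sup>+t. norm (?d t * indicator {T .. x $ i} t) \<partial>lborel)"
    using hb by (intro integral_norm_bound_ennreal) (auto simp: has_bochner_integral_iff)
  also have "\<dots> \<le> (\<integral>\<^sup>+t. ennreal s * ennreal (\<bar>\<phi> (?L t)\<bar> powr (s - 1) * \<bar>partial_deriv i \<phi> (?L t)\<bar>) \<partial>lborel)"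
    using s by (intro nn_integral_mono) (auto simp: ennreal_mult[symmetric] abs_mult sgn_if indicator_def)
  also have "\<dots> = ennreal s * (\<integral>\<^sup>+t. ennreal (\<bar>\<phi> (?L t)\<bar> powr (s - 1) * \<bar>partial_deriv i \<phi> (?L t)\<bar>) \<partial>lborel)"
  proof (rule nn_integral_cmult)
    have [measurable]: "(\<lambda>t. \<phi> (?L t)) \<in> borel_measurable borel" "(\<lambda>t. partial_deriv i \<phi> (?L t)) \<in> borel_measurable borel"
      using borel_measurable_continuous_onI cphi cpd by blast+
    show "(\<lambda>t. ennreal (\<bar>\<phi> (?L t)\<bar> powr (s - 1) * \<bar>partial_deriv i \<phi> (?L t)\<bar>)) \<in> borel_measurable lborel"
      by measurable
  qed
  finally show ?thesis .
qed

lemma prod_mono_ennreal: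
  fixes f g :: "'i \<Rightarrow> ennreal"
  assumes "\<And>i. i \<in> I \<Longrightarrow> f i \<le> g i"
  shows "prod f I \<le> prod g I"
  using assms by (induction I rule: infinite_finite_induct) (auto intro: mult_mono)

text \<open>
  The dimension is kept as a real number, because it only enters through exponents and
  constants.
\<close>

locale aniso_exponents =
  fixes p :: "'n::finite \<Rightarrow> real" and N :: real
  assumes p_gt1: "\<And>i. 1 < p i"
    and dim_eq: "N = real CARD('n)"
    and dim: "N > 1"
    and mean_less_dim: "harmonic_mean p < N"
begin

abbreviation "P \<equiv> harmonic_mean p"
abbreviation "q \<equiv> sobolev_conj p"

lemma p_pos: "0 < p i" and inv_p: "0 < 1 / p i" "1 / p i < 1"
  using p_gt1[of i] by (simp_all add: less_trans[OF zero_less_one])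

lemma sum_inv_p: "(\<Sum>i\<in>UNIV. 1 / p i) = N / P" and P_gt1: "1 < P"
proof -
  have pos: "0 < (\<Sum>i\<in>UNIV. 1 / p i)" using inv_p by (intro sum_pos) auto
  show s: "(\<Sum>i\<in>UNIV. 1 / p i) = N / P" using dim by (simp add: harmonic_mean_def dim_eq)
  have "(\<Sum>i\<in>UNIV. 1 / p i) < (\<Sum>i\<in>(UNIV::'n set). 1)" using inv_p by (intro sum_strict_mono) auto
  then have "N / P < N" using s by (simp add: dim_eq)
  moreover have "P > 0" using pos dim by (auto simp: harmonic_mean_def dim_eq)
  ultimately show "1 < P" using dim by (simp add: divide_less_eq)
qed

lemma inv_q: "1 / q = 1 / P - 1 / N" and q_gt_P: "P < q" and q_pos: "0 < q"
proof -
  have NP: "0 < N - P" "0 < N" "0 < P" using mean_less_dim P_gt1 dim by auto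
  then show "1 / q = 1 / P - 1 / N" by (simp add: sobolev_conj_def field_simps dim_eq[symmetric])
  show "0 < q" using NP by (simp add: sobolev_conj_def dim_eq[symmetric])
  have "P * (N - P) < N * P" using NP by (simp add: algebra_simps)
  then show "P < q" using NP by (simp add: sobolev_conj_def pos_less_divide_eq mult.commute dim_eq[symmetric])
qed

text \<open>
  With this exponent, Hoelder's inequality for \<open>p i\<close> bounds the integral of
  \<open>|\<phi>|^(sob_exp i - 1) |\<partial>\<^sub>i \<phi>|\<close> by powers of the integrals of \<open>|\<phi>|^q\<close> and \<open>|\<partial>\<^sub>i \<phi>|^p\<^sub>i\<close>,
  and the value \<open>q (N - 1)\<close> of the sum of all exponents is the one that makes the
  Loomis-Whitney inequality return the integral of \<open>|\<phi>|^q\<close>.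
\<close>

definition sob_exp :: "'n \<Rightarrow> real" where "sob_exp i = 1 + q * (1 - 1 / p i)"

definition sob_const :: real where "sob_const = (\<Prod>i\<in>UNIV. sob_exp i) powr (1 / N)"

lemma sob_exp_gt1: "1 < sob_exp i"
  using q_pos inv_p[of i] by (simp add: sob_exp_def)

lemma sob_exp_nonneg: "0 \<le> sob_exp i"
  using sob_exp_gt1[of i] by simp

lemma sob_const_nonneg: "0 \<le> sob_const"
  by (simp add: sob_const_def)

lemma sum_sob_exp: "(\<Sum>i\<in>UNIV. sob_exp i) = q * (N - 1)"
proof -
  have "(\<Sum>i\<in>UNIV. sob_exp i) = N + q * (\<Sum>i\<in>UNIV. 1 - 1 / p i)"
    by (simp add: sob_exp_def sum.distrib sum_distrib_left dim_eq)
  also have "(\<Sum>i\<in>UNIV. 1 - 1 / p i) = N - N / P" by (simp add: sum_subtractf sum_inv_p dim_eq[symmetric])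
  finally have "(\<Sum>i\<in>UNIV. sob_exp i) = N + q * (N - N / P)" .
  moreover have "q * (N / P - 1) = N"
  proof -
    have "N / P - 1 = N * (1 / q)" using dim by (simp add: inv_q right_diff_distrib)
    then show ?thesis using q_pos by simp
  qed
  ultimately show ?thesis by (simp add: right_diff_distrib)
qed

text \<open>
  Let \<open>X\<close> be the integral of \<open>|\<phi>|^q\<close>. The line bounds, the Loomis-Whitney inequality and
  Hoelder's inequality estimate \<open>X^((N - 1) / N)\<close> by \<open>X^(1 - 1 / P)\<close> times the norms of
  the partial derivatives. As \<open>X\<close> is finite, it may be cancelled, and the difference of
  the two exponents is \<open>1 / q\<close>.
\<close>

lemma sobolev_test_funs:
  fixes \<phi> :: "real^'n \<Rightarrow> real"
  assumes \<phi>: "\<phi> \<in> test_funs UNIV"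
  shows "integrable lborel (\<lambda>x. \<bar>\<phi> x\<bar> powr q)"
    and "(\<integral>x. \<bar>\<phi> x\<bar> powr q \<partial>lborel) powr (1 / q)
      \<le> sob_const * (\<Prod>i\<in>UNIV. (\<integral>x. \<bar>partial_deriv i \<phi> x\<bar> powr p i \<partial>lborel) powr (1 / (N * p i)))"
proof -
  obtain K where K: "compact K" "\<And>x. x \<notin> K \<Longrightarrow> \<phi> x = 0" "\<And>x i. x \<notin> K \<Longrightarrow> partial_deriv i \<phi> x = 0"
    using \<phi> by (rule test_funsE) blast
  have c: "continuous_on UNIV \<phi>" "\<And>i. continuous_on UNIV (partial_deriv i \<phi>)"
    using test_funs_continuous \<phi> test_funs_pd by blast+
  have cp: "continuous_on UNIV (\<lambda>x. \<bar>f x\<bar> powr r)" if "continuous_on UNIV f" "r > 0" for f :: "real^'n \<Rightarrow> real" and r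
    using that by (intro continuous_on_powr' continuous_intros) auto
  show iq: "integrable lborel (\<lambda>x. \<bar>\<phi> x\<bar> powr q)"
    by (rule continuous_compact_support_integrable[OF cp[OF c(1) q_pos] K(1)]) (use K in auto)
  have iE: "integrable lborel (\<lambda>x. \<bar>partial_deriv i \<phi> x\<bar> powr p i)" for i
    by (rule continuous_compact_support_integrable[OF cp[OF c(2) p_pos] K(1)]) (use K in auto)
  define X where "X = (\<integral>x. \<bar>\<phi> x\<bar> powr q \<partial>lborel)"
  define E where "E i = (\<integral>x. \<bar>partial_deriv i \<phi> x\<bar> powr p i \<partial>lborel)" for i
  have X0: "X \<ge> 0" and E0: "E i \<ge> 0" for i by (simp_all add: X_def E_def)
  have "X powr (1 / q) \<le> sob_const * (\<Prod>i\<in>UNIV. E i powr (1 / (N * p i)))"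
  proof (cases "X = 0")
    case True
    then show ?thesis by (simp add: sob_const_nonneg prod_nonneg)
  next
    case False
    then have X: "X > 0" using X0 by simp
    define n where "n = CARD('n) - 1"
    have n: "n > 0" "real n = N - 1" using dim by (auto simp: n_def dim_eq of_nat_diff)
    let ?h = "\<lambda>i x. ennreal (sob_exp i) * ennreal (\<bar>\<phi> x\<bar> powr (sob_exp i - 1) * \<bar>partial_deriv i \<phi> x\<bar>)"
    have [measurable]: "\<phi> \<in> borel_measurable borel" "\<And>i. partial_deriv i \<phi> \<in> borel_measurable borel"
      using \<phi> test_funs_borel test_funs_pd by blast+
    have hm: "?h i \<in> borel_measurable borel" for i by measurable
    have hint: "(\<integral>\<^sup>+x. ?h i x \<partial>lborel) \<le> ennreal (sob_exp i * (X powr (1 - 1 / p i) * E i powr (1 / p i)))" for i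
    proof -
      have l: "0 < 1 - 1 / p i" "1 - 1 / p i < 1" using inv_p[of i] by auto
      have eq: "\<bar>\<phi> x\<bar> powr (sob_exp i - 1) * \<bar>partial_deriv i \<phi> x\<bar> =
        (\<bar>\<phi> x\<bar> powr q) powr (1 - 1 / p i) * (\<bar>partial_deriv i \<phi> x\<bar> powr p i) powr (1 - (1 - 1 / p i))" for x
        using p_pos[of i] by (simp add: powr_powr sob_exp_def)
      note H = Hoelder_geometric[OF iq _ iE[of i] _ l]
      have I: "integrable lborel (\<lambda>x. \<bar>\<phi> x\<bar> powr (sob_exp i - 1) * \<bar>partial_deriv i \<phi> x\<bar>)"
        unfolding eq by (rule H(1)) auto
      have "(\<integral>\<^sup>+x. ?h i x \<partial>lborel) = ennreal (sob_exp i) * (\<integral>\<^sup>+x. ennreal (\<bar>\<phi> x\<bar> powr (sob_exp i - 1) * \<bar>partial_deriv i \<phi> x\<bar>) \<partial>lborel)"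
        by (rule nn_integral_cmult) measurable
      also have "\<dots> = ennreal (sob_exp i) * ennreal (\<integral>x. \<bar>\<phi> x\<bar> powr (sob_exp i - 1) * \<bar>partial_deriv i \<phi> x\<bar> \<partial>lborel)"
        using I by (subst nn_integral_eq_integral) auto
      also have "\<dots> \<le> ennreal (sob_exp i) * ennreal (X powr (1 - 1 / p i) * E i powr (1 - (1 - 1 / p i)))"
        unfolding X_def E_def eq by (intro mult_left_mono ennreal_leI H(2)) auto
      also have "\<dots> = ennreal (sob_exp i * (X powr (1 - 1 / p i) * E i powr (1 / p i)))"
        using sob_exp_gt1[of i] by (subst ennreal_mult[symmetric]) auto
      finally show ?thesis .
    qed
    have line: "(\<integral>\<^sup>+t. ?h i (\<chi> k. if k = i then t else x $ k) \<partial>lborel) \<ge> ennreal (\<bar>\<phi> x\<bar> powr sob_exp i)" for i x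
    proof -
      have Lm: "(\<lambda>t. (\<chi> k. if k = i then t else x $ k) :: real^'n) \<in> borel_measurable borel"
      proof (subst borel_measurable_euclidean_space, intro ballI)
        fix b :: "real^'n" assume "b \<in> Basis"
        then obtain k where "b = axis k 1" by (auto simp: Basis_vec_def)
        then show "(\<lambda>t. (\<chi> k. if k = i then t else x $ k) \<bullet> b) \<in> borel_measurable borel"
          by (cases "k = i") (auto simp: inner_axis)
      qed
      have "(\<integral>\<^sup>+t. ?h i (\<chi> k. if k = i then t else x $ k) \<partial>lborel) = ennreal (sob_exp i) *
        (\<integral>\<^sup>+t. ennreal (\<bar>\<phi> (\<chi> k. if k = i then t else x $ k)\<bar> powr (sob_exp i - 1) * \<bar>partial_deriv i \<phi> (\<chi> k. if k = i then t else x $ k)\<bar>) \<partial>lborel)"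
        by (rule nn_integral_cmult) (use Lm in measurable)
      then show ?thesis using test_funs_line_bound[OF \<phi> sob_exp_gt1, of x i] by simp
    qed
    have "ennreal X = (\<integral>\<^sup>+x. ennreal (\<bar>\<phi> x\<bar> powr q) \<partial>lborel)"
      unfolding X_def by (rule nn_integral_eq_integral[symmetric, OF iq]) simp
    also have "\<dots> = (\<integral>\<^sup>+x. (\<Prod>i\<in>UNIV. epow (1 / n) (ennreal (\<bar>\<phi> x\<bar> powr sob_exp i))) \<partial>lborel)"
    proof (rule nn_integral_cong)
      fix x
      have "(\<Prod>i\<in>UNIV. epow (1 / n) (ennreal (\<bar>\<phi> x\<bar> powr sob_exp i))) = ennreal (\<Prod>i\<in>UNIV. \<bar>\<phi> x\<bar> powr (sob_exp i / n))"
        by (subst prod_ennreal[symmetric]) (auto simp: epow_ennreal powr_powr)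
      also have "(\<Prod>i\<in>UNIV. \<bar>\<phi> x\<bar> powr (sob_exp i / n)) = \<bar>\<phi> x\<bar> powr q"
      proof (cases "\<phi> x = 0")
        case True
        then show ?thesis by (auto intro!: prod_zero)
      next
        case False
        then have "(\<Prod>i\<in>UNIV. \<bar>\<phi> x\<bar> powr (sob_exp i / n)) = \<bar>\<phi> x\<bar> powr (\<Sum>i\<in>UNIV. sob_exp i / n)"
          by (subst powr_sum) auto
        also have "(\<Sum>i\<in>UNIV. sob_exp i / n) = q" using n by (simp add: sum_divide_distrib[symmetric] sum_sob_exp)
        finally show ?thesis .
      qed
      finally show "ennreal (\<bar>\<phi> x\<bar> powr q) = (\<Prod>i\<in>UNIV. epow (1 / n) (ennreal (\<bar>\<phi> x\<bar> powr sob_exp i)))" by simp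
    qed
    also have "\<dots> \<le> (\<integral>\<^sup>+x. (\<Prod>i\<in>UNIV. epow (1 / n) (\<integral>\<^sup>+t. ?h i (\<chi> k. if k = i then t else x $ k) \<partial>lborel)) \<partial>lborel)"
      using n by (intro nn_integral_mono prod_mono_ennreal epow_mono line) auto
    also have "\<dots> \<le> (\<Prod>i\<in>UNIV. epow (1 / n) (\<integral>\<^sup>+x. ?h i x \<partial>lborel))"
      by (rule Loomis_Whitney[OF hm n_def n(1)])
    also have "\<dots> \<le> (\<Prod>i\<in>UNIV. epow (1 / n) (ennreal (sob_exp i * (X powr (1 - 1 / p i) * E i powr (1 / p i)))))"
      using n by (intro prod_mono_ennreal epow_mono hint) auto
    also have "\<dots> = ennreal (\<Prod>i\<in>UNIV. (sob_exp i * (X powr (1 - 1 / p i) * E i powr (1 / p i))) powr (1 / n))"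
      using sob_exp_gt1 by (subst prod_ennreal[symmetric]) (auto intro!: prod.cong epow_ennreal mult_nonneg_nonneg sob_exp_nonneg)
    finally have "X \<le> (\<Prod>i\<in>UNIV. (sob_exp i * (X powr (1 - 1 / p i) * E i powr (1 / p i))) powr (1 / n))"
      by (subst (asm) ennreal_le_iff) (auto intro!: prod_nonneg)
    then have "X powr (n / N) \<le> (\<Prod>i\<in>UNIV. (sob_exp i * (X powr (1 - 1 / p i) * E i powr (1 / p i))) powr (1 / n)) powr (n / N)"
      using X dim by (intro powr_mono2) auto
    also have "\<dots> = (\<Prod>i\<in>UNIV. sob_exp i powr (1 / N) * (X powr ((1 - 1 / p i) / N) * E i powr (1 / (N * p i))))"
    proof (subst prod_powr_distrib)
      show "(\<Prod>i\<in>UNIV. ((sob_exp i * (X powr (1 - 1 / p i) * E i powr (1 / p i))) powr (1 / n)) powr (n / N)) =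
        (\<Prod>i\<in>UNIV. sob_exp i powr (1 / N) * (X powr ((1 - 1 / p i) / N) * E i powr (1 / (N * p i))))"
      proof (rule prod.cong[OF refl])
        fix i
        have "0 \<le> sob_exp i" using sob_exp_gt1[of i] by simp
        then show "((sob_exp i * (X powr (1 - 1 / p i) * E i powr (1 / p i))) powr (1 / n)) powr (n / N) =
          sob_exp i powr (1 / N) * (X powr ((1 - 1 / p i) / N) * E i powr (1 / (N * p i)))"
          using n(1) by (simp add: powr_powr powr_mult mult.commute)
      qed
    qed
    also have "\<dots> = sob_const * (X powr (1 - 1 / P) * (\<Prod>i\<in>UNIV. E i powr (1 / (N * p i))))"
    proof -
      have "(\<Prod>i\<in>UNIV. X powr ((1 - 1 / p i) / N)) = X powr (\<Sum>i\<in>UNIV. (1 - 1 / p i) / N)"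
        using X by (subst powr_sum) auto
      also have "(\<Sum>i\<in>UNIV. (1 - 1 / p i) / N) = 1 - 1 / P"
      proof -
        have "(\<Sum>i\<in>UNIV. (1 - 1 / p i) / N) = (N - N / P) / N"
          by (simp only: sum_divide_distrib[symmetric] sum_subtractf sum_inv_p) (simp add: dim_eq)
        then show ?thesis using dim by (simp add: diff_divide_distrib)
      qed
      finally show ?thesis
        using sob_exp_gt1 by (simp add: prod.distrib sob_const_def prod_powr_distrib less_imp_le order_trans[OF zero_le_one])
    qed
    finally have le: "X powr (n / N) \<le> X powr (1 - 1 / P) * (sob_const * (\<Prod>i\<in>UNIV. E i powr (1 / (N * p i))))"
      by (simp add: mult_ac)
    have "n / N = (1 - 1 / P) + 1 / q" using n dim by (simp add: inv_q diff_divide_distrib)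
    then have "X powr (n / N) = X powr (1 - 1 / P) * X powr (1 / q)" by (simp add: powr_add)
    with le X show ?thesis by simp
  qed
  then show "(\<integral>x. \<bar>\<phi> x\<bar> powr q \<partial>lborel) powr (1 / q)
      \<le> sob_const * (\<Prod>i\<in>UNIV. (\<integral>x. \<bar>partial_deriv i \<phi> x\<bar> powr p i \<partial>lborel) powr (1 / (N * p i)))"
    by (simp add: X_def E_def)
qed

end

section \<open>Weak gradients of compactly supported functions\<close>

text \<open>
  The test functions range over the whole space: the zero extension of a weakly
  differentiable function with compact support is weakly differentiable everywhere, and it
  can be mollified without regard to a boundary.
\<close>

definition weak_grad_cpt :: "(real^'n) set \<Rightarrow> (real^'n \<Rightarrow> real) \<Rightarrow> (real^'n \<Rightarrow> real^'n) \<Rightarrow> bool"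
  where "weak_grad_cpt K v H \<longleftrightarrow> compact K \<and> integrable lborel v \<and> (\<forall>i. integrable lborel (\<lambda>x. H x $ i)) \<and>
    (\<forall>x. x \<notin> K \<longrightarrow> v x = 0 \<and> H x = 0) \<and>
    (\<forall>i. \<forall>\<phi>\<in>test_funs UNIV. (\<integral>x. v x * partial_deriv i \<phi> x \<partial>lborel) = - (\<integral>x. H x $ i * \<phi> x \<partial>lborel))"

lemma weak_grad_cptD:
  assumes "weak_grad_cpt K v H"
  shows "compact K" "integrable lborel v" "integrable lborel (\<lambda>x. H x $ i)"
    "x \<notin> K \<Longrightarrow> v x = 0" "x \<notin> K \<Longrightarrow> H x = 0"
    "\<phi> \<in> test_funs UNIV \<Longrightarrow> (\<integral>x. v x * partial_deriv i \<phi> x \<partial>lborel) = - (\<integral>x. H x $ i * \<phi> x \<partial>lborel)"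
  using assms by (auto simp: weak_grad_cpt_def)

lemma partial_deriv_conv_weak:
  assumes v: "weak_grad_cpt K v H" and \<rho>: "\<rho> \<in> test_funs UNIV"
  shows "partial_deriv i (conv v \<rho>) = conv (\<lambda>x. H x $ i) \<rho>"
proof
  fix x
  have "partial_deriv i (conv v \<rho>) x = (\<integral>y. v y * partial_deriv i \<rho> (x - y) \<partial>lborel)"
    by (simp add: partial_deriv_conv[OF weak_grad_cptD(2)[OF v] \<rho>] conv_def)
  also have "\<dots> = - (\<integral>y. v y * partial_deriv i (\<lambda>y. \<rho> (x - y)) y \<partial>lborel)"
    by (simp add: partial_deriv_reflect[OF \<rho>])
  also have "\<dots> = (\<integral>y. H y $ i * \<rho> (x - y) \<partial>lborel)"
    by (simp add: weak_grad_cptD(6)[OF v test_funs_reflect[OF \<rho>]])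
  finally show "partial_deriv i (conv v \<rho>) x = conv (\<lambda>x. H x $ i) \<rho> x" by (simp add: conv_def)
qed

lemma conv_mollifier_test_funs:
  assumes "integrable lborel v" "compact K" "\<And>x. x \<notin> K \<Longrightarrow> v x = 0"
  shows "conv v (mollifier n) \<in> test_funs UNIV"
  using assms by (intro conv_test_funs[OF _ mollifier_test _ _ compact_cball[of 0 "1 / real (Suc n)"]])
    (auto intro!: mollifier_zero simp del: of_nat_Suc)

text \<open>
  Fatou's lemma, including the integrability of the limit.
\<close>

lemma integrable_powr_liminf:
  fixes f :: "nat \<Rightarrow> 'a \<Rightarrow> real"
  assumes [measurable]: "\<And>n. f n \<in> borel_measurable M" "g \<in> borel_measurable M"
    and lim: "AE x in M. (\<lambda>n. f n x) \<longlonglongrightarrow> g x"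
    and s: "s > 0" and int: "\<And>n. integrable M (\<lambda>x. \<bar>f n x\<bar> powr s)"
    and bound: "\<And>n. (\<integral>x. \<bar>f n x\<bar> powr s \<partial>M) \<le> C"
  shows "integrable M (\<lambda>x. \<bar>g x\<bar> powr s)" "(\<integral>x. \<bar>g x\<bar> powr s \<partial>M) \<le> C"
proof -
  have C: "C \<ge> 0" using bound[of 0] by (rule order_trans[rotated]) simp
  have "(\<integral>\<^sup>+x. ennreal (\<bar>g x\<bar> powr s) \<partial>M) = (\<integral>\<^sup>+x. liminf (\<lambda>n. ennreal (\<bar>f n x\<bar> powr s)) \<partial>M)"
  proof (rule nn_integral_cong_AE)
    show "AE x in M. ennreal (\<bar>g x\<bar> powr s) = liminf (\<lambda>n. ennreal (\<bar>f n x\<bar> powr s))"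
      using lim
    proof eventually_elim
      case (elim x)
      have "(\<lambda>n. \<bar>f n x\<bar> powr s) \<longlonglongrightarrow> \<bar>g x\<bar> powr s"
        using s elim by (intro tendsto_powr2 tendsto_intros) auto
      then have "(\<lambda>n. ennreal (\<bar>f n x\<bar> powr s)) \<longlonglongrightarrow> ennreal (\<bar>g x\<bar> powr s)"
        by (rule tendsto_ennrealI)
      then show ?case by (intro lim_imp_Liminf[symmetric]) auto
    qed
  qed
  also have "\<dots> \<le> liminf (\<lambda>n. \<integral>\<^sup>+x. ennreal (\<bar>f n x\<bar> powr s) \<partial>M)"
    by (rule nn_integral_liminf) measurable
  also have "\<dots> \<le> limsup (\<lambda>n. \<integral>\<^sup>+x. ennreal (\<bar>f n x\<bar> powr s) \<partial>M)"
    by (rule Liminf_le_Limsup) simp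
  also have "\<dots> \<le> ennreal C"
    by (rule Limsup_bounded, rule always_eventually)
      (use int bound in \<open>auto simp: nn_integral_eq_integral intro!: ennreal_leI\<close>)
  finally have b: "(\<integral>\<^sup>+x. ennreal (\<bar>g x\<bar> powr s) \<partial>M) \<le> ennreal C" .
  show i: "integrable M (\<lambda>x. \<bar>g x\<bar> powr s)"
    by (rule integrableI_bounded) (use le_less_trans[OF b ennreal_less_top] in auto)
  show "(\<integral>x. \<bar>g x\<bar> powr s \<partial>M) \<le> C"
    using b C i by (simp add: nn_integral_eq_integral)
qed

text \<open>
  Mollification commutes with differentiation and does not increase the norms on the right
  (\<open>conv_Lp_bound\<close>); Fatou's lemma handles the left-hand side.
\<close>

lemma (in aniso_exponents) sobolev_weak:
  fixes v :: "real^'n \<Rightarrow> real"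
  assumes v: "weak_grad_cpt K v H" and H: "\<And>i. integrable lborel (\<lambda>x. \<bar>H x $ i\<bar> powr p i)"
  shows "integrable lborel (\<lambda>x. \<bar>v x\<bar> powr q)"
    and "(\<integral>x. \<bar>v x\<bar> powr q \<partial>lborel) powr (1 / q)
      \<le> sob_const * (\<Prod>i\<in>UNIV. (\<integral>x. \<bar>H x $ i\<bar> powr p i \<partial>lborel) powr (1 / (N * p i)))"
proof -
  note D = weak_grad_cptD[OF v]
  define S where "S = sob_const * (\<Prod>i\<in>UNIV. (\<integral>x. \<bar>H x $ i\<bar> powr p i \<partial>lborel) powr (1 / (N * p i)))"
  have S0: "S \<ge> 0" by (simp add: S_def sob_const_nonneg prod_nonneg)
  obtain r :: "nat \<Rightarrow> nat" where r: "AE x in lborel. (\<lambda>n. conv v (mollifier (r n)) x) \<longlonglongrightarrow> v x"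
    using conv_mollifier_AE[OF D(2)] by blast
  have t: "conv v (mollifier n) \<in> test_funs UNIV" for n
    by (rule conv_mollifier_test_funs[OF D(2) D(1)]) (rule D(4))
  have bound: "(\<integral>x. \<bar>conv v (mollifier n) x\<bar> powr q \<partial>lborel) \<le> S powr q" for n
  proof -
    let ?X = "\<integral>x. \<bar>conv v (mollifier n) x\<bar> powr q \<partial>lborel"
    have "?X powr (1 / q) \<le> sob_const * (\<Prod>i\<in>UNIV. (\<integral>x. \<bar>partial_deriv i (conv v (mollifier n)) x\<bar> powr p i \<partial>lborel) powr (1 / (N * p i)))"
      by (rule sobolev_test_funs(2)[OF t])
    also have "\<dots> \<le> S"
      unfolding S_def partial_deriv_conv_weak[OF v mollifier_test]
      using p_pos dim conv_Lp_bound(2)[OF D(3) H p_gt1 mollifier_test mollifier_nonneg mollifier_integral]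
      by (intro mult_left_mono prod_mono conjI powr_mono2 sob_const_nonneg) (auto simp: less_imp_le)
    finally have "(?X powr (1 / q)) powr q \<le> S powr q" using q_pos by (intro powr_mono2) auto
    then show ?thesis using q_pos by (simp add: powr_powr)
  qed
  have fin: "integrable lborel (\<lambda>x. \<bar>v x\<bar> powr q)" "(\<integral>x. \<bar>v x\<bar> powr q \<partial>lborel) \<le> S powr q"
    using integrable_powr_liminf[OF _ _ r q_pos sobolev_test_funs(1)[OF t] bound] test_funs_borel[OF t] D(2) by auto
  show "integrable lborel (\<lambda>x. \<bar>v x\<bar> powr q)" by (rule fin)
  have "(\<integral>x. \<bar>v x\<bar> powr q \<partial>lborel) powr (1 / q) \<le> (S powr q) powr (1 / q)"
    using fin(2) q_pos by (intro powr_mono2) auto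
  also have "\<dots> = S" using S0 q_pos by (simp add: powr_powr)
  finally show "(\<integral>x. \<bar>v x\<bar> powr q \<partial>lborel) powr (1 / q)
      \<le> sob_const * (\<Prod>i\<in>UNIV. (\<integral>x. \<bar>H x $ i\<bar> powr p i \<partial>lborel) powr (1 / (N * p i)))"
    by (simp add: S_def)
qed

subsection \<open>Products with test functions\<close>

text \<open>
  Both functions are integrable on the whole space, as extensions by zero are; only the
  integration by parts is confined to \<open>B\<close>.
\<close>

definition weak_grad_on :: "(real^'n) set \<Rightarrow> (real^'n \<Rightarrow> real) \<Rightarrow> (real^'n \<Rightarrow> real^'n) \<Rightarrow> bool"
  where "weak_grad_on B u G \<longleftrightarrow> integrable lborel u \<and> (\<forall>i. integrable lborel (\<lambda>x. G x $ i)) \<and>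
    (\<forall>i. \<forall>\<phi>\<in>test_funs B. (\<integral>x. u x * partial_deriv i \<phi> x \<partial>lborel) = - (\<integral>x. G x $ i * \<phi> x \<partial>lborel))"

lemma weak_grad_cpt_imp_on: "weak_grad_cpt K v H \<Longrightarrow> weak_grad_on UNIV v H"
  by (simp add: weak_grad_cpt_def weak_grad_on_def)

text \<open>
  Leibniz rule: for every test function \<open>\<phi>\<close> the product \<open>\<phi> \<eta>\<close> is admissible for \<open>u\<close>.
\<close>

lemma weak_grad_on_mult:
  assumes u: "weak_grad_on B u G" and \<eta>: "\<eta> \<in> test_funs B"
    and L: "compact L" "\<And>x. x \<notin> L \<Longrightarrow> \<eta> x = 0" "\<And>x i. x \<notin> L \<Longrightarrow> partial_deriv i \<eta> x = 0"
  shows "weak_grad_cpt L (\<lambda>x. \<eta> x * u x) (\<lambda>x. \<chi> i. \<eta> x * G x $ i + partial_deriv i \<eta> x * u x)"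
  unfolding weak_grad_cpt_def
proof (intro conjI allI ballI impI)
  have iu: "integrable lborel u" and iG: "integrable lborel (\<lambda>x. G x $ i)" for i
    using u by (auto simp: weak_grad_on_def)
  have ip: "integrable lborel (\<lambda>x. \<psi> x * f x)" if "\<psi> \<in> test_funs B'" "integrable lborel f"
    for \<psi> f and B' :: "(real^'a) set"
    using integrable_mult_test_funs[OF that(2,1)] by (simp add: mult.commute)
  show "integrable lborel (\<lambda>x. \<eta> x * u x)" by (rule ip[OF \<eta> iu])
  show "integrable lborel (\<lambda>x. (\<chi> i. \<eta> x * G x $ i + partial_deriv i \<eta> x * u x) $ i)" for i
    using ip[OF \<eta> iG, of i] ip[OF test_funs_pd[OF \<eta>] iu, of i] by simp
  fix i and \<phi> :: "real^'a \<Rightarrow> real" assume \<phi>: "\<phi> \<in> test_funs UNIV"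
  have s\<eta>: "Ck k \<eta>" and s\<phi>: "Ck k \<phi>" for k using \<eta> \<phi> unfolding test_funs_def by blast+
  have t: "(\<lambda>x. \<phi> x * \<eta> x) \<in> test_funs B" by (rule test_funs_mult[OF s\<phi> \<eta>])
  have t1: "(\<lambda>x. partial_deriv i \<phi> x * \<eta> x) \<in> test_funs B"
  proof (rule test_funs_mult[OF _ \<eta>])
    fix k show "Ck k (partial_deriv i \<phi>)" using s\<phi>[of "Suc k"] by simp
  qed
  have t2: "(\<lambda>x. \<phi> x * partial_deriv i \<eta> x) \<in> test_funs B" by (rule test_funs_mult[OF s\<phi> test_funs_pd[OF \<eta>]])
  have pd: "partial_deriv i (\<lambda>x. \<phi> x * \<eta> x) x = partial_deriv i \<phi> x * \<eta> x + \<phi> x * partial_deriv i \<eta> x" for x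
    by (rule partial_deriv_mult[OF test_funs_diff[OF \<phi>] test_funs_diff[OF \<eta>]])
  have "(\<integral>x. \<eta> x * u x * partial_deriv i \<phi> x \<partial>lborel) =
     (\<integral>x. u x * partial_deriv i (\<lambda>x. \<phi> x * \<eta> x) x - (\<phi> x * partial_deriv i \<eta> x) * u x \<partial>lborel)"
    by (intro Bochner_Integration.integral_cong refl) (simp only: pd, simp add: algebra_simps)
  also have "\<dots> = (\<integral>x. u x * partial_deriv i (\<lambda>x. \<phi> x * \<eta> x) x \<partial>lborel) - (\<integral>x. (\<phi> x * partial_deriv i \<eta> x) * u x \<partial>lborel)"
    using ip[OF test_funs_pd[OF t] iu, of i] ip[OF t2 iu] by (intro Bochner_Integration.integral_diff) (auto simp: mult.commute)
  also have "(\<integral>x. u x * partial_deriv i (\<lambda>x. \<phi> x * \<eta> x) x \<partial>lborel) = - (\<integral>x. G x $ i * (\<phi> x * \<eta> x) \<partial>lborel)"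
    using u t by (simp add: weak_grad_on_def)
  also have "- (\<integral>x. G x $ i * (\<phi> x * \<eta> x) \<partial>lborel) - (\<integral>x. (\<phi> x * partial_deriv i \<eta> x) * u x \<partial>lborel)
    = - (\<integral>x. G x $ i * (\<phi> x * \<eta> x) + (\<phi> x * partial_deriv i \<eta> x) * u x \<partial>lborel)"
    using ip[OF t iG, of i] ip[OF t2 iu] by (subst Bochner_Integration.integral_add) (auto simp: mult.commute)
  also have "\<dots> = - (\<integral>x. (\<chi> i. \<eta> x * G x $ i + partial_deriv i \<eta> x * u x) $ i * \<phi> x \<partial>lborel)"
    by (intro arg_cong[where f=uminus] Bochner_Integration.integral_cong) (auto simp: algebra_simps)
  finally show "(\<integral>x. \<eta> x * u x * partial_deriv i \<phi> x \<partial>lborel) = - (\<integral>x. (\<chi> i. \<eta> x * G x $ i + partial_deriv i \<eta> x * u x) $ i * \<phi> x \<partial>lborel)" .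
qed (use L in \<open>auto simp: vec_eq_iff\<close>)

subsection \<open>The chain rule\<close>

text \<open>
  Difference quotients have integral \<open>0\<close> by translation invariance, and they converge
  boundedly inside a fixed compact set. Only one continuous derivative is assumed because
  the chain rule below is applied with functions that are not smooth.
\<close>

lemma integral_partial_deriv_eq_0:
  fixes \<psi> :: "real^'n \<Rightarrow> real"
  assumes d: "\<And>x. \<psi> differentiable (at x)" and c: "continuous_on UNIV (partial_deriv i \<psi>)"
    and K: "compact K" "\<And>x. x \<notin> K \<Longrightarrow> \<psi> x = 0" "\<And>x. x \<notin> K \<Longrightarrow> partial_deriv i \<psi> x = 0"
  shows "(\<integral>x. partial_deriv i \<psi> x \<partial>lborel) = 0"
proof -
  let ?e = "axis i 1 :: real^'n"
  have c\<psi>: "continuous_on UNIV \<psi>"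
    using d differentiable_imp_continuous_within by (fastforce simp: continuous_on_eq_continuous_at)
  have [measurable]: "\<psi> \<in> borel_measurable borel" "partial_deriv i \<psi> \<in> borel_measurable borel"
    using c c\<psi> borel_measurable_continuous_onI by blast+
  obtain M where M: "M > 0" "\<And>x. \<bar>partial_deriv i \<psi> x\<bar> \<le> M"
    using continuous_compact_support_bounded[OF c K(1,3)] by metis
  have i\<psi>: "integrable lborel \<psi>" by (rule continuous_compact_support_integrable[OF c\<psi> K(1,2)])
  have dl: "((\<lambda>t. \<psi> (x + t *\<^sub>R ?e)) has_real_derivative partial_deriv i \<psi> (x + s *\<^sub>R ?e)) (at s)" for x s
  proof -
    have "((\<lambda>t. x + t *\<^sub>R ?e) has_derivative (\<lambda>h. h *\<^sub>R ?e)) (at s)" by (auto intro!: derivative_eq_intros)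
    from has_derivative_compose[OF this frechet_derivative_works[THEN iffD1, OF d]]
    have "((\<lambda>t. \<psi> (x + t *\<^sub>R ?e)) has_derivative (\<lambda>h. frechet_derivative \<psi> (at (x + s *\<^sub>R ?e)) (h *\<^sub>R ?e))) (at s)" .
    then show ?thesis using linear_scale[OF linear_frechet_derivative[OF d]]
      by (simp add: has_field_derivative_def partial_deriv_def mult_commute_abs)
  qed
  define h where "h n = 1 / real (Suc n)" for n
  have h: "0 < h n" "h n \<le> 1" for n by (auto simp: h_def)
  have h0: "h \<longlonglongrightarrow> 0" unfolding h_def using LIMSEQ_inverse_real_of_nat by (simp add: inverse_eq_divide)
  let ?Q = "\<lambda>n x. (\<psi> (x + h n *\<^sub>R ?e) - \<psi> x) / h n"
  let ?K = "{a + b |a b. a \<in> K \<and> b \<in> cball 0 1}"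
  have Kc: "compact ?K" using K(1) by (intro compact_sums) auto
  have "(\<lambda>n. \<integral>x. ?Q n x \<partial>lborel) \<longlonglongrightarrow> (\<integral>x. partial_deriv i \<psi> x \<partial>lborel)"
  proof (rule integral_dominated_convergence[where w="\<lambda>x. M * indicator ?K x"])
    show "AE x in lborel. (\<lambda>n. ?Q n x) \<longlonglongrightarrow> partial_deriv i \<psi> x"
    proof (rule AE_I2)
      fix x
      have "((\<lambda>t. (\<psi> (x + t *\<^sub>R ?e) - \<psi> x) / t) \<longlongrightarrow> partial_deriv i \<psi> x) (at 0)"
        using dl[of x 0] by (simp add: DERIV_def)
      moreover have "filterlim h (at 0) sequentially"
        using h0 h by (auto simp: filterlim_at less_le intro!: always_eventually)
      ultimately show "(\<lambda>n. ?Q n x) \<longlonglongrightarrow> partial_deriv i \<psi> x"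
        by (rule filterlim_compose)
    qed
    show "AE x in lborel. norm (?Q n x) \<le> M * indicator ?K x" for n
    proof (rule AE_I2)
      fix x
      obtain s where "\<psi> (x + h n *\<^sub>R ?e) - \<psi> (x + 0 *\<^sub>R ?e) = (h n - 0) * partial_deriv i \<psi> (x + s *\<^sub>R ?e)"
        using MVT2[OF h(1)[of n] dl[of x]] by blast
      then have "\<bar>?Q n x\<bar> \<le> M" using h[of n] M(2) by simp
      moreover have "?Q n x = 0" if "x \<notin> ?K"
      proof -
        have "x = x + 0 \<and> 0 \<in> cball (0::real^'n) 1" by simp
        then have "x \<notin> K" using that by blast
        moreover have "x + h n *\<^sub>R ?e \<notin> K"
        proof
          assume "x + h n *\<^sub>R ?e \<in> K"
          moreover have "x = (x + h n *\<^sub>R ?e) + (- (h n) *\<^sub>R ?e)" by simp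
          moreover have "- (h n) *\<^sub>R ?e \<in> cball 0 1" using h[of n] by simp
          ultimately show False using that by blast
        qed
        ultimately show ?thesis using K(2) by simp
      qed
      ultimately show "norm (?Q n x) \<le> M * indicator ?K x" by (auto simp: indicator_def)
    qed
    show "integrable lborel (\<lambda>x. M * indicator ?K x)"
    proof (intro integrable_mult_right)
      have "?K \<in> sets borel" using compact_imp_closed[OF Kc] by (rule borel_closed)
      then show "integrable lborel (indicator ?K :: real^'n \<Rightarrow> real)"
        using emeasure_compact_finite[OF Kc] by (simp add: integrable_indicator_iff)
    qed
  qed measurable
  moreover have Q0: "(\<integral>x. ?Q n x \<partial>lborel) = 0" for n
    using integral_translate[of \<psi> "h n *\<^sub>R ?e"] integrable_translate[OF i\<psi>, of "h n *\<^sub>R ?e"] i\<psi>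
    by (simp add: add.commute)
  ultimately show ?thesis unfolding Q0 by (simp only: LIMSEQ_const_iff)
qed

lemma norm_integral_le:
  fixes f g :: "'a \<Rightarrow> real"
  assumes f: "integrable M f" and g: "integrable M g" and le: "\<And>x. \<bar>f x\<bar> \<le> g x"
  shows "norm (\<integral>x. f x \<partial>M) \<le> (\<integral>x. g x \<partial>M)"
proof -
  have "norm (\<integral>x. f x \<partial>M) \<le> (\<integral>x. norm (f x) \<partial>M)" by (rule integral_norm_bound)
  also have "\<dots> \<le> (\<integral>x. g x \<partial>M)" using f g le by (intro integral_mono) auto
  finally show ?thesis .
qed

text \<open>
  For mollifications this is the classical chain rule. On the left the limit is taken in
  \<open>L^1\<close>, as \<open>f\<close> is Lipschitz. On the right the difference splits into
  \<open>f' (v\<^sub>n) (H\<^sub>n - H)\<close>, small in \<open>L^1\<close>, and \<open>(f' (v\<^sub>n) - f' (v)) H\<close>, for which a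
  subsequence of the \<open>v\<^sub>n\<close> converging almost everywhere and dominated convergence are
  used.
\<close>

lemma weak_chain_rule:
  fixes v :: "real^'n \<Rightarrow> real"
  assumes v: "weak_grad_cpt K v H"
    and f: "\<And>t. (f has_real_derivative f' t) (at t)" "continuous_on UNIV f'" "\<And>t. \<bar>f' t\<bar> \<le> 1" "f 0 = 0"
    and \<phi>: "\<phi> \<in> test_funs UNIV"
  shows "(\<integral>x. f (v x) * partial_deriv i \<phi> x \<partial>lborel) = - (\<integral>x. f' (v x) * H x $ i * \<phi> x \<partial>lborel)"
proof -
  note D = weak_grad_cptD[OF v]
  have fl: "\<bar>f s - f t\<bar> \<le> \<bar>s - t\<bar>" for s t
  proof -
    have "norm (f s - f t) \<le> 1 * norm (s - t)"
      by (rule field_differentiable_bound[of UNIV f f']) (use f in auto)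
    then show ?thesis by simp
  qed
  have cf: "continuous_on UNIV f" using f(1) DERIV_isCont by (auto simp: continuous_on_eq_continuous_at)
  have [measurable]: "f \<in> borel_measurable borel" "f' \<in> borel_measurable borel" "v \<in> borel_measurable borel"
    "(\<lambda>x. H x $ i) \<in> borel_measurable borel" "\<phi> \<in> borel_measurable borel" "partial_deriv i \<phi> \<in> borel_measurable borel"
    using borel_measurable_continuous_onI[OF cf] borel_measurable_continuous_onI[OF f(2)] D(2) D(3)[of i]
      test_funs_borel[OF \<phi>] test_funs_borel[OF test_funs_pd[OF \<phi>]] by auto
  obtain M where M: "M > 0" "\<And>x. \<bar>\<phi> x\<bar> \<le> M" using test_funs_bounded[OF \<phi>] by metis
  obtain M' where M': "M' > 0" "\<And>x. \<bar>partial_deriv i \<phi> x\<bar> \<le> M'" using test_funs_bounded[OF test_funs_pd[OF \<phi>]] by metis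
  obtain r :: "nat \<Rightarrow> nat" where r: "strict_mono r" "AE x in lborel. (\<lambda>n. conv v (mollifier (r n)) x) \<longlonglongrightarrow> v x"
    using conv_mollifier_AE[OF D(2)] by blast
  let ?v = "\<lambda>n. conv v (mollifier (r n))" and ?H = "\<lambda>n. conv (\<lambda>x. H x $ i) (mollifier (r n))"
  have t: "?v n \<in> test_funs UNIV" for n
    by (rule conv_mollifier_test_funs[OF D(2) D(1)]) (rule D(4))
  have pv: "partial_deriv i (?v n) = ?H n" for n
    by (rule partial_deriv_conv_weak[OF v mollifier_test])
  have [measurable]: "?v n \<in> borel_measurable borel" "?H n \<in> borel_measurable borel" for n
    using test_funs_borel[OF t] test_funs_borel[OF test_funs_pd[OF t, of i]] by (auto simp: pv)
  have iv: "integrable lborel (?v n)" "integrable lborel (?H n)" for n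
    by (rule conv_L1_bound(1)[OF D(2) mollifier_test], rule conv_L1_bound(1)[OF D(3) mollifier_test])
  have ibp: "(\<integral>x. f (?v n x) * partial_deriv i \<phi> x \<partial>lborel) = - (\<integral>x. f' (?v n x) * ?H n x * \<phi> x \<partial>lborel)" for n
  proof -
    let ?\<psi> = "\<lambda>x. f (?v n x) * \<phi> x"
    obtain L where L: "compact L" "\<And>x. x \<notin> L \<Longrightarrow> \<phi> x = 0" "\<And>x i. x \<notin> L \<Longrightarrow> partial_deriv i \<phi> x = 0"
      using \<phi> by (rule test_funsE) blast
    have df: "((\<lambda>x. f (?v n x)) has_derivative (\<lambda>h. f' (?v n x) * frechet_derivative (?v n) (at x) h)) (at x)" for x
      using has_derivative_compose[OF frechet_derivative_works[THEN iffD1, OF test_funs_diff[OF t]] f(1)[unfolded has_field_derivative_def]]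
      by (simp add: mult.commute)
    have dff: "(\<lambda>x. f (?v n x)) differentiable (at x)" for x using df differentiable_def by blast
    have pdf: "partial_deriv i (\<lambda>x. f (?v n x)) x = f' (?v n x) * ?H n x" for x
      using partial_deriv_eq[OF df] pv[of n] by (simp add: partial_deriv_def fun_eq_iff)
    have pd: "partial_deriv i ?\<psi> x = f' (?v n x) * ?H n x * \<phi> x + f (?v n x) * partial_deriv i \<phi> x" for x
      by (subst partial_deriv_mult[OF dff test_funs_diff[OF \<phi>]]) (simp add: pdf)
    have cv: "continuous_on UNIV (?v n)" "continuous_on UNIV (?H n)"
      using test_funs_continuous[OF t] test_funs_continuous[OF test_funs_pd[OF t, of i]] by (auto simp: pv)
    have cpsi1: "continuous_on UNIV (\<lambda>x. f' (?v n x) * ?H n x * \<phi> x)"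
      by (intro continuous_on_mult continuous_on_compose2[OF f(2) cv(1)] cv test_funs_continuous[OF \<phi>]) auto
    have cpsi2: "continuous_on UNIV (\<lambda>x. f (?v n x) * partial_deriv i \<phi> x)"
      by (intro continuous_on_mult continuous_on_compose2[OF cf cv(1)] test_funs_continuous[OF test_funs_pd[OF \<phi>]]) auto
    have "0 = (\<integral>x. partial_deriv i ?\<psi> x \<partial>lborel)"
    proof (rule integral_partial_deriv_eq_0[symmetric, OF _ _ L(1)])
      show "?\<psi> differentiable (at x)" for x by (intro differentiable_mult dff test_funs_diff[OF \<phi>])
      show "continuous_on UNIV (partial_deriv i ?\<psi>)" unfolding pd by (intro continuous_on_add cpsi1 cpsi2)
    qed (use L in \<open>auto simp: pd\<close>)
    also have "\<dots> = (\<integral>x. f' (?v n x) * ?H n x * \<phi> x \<partial>lborel) + (\<integral>x. f (?v n x) * partial_deriv i \<phi> x \<partial>lborel)"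
      unfolding pd using L by (intro Bochner_Integration.integral_add continuous_compact_support_integrable[OF cpsi1 L(1)]
        continuous_compact_support_integrable[OF cpsi2 L(1)]) auto
    finally show ?thesis by simp
  qed
  have L1v: "(\<lambda>n. \<integral>x. \<bar>?v n x - v x\<bar> \<partial>lborel) \<longlonglongrightarrow> 0"
    using LIMSEQ_subseq_LIMSEQ[OF conv_mollifier_L1[OF D(2)] r(1)] by (simp add: o_def)
  have L1H: "(\<lambda>n. \<integral>x. \<bar>?H n x - H x $ i\<bar> \<partial>lborel) \<longlonglongrightarrow> 0"
    using LIMSEQ_subseq_LIMSEQ[OF conv_mollifier_L1[OF D(3)[of i]] r(1)] by (simp add: o_def)
  have ifv: "integrable lborel (\<lambda>x. f (w x))" if "integrable lborel w" for w :: "real^'n \<Rightarrow> real"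
    by (rule Bochner_Integration.integrable_bound[OF that]) (use that fl[of _ 0] f(4) in auto)
  have lhs: "(\<lambda>n. \<integral>x. f (?v n x) * partial_deriv i \<phi> x \<partial>lborel) \<longlonglongrightarrow> (\<integral>x. f (v x) * partial_deriv i \<phi> x \<partial>lborel)"
  proof (rule LIM_zero_cancel, rule Lim_null_comparison)
    show "\<forall>\<^sub>F n in sequentially. norm ((\<integral>x. f (?v n x) * partial_deriv i \<phi> x \<partial>lborel) - (\<integral>x. f (v x) * partial_deriv i \<phi> x \<partial>lborel))
       \<le> M' * (\<integral>x. \<bar>?v n x - v x\<bar> \<partial>lborel)"
    proof (rule always_eventually, rule allI)
      fix n
      have i1: "integrable lborel (\<lambda>x. f (?v n x) * partial_deriv i \<phi> x)" "integrable lborel (\<lambda>x. f (v x) * partial_deriv i \<phi> x)"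
        by (intro integrable_mult_test_funs[OF _ test_funs_pd[OF \<phi>]] ifv iv D)+
      have "norm ((\<integral>x. f (?v n x) * partial_deriv i \<phi> x \<partial>lborel) - (\<integral>x. f (v x) * partial_deriv i \<phi> x \<partial>lborel))
        = norm (\<integral>x. f (?v n x) * partial_deriv i \<phi> x - f (v x) * partial_deriv i \<phi> x \<partial>lborel)"
        using i1 by (subst Bochner_Integration.integral_diff) auto
      also have "\<dots> \<le> (\<integral>x. M' * \<bar>?v n x - v x\<bar> \<partial>lborel)"
      proof (rule norm_integral_le)
        fix x
        show "\<bar>f (?v n x) * partial_deriv i \<phi> x - f (v x) * partial_deriv i \<phi> x\<bar> \<le> M' * \<bar>?v n x - v x\<bar>"
          using mult_mono[OF M'(2)[of x] fl[of "?v n x" "v x"]] M'(1)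
          unfolding left_diff_distrib[symmetric] abs_mult by (simp add: mult.commute)
      qed (use i1 iv D in auto)
      finally show "norm ((\<integral>x. f (?v n x) * partial_deriv i \<phi> x \<partial>lborel) - (\<integral>x. f (v x) * partial_deriv i \<phi> x \<partial>lborel))
       \<le> M' * (\<integral>x. \<bar>?v n x - v x\<bar> \<partial>lborel)" by simp
    qed
    show "(\<lambda>n. M' * (\<integral>x. \<bar>?v n x - v x\<bar> \<partial>lborel)) \<longlonglongrightarrow> 0"
      using tendsto_mult_right_zero[OF L1v] .
  qed
  have ib: "integrable lborel (\<lambda>x. f' (w x) * g x * \<phi> x)" if "integrable lborel g" "w \<in> borel_measurable borel" for w g :: "real^'n \<Rightarrow> real"
  proof -
    have "integrable lborel (\<lambda>x. g x * f' (w x))"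
      by (rule integrable_mult_bounded[OF that(1) _ f(3)]) (use that in measurable)
    from integrable_mult_test_funs[OF this \<phi>] show ?thesis by (simp add: mult.commute)
  qed
  have rhs: "(\<lambda>n. \<integral>x. f' (?v n x) * ?H n x * \<phi> x \<partial>lborel) \<longlonglongrightarrow> (\<integral>x. f' (v x) * H x $ i * \<phi> x \<partial>lborel)"
  proof -
    have a: "(\<lambda>n. \<integral>x. f' (?v n x) * H x $ i * \<phi> x \<partial>lborel) \<longlonglongrightarrow> (\<integral>x. f' (v x) * H x $ i * \<phi> x \<partial>lborel)"
    proof (rule integral_dominated_convergence[where w="\<lambda>x. \<bar>H x $ i\<bar> * M"])
      show "AE x in lborel. (\<lambda>n. f' (?v n x) * H x $ i * \<phi> x) \<longlonglongrightarrow> f' (v x) * H x $ i * \<phi> x"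
        using r(2)
      proof eventually_elim
        case (elim x)
        have "isCont f' (v x)" using f(2) by (simp add: continuous_on_eq_continuous_at)
        from isCont_tendsto_compose[OF this elim]
        show ?case by (intro tendsto_intros)
      qed
      show "AE x in lborel. norm (f' (?v n x) * H x $ i * \<phi> x) \<le> \<bar>H x $ i\<bar> * M" for n
      proof (rule AE_I2)
        fix x
        have "\<bar>f' (?v n x)\<bar> * \<bar>H x $ i\<bar> \<le> 1 * \<bar>H x $ i\<bar>" by (intro mult_right_mono f(3)) simp
        then show "norm (f' (?v n x) * H x $ i * \<phi> x) \<le> \<bar>H x $ i\<bar> * M"
          unfolding real_norm_def abs_mult using M by (intro mult_mono) auto
      qed
      show "integrable lborel (\<lambda>x. \<bar>H x $ i\<bar> * M)" using D(3)[of i] by auto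
    qed measurable
    have b: "(\<lambda>n. (\<integral>x. f' (?v n x) * ?H n x * \<phi> x \<partial>lborel) - (\<integral>x. f' (?v n x) * H x $ i * \<phi> x \<partial>lborel)) \<longlonglongrightarrow> 0"
    proof (rule Lim_null_comparison)
      show "\<forall>\<^sub>F n in sequentially. norm ((\<integral>x. f' (?v n x) * ?H n x * \<phi> x \<partial>lborel) - (\<integral>x. f' (?v n x) * H x $ i * \<phi> x \<partial>lborel))
         \<le> M * (\<integral>x. \<bar>?H n x - H x $ i\<bar> \<partial>lborel)"
      proof (rule always_eventually, rule allI)
        fix n
        have i1: "integrable lborel (\<lambda>x. f' (?v n x) * ?H n x * \<phi> x)" "integrable lborel (\<lambda>x. f' (?v n x) * H x $ i * \<phi> x)"
          by (intro ib iv D; measurable)+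
        have "norm ((\<integral>x. f' (?v n x) * ?H n x * \<phi> x \<partial>lborel) - (\<integral>x. f' (?v n x) * H x $ i * \<phi> x \<partial>lborel))
          = norm (\<integral>x. f' (?v n x) * ?H n x * \<phi> x - f' (?v n x) * H x $ i * \<phi> x \<partial>lborel)"
          using i1 by (subst Bochner_Integration.integral_diff) auto
        also have "\<dots> \<le> (\<integral>x. M * \<bar>?H n x - H x $ i\<bar> \<partial>lborel)"
        proof (rule norm_integral_le)
          fix x
          have "f' (?v n x) * ?H n x * \<phi> x - f' (?v n x) * H x $ i * \<phi> x = f' (?v n x) * ((?H n x - H x $ i) * \<phi> x)"
            by (simp add: algebra_simps)
          also have "\<bar>\<dots>\<bar> \<le> 1 * (\<bar>?H n x - H x $ i\<bar> * M)"
            unfolding abs_mult using M f(3) by (intro mult_mono mult_nonneg_nonneg) auto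
          finally show "\<bar>f' (?v n x) * ?H n x * \<phi> x - f' (?v n x) * H x $ i * \<phi> x\<bar> \<le> M * \<bar>?H n x - H x $ i\<bar>"
            by (simp add: mult.commute)
        qed (use i1 iv D in auto)
        finally show "norm ((\<integral>x. f' (?v n x) * ?H n x * \<phi> x \<partial>lborel) - (\<integral>x. f' (?v n x) * H x $ i * \<phi> x \<partial>lborel))
         \<le> M * (\<integral>x. \<bar>?H n x - H x $ i\<bar> \<partial>lborel)" by simp
      qed
      show "(\<lambda>n. M * (\<integral>x. \<bar>?H n x - H x $ i\<bar> \<partial>lborel)) \<longlonglongrightarrow> 0" using tendsto_mult_right_zero[OF L1H] .
    qed
    from tendsto_add[OF a b] show ?thesis by simp
  qed
  from lhs[unfolded ibp] tendsto_minus[OF rhs] show ?thesis by (rule LIMSEQ_unique)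
qed

text \<open>
  A continuously differentiable minorant of \<open>max 0 (s - k)\<close> that converges to it as \<open>e\<close>
  tends to \<open>0\<close>. Its derivative lies between \<open>0\<close> and \<open>1\<close> and converges at every point to
  the indicator of \<open>s > k\<close>, the level \<open>s = k\<close> included.
\<close>

definition smooth_pos :: "real \<Rightarrow> real \<Rightarrow> real \<Rightarrow> real"
  where "smooth_pos e k s = (max 0 (s - k))\<^sup>2 / (e + max 0 (s - k))"

definition smooth_pos' :: "real \<Rightarrow> real \<Rightarrow> real \<Rightarrow> real"
  where "smooth_pos' e k s = 1 - (e / (e + max 0 (s - k)))\<^sup>2"

lemma smooth_pos_deriv:
  assumes e: "e > 0"
  shows "(smooth_pos e k has_real_derivative smooth_pos' e k s) (at s)"
proof -
  consider "s > k" | "s < k" | "s = k" by linarith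
  then show ?thesis
  proof cases
    case 1
    define D where "D = e + (s - k)"
    have D: "D \<noteq> 0" "s - k = D - e" using e 1 by (auto simp: D_def)
    have "((\<lambda>s. (s - k)\<^sup>2 / (e + (s - k))) has_real_derivative (2 * (s - k) * D - (s - k)\<^sup>2) / (D * D)) (at s)"
      using D(1) by (auto intro!: derivative_eq_intros simp: D_def)
    moreover have "(2 * (s - k) * D - (s - k)\<^sup>2) / (D * D) = 1 - (e / (e + (s - k)))\<^sup>2"
      unfolding D(2) using D(1) by (simp add: power2_eq_square field_simps)
    ultimately have "((\<lambda>s. (s - k)\<^sup>2 / (e + (s - k))) has_real_derivative 1 - (e / (e + (s - k)))\<^sup>2) (at s)" by simp
    then have "(smooth_pos e k has_real_derivative 1 - (e / (e + (s - k)))\<^sup>2) (at s)"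
      by (rule has_field_derivative_transform_within_open[where S="{k<..}"]) (use 1 in \<open>auto simp: smooth_pos_def\<close>)
    then show ?thesis using 1 by (simp add: smooth_pos'_def)
  next
    case 2
    have "((\<lambda>s. 0) has_real_derivative 0) (at s)" by simp
    then have "(smooth_pos e k has_real_derivative 0) (at s)"
      by (rule has_field_derivative_transform_within_open[where S="{..<k}"]) (use 2 in \<open>auto simp: smooth_pos_def\<close>)
    then show ?thesis using 2 e by (simp add: smooth_pos'_def)
  next
    case 3
    have "((\<lambda>h. smooth_pos e k (k + h) / h) \<longlongrightarrow> 0) (at 0)"
    proof (rule Lim_null_comparison)
      have "norm (smooth_pos e k (k + h) / h) \<le> \<bar>h\<bar> / e" for h
      proof (cases "h > 0")
        case True
        then have "smooth_pos e k (k + h) / h = h / (e + h)"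
          by (simp add: smooth_pos_def power2_eq_square)
        moreover have "h / (e + h) \<le> h / e" using e True by (intro divide_left_mono) auto
        ultimately show ?thesis using e True by simp
      qed (use e in \<open>auto simp: smooth_pos_def intro: divide_nonpos_pos\<close>)
      then show "\<forall>\<^sub>F h in at 0. norm (smooth_pos e k (k + h) / h) \<le> \<bar>h\<bar> / e" by simp
      show "((\<lambda>h. \<bar>h\<bar> / e) \<longlongrightarrow> 0) (at (0::real))" using e by (auto intro!: tendsto_eq_intros)
    qed
    moreover have "smooth_pos e k k = 0" "smooth_pos' e k k = 0" using e by (simp_all add: smooth_pos_def smooth_pos'_def)
    ultimately show ?thesis using 3 by (simp add: DERIV_def)
  qed
qed

lemma smooth_pos'_bounds:
  assumes "e > 0" shows "0 \<le> smooth_pos' e k s" "smooth_pos' e k s \<le> 1"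
proof -
  have "0 \<le> e / (e + max 0 (s - k))" "e / (e + max 0 (s - k)) \<le> 1" using assms by (auto simp: divide_le_eq)
  then show "0 \<le> smooth_pos' e k s" "smooth_pos' e k s \<le> 1"
    by (auto simp: smooth_pos'_def power_le_one)
qed

text \<open>
  Chain rule for \<open>smooth_pos\<close> and dominated convergence. Since \<open>k \<ge> 0\<close>, the support does
  not grow.
\<close>

lemma weak_grad_pos_part:
  fixes v :: "real^'n \<Rightarrow> real"
  assumes v: "weak_grad_cpt K v H" and k: "k \<ge> 0"
  shows "weak_grad_cpt K (\<lambda>x. max 0 (v x - k)) (\<lambda>x. if k < v x then H x else 0)"
  unfolding weak_grad_cpt_def
proof (intro conjI allI ballI impI)
  note D = weak_grad_cptD[OF v]
  have [measurable]: "v \<in> borel_measurable borel" "\<And>i. (\<lambda>x. H x $ i) \<in> borel_measurable borel"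
    using D(2,3) by auto
  show "compact K" by (rule D)
  show int: "integrable lborel (\<lambda>x. max 0 (v x - k))"
    by (rule Bochner_Integration.integrable_bound[OF D(2)]) (use k in auto)
  have iH: "integrable lborel (\<lambda>x. if k < v x then H x $ i else 0)" for i
    by (rule Bochner_Integration.integrable_bound[OF D(3)[of i]]) auto
  have comp: "(if k < v x then H x else 0) $ i = (if k < v x then H x $ i else 0)" for x i by simp
  show "integrable lborel (\<lambda>x. (if k < v x then H x else 0) $ i)" for i unfolding comp by (rule iH)
  fix i and \<phi> :: "real^'n \<Rightarrow> real" assume \<phi>: "\<phi> \<in> test_funs UNIV"
  have [measurable]: "\<phi> \<in> borel_measurable borel" "partial_deriv i \<phi> \<in> borel_measurable borel"
    using test_funs_borel[OF \<phi>] test_funs_borel[OF test_funs_pd[OF \<phi>]] by auto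
  define e where "e n = 1 / real (Suc n)" for n
  have e: "0 < e n" for n by (simp add: e_def)
  have e0: "e \<longlonglongrightarrow> 0" unfolding e_def using LIMSEQ_inverse_real_of_nat by (simp add: inverse_eq_divide)
  have cont: "continuous_on UNIV (smooth_pos' (e n) k)" for n
  proof -
    have "e n + max 0 (s - k) \<noteq> 0" for s using e[of n] by (simp add: add_pos_nonneg less_imp_neq[symmetric])
    then show ?thesis unfolding smooth_pos'_def by (intro continuous_intros) auto
  qed
  have [measurable]: "smooth_pos (e n) k \<in> borel_measurable borel" "smooth_pos' (e n) k \<in> borel_measurable borel" for n
    unfolding smooth_pos_def[abs_def] smooth_pos'_def[abs_def] by measurable
  have eq: "(\<integral>x. smooth_pos (e n) k (v x) * partial_deriv i \<phi> x \<partial>lborel) = - (\<integral>x. smooth_pos' (e n) k (v x) * H x $ i * \<phi> x \<partial>lborel)" for n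
  proof (rule weak_chain_rule[OF v _ cont _ _ \<phi>])
    show "(smooth_pos (e n) k has_real_derivative smooth_pos' (e n) k t) (at t)" for t by (rule smooth_pos_deriv[OF e])
    show "\<bar>smooth_pos' (e n) k t\<bar> \<le> 1" for t using smooth_pos'_bounds[OF e, of n k t] by simp
    show "smooth_pos (e n) k 0 = 0" using k by (simp add: smooth_pos_def)
  qed
  have lhs: "(\<lambda>n. \<integral>x. smooth_pos (e n) k (v x) * partial_deriv i \<phi> x \<partial>lborel) \<longlonglongrightarrow> (\<integral>x. max 0 (v x - k) * partial_deriv i \<phi> x \<partial>lborel)"
  proof (rule integral_dominated_convergence[where w="\<lambda>x. \<bar>max 0 (v x - k) * partial_deriv i \<phi> x\<bar>"])
    show "integrable lborel (\<lambda>x. \<bar>max 0 (v x - k) * partial_deriv i \<phi> x\<bar>)"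
      by (intro integrable_abs integrable_mult_test_funs[OF int test_funs_pd[OF \<phi>]])
    show "AE x in lborel. (\<lambda>n. smooth_pos (e n) k (v x) * partial_deriv i \<phi> x) \<longlonglongrightarrow> max 0 (v x - k) * partial_deriv i \<phi> x"
    proof (intro AE_I2 tendsto_mult tendsto_const)
      fix x
      show "(\<lambda>n. smooth_pos (e n) k (v x)) \<longlonglongrightarrow> max 0 (v x - k)"
      proof (cases "v x > k")
        case True
        have "(\<lambda>n. (v x - k)\<^sup>2 / (e n + (v x - k))) \<longlonglongrightarrow> (v x - k)\<^sup>2 / (0 + (v x - k))"
          using True by (intro tendsto_intros e0) auto
        then show ?thesis using True by (simp add: smooth_pos_def power2_eq_square)
      qed (simp add: smooth_pos_def)
    qed
    show "AE x in lborel. norm (smooth_pos (e n) k (v x) * partial_deriv i \<phi> x) \<le> \<bar>max 0 (v x - k) * partial_deriv i \<phi> x\<bar>" for n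
    proof (rule AE_I2)
      fix x
      let ?t = "max 0 (v x - k)"
      have "?t * ?t \<le> ?t * (e n + ?t)" using e[of n] by (intro mult_left_mono) auto
      moreover have "0 < e n + ?t" using e[of n] by (simp add: add_pos_nonneg)
      ultimately have "\<bar>smooth_pos (e n) k (v x)\<bar> \<le> \<bar>?t\<bar>"
        by (simp add: smooth_pos_def power2_eq_square pos_divide_le_eq abs_mult)
      then show "norm (smooth_pos (e n) k (v x) * partial_deriv i \<phi> x) \<le> \<bar>?t * partial_deriv i \<phi> x\<bar>"
        unfolding real_norm_def abs_mult by (rule mult_right_mono) simp
    qed
  qed measurable
  have rhs: "(\<lambda>n. \<integral>x. smooth_pos' (e n) k (v x) * H x $ i * \<phi> x \<partial>lborel) \<longlonglongrightarrow> (\<integral>x. (if k < v x then H x $ i else 0) * \<phi> x \<partial>lborel)"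
  proof (rule integral_dominated_convergence[where w="\<lambda>x. \<bar>H x $ i * \<phi> x\<bar>"])
    show "integrable lborel (\<lambda>x. \<bar>H x $ i * \<phi> x\<bar>)" by (intro integrable_abs integrable_mult_test_funs[OF D(3) \<phi>])
    show "AE x in lborel. (\<lambda>n. smooth_pos' (e n) k (v x) * H x $ i * \<phi> x) \<longlonglongrightarrow> (if k < v x then H x $ i else 0) * \<phi> x"
    proof (intro AE_I2 tendsto_mult tendsto_const)
      fix x
      show "(\<lambda>n. smooth_pos' (e n) k (v x) * H x $ i) \<longlonglongrightarrow> (if k < v x then H x $ i else 0)"
      proof (cases "v x > k")
        case True
        have "(\<lambda>n. (1 - (e n / (e n + (v x - k)))\<^sup>2) * H x $ i) \<longlonglongrightarrow> (1 - (0 / (0 + (v x - k)))\<^sup>2) * H x $ i"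
          using True by (intro tendsto_intros e0) auto
        then show ?thesis using True by (simp add: smooth_pos'_def)
      next
        case False
        then have "smooth_pos' (e n) k (v x) = 0" for n using e[of n] by (simp add: smooth_pos'_def)
        then show ?thesis using False by simp
      qed
    qed
    show "AE x in lborel. norm (smooth_pos' (e n) k (v x) * H x $ i * \<phi> x) \<le> \<bar>H x $ i * \<phi> x\<bar>" for n
    proof (rule AE_I2)
      fix x
      have "\<bar>smooth_pos' (e n) k (v x)\<bar> * \<bar>H x $ i * \<phi> x\<bar> \<le> 1 * \<bar>H x $ i * \<phi> x\<bar>"
        using smooth_pos'_bounds[OF e, of n k "v x"] by (intro mult_right_mono) auto
      then show "norm (smooth_pos' (e n) k (v x) * H x $ i * \<phi> x) \<le> \<bar>H x $ i * \<phi> x\<bar>" by (simp add: abs_mult mult.assoc)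
    qed
  qed measurable
  show "(\<integral>x. max 0 (v x - k) * partial_deriv i \<phi> x \<partial>lborel) = - (\<integral>x. (if k < v x then H x else 0) $ i * \<phi> x \<partial>lborel)"
    unfolding comp using lhs[unfolded eq] tendsto_minus[OF rhs] by (rule LIMSEQ_unique)
qed (use k weak_grad_cptD(4,5)[OF v] in auto)

subsection \<open>The fundamental lemma\<close>

lemma bump_ball:
  fixes x0 :: "real^'n"
  assumes "0 < r" "r < R"
  defines "\<eta> \<equiv> \<lambda>x. bump 0 ((1 / r) *\<^sub>R (x - x0))"
  shows "\<eta> \<in> test_funs (ball x0 R)" "x \<in> ball x0 r \<Longrightarrow> \<eta> x > 0"
proof -
  have n: "norm ((1 / r) *\<^sub>R (x - x0)) = dist x0 x / r" for x
    using assms(1) by (simp only: norm_scaleR) (simp add: dist_norm norm_minus_commute)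
  have eq: "\<eta> = (\<lambda>x. bump 0 (- (1 / r) *\<^sub>R x0 + (1 / r) *\<^sub>R x))"
    by (simp add: \<eta>_def algebra_simps)
  show "\<eta> \<in> test_funs (ball x0 R)"
  proof (rule test_funsI[of _ "cball x0 r"])
    show "Ck k \<eta>" for k unfolding eq by (intro Ck_affine Ck_bump)
    show "\<eta> x = 0" if "x \<notin> cball x0 r" for x
      unfolding \<eta>_def using that assms(1) by (intro bump_zero) (simp only: n, simp)
  qed (use assms in auto)
  show "\<eta> x > 0" if "x \<in> ball x0 r"
    unfolding \<eta>_def using that assms(1) by (intro bump_pos) (simp only: n, simp)
qed

text \<open>
  After multiplication by a cut-off function \<open>\<eta>\<close>, each value of a mollification of \<open>h \<eta>\<close>
  is the integral of \<open>h\<close> against an admissible test function, hence \<open>0\<close>.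
\<close>

lemma AE_zero_of_integral_test_funs_zero:
  fixes h :: "real^'n \<Rightarrow> real"
  assumes h: "integrable lborel h" and z: "\<And>\<phi>. \<phi> \<in> test_funs (ball x0 R) \<Longrightarrow> (\<integral>x. h x * \<phi> x \<partial>lborel) = 0"
    and r: "0 < r" "r < R"
  shows "AE x in lborel. x \<in> ball x0 r \<longrightarrow> h x = 0"
proof -
  let ?\<eta> = "\<lambda>x. bump 0 ((1 / r) *\<^sub>R (x - x0))"
  have \<eta>: "?\<eta> \<in> test_funs (ball x0 R)" by (rule bump_ball[OF r])
  have i: "integrable lborel (\<lambda>x. h x * ?\<eta> x)" by (rule integrable_mult_test_funs[OF h \<eta>])
  have "conv (\<lambda>x. h x * ?\<eta> x) (mollifier n) = (\<lambda>x. 0)" for n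
  proof
    fix x
    have "(\<lambda>y. mollifier n (x - y) * ?\<eta> y) \<in> test_funs (ball x0 R)"
      using test_funs_reflect[OF mollifier_test[of n], of x] by (intro test_funs_mult[OF _ \<eta>]) (auto simp: test_funs_def)
    from z[OF this] show "conv (\<lambda>x. h x * ?\<eta> x) (mollifier n) x = 0"
      unfolding conv_def by (simp add: mult_ac)
  qed
  with conv_mollifier_L1[OF i] have "(\<integral>x. \<bar>h x * ?\<eta> x\<bar> \<partial>lborel) = 0" by (simp add: LIMSEQ_const_iff)
  then have "AE x in lborel. \<bar>h x * ?\<eta> x\<bar> = 0"
    using integral_nonneg_eq_0_iff_AE[OF integrable_abs[OF i]] by simp
  then show ?thesis
  proof eventually_elim
    case (elim x)
    then show ?case using bump_ball(2)[OF r, of x x0] by fastforce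
  qed
qed

subsection \<open>Cut-off functions\<close>

lemma powr_power_m1:
  fixes y :: real
  assumes "0 \<le> y" "m > 1" shows "y ^ (m - 1) \<le> (y ^ m) powr (1 - 1 / real m)"
proof (cases "y = 0")
  case True
  then show ?thesis using assms by (simp add: power_0_left)
next
  case False
  then have "(y ^ m) powr (1 - 1 / real m) = y powr (real m * (1 - 1 / real m))"
    using assms by (simp add: powr_realpow[symmetric] powr_powr)
  also have "real m * (1 - 1 / real m) = real (m - 1)" using assms by (simp add: of_nat_diff right_diff_distrib)
  also have "y powr real (m - 1) = y ^ (m - 1)" by (rule powr_realpow) (use False assms in auto)
  finally show ?thesis by simp
qed

lemma partial_deriv_power:
  fixes f :: "real^'n \<Rightarrow> real"
  assumes "f differentiable (at x)"
  shows "partial_deriv i (\<lambda>x. f x ^ m) x = real m * f x ^ (m - 1) * partial_deriv i f x"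
proof -
  from frechet_derivative_works[THEN iffD1, OF assms]
  have "((\<lambda>x. f x ^ m) has_derivative (\<lambda>h. of_nat m * frechet_derivative f (at x) h * f x ^ (m - 1))) (at x)"
    by (rule has_derivative_power)
  from partial_deriv_eq[OF this] show ?thesis by (simp add: partial_deriv_def mult_ac)
qed

text \<open>
  The power of \<open>\<zeta>\<close> in the bound for the gradient lets terms that contain a derivative of
  \<open>\<zeta>\<close> be absorbed by an energy with weight \<open>\<zeta>\<close>. The dependence on the radii is explicit
  because \<open>C\<close> has to be the same in all steps of an iteration over shrinking balls.
\<close>

definition cutoff :: "real \<Rightarrow> nat \<Rightarrow> real^'n \<Rightarrow> real \<Rightarrow> real \<Rightarrow> (real^'n \<Rightarrow> real) \<Rightarrow> bool"
  where "cutoff C m x0 r R \<zeta> \<longleftrightarrow> \<zeta> \<in> test_funs (ball x0 R) \<and> (\<forall>x. 0 \<le> \<zeta> x \<and> \<zeta> x \<le> 1) \<and>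
    (\<forall>x\<in>ball x0 r. \<zeta> x = 1) \<and>
    (\<forall>i x. \<bar>partial_deriv i \<zeta> x\<bar> \<le> C / (R - r) * \<zeta> x powr (1 - 1 / real m))"

lemma cutoffD:
  assumes "cutoff C m x0 r R \<zeta>"
  shows "\<zeta> \<in> test_funs (ball x0 R)" "0 \<le> \<zeta> x" "\<zeta> x \<le> 1" "x \<in> ball x0 r \<Longrightarrow> \<zeta> x = 1"
    "\<bar>partial_deriv i \<zeta> x\<bar> \<le> C / (R - r) * \<zeta> x powr (1 - 1 / real m)"
  using assms unfolding cutoff_def by blast+

text \<open>
  The \<open>m\<close>-th power of a rescaled mollified indicator of a ball; differentiating the power
  leaves its power with exponent \<open>1 - 1 / m\<close> as a factor.
\<close>

lemma cutoff_exists: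
  fixes m :: nat
  assumes m: "m > 1"
  shows "\<exists>C>0. \<forall>(x0 :: real^'n) r R. 0 < r \<longrightarrow> r < R \<longrightarrow> (\<exists>\<zeta>. cutoff C m x0 r R \<zeta>)"
proof -
  let ?\<rho> = "mollifier 0 :: real^'n \<Rightarrow> real"
  define D where "D = (\<Sum>i\<in>UNIV. \<integral>x. \<bar>partial_deriv i ?\<rho> x\<bar> \<partial>lborel) + 1"
  have Di: "(\<integral>x. \<bar>partial_deriv i ?\<rho> x\<bar> \<partial>lborel) \<le> D" for i
  proof -
    have "(\<integral>x. \<bar>partial_deriv i ?\<rho> x\<bar> \<partial>lborel) \<le> (\<Sum>i\<in>UNIV. \<integral>x. \<bar>partial_deriv i ?\<rho> x\<bar> \<partial>lborel)"
      by (rule member_le_sum) auto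
    then show ?thesis by (simp add: D_def)
  qed
  have D: "D > 0" unfolding D_def by (intro add_nonneg_pos sum_nonneg) auto
  define C where "C = 3 * real m * D"
  have C: "C > 0" using m D by (simp add: C_def)
  have i\<rho>: "integrable lborel ?\<rho>" by (rule test_funs_integrable[OF mollifier_test])
  note rz = mollifier_zero[of 0, simplified]
  show ?thesis
  proof (intro exI[of _ C] conjI C allI impI)
    fix x0 :: "real^'n" and r R :: real assume r: "0 < r" "r < R"
    \<comment> \<open>In units of \<open>e\<close>, mollification at scale \<open>1\<close> of the indicator of the ball of radius
      \<open>r / e + 1\<close> gives \<open>1\<close> up to radius \<open>r / e\<close> and \<open>0\<close> from radius \<open>r / e + 2\<close> on; after
      rescaling these are \<open>r\<close> and \<open>r + 2 e\<close>, and the latter is less than \<open>R\<close>.\<close>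
    define e where "e = (R - r) / 3"
    have e: "e > 0" using r by (simp add: e_def)
    define s where "s = r / e + 1"
    let ?I = "indicator (ball 0 s) :: real^'n \<Rightarrow> real"
    have iI: "integrable lborel ?I" by (simp add: integrable_indicator_iff)
      (rule emeasure_lborel_ball_finite[unfolded infinity_ennreal_def])
    define g where "g = conv ?I ?\<rho>"
    have gt: "Ck k g" for k unfolding g_def by (rule Ck_conv[OF iI mollifier_test])
    have g_eq: "g x = (\<integral>y. ?I (x - y) * ?\<rho> y \<partial>lborel)" for x
    proof -
      have "(\<lambda>y. ?I y * ?\<rho> (x - y)) \<in> borel_measurable borel"
        using borel_measurable_integrable[OF conv_integrable[OF iI mollifier_test[of 0], of x]] by simp
      from integral_reflect[OF this, of x] show ?thesis unfolding g_def conv_def by simp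
    qed
    have igx: "integrable lborel (\<lambda>y. ?I (x - y) * ?\<rho> y)" for x
      using integrable_reflect[OF conv_integrable[OF iI mollifier_test[of 0], of x], of x] by simp
    have g0: "0 \<le> g x" and g1: "g x \<le> 1" for x
    proof -
      show "0 \<le> g x" unfolding g_eq by (simp add: mollifier_nonneg)
      have "g x \<le> (\<integral>y. ?\<rho> y \<partial>lborel)" unfolding g_eq
        by (intro integral_mono igx i\<rho>) (auto simp: mollifier_nonneg indicator_def)
      then show "g x \<le> 1" by (simp add: mollifier_integral)
    qed
    have gone: "g x = 1" if "norm x < r / e" for x
    proof -
      have "?I (x - y) * ?\<rho> y = ?\<rho> y" for y
      proof (cases "norm y < 1")
        case True
        then have "norm (x - y) < s" using norm_triangle_ineq4[of x y] that by (simp add: s_def)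
        then show ?thesis by (simp add: indicator_def)
      next
        case False
        then show ?thesis using rz[of y] by simp
      qed
      then have "(\<lambda>y. ?I (x - y) * ?\<rho> y) = ?\<rho>" by blast
      then show ?thesis unfolding g_eq by (simp add: mollifier_integral)
    qed
    have gz: "g x = 0" if "norm x \<ge> r / e + 2" for x
    proof -
      have "?I (x - y) * ?\<rho> y = 0" for y
      proof (cases "norm y < 1")
        case True
        then have "norm (x - y) \<ge> s" using norm_triangle_ineq2[of x y] that by (simp add: s_def)
        then show ?thesis by (simp add: indicator_def)
      next
        case False
        then show ?thesis using rz[of y] by simp
      qed
      then have "(\<lambda>y. ?I (x - y) * ?\<rho> y) = (\<lambda>_. 0)" by blast
      then show ?thesis unfolding g_eq by simp
    qed
    have gd: "\<bar>partial_deriv i g x\<bar> \<le> D" for i x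
    proof -
      have p: "partial_deriv i ?\<rho> \<in> test_funs UNIV" by (rule test_funs_pd[OF mollifier_test])
      have ip: "integrable lborel (partial_deriv i ?\<rho>)" by (rule test_funs_integrable[OF p])
      have "\<bar>partial_deriv i g x\<bar> = norm (\<integral>y. ?I y * partial_deriv i ?\<rho> (x - y) \<partial>lborel)"
        unfolding g_def partial_deriv_conv[OF iI mollifier_test] conv_def by simp
      also have "\<dots> \<le> (\<integral>y. \<bar>partial_deriv i ?\<rho> (x - y)\<bar> \<partial>lborel)"
        by (intro norm_integral_le conv_integrable[OF iI p] integrable_abs integrable_reflect[OF ip]) (simp add: indicator_def)
      also have "\<dots> = (\<integral>y. \<bar>partial_deriv i ?\<rho> y\<bar> \<partial>lborel)"
        using ip by (intro integral_reflect) auto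
      finally show ?thesis using Di[of i] by simp
    qed
    define \<eta> where "\<eta> x = g ((1 / e) *\<^sub>R (x - x0))" for x
    have \<eta>eq: "\<eta> = (\<lambda>x. g (- (1 / e) *\<^sub>R x0 + (1 / e) *\<^sub>R x))" by (simp add: \<eta>_def[abs_def] algebra_simps)
    have \<eta>C: "Ck k \<eta>" for k unfolding \<eta>eq by (intro Ck_affine gt)
    have \<eta>d: "\<eta> differentiable (at x)" for x using \<eta>C[of "Suc 0"] by simp
    have gdiff: "g differentiable (at x)" for x using gt[of "Suc 0"] by simp
    have \<eta>p: "\<bar>partial_deriv i \<eta> x\<bar> \<le> D / e" for i x
      unfolding \<eta>eq using e gd by (subst partial_deriv_affine[OF gdiff]) (simp add: abs_mult divide_right_mono)
    define \<zeta> where "\<zeta> x = \<eta> x ^ m" for x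
    show "\<exists>\<zeta>. cutoff C m x0 r R \<zeta>"
      unfolding cutoff_def
    proof (intro exI[of _ \<zeta>] conjI allI ballI)
      fix x i
      show "0 \<le> \<zeta> x" "\<zeta> x \<le> 1" using g0 g1 by (simp_all add: \<zeta>_def \<eta>_def power_le_one)
      have "\<bar>partial_deriv i \<zeta> x\<bar> = real m * (\<eta> x ^ (m - 1) * \<bar>partial_deriv i \<eta> x\<bar>)"
        unfolding \<zeta>_def[abs_def] partial_deriv_power[OF \<eta>d] using g0 by (simp add: abs_mult \<eta>_def)
      also have "\<dots> \<le> real m * (\<zeta> x powr (1 - 1 / real m) * (D / e))"
        unfolding \<zeta>_def using m g0 by (intro mult_left_mono mult_mono powr_power_m1 \<eta>p) (auto simp: \<eta>_def)
      also have "\<dots> = C / (R - r) * \<zeta> x powr (1 - 1 / real m)"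
        by (simp add: C_def e_def)
      finally show "\<bar>partial_deriv i \<zeta> x\<bar> \<le> C / (R - r) * \<zeta> x powr (1 - 1 / real m)" .
    next
      fix x assume "x \<in> ball x0 r"
      then have "norm ((1 / e) *\<^sub>R (x - x0)) < r / e"
        using e by (simp add: dist_norm norm_minus_commute divide_strict_right_mono)
      then show "\<zeta> x = 1" by (simp add: \<zeta>_def \<eta>_def gone)
    next
      show "\<zeta> \<in> test_funs (ball x0 R)"
      proof (rule test_funsI[of _ "cball x0 (r + 2 * e)"])
        show "Ck k \<zeta>" for k unfolding \<zeta>_def[abs_def] by (intro Ck_power \<eta>C)
        have "r + 2 * e < R" using r by (simp add: e_def field_simps)
        then show "cball x0 (r + 2 * e) \<subseteq> ball x0 R" by auto
        fix x assume "x \<notin> cball x0 (r + 2 * e)"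
        then have "(r + 2 * e) / e \<le> dist x0 x / e" using e by (intro divide_right_mono) auto
        moreover have "(r + 2 * e) / e = r / e + 2" using e by (simp add: add_divide_distrib)
        moreover have "norm ((1 / e) *\<^sub>R (x - x0)) = dist x0 x / e"
          using e by (simp only: norm_scaleR) (simp add: dist_norm norm_minus_commute)
        ultimately have "r / e + 2 \<le> norm ((1 / e) *\<^sub>R (x - x0))" by simp
        then show "\<zeta> x = 0" using m by (simp add: \<zeta>_def \<eta>_def gz)
      qed simp
    qed
  qed
qed

section \<open>Testing the equation with weakly differentiable functions\<close>

lemma Hoelder_conj:
  fixes f g :: "'a \<Rightarrow> real"
  assumes p: "p > 1"
    and [measurable]: "f \<in> borel_measurable M" "g \<in> borel_measurable M"
    and f: "integrable M (\<lambda>x. \<bar>f x\<bar> powr p)" and g: "integrable M (\<lambda>x. \<bar>g x\<bar> powr conj_exp p)"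
  shows "integrable M (\<lambda>x. f x * g x)"
    and "(\<integral>x. \<bar>f x * g x\<bar> \<partial>M) \<le> (\<integral>x. \<bar>f x\<bar> powr p \<partial>M) powr (1 / p) * (\<integral>x. \<bar>g x\<bar> powr conj_exp p \<partial>M) powr (1 - 1 / p)"
proof -
  have l: "0 < 1 / p" "1 / p < 1" using p by auto
  have "conj_exp p * (1 - 1 / p) = 1" using p by (simp add: conj_exp_def field_simps)
  then have eq: "\<bar>f x * g x\<bar> = (\<bar>f x\<bar> powr p) powr (1 / p) * (\<bar>g x\<bar> powr conj_exp p) powr (1 - 1 / p)" for x
    using p by (simp add: powr_powr abs_mult)
  note H = Hoelder_geometric[OF f _ g _ l]
  have "integrable M (\<lambda>x. \<bar>f x * g x\<bar>)" unfolding eq by (rule H(1)) auto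
  then show "integrable M (\<lambda>x. f x * g x)" by (rule integrable_abs_cancel) simp
  show "(\<integral>x. \<bar>f x * g x\<bar> \<partial>M) \<le> (\<integral>x. \<bar>f x\<bar> powr p \<partial>M) powr (1 / p) * (\<integral>x. \<bar>g x\<bar> powr conj_exp p \<partial>M) powr (1 - 1 / p)"
    unfolding eq by (rule H(2)) auto
qed

text \<open>
  Weak convergence in \<open>L^p\<close>. The function \<open>h\<close> is cut at a large height \<open>m\<close>: the bounded
  part is paired with differences that are small in \<open>L^1\<close>, and the tail is small in the
  conjugate norm, uniformly in the mollification because of \<open>conv_Lp_bound\<close>.
\<close>

lemma conv_pairing:
  fixes v h :: "real^'n \<Rightarrow> real"
  assumes p: "p > 1" and v: "integrable lborel v" "integrable lborel (\<lambda>x. \<bar>v x\<bar> powr p)"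
    and h[measurable]: "h \<in> borel_measurable borel" and hp: "integrable lborel (\<lambda>x. \<bar>h x\<bar> powr conj_exp p)"
  shows "(\<lambda>n. \<integral>x. conv v (mollifier n) x * h x \<partial>lborel) \<longlonglongrightarrow> (\<integral>x. v x * h x \<partial>lborel)"
proof (rule LIM_zero_cancel, rule LIMSEQ_I)
  fix \<epsilon> :: real assume \<epsilon>: "\<epsilon> > 0"
  let ?v = "\<lambda>n. conv v (mollifier n)"
  let ?hi = "\<lambda>M x. if \<bar>h x\<bar> > M then h x else 0"
  define V where "V = (\<integral>x. \<bar>v x\<bar> powr p \<partial>lborel) powr (1 / p)"
  have V: "V \<ge> 0" by (simp add: V_def)
  have c: "0 < 1 - 1 / p" "0 < conj_exp p" using p by (auto simp: conj_exp_def)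
  have [measurable]: "v \<in> borel_measurable borel" "?v n \<in> borel_measurable borel" for n
    using v conv_borel[OF v(1) mollifier_test] by auto
  note vn = conv_Lp_bound[OF v p mollifier_test mollifier_nonneg mollifier_integral]
  have ivn: "integrable lborel (?v n)" for n by (rule conv_L1_bound(1)[OF v(1) mollifier_test])
  have hi_int: "integrable lborel (\<lambda>x. \<bar>?hi M x\<bar> powr conj_exp p)" for M
    by (rule Bochner_Integration.integrable_bound[OF hp]) auto
  have "(\<lambda>n. \<integral>x. \<bar>?hi (real n) x\<bar> powr conj_exp p \<partial>lborel) \<longlonglongrightarrow> (\<integral>x. 0 \<partial>(lborel :: (real^'n) measure))"
  proof (rule integral_dominated_convergence[OF _ _ hp])
    show "AE x in lborel. (\<lambda>n. \<bar>?hi (real n) x\<bar> powr conj_exp p) \<longlonglongrightarrow> 0"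
    proof (rule AE_I2)
      fix x
      obtain m where "\<bar>h x\<bar> \<le> real m" using real_arch_simple by blast
      then have "\<forall>n\<ge>m. \<bar>?hi (real n) x\<bar> powr conj_exp p = 0" by auto
      then show "(\<lambda>n. \<bar>?hi (real n) x\<bar> powr conj_exp p) \<longlonglongrightarrow> 0"
        by (intro tendsto_eventually) (unfold eventually_sequentially, blast)
    qed
  qed auto
  then have "(\<lambda>n. (\<integral>x. \<bar>?hi (real n) x\<bar> powr conj_exp p \<partial>lborel) powr (1 - 1 / p)) \<longlonglongrightarrow> 0"
    using c(1) by (intro tendsto_zero_powrI[where b="1 - 1 / p"]) auto
  from order_tendstoD(2)[OF this, of "\<epsilon> / (4 * (V + 1))"]
  have "\<forall>\<^sub>F n in sequentially. (\<integral>x. \<bar>?hi (real n) x\<bar> powr conj_exp p \<partial>lborel) powr (1 - 1 / p) < \<epsilon> / (4 * (V + 1))"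
    using \<epsilon> V by simp
  then obtain m where m: "(\<integral>x. \<bar>?hi (real m) x\<bar> powr conj_exp p \<partial>lborel) powr (1 - 1 / p) < \<epsilon> / (4 * (V + 1))"
    by (metis (no_types, lifting) eventually_sequentially order_refl)
  let ?t = "?hi (real m)"
  have tail: "(\<integral>x. \<bar>f x * ?t x\<bar> \<partial>lborel) \<le> \<epsilon> / 4" "integrable lborel (\<lambda>x. f x * ?t x)"
    if f: "f \<in> borel_measurable borel" "integrable lborel (\<lambda>x. \<bar>f x\<bar> powr p)" "(\<integral>x. \<bar>f x\<bar> powr p \<partial>lborel) \<le> (\<integral>x. \<bar>v x\<bar> powr p \<partial>lborel)" for f
  proof -
    have [measurable]: "f \<in> borel_measurable borel" by (rule f)
    have "(\<integral>x. \<bar>f x * ?t x\<bar> \<partial>lborel) \<le> (\<integral>x. \<bar>f x\<bar> powr p \<partial>lborel) powr (1 / p) * (\<integral>x. \<bar>?t x\<bar> powr conj_exp p \<partial>lborel) powr (1 - 1 / p)"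
      by (rule Hoelder_conj(2)[OF p _ _ f(2) hi_int]) (use f in measurable)
    also have "\<dots> \<le> V * (\<epsilon> / (4 * (V + 1)))"
      unfolding V_def[symmetric] using f(3) p m V by (intro mult_mono) (auto simp: V_def intro!: powr_mono2)
    also have "\<dots> = V / (V + 1) * (\<epsilon> / 4)" by simp
    also have "\<dots> \<le> 1 * (\<epsilon> / 4)" using V \<epsilon> by (intro mult_right_mono) auto
    finally show "(\<integral>x. \<bar>f x * ?t x\<bar> \<partial>lborel) \<le> \<epsilon> / 4" by simp
    show "integrable lborel (\<lambda>x. f x * ?t x)"
      by (rule Hoelder_conj(1)[OF p _ _ f(2) hi_int]) (use f in measurable)
  qed
  have "(\<lambda>n. real m * (\<integral>x. \<bar>?v n x - v x\<bar> \<partial>lborel)) \<longlonglongrightarrow> 0"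
    using tendsto_mult_right_zero[OF conv_mollifier_L1[OF v(1)]] .
  then obtain n0 where n0: "\<And>n. n \<ge> n0 \<Longrightarrow> real m * (\<integral>x. \<bar>?v n x - v x\<bar> \<partial>lborel) < \<epsilon> / 4"
    using order_tendstoD(2)[of _ 0 sequentially "\<epsilon> / 4"] \<epsilon> by (auto simp: eventually_sequentially)
  show "\<exists>n0. \<forall>n\<ge>n0. norm ((\<integral>x. ?v n x * h x \<partial>lborel) - (\<integral>x. v x * h x \<partial>lborel) - 0) < \<epsilon>"
  proof (intro exI[of _ n0] allI impI)
    fix n assume n: "n \<ge> n0"
    have I: "integrable lborel (\<lambda>x. ?v n x * h x)" "integrable lborel (\<lambda>x. v x * h x)"
      by (rule Hoelder_conj(1)[OF p _ _ vn(1) hp]; measurable) (rule Hoelder_conj(1)[OF p _ _ v(2) hp]; measurable)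
    have t1: "(\<integral>x. \<bar>?v n x * ?t x\<bar> \<partial>lborel) \<le> \<epsilon> / 4" "integrable lborel (\<lambda>x. ?v n x * ?t x)"
      using tail[of "?v n"] vn by auto
    have t2: "(\<integral>x. \<bar>v x * ?t x\<bar> \<partial>lborel) \<le> \<epsilon> / 4" "integrable lborel (\<lambda>x. v x * ?t x)"
      using tail[of v] v by auto
    have "norm ((\<integral>x. ?v n x * h x \<partial>lborel) - (\<integral>x. v x * h x \<partial>lborel)) = norm (\<integral>x. ?v n x * h x - v x * h x \<partial>lborel)"
      using I by simp
    also have "\<dots> \<le> (\<integral>x. real m * \<bar>?v n x - v x\<bar> + \<bar>?v n x * ?t x\<bar> + \<bar>v x * ?t x\<bar> \<partial>lborel)"
    proof (rule norm_integral_le)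
      fix x
      show "\<bar>?v n x * h x - v x * h x\<bar> \<le> real m * \<bar>?v n x - v x\<bar> + \<bar>?v n x * ?t x\<bar> + \<bar>v x * ?t x\<bar>"
      proof (cases "\<bar>h x\<bar> > real m")
        case True
        have "0 \<le> real m * \<bar>?v n x - v x\<bar>" by simp
        with abs_triangle_ineq4[of "?v n x * h x" "v x * h x"] show ?thesis
          unfolding if_P[OF True] by linarith
      next
        case False
        then have "\<bar>h x\<bar> * \<bar>?v n x - v x\<bar> \<le> real m * \<bar>?v n x - v x\<bar>" by (intro mult_right_mono) auto
        moreover have "?v n x * h x - v x * h x = h x * (?v n x - v x)" by (simp add: algebra_simps)
        ultimately show ?thesis using False by (simp add: abs_mult)
      qed
    qed (use I ivn v t1(2) t2(2) in auto)
    also have "\<dots> = real m * (\<integral>x. \<bar>?v n x - v x\<bar> \<partial>lborel) + (\<integral>x. \<bar>?v n x * ?t x\<bar> \<partial>lborel) + (\<integral>x. \<bar>v x * ?t x\<bar> \<partial>lborel)"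
      using ivn[of n] v(1) integrable_abs[OF t1(2)] integrable_abs[OF t2(2)] by simp
    also have "\<dots> < \<epsilon>" using n0[OF n] t1(1) t2(1) \<epsilon> by linarith
    finally show "norm ((\<integral>x. ?v n x * h x \<partial>lborel) - (\<integral>x. v x * h x \<partial>lborel) - 0) < \<epsilon>" by simp
  qed
qed

text \<open>
  If the mollifier is narrower than the distance from \<open>K\<close> to the complement of \<open>B\<close>, then
  the mollification of \<open>v\<close> is an admissible test function, with partial derivatives the
  mollifications of the \<open>H $ i\<close>; the pairings with \<open>h i\<close> converge by \<open>conv_pairing\<close>.
\<close>

lemma weak_equation_extends:
  fixes h :: "'n::finite \<Rightarrow> real^'n \<Rightarrow> real" and p :: "'n \<Rightarrow> real"
  assumes p: "\<And>i. p i > 1"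
    and h: "\<And>i. h i \<in> borel_measurable borel" "\<And>i. integrable lborel (\<lambda>x. \<bar>h i x\<bar> powr conj_exp (p i))"
    and eq: "\<And>\<phi>. \<phi> \<in> test_funs B \<Longrightarrow> (\<Sum>i\<in>UNIV. \<integral>x. partial_deriv i \<phi> x * h i x \<partial>lborel) = 0"
    and B: "open B" "K \<subseteq> B"
    and v: "weak_grad_cpt K v H" "\<And>i. integrable lborel (\<lambda>x. \<bar>H x $ i\<bar> powr p i)"
  shows "(\<Sum>i\<in>UNIV. \<integral>x. H x $ i * h i x \<partial>lborel) = 0"
proof -
  note D = weak_grad_cptD[OF v(1)]
  have lim: "(\<lambda>n. \<Sum>i\<in>UNIV. \<integral>x. conv (\<lambda>x. H x $ i) (mollifier n) x * h i x \<partial>lborel) \<longlonglongrightarrow> (\<Sum>i\<in>UNIV. \<integral>x. H x $ i * h i x \<partial>lborel)"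
    by (intro tendsto_sum conv_pairing[OF p D(3) v(2) h])
  have "\<forall>\<^sub>F n in sequentially. (\<Sum>i\<in>UNIV. \<integral>x. conv (\<lambda>x. H x $ i) (mollifier n) x * h i x \<partial>lborel) = 0"
  proof -
    obtain d where d: "d > 0" "\<And>x y. x \<in> K \<Longrightarrow> y \<in> - B \<Longrightarrow> d \<le> dist x y"
    proof -
      have "closed (- B)" "K \<inter> - B = {}" using B by (auto simp: closed_def)
      from separate_compact_closed[OF D(1) this] show thesis using that by blast
    qed
    obtain n0 where n0: "1 / real (Suc n0) < d" using d(1) nat_approx_posE by blast
    show ?thesis unfolding eventually_sequentially
    proof (intro exI[of _ n0] allI impI)
      fix n assume n: "n \<ge> n0"
      have "conv v (mollifier n) \<in> test_funs B"
      proof (rule conv_test_funs[OF D(2) mollifier_test D(1) D(4) compact_cball[of 0 "1 / real (Suc n)"]])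
        show "mollifier n y = 0" if "y \<notin> cball 0 (1 / real (Suc n))" for y :: "real^'n"
          using that by (intro mollifier_zero) (simp del: of_nat_Suc)
        show "{a + b |a b. a \<in> K \<and> b \<in> cball 0 (1 / real (Suc n))} \<subseteq> B"
        proof
          fix z assume "z \<in> {a + b |a b. a \<in> K \<and> b \<in> cball 0 (1 / real (Suc n))}"
          then obtain a b where ab: "z = a + b" "a \<in> K" "norm b \<le> 1 / real (Suc n)" by (auto simp del: of_nat_Suc)
          have "1 / real (Suc n) \<le> 1 / real (Suc n0)" using n by (intro divide_left_mono) auto
          then have "dist a z < d" using ab n0 by (simp add: dist_norm)
          then show "z \<in> B" using d(2)[OF ab(2), of z] by force
        qed
      qed auto
      from eq[OF this] show "(\<Sum>i\<in>UNIV. \<integral>x. conv (\<lambda>x. H x $ i) (mollifier n) x * h i x \<partial>lborel) = 0"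
        by (simp add: partial_deriv_conv_weak[OF v(1) mollifier_test])
    qed
  qed
  from tendsto_eventually[OF this] lim show ?thesis
    by (rule LIMSEQ_unique[symmetric])
qed

lemma partial_deriv_zero_on_open:
  assumes "open S" "x \<in> S" "\<And>y. y \<in> S \<Longrightarrow> f y = c"
  shows "partial_deriv i f x = 0"
proof -
  have "((\<lambda>_. c) has_derivative (\<lambda>_. 0)) (at x)" by simp
  then have "(f has_derivative (\<lambda>_. 0)) (at x)"
    by (rule has_derivative_transform_within_open[OF _ assms(1,2)]) (simp add: assms(3))
  from partial_deriv_eq[OF this] show ?thesis by simp
qed

text \<open>
  Positive parts have been differentiated for compact support only, so \<open>u\<close> is first
  multiplied by a cut-off function that is \<open>1\<close> on the ball of radius \<open>\<rho>\<close>. The compact set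
  is the same for all \<open>k\<close>, which allows differences of two such functions, in particular
  truncations of \<open>u\<close>.
\<close>

lemma weak_grad_cutoff_pos_part:
  fixes u :: "real^'n \<Rightarrow> real"
  assumes wg: "weak_grad_on (ball x0 R) u G" and \<zeta>: "\<zeta> \<in> test_funs (ball x0 \<rho>)" and \<rho>: "0 < \<rho>" "\<rho> < R"
  shows "\<exists>L. compact L \<and> L \<subseteq> ball x0 \<rho> \<and> (\<forall>k\<ge>0. weak_grad_cpt L (\<lambda>x. \<zeta> x * max 0 (u x - k))
      (\<lambda>x. \<chi> i. \<zeta> x * (if k < u x then G x $ i else 0) + partial_deriv i \<zeta> x * max 0 (u x - k)))"
proof -
  obtain L where L: "compact L" "L \<subseteq> ball x0 \<rho>" "\<And>x. x \<notin> L \<Longrightarrow> \<zeta> x = 0" "\<And>x i. x \<notin> L \<Longrightarrow> partial_deriv i \<zeta> x = 0"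
    using \<zeta> by (rule test_funsE) blast
  obtain C \<eta> where "cutoff C 2 x0 \<rho> R \<eta>"
  proof -
    have "(1::nat) < 2" by simp
    from cutoff_exists[OF this, where 'n='n] \<rho> show thesis using that by blast
  qed
  note \<eta> = cutoffD(1,4)[OF this]
  obtain L1 where L1: "compact L1" "\<And>x. x \<notin> L1 \<Longrightarrow> \<eta> x = 0" "\<And>x i. x \<notin> L1 \<Longrightarrow> partial_deriv i \<eta> x = 0"
    using \<eta>(1) by (rule test_funsE) blast
  let ?u = "\<lambda>x. \<eta> x * u x" and ?H = "\<lambda>x. \<chi> i. \<eta> x * G x $ i + partial_deriv i \<eta> x * u x"
  have w1: "weak_grad_cpt L1 ?u ?H" by (rule weak_grad_on_mult[OF wg \<eta>(1) L1])
  show ?thesis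
  proof (intro exI[of _ L] conjI L(1,2) allI impI)
    fix k :: real assume k: "k \<ge> 0"
    note w2 = weak_grad_cpt_imp_on[OF weak_grad_pos_part[OF w1 k]]
    have "weak_grad_cpt L (\<lambda>x. \<zeta> x * max 0 (?u x - k))
      (\<lambda>x. \<chi> i. \<zeta> x * (if k < ?u x then ?H x else 0) $ i + partial_deriv i \<zeta> x * max 0 (?u x - k))"
      by (rule weak_grad_on_mult[OF w2 test_funs_mono[OF subset_UNIV \<zeta>] L(1,3,4)])
    moreover have "\<zeta> x * max 0 (?u x - k) = \<zeta> x * max 0 (u x - k)" for x
      using L(2) L(3)[of x] \<eta>(2)[of x] by (cases "x \<in> L") auto
    moreover have "(\<chi> i. \<zeta> x * (if k < ?u x then ?H x else 0) $ i + partial_deriv i \<zeta> x * max 0 (?u x - k))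
      = (\<chi> i. \<zeta> x * (if k < u x then G x $ i else 0) + partial_deriv i \<zeta> x * max 0 (u x - k))" for x
    proof (cases "x \<in> L")
      case True
      then have x: "x \<in> ball x0 \<rho>" using L(2) by blast
      have "partial_deriv i \<eta> x = 0" for i
        by (rule partial_deriv_zero_on_open[OF open_ball x \<eta>(2)])
      then show ?thesis using \<eta>(2)[OF x] by (simp add: vec_eq_iff)
    next
      case False
      then show ?thesis using L(3)[OF False] L(4)[OF False] by (simp add: vec_eq_iff)
    qed
    ultimately show "weak_grad_cpt L (\<lambda>x. \<zeta> x * max 0 (u x - k))
      (\<lambda>x. \<chi> i. \<zeta> x * (if k < u x then G x $ i else 0) + partial_deriv i \<zeta> x * max 0 (u x - k))" by simp
  qed
qed

lemma weak_grad_cpt_diff: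
  assumes v: "weak_grad_cpt K v H" and w: "weak_grad_cpt K w J"
  shows "weak_grad_cpt K (\<lambda>x. v x - w x) (\<lambda>x. H x - J x)"
  unfolding weak_grad_cpt_def
proof (intro conjI allI ballI impI)
  note V = weak_grad_cptD[OF v] and W = weak_grad_cptD[OF w]
  show "compact K" "integrable lborel (\<lambda>x. v x - w x)" "integrable lborel (\<lambda>x. (H x - J x) $ i)" for i
    using V W by auto
  fix i and \<phi> :: "real^'a \<Rightarrow> real" assume \<phi>: "\<phi> \<in> test_funs UNIV"
  have "(\<integral>x. (v x - w x) * partial_deriv i \<phi> x \<partial>lborel) = (\<integral>x. v x * partial_deriv i \<phi> x \<partial>lborel) - (\<integral>x. w x * partial_deriv i \<phi> x \<partial>lborel)"
    unfolding left_diff_distrib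
    by (intro Bochner_Integration.integral_diff integrable_mult_test_funs[OF _ test_funs_pd[OF \<phi>]] V W)
  moreover have "(\<integral>x. (H x - J x) $ i * \<phi> x \<partial>lborel) = (\<integral>x. H x $ i * \<phi> x \<partial>lborel) - (\<integral>x. J x $ i * \<phi> x \<partial>lborel)"
    unfolding left_diff_distrib vector_minus_component
    by (intro Bochner_Integration.integral_diff integrable_mult_test_funs[OF _ \<phi>] V W)
  ultimately show "(\<integral>x. (v x - w x) * partial_deriv i \<phi> x \<partial>lborel) = - (\<integral>x. (H x - J x) $ i * \<phi> x \<partial>lborel)"
    using V(6)[OF \<phi>, of i] W(6)[OF \<phi>, of i] by simp
qed (use weak_grad_cptD(4,5)[OF v] weak_grad_cptD(4,5)[OF w] in auto)

section \<open>Local integrability with the Sobolev exponent\<close>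

lemma powr_add_le:
  fixes a b s :: real
  assumes "0 \<le> a" "0 \<le> b" "0 \<le> s"
  shows "(a + b) powr s \<le> 2 powr s * (a powr s + b powr s)"
proof -
  have "(a + b) powr s \<le> (2 * max a b) powr s" using assms by (intro powr_mono2) auto
  also have "\<dots> = 2 powr s * max a b powr s" using assms by (simp add: powr_mult)
  also have "\<dots> \<le> 2 powr s * (a powr s + b powr s)" by (intro mult_left_mono) (auto simp: max_def)
  finally show ?thesis .
qed

lemma weak_grad_on_borel:
  assumes "weak_grad_on B u G"
  shows "u \<in> borel_measurable borel" "(\<lambda>x. G x $ i) \<in> borel_measurable borel"
proof -
  have "integrable lborel u" "integrable lborel (\<lambda>x. G x $ i)" using assms by (auto simp: weak_grad_on_def)
  from this[THEN borel_measurable_integrable]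
  show "u \<in> borel_measurable borel" "(\<lambda>x. G x $ i) \<in> borel_measurable borel" by simp_all
qed

lemma weak_grad_on_uminus: "weak_grad_on B u G \<Longrightarrow> weak_grad_on B (\<lambda>x. - u x) (\<lambda>x. - G x)"
  by (simp add: weak_grad_on_def)

context aniso_exponents
begin

text \<open>
  The powers of \<open>X\<close> on the right add up to \<open>(1 - 1 / P) / (q - 1)\<close>, and this is less than
  \<open>1 / q\<close> because \<open>P < q\<close>. For \<open>X > 1\<close> the summand \<open>1\<close> is absorbed and \<open>X\<close> can be
  isolated.
\<close>

lemma bound_of_sublinear_sobolev:
  fixes A lam :: "'n \<Rightarrow> real"
  assumes lam: "\<And>i. lam i = (p i - 1) / (q - 1)" and A: "\<And>i. 0 \<le> A i" and X: "0 \<le> X"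
    and le: "X powr (1 / q) \<le> sob_const * (\<Prod>i\<in>UNIV. (A i * (1 + X powr lam i)) powr (1 / (N * p i)))"
  shows "X \<le> max 1 ((sob_const * (\<Prod>i\<in>UNIV. (2 * A i) powr (1 / (N * p i)))) powr (1 / (1 / q - (1 - 1 / P) / (q - 1))))"
proof (cases "X \<le> 1")
  case False
  define \<theta> where "\<theta> = (1 - 1 / P) / (q - 1)"
  define S where "S = sob_const * (\<Prod>i\<in>UNIV. (2 * A i) powr (1 / (N * p i)))"
  have q1: "q > 1" using q_gt_P P_gt1 by simp
  have lam0: "0 \<le> lam i" for i using q1 p_gt1[of i] by (simp add: lam)
  have sum: "(\<Sum>i\<in>UNIV. lam i / (N * p i)) = \<theta>"
  proof -
    have "lam i / (N * p i) = (1 - 1 / p i) / (N * (q - 1))" for i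
      using q1 dim p_pos[of i] by (simp add: lam field_simps)
    then have "(\<Sum>i\<in>UNIV. lam i / (N * p i)) = (N - N / P) / (N * (q - 1))"
      by (simp only: sum_divide_distrib[symmetric] sum_subtractf sum_inv_p) (simp add: dim_eq)
    also have "N - N / P = N * (1 - 1 / P)" by (simp add: right_diff_distrib)
    finally show ?thesis using dim by (simp add: \<theta>_def)
  qed
  have \<theta>: "\<theta> < 1 / q"
  proof -
    have "q * (1 - 1 / P) < q - 1" using q_gt_P P_gt1 by (simp add: right_diff_distrib)
    then show ?thesis using q1 by (simp add: \<theta>_def pos_divide_less_eq pos_less_divide_eq mult.commute)
  qed
  have "X powr (1 / q) \<le> sob_const * (\<Prod>i\<in>UNIV. (A i * (1 + X powr lam i)) powr (1 / (N * p i)))" by (rule le)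
  also have "\<dots> \<le> sob_const * (\<Prod>i\<in>UNIV. (2 * A i) powr (1 / (N * p i)) * X powr (lam i / (N * p i)))"
  proof (intro mult_left_mono prod_mono conjI sob_const_nonneg)
    fix i
    have "1 \<le> X powr lam i" using False lam0 by (simp add: ge_one_powr_ge_zero)
    then have "A i * (1 + X powr lam i) \<le> 2 * A i * X powr lam i"
      using mult_left_mono[OF _ A, of 1 "X powr lam i" i] by (simp add: distrib_left)
    then have "(A i * (1 + X powr lam i)) powr (1 / (N * p i)) \<le> (2 * A i * X powr lam i) powr (1 / (N * p i))"
      using A[of i] p_pos[of i] dim by (intro powr_mono2) (auto intro!: mult_nonneg_nonneg add_nonneg_nonneg)
    also have "\<dots> = (2 * A i) powr (1 / (N * p i)) * X powr (lam i / (N * p i))"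
      using A[of i] by (simp add: powr_mult powr_powr)
    finally show "(A i * (1 + X powr lam i)) powr (1 / (N * p i)) \<le> (2 * A i) powr (1 / (N * p i)) * X powr (lam i / (N * p i))" .
  qed auto
  also have "\<dots> = S * X powr \<theta>"
    using False by (simp add: prod.distrib S_def sum[symmetric] powr_sum)
  finally have "X powr (1 / q) \<le> S * X powr \<theta>" .
  then have "X powr (1 / q - \<theta>) \<le> S"
    using False by (simp add: powr_diff divide_le_eq)
  then have "(X powr (1 / q - \<theta>)) powr (1 / (1 / q - \<theta>)) \<le> S powr (1 / (1 / q - \<theta>))"
    using \<theta> by (intro powr_mono2) auto
  moreover have "(X powr (1 / q - \<theta>)) powr (1 / (1 / q - \<theta>)) = X" using \<theta> False by (simp add: powr_powr)
  ultimately show ?thesis by (simp add: S_def \<theta>_def)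
qed simp

text \<open>
  Sobolev's inequality is applied to \<open>\<zeta> T\<close>, where \<open>T\<close> is \<open>u\<close> truncated between \<open>0\<close> and
  \<open>M\<close>. The term in which \<open>\<zeta>\<close> is differentiated requires the \<open>p i\<close>-th power of \<open>T\<close>, which
  is interpolated between \<open>L^1\<close>, where \<open>u\<close> is bounded, and \<open>L^q\<close>:
  \<open>p i = q (lam i) + (1 - lam i)\<close> with \<open>lam i < 1\<close> because \<open>p i < q\<close>. So the integral of
  \<open>(\<zeta> T)^q\<close>, finite by the truncation, is controlled by a sublinear expression in itself,
  and the resulting bound does not depend on \<open>M\<close>. Fatou's lemma removes the truncation.
\<close>

lemma local_Lq_pos_part:
  fixes u :: "real^'n \<Rightarrow> real"
  assumes wg: "weak_grad_on (ball x0 R) u G" and G: "\<And>i. integrable lborel (\<lambda>x. \<bar>G x $ i\<bar> powr p i)"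
    and pq: "\<And>i. p i < q" and r: "0 < r" "r < R"
  shows "integrable lborel (\<lambda>x. indicator (ball x0 r) x * max 0 (u x) powr q)"
proof -
  define \<rho> where "\<rho> = (r + R) / 2"
  have \<rho>: "0 < \<rho>" "r < \<rho>" "\<rho> < R" using r by (auto simp: \<rho>_def)
  have q1: "q > 1" using q_gt_P P_gt1 by simp
  define lam where "lam i = (p i - 1) / (q - 1)" for i
  have lam: "0 < lam i" "lam i < 1" "q * lam i + (1 - lam i) = p i" for i
  proof -
    show "0 < lam i" "lam i < 1" using p_gt1[of i] pq[of i] q1 by (auto simp: lam_def)
    have "lam i * (q - 1) = p i - 1" using q1 by (simp add: lam_def)
    then show "q * lam i + (1 - lam i) = p i" by (simp add: algebra_simps)
  qed
  \<comment> \<open>The power of \<open>\<zeta>\<close> that accompanies a derivative of \<open>\<zeta>\<close> has to be at least the power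
    \<open>q (lam i)\<close> that the interpolation consumes, see \<open>expo\<close> below.\<close>
  obtain m :: nat where m: "m > 1" "\<And>i. p i / (1 - lam i) \<le> real m"
  proof
    let ?s = "\<Sum>i\<in>UNIV. p i / (1 - lam i)"
    show "nat \<lceil>?s\<rceil> + 2 > 1" by simp
    fix i
    have "p i / (1 - lam i) \<le> ?s"
      using lam p_pos by (intro member_le_sum) (auto simp: less_imp_le)
    then show "p i / (1 - lam i) \<le> real (nat \<lceil>?s\<rceil> + 2)" by linarith
  qed
  have expo: "q * lam i \<le> (1 - 1 / real m) * p i" for i
  proof -
    have "p i / real m \<le> 1 - lam i"
      using m(2)[of i] m(1) lam(2)[of i] by (simp add: field_simps)
    then show ?thesis using lam(3)[of i] by (simp add: left_diff_distrib)
  qed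
  obtain C \<zeta> where C: "C > 0" and "cutoff C m x0 r \<rho> \<zeta>"
    using cutoff_exists[OF m(1), where 'n='n] r(1) \<rho>(2) by blast
  note \<zeta> = C cutoffD[OF this(2)]
  define L where "L = C / (\<rho> - r)"
  have L: "L > 0" using \<zeta>(1) \<rho> by (simp add: L_def)
  from weak_grad_cutoff_pos_part[OF wg \<zeta>(2) \<rho>(1,3)]
  obtain K where K: "compact K" "\<forall>k\<ge>0. weak_grad_cpt K (\<lambda>x. \<zeta> x * max 0 (u x - k))
      (\<lambda>x. \<chi> i. \<zeta> x * (if k < u x then G x $ i else 0) + partial_deriv i \<zeta> x * max 0 (u x - k))"
    by blast
  note wk = K(2)[rule_format]
  have iu: "integrable lborel u" using wg by (simp add: weak_grad_on_def)
  have [measurable]: "u \<in> borel_measurable borel" "\<And>i. (\<lambda>x. G x $ i) \<in> borel_measurable borel"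
    "\<zeta> \<in> borel_measurable borel" "\<And>i. partial_deriv i \<zeta> \<in> borel_measurable borel"
    using weak_grad_on_borel[OF wg] test_funs_borel[OF \<zeta>(2)] test_funs_borel[OF test_funs_pd[OF \<zeta>(2)]] by auto
  define T where "T M x = max 0 (u x) - max 0 (u x - M)" for M x
  define V where "V M x = ((\<chi> i. \<zeta> x * (if 0 < u x then G x $ i else 0) + partial_deriv i \<zeta> x * max 0 (u x - 0))
     - (\<chi> i. \<zeta> x * (if M < u x then G x $ i else 0) + partial_deriv i \<zeta> x * max 0 (u x - M)) :: real^'n)" for M x
  have wv: "weak_grad_cpt K (\<lambda>x. \<zeta> x * T M x) (V M)" if "M \<ge> 0" for M
    using weak_grad_cpt_diff[OF wk[of 0] wk[OF that]] unfolding V_def[abs_def] T_def by (simp add: right_diff_distrib)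
  have T: "0 \<le> T M x" "T M x \<le> M" "T M x \<le> \<bar>u x\<bar>" if "M \<ge> 0" for M x
    using that by (auto simp: T_def max_def)
  have Vb: "\<bar>V M x $ i\<bar> \<le> \<bar>G x $ i\<bar> + L * \<zeta> x powr (1 - 1 / real m) * T M x" if M: "M \<ge> 0" for M x i
  proof -
    have "V M x $ i = \<zeta> x * (if 0 < u x \<and> u x \<le> M then G x $ i else 0) + partial_deriv i \<zeta> x * T M x"
      using M by (auto simp: V_def T_def algebra_simps)
    also have "\<bar>\<dots>\<bar> \<le> \<bar>\<zeta> x\<bar> * \<bar>if 0 < u x \<and> u x \<le> M then G x $ i else 0\<bar> + \<bar>partial_deriv i \<zeta> x\<bar> * \<bar>T M x\<bar>"
      unfolding abs_mult[symmetric] by (rule abs_triangle_ineq)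
    also have "\<dots> \<le> 1 * \<bar>G x $ i\<bar> + L * \<zeta> x powr (1 - 1 / real m) * T M x"
      using \<zeta>(3,4)[of x] \<zeta>(6)[of i x] T(1)[OF M, of x] by (intro add_mono mult_mono) (auto simp: L_def)
    finally show ?thesis by simp
  qed
  have Vp: "\<bar>V M x $ i\<bar> powr p i \<le> 2 powr p i * (\<bar>G x $ i\<bar> powr p i + L powr p i * (\<zeta> x powr ((1 - 1 / real m) * p i) * T M x powr p i))"
    if M: "M \<ge> 0" for M x i
  proof -
    have "\<bar>V M x $ i\<bar> powr p i \<le> (\<bar>G x $ i\<bar> + L * \<zeta> x powr (1 - 1 / real m) * T M x) powr p i"
      using p_pos[of i] by (intro powr_mono2 Vb M) auto
    also have "\<dots> \<le> 2 powr p i * (\<bar>G x $ i\<bar> powr p i + (L * \<zeta> x powr (1 - 1 / real m) * T M x) powr p i)"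
      using p_pos[of i] L T(1)[OF M, of x] by (intro powr_add_le) auto
    also have "(L * \<zeta> x powr (1 - 1 / real m) * T M x) powr p i = L powr p i * (\<zeta> x powr ((1 - 1 / real m) * p i) * T M x powr p i)"
      using L T(1)[OF M, of x] by (simp add: powr_mult powr_powr)
    finally show ?thesis .
  qed
  have \<zeta>0: "\<zeta> x = 0" if "x \<notin> ball x0 \<rho>" for x
    using \<zeta>(2) by (rule test_funsE) (use that in blast)
  have ib: "integrable lborel (indicator (ball x0 s) :: real^'n \<Rightarrow> real)" for s
    by (simp add: integrable_indicator_iff) (rule emeasure_lborel_ball_finite[unfolded infinity_ennreal_def])
  have Vmeas: "(\<lambda>x. V M x $ i) \<in> borel_measurable borel" for M i unfolding V_def by simp
  have Vint: "integrable lborel (\<lambda>x. \<bar>V M x $ i\<bar> powr p i)" if M: "M \<ge> 0" for M i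
  proof (rule Bochner_Integration.integrable_bound)
    show "integrable lborel (\<lambda>x. 2 powr p i * (\<bar>G x $ i\<bar> powr p i + L powr p i * M powr p i * indicator (ball x0 \<rho>) x))"
      using G ib by auto
    show "(\<lambda>x. \<bar>V M x $ i\<bar> powr p i) \<in> borel_measurable lborel" using Vmeas[of M i] by simp
    have "\<bar>V M x $ i\<bar> powr p i \<le> 2 powr p i * (\<bar>G x $ i\<bar> powr p i + L powr p i * M powr p i * indicator (ball x0 \<rho>) x)" for x
    proof -
      have "\<zeta> x powr ((1 - 1 / real m) * p i) * T M x powr p i \<le> M powr p i * indicator (ball x0 \<rho>) x"
      proof (cases "x \<in> ball x0 \<rho>")
        case True
        have "\<zeta> x powr ((1 - 1 / real m) * p i) \<le> 1"
          using \<zeta>(3,4)[of x] m(1) p_pos[of i] by (intro powr_le1) auto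
        moreover have "T M x powr p i \<le> M powr p i" using T[OF M, of x] p_pos[of i] by (intro powr_mono2) auto
        ultimately have "\<zeta> x powr ((1 - 1 / real m) * p i) * T M x powr p i \<le> 1 * M powr p i" by (intro mult_mono) auto
        then show ?thesis using True by simp
      qed (simp add: \<zeta>0)
      then have "L powr p i * (\<zeta> x powr ((1 - 1 / real m) * p i) * T M x powr p i) \<le> L powr p i * (M powr p i * indicator (ball x0 \<rho>) x)"
        by (rule mult_left_mono) simp
      then show ?thesis using Vp[OF M, of x i] by (smt (verit) mult.assoc mult_left_mono powr_ge_zero)
    qed
    then show "AE x in lborel. norm (\<bar>V M x $ i\<bar> powr p i) \<le> norm (2 powr p i * (\<bar>G x $ i\<bar> powr p i + L powr p i * M powr p i * indicator (ball x0 \<rho>) x))"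
      by (intro AE_I2) (smt (verit) powr_ge_zero real_norm_def)
  qed
  define I0 where "I0 = (\<integral>x. \<bar>u x\<bar> \<partial>lborel)"
  have I0: "I0 \<ge> 0" by (simp add: I0_def)
  define A where "A i = 2 powr p i * ((\<integral>x. \<bar>G x $ i\<bar> powr p i \<partial>lborel) + L powr p i * I0 powr (1 - lam i))" for i
  have A: "0 \<le> A i" for i by (simp add: A_def)
  define Q where "Q = max 1 ((sob_const * (\<Prod>i\<in>UNIV. (2 * A i) powr (1 / (N * p i)))) powr (1 / (1 / q - (1 - 1 / P) / (q - 1))))"
  have bound: "integrable lborel (\<lambda>x. \<bar>\<zeta> x * T M x\<bar> powr q)" "(\<integral>x. \<bar>\<zeta> x * T M x\<bar> powr q \<partial>lborel) \<le> Q" if M: "M \<ge> 0" for M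
  proof -
    note S = sobolev_weak[OF wv[OF M] Vint[OF M]]
    show iq: "integrable lborel (\<lambda>x. \<bar>\<zeta> x * T M x\<bar> powr q)" by (rule S(1))
    define X where "X = (\<integral>x. \<bar>\<zeta> x * T M x\<bar> powr q \<partial>lborel)"
    have X: "X \<ge> 0" by (simp add: X_def)
    have E: "(\<integral>x. \<bar>V M x $ i\<bar> powr p i \<partial>lborel) \<le> A i * (1 + X powr lam i)" for i
    proof -
      note Ho = Hoelder_geometric[OF iq _ integrable_abs[OF iu] _ lam(1,2)[of i]]
      have iH: "integrable lborel (\<lambda>x. (\<bar>\<zeta> x * T M x\<bar> powr q) powr lam i * \<bar>u x\<bar> powr (1 - lam i))" by (rule Ho(1)) auto
      have pt: "\<zeta> x powr ((1 - 1 / real m) * p i) * T M x powr p i \<le> (\<bar>\<zeta> x * T M x\<bar> powr q) powr lam i * \<bar>u x\<bar> powr (1 - lam i)" for x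
      proof -
        have "\<zeta> x powr ((1 - 1 / real m) * p i) \<le> \<zeta> x powr (q * lam i)"
          using \<zeta>(3,4)[of x] by (intro powr_mono' expo)
        moreover have "T M x powr p i \<le> T M x powr (q * lam i) * \<bar>u x\<bar> powr (1 - lam i)"
        proof -
          have "T M x powr p i = T M x powr (q * lam i) * T M x powr (1 - lam i)"
            unfolding powr_add[symmetric] lam(3) ..
          also have "\<dots> \<le> T M x powr (q * lam i) * \<bar>u x\<bar> powr (1 - lam i)"
            using T[OF M, of x] lam(2)[of i] by (intro mult_left_mono powr_mono2) auto
          finally show ?thesis .
        qed
        ultimately have "\<zeta> x powr ((1 - 1 / real m) * p i) * T M x powr p i \<le> \<zeta> x powr (q * lam i) * (T M x powr (q * lam i) * \<bar>u x\<bar> powr (1 - lam i))"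
          by (intro mult_mono) auto
        also have "\<dots> = (\<bar>\<zeta> x * T M x\<bar> powr q) powr lam i * \<bar>u x\<bar> powr (1 - lam i)"
          using \<zeta>(3)[of x] T(1)[OF M, of x] by (simp add: powr_powr powr_mult abs_mult)
        finally show ?thesis .
      qed
      have "(\<integral>x. \<bar>V M x $ i\<bar> powr p i \<partial>lborel) \<le>
        (\<integral>x. 2 powr p i * (\<bar>G x $ i\<bar> powr p i + L powr p i * ((\<bar>\<zeta> x * T M x\<bar> powr q) powr lam i * \<bar>u x\<bar> powr (1 - lam i))) \<partial>lborel)"
      proof (rule integral_mono[OF Vint[OF M]])
        show "integrable lborel (\<lambda>x. 2 powr p i * (\<bar>G x $ i\<bar> powr p i + L powr p i * ((\<bar>\<zeta> x * T M x\<bar> powr q) powr lam i * \<bar>u x\<bar> powr (1 - lam i))))"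
          using G iH by auto
        fix x
        show "\<bar>V M x $ i\<bar> powr p i \<le> 2 powr p i * (\<bar>G x $ i\<bar> powr p i + L powr p i * ((\<bar>\<zeta> x * T M x\<bar> powr q) powr lam i * \<bar>u x\<bar> powr (1 - lam i)))"
          by (rule order_trans[OF Vp[OF M]]) (intro mult_left_mono add_left_mono pt, auto)
      qed
      also have "\<dots> = 2 powr p i * ((\<integral>x. \<bar>G x $ i\<bar> powr p i \<partial>lborel) + L powr p i * (\<integral>x. (\<bar>\<zeta> x * T M x\<bar> powr q) powr lam i * \<bar>u x\<bar> powr (1 - lam i) \<partial>lborel))"
        using G iH by simp
      also have "\<dots> \<le> 2 powr p i * ((\<integral>x. \<bar>G x $ i\<bar> powr p i \<partial>lborel) + L powr p i * (X powr lam i * I0 powr (1 - lam i)))"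
        unfolding X_def I0_def by (intro mult_left_mono add_left_mono Ho(2)) auto
      also have "\<dots> \<le> 2 powr p i * (((\<integral>x. \<bar>G x $ i\<bar> powr p i \<partial>lborel) + L powr p i * I0 powr (1 - lam i)) * (1 + X powr lam i))"
      proof (rule mult_left_mono)
        have "0 \<le> (\<integral>x. \<bar>G x $ i\<bar> powr p i \<partial>lborel) * X powr lam i" "0 \<le> L powr p i * I0 powr (1 - lam i)" by auto
        then show "(\<integral>x. \<bar>G x $ i\<bar> powr p i \<partial>lborel) + L powr p i * (X powr lam i * I0 powr (1 - lam i))
           \<le> ((\<integral>x. \<bar>G x $ i\<bar> powr p i \<partial>lborel) + L powr p i * I0 powr (1 - lam i)) * (1 + X powr lam i)"
          by (simp add: algebra_simps)
      qed simp
      finally show ?thesis by (simp add: A_def mult.assoc)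
    qed
    have "X powr (1 / q) \<le> sob_const * (\<Prod>i\<in>UNIV. (\<integral>x. \<bar>V M x $ i\<bar> powr p i \<partial>lborel) powr (1 / (N * p i)))"
      unfolding X_def by (rule S(2))
    also have "\<dots> \<le> sob_const * (\<Prod>i\<in>UNIV. (A i * (1 + X powr lam i)) powr (1 / (N * p i)))"
      using E p_pos dim by (intro mult_left_mono prod_mono conjI powr_mono2 sob_const_nonneg) (auto simp: less_imp_le)
    finally show "(\<integral>x. \<bar>\<zeta> x * T M x\<bar> powr q \<partial>lborel) \<le> Q"
      unfolding Q_def X_def[symmetric] by (intro bound_of_sublinear_sobolev[OF lam_def A X])
  qed
  have "integrable lborel (\<lambda>x. \<bar>\<zeta> x * max 0 (u x)\<bar> powr q)"
  proof (rule integrable_powr_liminf(1)[where f="\<lambda>n x. \<zeta> x * T (real n) x" and C=Q])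
    show "(\<lambda>x. \<zeta> x * T (real n) x) \<in> borel_measurable lborel" for n unfolding T_def by simp
    show "AE x in lborel. (\<lambda>n. \<zeta> x * T (real n) x) \<longlonglongrightarrow> \<zeta> x * max 0 (u x)"
    proof (rule AE_I2)
      fix x
      obtain m where m: "u x \<le> real m" using real_arch_simple by blast
      have "\<zeta> x * T (real n) x = \<zeta> x * max 0 (u x)" if "n \<ge> m" for n
      proof -
        have "u x - real n \<le> 0" using m that by (simp add: order_trans[OF m])
        then show ?thesis by (simp add: T_def max_def)
      qed
      then show "(\<lambda>n. \<zeta> x * T (real n) x) \<longlonglongrightarrow> \<zeta> x * max 0 (u x)"
        by (intro tendsto_eventually) (unfold eventually_sequentially, blast)
    qed
  qed (use bound q_pos in auto)
  then show ?thesis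
  proof (rule Bochner_Integration.integrable_bound)
    show "AE x in lborel. norm (indicator (ball x0 r) x * max 0 (u x) powr q) \<le> norm (\<bar>\<zeta> x * max 0 (u x)\<bar> powr q)"
      by (intro AE_I2) (auto simp: indicator_def \<zeta>(5))
    have "(\<lambda>x. indicator (ball x0 r) x * max 0 (u x) powr q) \<in> borel_measurable borel"
      by (intro borel_measurable_times borel_measurable_indicator powr_real_measurable borel_measurable_max
          borel_measurable_const weak_grad_on_borel(1)[OF wg]) auto
    then show "(\<lambda>x. indicator (ball x0 r) x * max 0 (u x) powr q) \<in> borel_measurable lborel" unfolding measurable_lborel2 .
  qed
qed

lemma local_Lq:
  fixes u :: "real^'n \<Rightarrow> real"
  assumes wg: "weak_grad_on (ball x0 R) u G" and G: "\<And>i. integrable lborel (\<lambda>x. \<bar>G x $ i\<bar> powr p i)"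
    and pq: "\<And>i. p i < q" and r: "0 < r" "r < R"
  shows "integrable lborel (\<lambda>x. indicator (ball x0 r) x * \<bar>u x\<bar> powr q)"
proof -
  have "integrable lborel (\<lambda>x. indicator (ball x0 r) x * max 0 (u x) powr q + indicator (ball x0 r) x * max 0 (- u x) powr q)"
    using local_Lq_pos_part[OF wg G pq r] local_Lq_pos_part[OF weak_grad_on_uminus[OF wg] _ pq r] G by auto
  moreover have "indicator (ball x0 r) x * \<bar>u x\<bar> powr q = indicator (ball x0 r) x * max 0 (u x) powr q + indicator (ball x0 r) x * max 0 (- u x) powr q" for x
    by (cases "u x \<ge> 0") (auto simp: max_def)
  ultimately show ?thesis by simp
qed

end

section \<open>The energy estimate\<close>

text \<open>
  Either \<open>b \<le> \<delta> s\<close>, and the product is below the first summand, or \<open>s < b / \<delta>\<close>, and it is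
  below the second.
\<close>

lemma Young_eps:
  fixes s b \<delta> p :: real
  assumes "0 \<le> s" "0 \<le> b" "0 < \<delta>" "1 < p"
  shows "s powr (p - 1) * b \<le> \<delta> * s powr p + \<delta> powr (1 - p) * b powr p"
proof (cases "b \<le> \<delta> * s")
  case True
  have "s powr (p - 1) * b \<le> s powr (p - 1) * (\<delta> * s)" using True by (rule mult_left_mono) simp
  also have "\<dots> = \<delta> * (s powr (p - 1) * s powr 1)" using assms by simp
  also have "\<dots> = \<delta> * s powr p" by (simp only: powr_add[symmetric]) simp
  finally show ?thesis by (simp add: add_increasing2)
next
  case False
  then have sb: "s \<le> b / \<delta>" using assms by (simp add: pos_le_divide_eq mult.commute)
  have "s powr (p - 1) * b \<le> (b / \<delta>) powr (p - 1) * b"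
    using assms sb by (intro mult_right_mono powr_mono2) auto
  also have "\<dots> = (1 / \<delta> powr (p - 1)) * (b powr (p - 1) * b powr 1)" using assms by (simp add: powr_divide)
  also have "\<dots> = \<delta> powr (1 - p) * b powr p"
    using powr_minus_divide[of \<delta> "p - 1"] by (simp only: powr_add[symmetric]) simp
  finally show ?thesis using assms by (simp add: add_increasing)
qed

lemma Young_eps_conj:
  fixes s c \<delta> p :: real
  assumes "0 \<le> s" "0 \<le> c" "0 < \<delta>" "1 < p"
  shows "s * c \<le> \<delta> * s powr p + \<delta> powr (- (1 / (p - 1))) * c powr conj_exp p"
proof (cases "c \<le> \<delta> * s powr (p - 1)")
  case True
  have "s * c \<le> s powr 1 * (\<delta> * s powr (p - 1))" using True assms by (auto intro: mult_left_mono)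
  also have "\<dots> = \<delta> * (s powr 1 * s powr (p - 1))" by (simp only: mult.left_commute)
  also have "\<dots> = \<delta> * s powr p" by (simp only: powr_add[symmetric]) simp
  finally show ?thesis by (simp add: add_increasing2)
next
  case False
  then have "s powr (p - 1) \<le> c / \<delta>" using assms by (simp add: pos_le_divide_eq mult.commute)
  then have "(s powr (p - 1)) powr (1 / (p - 1)) \<le> (c / \<delta>) powr (1 / (p - 1))"
    using assms by (intro powr_mono2) auto
  then have "s \<le> (c / \<delta>) powr (1 / (p - 1))" using assms by (simp add: powr_powr)
  then have "s * c \<le> (c / \<delta>) powr (1 / (p - 1)) * c" using assms by (intro mult_right_mono) auto
  also have "\<dots> = \<delta> powr (- (1 / (p - 1))) * (c powr (1 / (p - 1)) * c powr 1)"
    using assms by (simp add: powr_divide powr_minus_divide)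
  also have "\<dots> = \<delta> powr (- (1 / (p - 1))) * c powr (1 / (p - 1) + 1)"
    by (simp only: powr_add)
  also have "1 / (p - 1) + 1 = conj_exp p" using assms by (simp add: conj_exp_def field_simps)
  finally show ?thesis using assms by (simp add: add_increasing)
qed

lemma norm_mono_nonneg: "0 \<le> s \<Longrightarrow> s \<le> t \<Longrightarrow> norm s \<le> norm (t :: real)"
  by simp

lemma integrable_indicator_ball: "integrable lborel (indicator (ball x0 r) :: 'a::euclidean_space \<Rightarrow> real)"
  by (simp add: integrable_indicator_iff) (rule emeasure_lborel_ball_finite[unfolded infinity_ennreal_def])

lemma powr_le_one_plus_powr:
  fixes t :: real assumes "0 \<le> t" "0 < s" "s \<le> s'" shows "t powr s \<le> 1 + t powr s'"
proof (cases "t \<le> 1")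
  case True
  then have "t powr s \<le> 1" using assms by (intro powr_le1) auto
  then show ?thesis by (simp add: add_increasing2)
next
  case False
  then have "t powr s \<le> t powr s'" using assms by (intro powr_mono) auto
  then show ?thesis by simp
qed

text \<open>
  The equation on a ball in the form in which the iteration uses it. The principal flux
  \<open>a\<close> stands for \<open>A i x (\<nabla>u)\<close>, the flux \<open>e\<close> for \<open>B i x (u x) - |F i x|^(p i - 2) (F i x)\<close>,
  and \<open>g\<close> collects the powers of \<open>b i\<close> and \<open>F i\<close> that bound \<open>e\<close>. All functions are Borel
  and all inequalities hold at every point. The equation itself is added in a second step,
  since the integrability of the flux is already needed to bring the weak formulation into
  this form.
\<close>

locale aniso_data = aniso_exponents p N for p :: "'n::finite \<Rightarrow> real" and N +
  fixes x0 :: "real^'n" and R \<alpha> \<beta> \<mu> :: real and u :: "real^'n \<Rightarrow> real" and G :: "real^'n \<Rightarrow> real^'n"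
    and a e :: "'n \<Rightarrow> real^'n \<Rightarrow> real" and g :: "real^'n \<Rightarrow> real"
  assumes p_less_q: "\<And>i. p i < q" and R: "0 < R" and \<alpha>: "0 < \<alpha>" and \<beta>: "0 \<le> \<beta>" and \<mu>: "N / P < \<mu>"
    and wg: "weak_grad_on (ball x0 R) u G"
    and u_q: "integrable lborel (\<lambda>x. \<bar>u x\<bar> powr q)"
    and G_p: "\<And>i. integrable lborel (\<lambda>x. \<bar>G x $ i\<bar> powr p i)"
    and a_borel[measurable]: "\<And>i. a i \<in> borel_measurable borel"
    and e_borel[measurable]: "\<And>i. e i \<in> borel_measurable borel"
    and g_borel[measurable]: "g \<in> borel_measurable borel"
    and g_nonneg: "\<And>x. 0 \<le> g x" and g_supp: "\<And>x. x \<notin> ball x0 R \<Longrightarrow> g x = 0"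
    and g_\<mu>: "integrable lborel (\<lambda>x. g x powr \<mu>)"
    and a_bound: "\<And>i x. \<bar>a i x\<bar> \<le> \<beta> * \<bar>G x $ i\<bar> powr (p i - 1)"
    and coercive: "\<And>x. \<alpha> * (\<Sum>i\<in>UNIV. \<bar>G x $ i\<bar> powr p i) \<le> (\<Sum>i\<in>UNIV. a i x * G x $ i)"
    and e_bound: "\<And>i x. \<bar>e i x\<bar> powr conj_exp (p i) \<le> g x * (1 + \<bar>u x\<bar> powr P)"
begin

lemma u_borel[measurable]: "u \<in> borel_measurable borel"
  and G_borel[measurable]: "(\<lambda>x. G x $ i) \<in> borel_measurable borel"
  using weak_grad_on_borel[OF wg] by auto

text \<open>
  As \<open>1 - P / N = P / q\<close>, the assumption \<open>N / P < \<mu>\<close> is equivalent to the fact \<open>gain\<close>,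
  which makes the iteration superlinear.
\<close>

lemma mu_gt1: "1 < \<mu>" and inv_mu: "0 < 1 / \<mu>" "1 / \<mu> < 1" and gain: "1 < (1 - 1 / \<mu>) * (q / P)"
proof -
  have "1 < N / P" using mean_less_dim P_gt1 by (simp add: less_divide_eq)
  then show mu: "1 < \<mu>" using \<mu> by simp
  then show "0 < 1 / \<mu>" "1 / \<mu> < 1" by auto
  have "1 / \<mu> < P / N" using \<mu> mu P_gt1 dim by (simp add: field_simps)
  then have "1 - P / N < 1 - 1 / \<mu>" by simp
  moreover have "1 - P / N = P * (1 / q)" using P_gt1 by (simp add: inv_q right_diff_distrib)
  ultimately have "P / q < 1 - 1 / \<mu>" by simp
  then show "1 < (1 - 1 / \<mu>) * (q / P)" using P_gt1 q_pos by (simp add: field_simps)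
qed

lemma conj_p: "1 < conj_exp (p i)" "conj_exp (p i) * (1 - 1 / p i) = 1" "(p i - 1) * conj_exp (p i) = p i"
  using p_gt1[of i] by (auto simp: conj_exp_def field_simps)

definition g_norm :: real where "g_norm = (\<integral>x. g x powr \<mu> \<partial>lborel) powr (1 / \<mu>)"

lemma g_Hoelder:
  assumes [measurable]: "f \<in> borel_measurable borel" and f: "\<And>x. 0 \<le> f x"
    and int: "integrable lborel (\<lambda>x. f x powr (1 / (1 - 1 / \<mu>)))"
  shows "integrable lborel (\<lambda>x. g x * f x)"
    and "(\<integral>x. g x * f x \<partial>lborel) \<le> g_norm * (\<integral>x. f x powr (1 / (1 - 1 / \<mu>)) \<partial>lborel) powr (1 - 1 / \<mu>)"
proof -
  have eq: "g x * f x = (g x powr \<mu>) powr (1 / \<mu>) * (f x powr (1 / (1 - 1 / \<mu>))) powr (1 - 1 / \<mu>)" for x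
  proof -
    have "(g x powr \<mu>) powr (1 / \<mu>) = g x" using mu_gt1 g_nonneg by (simp add: powr_powr)
    moreover have "(f x powr (1 / (1 - 1 / \<mu>))) powr (1 - 1 / \<mu>) = f x"
      unfolding powr_powr using inv_mu f by simp
    ultimately show ?thesis by simp
  qed
  note H = Hoelder_geometric[OF g_\<mu> _ int _ inv_mu]
  show "integrable lborel (\<lambda>x. g x * f x)" unfolding eq by (rule H(1)) auto
  show "(\<integral>x. g x * f x \<partial>lborel) \<le> g_norm * (\<integral>x. f x powr (1 / (1 - 1 / \<mu>)) \<partial>lborel) powr (1 - 1 / \<mu>)"
    unfolding eq g_norm_def by (rule H(2)) auto
qed

lemma P_mu_less_q: "P * (1 / (1 - 1 / \<mu>)) < q"
  using gain inv_mu P_gt1 by (simp add: field_simps)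

lemma lower_integrable: "integrable lborel (\<lambda>x. g x * (1 + \<bar>u x\<bar> powr P))"
proof -
  let ?f = "\<lambda>x. indicator (ball x0 R) x * (1 + \<bar>u x\<bar> powr P)"
  have f_borel: "?f \<in> borel_measurable borel"
    by (intro borel_measurable_times borel_measurable_indicator borel_measurable_add borel_measurable_const
        measurable_abs_powr u_borel) auto
  have "integrable lborel (\<lambda>x. ?f x powr (1 / (1 - 1 / \<mu>)))"
  proof (rule Bochner_Integration.integrable_bound)
    show "integrable lborel (\<lambda>x. 2 powr (1 / (1 - 1 / \<mu>)) * (2 * indicator (ball x0 R) x + \<bar>u x\<bar> powr q))"
      by (intro integrable_mult_right Bochner_Integration.integrable_add u_q integrable_indicator_ball)
    have le: "?f x powr (1 / (1 - 1 / \<mu>)) \<le> 2 powr (1 / (1 - 1 / \<mu>)) * (2 * indicator (ball x0 R) x + \<bar>u x\<bar> powr q)" for x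
    proof (cases "x \<in> ball x0 R")
      case True
      have s: "0 < 1 / (1 - 1 / \<mu>)" using inv_mu by simp
      have "?f x powr (1 / (1 - 1 / \<mu>)) \<le> 2 powr (1 / (1 - 1 / \<mu>)) * (1 powr (1 / (1 - 1 / \<mu>)) + (\<bar>u x\<bar> powr P) powr (1 / (1 - 1 / \<mu>)))"
        using True powr_add_le[of 1 "\<bar>u x\<bar> powr P" "1 / (1 - 1 / \<mu>)"] s by simp
      also have "(\<bar>u x\<bar> powr P) powr (1 / (1 - 1 / \<mu>)) \<le> 1 + \<bar>u x\<bar> powr q"
        unfolding powr_powr using P_mu_less_q P_gt1 s by (intro powr_le_one_plus_powr mult_pos_pos) auto
      finally show ?thesis using True by simp
    qed simp
    show "AE x in lborel. norm (?f x powr (1 / (1 - 1 / \<mu>))) \<le> norm (2 powr (1 / (1 - 1 / \<mu>)) * (2 * indicator (ball x0 R) x + \<bar>u x\<bar> powr q))"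
      by (intro AE_I2 norm_mono_nonneg powr_ge_zero le)
    have "(\<lambda>x. ?f x powr (1 / (1 - 1 / \<mu>))) \<in> borel_measurable borel"
      by (intro powr_real_measurable f_borel borel_measurable_const)
    then show "(\<lambda>x. ?f x powr (1 / (1 - 1 / \<mu>))) \<in> borel_measurable lborel" unfolding measurable_lborel2 .
  qed
  moreover have "0 \<le> ?f x" for x by (simp add: indicator_def)
  ultimately have "integrable lborel (\<lambda>x. g x * ?f x)"
    using g_Hoelder(1)[OF f_borel] by blast
  moreover have "g x * ?f x = g x * (1 + \<bar>u x\<bar> powr P)" for x
    using g_supp[of x] by (cases "x \<in> ball x0 R") auto
  ultimately show ?thesis by simp
qed

lemma flux_integrable: "integrable lborel (\<lambda>x. \<bar>a i x + e i x\<bar> powr conj_exp (p i))"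
proof (rule Bochner_Integration.integrable_bound)
  let ?c = "conj_exp (p i)"
  show "integrable lborel (\<lambda>x. 2 powr ?c * (\<beta> powr ?c * \<bar>G x $ i\<bar> powr p i + g x * (1 + \<bar>u x\<bar> powr P)))"
    using G_p lower_integrable by auto
  have "\<bar>a i x + e i x\<bar> powr ?c \<le> 2 powr ?c * (\<beta> powr ?c * \<bar>G x $ i\<bar> powr p i + g x * (1 + \<bar>u x\<bar> powr P))" for x
  proof -
    have "\<bar>a i x + e i x\<bar> powr ?c \<le> (\<bar>a i x\<bar> + \<bar>e i x\<bar>) powr ?c"
      using conj_p(1)[of i] by (intro powr_mono2) auto
    also have "\<dots> \<le> 2 powr ?c * (\<bar>a i x\<bar> powr ?c + \<bar>e i x\<bar> powr ?c)"
      using conj_p(1)[of i] by (intro powr_add_le) auto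
    also have "\<dots> \<le> 2 powr ?c * ((\<beta> * \<bar>G x $ i\<bar> powr (p i - 1)) powr ?c + g x * (1 + \<bar>u x\<bar> powr P))"
      using conj_p(1)[of i] a_bound[of i x] by (intro mult_left_mono add_mono e_bound powr_mono2) auto
    also have "(\<beta> * \<bar>G x $ i\<bar> powr (p i - 1)) powr ?c = \<beta> powr ?c * \<bar>G x $ i\<bar> powr p i"
      using \<beta> by (simp add: powr_mult powr_powr conj_p(3))
    finally show ?thesis .
  qed
  then show "AE x in lborel. norm (\<bar>a i x + e i x\<bar> powr ?c) \<le> norm (2 powr ?c * (\<beta> powr ?c * \<bar>G x $ i\<bar> powr p i + g x * (1 + \<bar>u x\<bar> powr P)))"
    by (intro AE_I2) (smt (verit) powr_ge_zero real_norm_def)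
qed measurable

end

locale aniso_equation = aniso_data p N x0 R \<alpha> \<beta> \<mu> u G a e g
  for p :: "'n::finite \<Rightarrow> real" and N and x0 :: "real^'n" and R \<alpha> \<beta> \<mu> :: real
    and u :: "real^'n \<Rightarrow> real" and G :: "real^'n \<Rightarrow> real^'n"
    and a e :: "'n \<Rightarrow> real^'n \<Rightarrow> real" and g :: "real^'n \<Rightarrow> real" +
  assumes equation: "\<And>\<phi>. \<phi> \<in> test_funs (ball x0 R) \<Longrightarrow> (\<Sum>i\<in>UNIV. \<integral>x. partial_deriv i \<phi> x * (a i x + e i x) \<partial>lborel) = 0"
begin

definition young_const :: real
  where "young_const = (\<Sum>i\<in>UNIV. (\<alpha> / 4) powr (1 - p i) * \<beta> powr p i + 1) + (\<Sum>i\<in>UNIV. (\<alpha> / 4) powr (- (1 / (p i - 1))) + 1)"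

lemma young_const:
  "(\<alpha> / 4) powr (1 - p i) * \<beta> powr p i + 1 \<le> young_const"
  "(\<Sum>i\<in>UNIV. (\<alpha> / 4) powr (- (1 / (p i - 1))) + 1) \<le> young_const" "0 \<le> young_const"
proof -
  let ?c = "\<lambda>i. (\<alpha> / 4) powr (1 - p i) * \<beta> powr p i + 1" and ?d = "\<lambda>i. (\<alpha> / 4) powr (- (1 / (p i - 1))) + 1"
  have "?c i \<le> sum ?c UNIV" by (rule member_le_sum) (auto intro!: add_nonneg_nonneg)
  moreover have "0 \<le> sum ?c UNIV" "0 \<le> sum ?d UNIV" by (auto intro!: sum_nonneg add_nonneg_nonneg)
  ultimately show "?c i \<le> young_const" "sum ?d UNIV \<le> young_const" "0 \<le> young_const"
    by (auto simp: young_const_def)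
qed

text \<open>
  The integrand of the equation tested with \<open>\<zeta> (u - k)\<^sup>+\<close>, where \<open>z\<close> and \<open>dz\<close> are the
  values of \<open>\<zeta>\<close> and its partial derivatives. Coercivity bounds the term \<open>z G a\<close> from
  below. Of the remaining terms, \<open>dz w a\<close> and \<open>z G e\<close> each cost \<open>\<alpha> / 4\<close> of the energy by
  Young's inequality, and \<open>dz w e\<close> does not involve the gradient. The bound on \<open>dz\<close>
  matches the weights: \<open>z^(1 - 1 / p i)\<close> is the \<open>(p i - 1)\<close>-th power of \<open>z^(1 / p i)\<close>.
\<close>

lemma flux_pointwise:
  fixes z L k :: real and dz :: "'n \<Rightarrow> real" and x :: "real^'n"
  assumes z: "0 \<le> z" "z \<le> 1" and dz: "\<And>i. \<bar>dz i\<bar> \<le> L * z powr (1 - 1 / p i)" and L: "0 \<le> L"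
  defines "w \<equiv> max 0 (u x - k)"
  shows "\<alpha> / 2 * (\<Sum>i\<in>UNIV. z * (if k < u x then \<bar>G x $ i\<bar> powr p i else 0)) \<le>
    (\<Sum>i\<in>UNIV. (z * (if k < u x then G x $ i else 0) + dz i * w) * (a i x + e i x))
    + young_const * ((\<Sum>i\<in>UNIV. (L * w) powr p i) + (if k < u x then g x * (1 + \<bar>u x\<bar> powr P) else 0))"
proof (cases "k < u x")
  case False
  then have "w = 0" by (simp add: w_def)
  then show ?thesis using False by simp
next
  case True
  let ?\<delta> = "\<alpha> / 4"
  have \<delta>: "?\<delta> > 0" using \<alpha> by simp
  have w: "w \<ge> 0" by (simp add: w_def)
  define h where "h = g x * (1 + \<bar>u x\<bar> powr P)"
  have h: "0 \<le> h" unfolding h_def by (intro mult_nonneg_nonneg g_nonneg add_nonneg_nonneg) auto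
  let ?c1 = "\<lambda>i. ?\<delta> powr (1 - p i) * \<beta> powr p i + 1" and ?c2 = "\<lambda>i. ?\<delta> powr (- (1 / (p i - 1))) + 1"
  have flux_le: "- ((dz i * w) * (a i x + e i x) + z * G x $ i * e i x) \<le> \<alpha> / 2 * (z * \<bar>G x $ i\<bar> powr p i) + ?c1 i * (L * w) powr p i + ?c2 i * h" for i
  proof -
    have zp: "(z powr (1 / p i)) powr p i = z" "(z powr (1 - 1 / p i)) powr conj_exp (p i) = z"
      using z p_pos[of i] conj_p(2)[of i] by (simp_all add: powr_powr mult.commute)
    have t2: "\<bar>dz i * w * a i x\<bar> \<le> ?\<delta> * (z * \<bar>G x $ i\<bar> powr p i) + ?\<delta> powr (1 - p i) * \<beta> powr p i * (L * w) powr p i"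
    proof -
      let ?s = "z powr (1 / p i) * \<bar>G x $ i\<bar>" and ?b = "\<beta> * (L * w)"
      have "\<bar>dz i * w * a i x\<bar> \<le> (L * z powr (1 - 1 / p i)) * w * (\<beta> * \<bar>G x $ i\<bar> powr (p i - 1))"
        unfolding abs_mult using w L \<beta> dz[of i] a_bound[of i x] by (intro mult_mono mult_nonneg_nonneg) auto
      also have "\<dots> = ?s powr (p i - 1) * ?b"
      proof -
        have "?s powr (p i - 1) = z powr (1 - 1 / p i) * \<bar>G x $ i\<bar> powr (p i - 1)"
          using p_pos[of i] by (simp add: powr_mult powr_powr diff_divide_distrib)
        then show ?thesis by (simp add: mult_ac)
      qed
      also have "\<dots> \<le> ?\<delta> * ?s powr p i + ?\<delta> powr (1 - p i) * ?b powr p i"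
        using \<delta> \<beta> L w p_gt1 by (intro Young_eps) auto
      also have "?s powr p i = z * \<bar>G x $ i\<bar> powr p i" by (simp add: powr_mult zp)
      also have "?b powr p i = \<beta> powr p i * (L * w) powr p i" using \<beta> L w by (simp add: powr_mult)
      finally show ?thesis by (simp add: mult.assoc)
    qed
    have t3: "\<bar>z * G x $ i * e i x\<bar> \<le> ?\<delta> * (z * \<bar>G x $ i\<bar> powr p i) + ?\<delta> powr (- (1 / (p i - 1))) * h"
    proof -
      have "\<bar>z * G x $ i * e i x\<bar> = z * (\<bar>G x $ i\<bar> * \<bar>e i x\<bar>)" using z by (simp add: abs_mult)
      also have "\<dots> \<le> z * (?\<delta> * \<bar>G x $ i\<bar> powr p i + ?\<delta> powr (- (1 / (p i - 1))) * \<bar>e i x\<bar> powr conj_exp (p i))"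
        using \<delta> z p_gt1 by (intro mult_left_mono Young_eps_conj) auto
      also have "\<dots> = ?\<delta> * (z * \<bar>G x $ i\<bar> powr p i) + z * (?\<delta> powr (- (1 / (p i - 1))) * \<bar>e i x\<bar> powr conj_exp (p i))"
        by (simp add: algebra_simps)
      also have "\<dots> \<le> ?\<delta> * (z * \<bar>G x $ i\<bar> powr p i) + 1 * (?\<delta> powr (- (1 / (p i - 1))) * h)"
        unfolding h_def using z h by (intro add_left_mono mult_mono e_bound) auto
      finally show ?thesis by simp
    qed
    have t4: "\<bar>dz i * w * e i x\<bar> \<le> (L * w) powr p i + h"
    proof -
      have "\<bar>dz i * w * e i x\<bar> \<le> (L * z powr (1 - 1 / p i)) * w * \<bar>e i x\<bar>"
        unfolding abs_mult using w L dz[of i] by (intro mult_mono mult_nonneg_nonneg) auto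
      also have "\<dots> = (L * w) * (z powr (1 - 1 / p i) * \<bar>e i x\<bar>)" by (simp add: mult_ac)
      also have "\<dots> \<le> 1 * (L * w) powr p i + 1 powr (- (1 / (p i - 1))) * (z powr (1 - 1 / p i) * \<bar>e i x\<bar>) powr conj_exp (p i)"
        using L w z p_gt1 by (intro Young_eps_conj) auto
      also have "\<dots> = (L * w) powr p i + z * \<bar>e i x\<bar> powr conj_exp (p i)" by (simp add: powr_mult zp)
      also have "\<dots> \<le> (L * w) powr p i + 1 * h"
        unfolding h_def using z by (intro add_left_mono mult_mono e_bound) auto
      finally show ?thesis by simp
    qed
    have "- ((dz i * w) * (a i x + e i x) + z * G x $ i * e i x) = - (dz i * w * a i x) - dz i * w * e i x - z * G x $ i * e i x"
      by (simp add: algebra_simps)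
    also have "\<dots> \<le> \<bar>dz i * w * a i x\<bar> + \<bar>dz i * w * e i x\<bar> + \<bar>z * G x $ i * e i x\<bar>" by linarith
    also have "\<dots> \<le> (?\<delta> * (z * \<bar>G x $ i\<bar> powr p i) + ?\<delta> powr (1 - p i) * \<beta> powr p i * (L * w) powr p i) + ((L * w) powr p i + h)
       + (?\<delta> * (z * \<bar>G x $ i\<bar> powr p i) + ?\<delta> powr (- (1 / (p i - 1))) * h)"
      by (intro add_mono t2 t3 t4)
    also have "\<dots> = \<alpha> / 2 * (z * \<bar>G x $ i\<bar> powr p i) + ?c1 i * (L * w) powr p i + ?c2 i * h"
      by (simp add: algebra_simps)
    finally show ?thesis .
  qed
  have "\<alpha> * (\<Sum>i\<in>UNIV. z * \<bar>G x $ i\<bar> powr p i) \<le> (\<Sum>i\<in>UNIV. z * G x $ i * a i x)"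
    using mult_left_mono[OF coercive[of x] z(1)] by (simp add: sum_distrib_left mult_ac)
  also have "\<dots> = (\<Sum>i\<in>UNIV. (z * G x $ i + dz i * w) * (a i x + e i x)) + (\<Sum>i\<in>UNIV. - ((dz i * w) * (a i x + e i x) + z * G x $ i * e i x))"
    by (simp add: sum.distrib[symmetric] algebra_simps)
  also have "\<dots> \<le> (\<Sum>i\<in>UNIV. (z * G x $ i + dz i * w) * (a i x + e i x))
     + (\<Sum>i\<in>UNIV. \<alpha> / 2 * (z * \<bar>G x $ i\<bar> powr p i) + ?c1 i * (L * w) powr p i + ?c2 i * h)"
    by (intro add_left_mono sum_mono flux_le)
  also have "\<dots> = (\<Sum>i\<in>UNIV. (z * G x $ i + dz i * w) * (a i x + e i x))
     + \<alpha> / 2 * (\<Sum>i\<in>UNIV. z * \<bar>G x $ i\<bar> powr p i) + (\<Sum>i\<in>UNIV. ?c1 i * (L * w) powr p i) + (\<Sum>i\<in>UNIV. ?c2 i) * h"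
    by (subst sum.distrib, subst sum.distrib) (simp only: sum_distrib_left sum_distrib_right add.assoc)
  also have "\<dots> \<le> (\<Sum>i\<in>UNIV. (z * G x $ i + dz i * w) * (a i x + e i x))
     + \<alpha> / 2 * (\<Sum>i\<in>UNIV. z * \<bar>G x $ i\<bar> powr p i) + (\<Sum>i\<in>UNIV. young_const * (L * w) powr p i) + young_const * h"
    using h by (intro add_mono order_refl sum_mono mult_right_mono young_const) auto
  finally have "\<alpha> * (\<Sum>i\<in>UNIV. z * \<bar>G x $ i\<bar> powr p i) \<le> (\<Sum>i\<in>UNIV. (z * G x $ i + dz i * w) * (a i x + e i x))
     + \<alpha> / 2 * (\<Sum>i\<in>UNIV. z * \<bar>G x $ i\<bar> powr p i) + young_const * (\<Sum>i\<in>UNIV. (L * w) powr p i) + young_const * h"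
    by (simp add: sum_distrib_left)
  then show ?thesis using True by (simp add: h_def distrib_left)
qed

definition data_term :: "real \<Rightarrow> real \<Rightarrow> real \<Rightarrow> real"
  where "data_term \<rho> L k = (\<integral>x. indicator (ball x0 \<rho>) x * ((\<Sum>i\<in>UNIV. (L * max 0 (u x - k)) powr p i)
    + (if k < u x then g x * (1 + \<bar>u x\<bar> powr P) else 0)) \<partial>lborel)"

definition energy_const :: real
  where "energy_const = (\<Sum>i\<in>UNIV. 2 powr p i) * (2 * young_const / \<alpha> + 1)"

lemma energy_const_pos: "0 < energy_const"
  unfolding energy_const_def
  using young_const(3) \<alpha> by (intro mult_pos_pos sum_pos add_nonneg_pos divide_nonneg_pos) auto

lemma pos_part_powr_integrable:
  assumes "0 < s" "s \<le> q" "0 \<le> k"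
  shows "integrable lborel (\<lambda>x. indicator (ball x0 \<rho>) x * max 0 (u x - k) powr s)"
proof (rule Bochner_Integration.integrable_bound)
  show "integrable lborel (\<lambda>x. indicator (ball x0 \<rho>) x + \<bar>u x\<bar> powr q)"
    by (intro Bochner_Integration.integrable_add u_q integrable_indicator_ball)
  have "max 0 (u x - k) powr s \<le> 1 + \<bar>u x\<bar> powr q" for x
  proof -
    have "max 0 (u x - k) powr s \<le> \<bar>u x\<bar> powr s" using assms by (intro powr_mono2) auto
    also have "\<dots> \<le> 1 + \<bar>u x\<bar> powr q" using assms by (intro powr_le_one_plus_powr) auto
    finally show ?thesis .
  qed
  then show "AE x in lborel. norm (indicator (ball x0 \<rho>) x * max 0 (u x - k) powr s) \<le> norm (indicator (ball x0 \<rho>) x + \<bar>u x\<bar> powr q)"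
    by (intro AE_I2) (auto simp: indicator_def)
  have "(\<lambda>x. indicator (ball x0 \<rho>) x * max 0 (u x - k) powr s) \<in> borel_measurable borel"
    by (intro borel_measurable_times borel_measurable_indicator powr_real_measurable borel_measurable_max
        borel_measurable_diff borel_measurable_const u_borel) auto
  then show "(\<lambda>x. indicator (ball x0 \<rho>) x * max 0 (u x - k) powr s) \<in> borel_measurable lborel" unfolding measurable_lborel2 .
qed

text \<open>
  Integrating the pointwise estimate gives Caccioppoli's inequality, because the tested
  equation has value \<open>0\<close>. Sobolev's inequality for \<open>\<zeta> (u - k)\<^sup>+\<close> then has all its factors
  bounded by multiples of the same quantity \<open>S\<close>, and the exponents \<open>1 / (N p\<^sub>i)\<close> add up to
  \<open>1 / P\<close>.
\<close>

lemma energy_estimate: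
  assumes \<zeta>: "\<zeta> \<in> test_funs (ball x0 \<rho>)" "\<And>x. 0 \<le> \<zeta> x" "\<And>x. \<zeta> x \<le> 1"
    and d\<zeta>: "\<And>i x. \<bar>partial_deriv i \<zeta> x\<bar> \<le> L * \<zeta> x powr (1 - 1 / p i)" and L: "0 \<le> L"
    and \<rho>: "0 < \<rho>" "\<rho> < R" and k: "0 \<le> k"
  shows "(\<integral>x. \<bar>\<zeta> x * max 0 (u x - k)\<bar> powr q \<partial>lborel) \<le> (sob_const * energy_const powr (1 / P)) powr q * data_term \<rho> L k powr (q / P)"
    and "integrable lborel (\<lambda>x. \<bar>\<zeta> x * max 0 (u x - k)\<bar> powr q)"
proof -
  let ?w = "\<lambda>x. max 0 (u x - k)" and ?B = "indicator (ball x0 \<rho>) :: real^'n \<Rightarrow> real"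
  let ?V = "\<lambda>x. (\<chi> i. \<zeta> x * (if k < u x then G x $ i else 0) + partial_deriv i \<zeta> x * ?w x) :: real^'n"
  let ?D = "\<lambda>x. (\<Sum>i\<in>UNIV. (L * ?w x) powr p i) + (if k < u x then g x * (1 + \<bar>u x\<bar> powr P) else 0)"
  have [measurable]: "\<zeta> \<in> borel_measurable borel" "\<And>i. partial_deriv i \<zeta> \<in> borel_measurable borel"
    using test_funs_borel[OF \<zeta>(1)] test_funs_borel[OF test_funs_pd[OF \<zeta>(1)]] by auto
  from weak_grad_cutoff_pos_part[OF wg \<zeta>(1) \<rho>]
  obtain K where K: "compact K" "K \<subseteq> ball x0 \<rho>" "\<forall>k\<ge>0. weak_grad_cpt K (\<lambda>x. \<zeta> x * max 0 (u x - k))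
      (\<lambda>x. \<chi> i. \<zeta> x * (if k < u x then G x $ i else 0) + partial_deriv i \<zeta> x * max 0 (u x - k))"
    by blast
  have wk: "weak_grad_cpt K (\<lambda>x. \<zeta> x * ?w x) ?V" using K(3) k by blast
  have \<zeta>0: "\<zeta> x = 0" "partial_deriv i \<zeta> x = 0" if "x \<notin> ball x0 \<rho>" for x i
    using \<zeta>(1) that by - (erule test_funsE, blast)+
  have iw: "integrable lborel (\<lambda>x. ?B x * (L * ?w x) powr p i)" for i
  proof -
    have "integrable lborel (\<lambda>x. L powr p i * (?B x * ?w x powr p i))"
      using pos_part_powr_integrable[OF p_pos less_imp_le[OF p_less_q] k] by (rule integrable_mult_right)
    then show ?thesis using L by (simp add: powr_mult mult_ac)
  qed
  have ig: "integrable lborel (\<lambda>x. ?B x * (if k < u x then g x * (1 + \<bar>u x\<bar> powr P) else 0))"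
    by (rule Bochner_Integration.integrable_bound[OF lower_integrable])
      (auto simp: indicator_def abs_mult)
  have iD: "integrable lborel (\<lambda>x. ?B x * ?D x)"
  proof -
    have "?B x * ?D x = (\<Sum>i\<in>UNIV. ?B x * (L * ?w x) powr p i) + ?B x * (if k < u x then g x * (1 + \<bar>u x\<bar> powr P) else 0)" for x
      by (simp only: distrib_left[of "?B x"] sum_distrib_left)
    then show ?thesis using iw ig by (simp only:) (intro Bochner_Integration.integrable_add Bochner_Integration.integrable_sum)
  qed
  have iG: "integrable lborel (\<lambda>x. \<zeta> x * (if k < u x then \<bar>G x $ i\<bar> powr p i else 0))" for i
  proof (rule Bochner_Integration.integrable_bound[OF G_p[of i]])
    have "\<zeta> x * (if k < u x then \<bar>G x $ i\<bar> powr p i else 0) \<le> 1 * \<bar>G x $ i\<bar> powr p i" for x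
      using \<zeta> by (intro mult_mono) auto
    then show "AE x in lborel. norm (\<zeta> x * (if k < u x then \<bar>G x $ i\<bar> powr p i else 0)) \<le> norm (\<bar>G x $ i\<bar> powr p i)"
      using \<zeta>(2) by (intro AE_I2) (auto simp: abs_mult)
  qed measurable
  have Vp: "\<bar>?V x $ i\<bar> powr p i \<le> 2 powr p i * (\<zeta> x * (if k < u x then \<bar>G x $ i\<bar> powr p i else 0) + ?B x * (L * ?w x) powr p i)" for x i
  proof (cases "x \<in> ball x0 \<rho>")
    case True
    have "\<bar>?V x $ i\<bar> powr p i \<le> (\<bar>\<zeta> x * (if k < u x then G x $ i else 0)\<bar> + \<bar>partial_deriv i \<zeta> x * ?w x\<bar>) powr p i"
      using p_pos[of i] by (intro powr_mono2) auto
    also have "\<dots> \<le> 2 powr p i * (\<bar>\<zeta> x * (if k < u x then G x $ i else 0)\<bar> powr p i + \<bar>partial_deriv i \<zeta> x * ?w x\<bar> powr p i)"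
      using p_pos[of i] by (intro powr_add_le) auto
    also have "\<dots> \<le> 2 powr p i * (\<zeta> x * (if k < u x then \<bar>G x $ i\<bar> powr p i else 0) + (L * ?w x) powr p i)"
    proof (intro mult_left_mono add_mono)
      have "\<zeta> x powr p i \<le> \<zeta> x powr 1" using \<zeta>(2,3)[of x] p_gt1[of i] by (intro powr_mono') auto
      then have "\<zeta> x powr p i * \<bar>G x $ i\<bar> powr p i \<le> \<zeta> x * \<bar>G x $ i\<bar> powr p i"
        using \<zeta>(2)[of x] by (intro mult_right_mono) auto
      then show "\<bar>\<zeta> x * (if k < u x then G x $ i else 0)\<bar> powr p i \<le> \<zeta> x * (if k < u x then \<bar>G x $ i\<bar> powr p i else 0)"
        using \<zeta>(2)[of x] by (simp add: abs_mult powr_mult)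
      have "\<zeta> x powr (1 - 1 / p i) \<le> 1" using \<zeta>(2,3)[of x] inv_p[of i] by (intro powr_le1) auto
      then have "\<bar>partial_deriv i \<zeta> x\<bar> \<le> L" using d\<zeta>[of i x] mult_left_mono[OF _ L, of "\<zeta> x powr (1 - 1 / p i)" 1] by simp
      then show "\<bar>partial_deriv i \<zeta> x * ?w x\<bar> powr p i \<le> (L * ?w x) powr p i"
        using p_pos[of i] unfolding abs_mult by (intro powr_mono2 mult_mono) auto
    qed auto
    finally show ?thesis using True by simp
  next
    case False
    then show ?thesis using \<zeta>0[OF False] by simp
  qed
  have Vint: "integrable lborel (\<lambda>x. \<bar>?V x $ i\<bar> powr p i)" for i
  proof (rule Bochner_Integration.integrable_bound)
    show "integrable lborel (\<lambda>x. 2 powr p i * (\<zeta> x * (if k < u x then \<bar>G x $ i\<bar> powr p i else 0) + ?B x * (L * ?w x) powr p i))"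
      using iG iw by auto
    show "AE x in lborel. norm (\<bar>?V x $ i\<bar> powr p i) \<le> norm (2 powr p i * (\<zeta> x * (if k < u x then \<bar>G x $ i\<bar> powr p i else 0) + ?B x * (L * ?w x) powr p i))"
      using Vp by (intro AE_I2) (smt (verit) powr_ge_zero real_norm_def)
  qed simp
  have flux: "(\<Sum>i\<in>UNIV. \<integral>x. ?V x $ i * (a i x + e i x) \<partial>lborel) = 0"
    using K(2) \<rho>(2)
    by (intro weak_equation_extends[OF p_gt1 _ flux_integrable equation open_ball[of x0 R] _ wk Vint]) auto
  have iF: "integrable lborel (\<lambda>x. ?V x $ i * (a i x + e i x))" for i
    by (rule Hoelder_conj(1)[OF p_gt1 _ _ Vint flux_integrable]) simp_all
  define S where "S = data_term \<rho> L k"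
  have S: "S = (\<integral>x. ?B x * ?D x \<partial>lborel)" by (simp add: S_def data_term_def)
  have D0: "0 \<le> ?D x" for x using g_nonneg[of x] by (intro add_nonneg_nonneg sum_nonneg) auto
  have S0: "0 \<le> S" unfolding S using D0 by (intro integral_nonneg_AE AE_I2 mult_nonneg_nonneg) auto
  have cacc: "(\<integral>x. \<zeta> x * (if k < u x then \<bar>G x $ i\<bar> powr p i else 0) \<partial>lborel) \<le> 2 * young_const / \<alpha> * S" for i
  proof -
    let ?E = "\<lambda>x. \<Sum>i\<in>UNIV. \<zeta> x * (if k < u x then \<bar>G x $ i\<bar> powr p i else 0)"
    have iE: "integrable lborel ?E" by (intro Bochner_Integration.integrable_sum iG)
    have "\<alpha> / 2 * (\<integral>x. ?E x \<partial>lborel) = (\<integral>x. \<alpha> / 2 * ?E x \<partial>lborel)" by simp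
    also have "\<dots> \<le> (\<integral>x. (\<Sum>i\<in>UNIV. ?V x $ i * (a i x + e i x)) + young_const * (?B x * ?D x) \<partial>lborel)"
    proof (rule integral_mono)
      show "integrable lborel (\<lambda>x. \<alpha> / 2 * ?E x)" using iE by (rule integrable_mult_right)
      show "integrable lborel (\<lambda>x. (\<Sum>i\<in>UNIV. ?V x $ i * (a i x + e i x)) + young_const * (?B x * ?D x))"
        using iF iD by (intro Bochner_Integration.integrable_add Bochner_Integration.integrable_sum integrable_mult_right)
      fix x
      show "\<alpha> / 2 * ?E x \<le> (\<Sum>i\<in>UNIV. ?V x $ i * (a i x + e i x)) + young_const * (?B x * ?D x)"
      proof (cases "x \<in> ball x0 \<rho>")
        case True
        then show ?thesis
          using flux_pointwise[OF \<zeta>(2,3)[of x] d\<zeta>[of _ x] L, where k=k and x=x] by simp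
      next
        case False
        then show ?thesis using \<zeta>0[OF False] by simp
      qed
    qed
    also have "\<dots> = (\<Sum>i\<in>UNIV. \<integral>x. ?V x $ i * (a i x + e i x) \<partial>lborel) + young_const * S"
      unfolding S using iF iD
      by (subst Bochner_Integration.integral_add) (auto intro!: Bochner_Integration.integrable_sum simp del: vec_lambda_beta)
    finally have "\<alpha> / 2 * (\<integral>x. ?E x \<partial>lborel) \<le> young_const * S" using flux by simp
    moreover have "(\<integral>x. \<zeta> x * (if k < u x then \<bar>G x $ i\<bar> powr p i else 0) \<partial>lborel) \<le> (\<integral>x. ?E x \<partial>lborel)"
      using \<zeta>(2) by (intro integral_mono iG iE member_le_sum) (auto intro!: mult_nonneg_nonneg)
    ultimately have "\<alpha> / 2 * (\<integral>x. \<zeta> x * (if k < u x then \<bar>G x $ i\<bar> powr p i else 0) \<partial>lborel) \<le> young_const * S"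
      using \<alpha> by (smt (verit) mult_left_mono half_gt_zero)
    then show ?thesis using \<alpha> by (simp add: field_simps)
  qed
  have wS: "(\<integral>x. ?B x * (L * ?w x) powr p i \<partial>lborel) \<le> S" for i
    unfolding S
  proof (rule integral_mono[OF iw iD])
    fix x
    have "(L * ?w x) powr p i \<le> (\<Sum>i\<in>UNIV. (L * ?w x) powr p i)" by (rule member_le_sum) auto
    also have "\<dots> \<le> ?D x" using g_nonneg[of x] by auto
    finally show "?B x * (L * ?w x) powr p i \<le> ?B x * ?D x" by (rule mult_left_mono) simp
  qed
  have E: "(\<integral>x. \<bar>?V x $ i\<bar> powr p i \<partial>lborel) \<le> energy_const * S" for i
  proof -
    have "(\<integral>x. \<bar>?V x $ i\<bar> powr p i \<partial>lborel) \<le> (\<integral>x. 2 powr p i * (\<zeta> x * (if k < u x then \<bar>G x $ i\<bar> powr p i else 0) + ?B x * (L * ?w x) powr p i) \<partial>lborel)"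
      using iG iw by (intro integral_mono Vint Vp integrable_mult_right Bochner_Integration.integrable_add)
    also have "\<dots> = 2 powr p i * ((\<integral>x. \<zeta> x * (if k < u x then \<bar>G x $ i\<bar> powr p i else 0) \<partial>lborel) + (\<integral>x. ?B x * (L * ?w x) powr p i \<partial>lborel))"
      using iG iw by simp
    also have "\<dots> \<le> 2 powr p i * (2 * young_const / \<alpha> * S + S)"
      by (intro mult_left_mono add_mono cacc wS) auto
    also have "\<dots> = 2 powr p i * ((2 * young_const / \<alpha> + 1) * S)" by (simp add: distrib_right)
    also have "\<dots> \<le> (\<Sum>i\<in>UNIV. 2 powr p i) * ((2 * young_const / \<alpha> + 1) * S)"
    proof (rule mult_right_mono)
      show "2 powr p i \<le> (\<Sum>i\<in>UNIV. 2 powr p i)" by (rule member_le_sum) auto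
      show "0 \<le> (2 * young_const / \<alpha> + 1) * S" using S0 young_const(3) \<alpha> by (intro mult_nonneg_nonneg add_nonneg_nonneg) auto
    qed
    finally show ?thesis by (simp add: energy_const_def mult.assoc)
  qed
  note Sob = sobolev_weak[OF wk Vint]
  show "integrable lborel (\<lambda>x. \<bar>\<zeta> x * max 0 (u x - k)\<bar> powr q)" by (rule Sob(1))
  let ?X = "\<integral>x. \<bar>\<zeta> x * ?w x\<bar> powr q \<partial>lborel"
  have "?X powr (1 / q) \<le> sob_const * (\<Prod>i\<in>UNIV. (\<integral>x. \<bar>?V x $ i\<bar> powr p i \<partial>lborel) powr (1 / (N * p i)))"
    by (rule Sob(2))
  also have "\<dots> \<le> sob_const * (\<Prod>i\<in>UNIV. (energy_const * S) powr (1 / (N * p i)))"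
  proof (intro mult_left_mono prod_mono conjI powr_mono2 E sob_const_nonneg)
    show "0 \<le> 1 / (N * p i)" for i using p_pos[of i] dim by simp
  qed auto
  also have "(\<Prod>i\<in>UNIV. (energy_const * S) powr (1 / (N * p i))) = (energy_const * S) powr (1 / P)"
  proof (cases "S = 0")
    case True
    then show ?thesis by (auto intro: prod_zero)
  next
    case False
    have "(\<Sum>i\<in>UNIV. 1 / (N * p i)) = 1 / P"
    proof -
      have "(\<Sum>i\<in>UNIV. 1 / (N * p i)) = (\<Sum>i\<in>UNIV. (1 / p i) / N)" by (simp add: mult.commute)
      also have "\<dots> = (N / P) / N" by (simp only: sum_divide_distrib[symmetric] sum_inv_p)
      finally show ?thesis using dim by simp
    qed
    then show ?thesis using False energy_const_pos by (simp add: powr_sum[symmetric])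
  qed
  finally have "(?X powr (1 / q)) powr q \<le> (sob_const * (energy_const * S) powr (1 / P)) powr q"
    using q_pos by (intro powr_mono2) auto
  moreover have "(?X powr (1 / q)) powr q = ?X" using q_pos by (simp add: powr_powr)
  moreover have "(sob_const * (energy_const * S) powr (1 / P)) powr q = (sob_const * energy_const powr (1 / P)) powr q * S powr (q / P)"
    using sob_const_nonneg energy_const_pos S0 by (simp add: powr_mult powr_powr)
  ultimately show "?X \<le> (sob_const * energy_const powr (1 / P)) powr q * data_term \<rho> L k powr (q / P)" by (simp add: S_def)
qed

end

section \<open>De Giorgi's iteration\<close>

text \<open>
  By induction \<open>J j \<le> \<theta> \<kappa>^j\<close>: the choice of \<open>\<kappa>\<close> compensates the growth of \<open>\<Lambda>^j\<close>, and that
  of \<open>\<theta>\<close> the constant \<open>A\<close>. The bound also keeps \<open>J j \<le> 1\<close>, so the recursion is needed only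
  there.
\<close>

lemma fast_geometric_convergence:
  fixes J :: "nat \<Rightarrow> real"
  assumes A: "0 < A" and \<Lambda>: "1 < \<Lambda>" and \<gamma>: "0 < \<gamma>"
  defines "\<kappa> \<equiv> \<Lambda> powr (- (1 / \<gamma>))"
  defines "\<theta> \<equiv> min 1 ((\<kappa> / A) powr (1 / \<gamma>))"
  assumes J: "\<And>j. 0 \<le> J j" and J0: "J 0 \<le> \<theta>"
    and step: "\<And>j. J j \<le> 1 \<Longrightarrow> J (Suc j) \<le> A * \<Lambda> ^ j * J j powr (1 + \<gamma>)"
  shows "J \<longlonglongrightarrow> 0"
proof -
  have \<kappa>: "0 < \<kappa>" "\<kappa> < 1" using \<Lambda> \<gamma> by (auto simp: \<kappa>_def powr_less_one)
  have \<theta>: "0 < \<theta>" "\<theta> \<le> 1" using \<kappa> A by (auto simp: \<theta>_def)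
  have \<kappa>\<gamma>: "\<kappa> powr \<gamma> = 1 / \<Lambda>" unfolding \<kappa>_def powr_powr using \<gamma> \<Lambda> by (simp add: powr_minus_divide)
  have A\<theta>: "A * \<theta> powr \<gamma> \<le> \<kappa>"
  proof -
    have "\<theta> powr \<gamma> \<le> ((\<kappa> / A) powr (1 / \<gamma>)) powr \<gamma>" using \<theta> \<gamma> by (intro powr_mono2) (auto simp: \<theta>_def)
    also have "\<dots> = \<kappa> / A" using \<gamma> \<kappa> A by (simp add: powr_powr)
    finally show ?thesis using A by (simp add: field_simps)
  qed
  have bound: "J j \<le> \<theta> * \<kappa> ^ j" for j
  proof (induction j)
    case (Suc j)
    have "\<kappa> ^ j \<le> 1" using \<kappa> by (intro power_le_one) auto
    then have "\<theta> * \<kappa> ^ j \<le> 1" using \<theta> \<kappa> mult_mono[of \<theta> 1 "\<kappa> ^ j" 1] by simp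
    then have "J (Suc j) \<le> A * \<Lambda> ^ j * J j powr (1 + \<gamma>)" using Suc by (intro step) simp
    also have "\<dots> \<le> A * \<Lambda> ^ j * (\<theta> * \<kappa> ^ j) powr (1 + \<gamma>)"
      using Suc J A \<Lambda> \<gamma> by (intro mult_left_mono powr_mono2) auto
    also have "(\<theta> * \<kappa> ^ j) powr (1 + \<gamma>) = (\<theta> * \<kappa> ^ j) * (\<theta> powr \<gamma> * (\<kappa> powr \<gamma>) ^ j)"
    proof -
      have "(\<kappa> ^ j) powr \<gamma> = (\<kappa> powr \<gamma>) ^ j"
        using \<kappa> by (simp add: powr_realpow[symmetric] powr_powr mult.commute)
      then show ?thesis using \<theta> \<kappa> by (simp add: powr_add powr_mult)
    qed
    also have "A * \<Lambda> ^ j * ((\<theta> * \<kappa> ^ j) * (\<theta> powr \<gamma> * (\<kappa> powr \<gamma>) ^ j)) = (A * \<theta> powr \<gamma>) * (\<theta> * \<kappa> ^ j)"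
      using \<Lambda> by (simp add: \<kappa>\<gamma> power_divide)
    also have "\<dots> \<le> \<kappa> * (\<theta> * \<kappa> ^ j)" using A\<theta> \<theta> \<kappa> by (intro mult_right_mono) auto
    finally show ?case by (simp add: mult_ac)
  qed (use J0 in simp)
  have "(\<lambda>j. \<theta> * \<kappa> ^ j) \<longlonglongrightarrow> 0" using \<kappa> by (intro tendsto_mult_right_zero LIMSEQ_realpow_zero) auto
  then show ?thesis by (rule tendsto_sandwich[rotated 2, OF tendsto_const]) (auto simp: J bound)
qed

context aniso_equation
begin

definition excess :: "real \<Rightarrow> real \<Rightarrow> real"
  where "excess \<rho> k = (\<integral>x. indicator (ball x0 \<rho>) x * max 0 (u x - k) powr q \<partial>lborel)"

lemma excess_nonneg: "0 \<le> excess \<rho> k" by (simp add: excess_def)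

lemma excess_integrable: "0 \<le> k \<Longrightarrow> integrable lborel (\<lambda>x. indicator (ball x0 \<rho>) x * max 0 (u x - k) powr q)"
  using pos_part_powr_integrable[OF q_pos order_refl] .

text \<open>
  Above the next level the function \<open>h\<close> exceeds the gap \<open>d\<close>, so lower powers are
  controlled by the \<open>q\<close>-th.
\<close>

lemma level_gap_powr:
  fixes s h d :: real
  assumes "0 < s" "s \<le> q" "0 < d" "d \<le> h"
  shows "h powr s \<le> (1 / d) powr (q - s) * h powr q"
proof -
  have "h powr q = h powr (q - s) * h powr s" by (simp add: powr_add[symmetric])
  moreover have "1 \<le> (1 / d) powr (q - s) * h powr (q - s)"
  proof -
    have "(1 / d) powr (q - s) * h powr (q - s) = (h / d) powr (q - s)" using assms by (simp add: powr_divide)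
    moreover have "1 \<le> (h / d) powr (q - s)" using assms by (intro ge_one_powr_ge_zero) auto
    ultimately show ?thesis by simp
  qed
  ultimately show ?thesis using mult_right_mono[of 1 "(1 / d) powr (q - s) * h powr (q - s)" "h powr s"] by simp
qed

text \<open>
  Where \<open>u > k (j + 1)\<close>, the function \<open>h = (u - k j)\<^sup>+\<close> is at least the gap
  \<open>d = K / 2^(j + 1)\<close>. Hence \<open>|u|\<close> and, because of \<open>K \<ge> 1\<close>, also \<open>1\<close> are at most a
  multiple of \<open>2^j h\<close>, with a factor independent of \<open>K\<close>, and all powers of \<open>h\<close> reduce to
  the \<open>q\<close>-th. Hoelder's inequality with \<open>g\<close> in \<open>L^\<mu>\<close> gives the exponent \<open>1 - 1 / \<mu>\<close>; the
  other terms are linear in the excess and are compared with this power because the excess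
  is at most \<open>1\<close>.
\<close>

lemma data_term_le:
  fixes j :: nat and K L :: real
  assumes K: "1 \<le> K" and L: "1 \<le> L"
  defines "k \<equiv> \<lambda>j. K * (2 - (1 / 2) ^ j)"
  assumes J: "excess \<rho> (k j) \<le> 1"
  shows "data_term \<rho> (L * 2 ^ j) (k (Suc j)) \<le>
    (N * L powr q * 2 powr q + 2 * 2 powr (3 * P) * g_norm * 2 powr q) * (2 powr (2 * q)) ^ j * excess \<rho> (k j) powr (1 - 1 / \<mu>)"
proof -
  let ?J = "excess \<rho> (k j)" and ?B = "indicator (ball x0 \<rho>) :: real^'n \<Rightarrow> real"
  let ?h = "\<lambda>x. max 0 (u x - k j)" and ?w = "\<lambda>x. max 0 (u x - k (Suc j))"
  define t :: real where "t = 2 ^ Suc j"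
  have t: "1 \<le> t" "0 < t" using one_le_power[of "2::real" "Suc j"] by (auto simp: t_def)
  have t2: "t = 2 * 2 ^ j" by (simp add: t_def)
  define d where "d = K / t"
  have d: "0 < d" "1 / d \<le> t" using K t by (auto simp: d_def field_simps)
  have kd: "k (Suc j) = k j + d" using t by (simp add: k_def d_def t_def power_one_over field_simps)
  have k0: "0 \<le> k j" "k j \<le> 2 * K"
  proof -
    have "(1 / 2 :: real) ^ j \<le> 1" by (intro power_le_one) auto
    then show "0 \<le> k j" using K by (simp add: k_def)
    show "k j \<le> 2 * K" using K by (simp add: k_def algebra_simps)
  qed
  have k1: "0 \<le> k (Suc j)" using kd k0 d by simp
  have hd: "d \<le> ?h x" if "k (Suc j) < u x" for x using that kd by simp
  have wh: "?w x \<le> ?h x" for x using kd d by auto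
  have lev: "(if k (Suc j) < u x then ?h x powr s else 0) \<le> t powr q * ?h x powr q" if s: "0 < s" "s \<le> q" for s x
  proof (cases "k (Suc j) < u x")
    case True
    have "?h x powr s \<le> (1 / d) powr (q - s) * ?h x powr q" using s d hd[OF True] by (intro level_gap_powr)
    also have "\<dots> \<le> t powr q * ?h x powr q"
    proof (rule mult_right_mono)
      have "(1 / d) powr (q - s) \<le> t powr (q - s)" using d s by (intro powr_mono2) auto
      also have "\<dots> \<le> t powr q" using t s by (intro powr_mono) auto
      finally show "(1 / d) powr (q - s) \<le> t powr q" .
    qed simp
    finally show ?thesis using True by simp
  qed simp
  have J0: "0 \<le> ?J" by (rule excess_nonneg)
  have iJ: "integrable lborel (\<lambda>x. ?B x * ?h x powr q)" using excess_integrable[OF k0(1)] .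
  have wi: "integrable lborel (\<lambda>x. ?B x * (L * 2 ^ j * ?w x) powr p i)"
    and wle: "(\<integral>x. ?B x * (L * 2 ^ j * ?w x) powr p i \<partial>lborel) \<le> L powr q * (2 ^ j) powr q * (t powr q * ?J)" for i
  proof -
    have L2: "1 \<le> L * 2 ^ j" using L mult_mono[of 1 L 1 "2 ^ j"] by simp
    have eq: "?B x * (L * 2 ^ j * ?w x) powr p i = (L * 2 ^ j) powr p i * (?B x * ?w x powr p i)" for x
      using L2 by (simp add: powr_mult mult_ac)
    have ip: "integrable lborel (\<lambda>x. ?B x * ?w x powr p i)"
      by (rule pos_part_powr_integrable[OF p_pos less_imp_le[OF p_less_q] k1])
    show "integrable lborel (\<lambda>x. ?B x * (L * 2 ^ j * ?w x) powr p i)" unfolding eq using ip by (rule integrable_mult_right)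
    have "(\<integral>x. ?B x * ?w x powr p i \<partial>lborel) \<le> (\<integral>x. t powr q * (?B x * ?h x powr q) \<partial>lborel)"
    proof (rule integral_mono[OF ip integrable_mult_right[OF iJ]])
      fix x
      have "?w x powr p i \<le> (if k (Suc j) < u x then ?h x powr p i else 0)"
        using wh[of x] p_pos[of i] by (auto intro!: powr_mono2)
      also have "\<dots> \<le> t powr q * ?h x powr q" using lev[OF p_pos less_imp_le[OF p_less_q]] .
      finally show "?B x * ?w x powr p i \<le> t powr q * (?B x * ?h x powr q)"
        by (auto simp: indicator_def)
    qed
    also have "\<dots> = t powr q * ?J" by (simp add: excess_def)
    finally have "(L * 2 ^ j) powr p i * (\<integral>x. ?B x * ?w x powr p i \<partial>lborel) \<le> (L * 2 ^ j) powr q * (t powr q * ?J)"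
      using L2 p_less_q[of i] J0 by (intro mult_mono powr_mono) auto
    then show "(\<integral>x. ?B x * (L * 2 ^ j * ?w x) powr p i \<partial>lborel) \<le> L powr q * (2 ^ j) powr q * (t powr q * ?J)"
      unfolding eq using L by (simp add: powr_mult)
  qed
  let ?f = "\<lambda>x. ?B x * (if k (Suc j) < u x then ?h x powr P else 0)"
  have f_borel: "?f \<in> borel_measurable borel"
  proof (intro borel_measurable_times borel_measurable_indicator measurable_If powr_real_measurable
        borel_measurable_max borel_measurable_diff borel_measurable_const u_borel)
    show "{x \<in> space borel. k (Suc j) < u x} \<in> sets borel" by measurable
  qed auto
  have s0: "0 < 1 / (1 - 1 / \<mu>)" using inv_mu by simp
  have fs: "?f x powr (1 / (1 - 1 / \<mu>)) \<le> t powr q * (?B x * ?h x powr q)" for x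
  proof -
    have "?f x powr (1 / (1 - 1 / \<mu>)) = ?B x * (if k (Suc j) < u x then ?h x powr (P * (1 / (1 - 1 / \<mu>))) else 0)"
      by (auto simp: indicator_def powr_powr)
    also have "\<dots> \<le> ?B x * (t powr q * ?h x powr q)"
      using P_mu_less_q P_gt1 s0 by (intro mult_left_mono lev mult_pos_pos) auto
    finally show ?thesis by (simp add: mult_ac)
  qed
  have fi: "integrable lborel (\<lambda>x. ?f x powr (1 / (1 - 1 / \<mu>)))"
  proof (rule Bochner_Integration.integrable_bound[OF integrable_mult_right[OF iJ, of "t powr q"]])
    show "AE x in lborel. norm (?f x powr (1 / (1 - 1 / \<mu>))) \<le> norm (t powr q * (?B x * ?h x powr q))"
      by (intro AE_I2 norm_mono_nonneg powr_ge_zero fs)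
    have "(\<lambda>x. ?f x powr (1 / (1 - 1 / \<mu>))) \<in> borel_measurable borel"
      by (intro powr_real_measurable f_borel borel_measurable_const)
    then show "(\<lambda>x. ?f x powr (1 / (1 - 1 / \<mu>))) \<in> borel_measurable lborel" unfolding measurable_lborel2 .
  qed
  have f0: "0 \<le> ?f x" for x by auto
  note gH = g_Hoelder[OF f_borel f0 fi]
  have gn: "0 \<le> g_norm" by (simp add: g_norm_def)
  have gle: "(\<integral>x. g x * ?f x \<partial>lborel) \<le> g_norm * (t powr q * ?J powr (1 - 1 / \<mu>))"
  proof -
    have "(\<integral>x. ?f x powr (1 / (1 - 1 / \<mu>)) \<partial>lborel) \<le> (\<integral>x. t powr q * (?B x * ?h x powr q) \<partial>lborel)"
      by (rule integral_mono[OF fi integrable_mult_right[OF iJ] fs])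
    also have "\<dots> = t powr q * ?J" by (simp add: excess_def)
    finally have "(\<integral>x. ?f x powr (1 / (1 - 1 / \<mu>)) \<partial>lborel) powr (1 - 1 / \<mu>) \<le> (t powr q * ?J) powr (1 - 1 / \<mu>)"
      using inv_mu by (intro powr_mono2) auto
    also have "\<dots> = (t powr q) powr (1 - 1 / \<mu>) * ?J powr (1 - 1 / \<mu>)" using J0 by (simp add: powr_mult)
    also have "\<dots> \<le> t powr q * ?J powr (1 - 1 / \<mu>)"
    proof (rule mult_right_mono)
      have "1 \<le> t powr q" using t q_pos by (intro ge_one_powr_ge_zero) auto
      then show "(t powr q) powr (1 - 1 / \<mu>) \<le> t powr q" using inv_mu powr_mono[of "1 - 1 / \<mu>" 1 "t powr q"] by simp
    qed simp
    finally show ?thesis using gH(2) gn by (meson mult_left_mono order_trans)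
  qed
  have low: "(if k (Suc j) < u x then g x * (1 + \<bar>u x\<bar> powr P) else 0) \<le> 2 * (8 * 2 ^ j) powr P * (g x * (if k (Suc j) < u x then ?h x powr P else 0))" for x
  proof (cases "k (Suc j) < u x")
    case True
    have h: "d \<le> ?h x" by (rule hd[OF True])
    have Kh: "K \<le> t * ?h x" using h t by (simp add: d_def pos_divide_le_eq mult.commute)
    have h0: "0 \<le> ?h x" by simp
    have th: "?h x \<le> t * ?h x" using mult_right_mono[OF t(1) h0] by simp
    have "\<bar>u x\<bar> \<le> ?h x + 2 * K" using True k1 k0 by auto
    also have "\<dots> \<le> 3 * (t * ?h x)" using Kh th by linarith
    also have "\<dots> \<le> (8 * 2 ^ j) * ?h x" using h0 by (simp add: t2 mult_right_mono)
    finally have "\<bar>u x\<bar> powr P \<le> ((8 * 2 ^ j) * ?h x) powr P" using P_gt1 by (intro powr_mono2) auto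
    moreover have "1 \<le> ((8 * 2 ^ j) * ?h x) powr P"
    proof (rule ge_one_powr_ge_zero)
      have "1 \<le> t * ?h x" using K Kh by simp
      also have "\<dots> \<le> (8 * 2 ^ j) * ?h x" using h0 by (simp add: t2 mult_right_mono)
      finally show "1 \<le> (8 * 2 ^ j) * ?h x" .
    qed (use P_gt1 in simp)
    ultimately have "1 + \<bar>u x\<bar> powr P \<le> 2 * ((8 * 2 ^ j) * ?h x) powr P" by simp
    also have "((8 * 2 ^ j) * ?h x) powr P = (8 * 2 ^ j) powr P * ?h x powr P" using h0 by (simp add: powr_mult)
    finally have "g x * (1 + \<bar>u x\<bar> powr P) \<le> g x * (2 * ((8 * 2 ^ j) powr P * ?h x powr P))"
      by (intro mult_left_mono g_nonneg)
    then show ?thesis using True by (simp add: mult_ac)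
  qed simp
  have "data_term \<rho> (L * 2 ^ j) (k (Suc j)) \<le> (\<integral>x. (\<Sum>i\<in>UNIV. ?B x * (L * 2 ^ j * ?w x) powr p i) + 2 * (8 * 2 ^ j) powr P * (g x * ?f x) \<partial>lborel)"
    unfolding data_term_def
  proof (rule integral_mono)
    have eq: "?B x * ((\<Sum>i\<in>UNIV. (L * 2 ^ j * ?w x) powr p i) + (if k (Suc j) < u x then g x * (1 + \<bar>u x\<bar> powr P) else 0))
      = (\<Sum>i\<in>UNIV. ?B x * (L * 2 ^ j * ?w x) powr p i) + ?B x * (if k (Suc j) < u x then g x * (1 + \<bar>u x\<bar> powr P) else 0)" for x
      by (simp only: distrib_left[of "?B x"] sum_distrib_left)
    have ig: "integrable lborel (\<lambda>x. ?B x * (if k (Suc j) < u x then g x * (1 + \<bar>u x\<bar> powr P) else 0))"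
      by (rule Bochner_Integration.integrable_bound[OF lower_integrable]) (auto simp: indicator_def abs_mult)
    show "integrable lborel (\<lambda>x. ?B x * ((\<Sum>i\<in>UNIV. (L * 2 ^ j * ?w x) powr p i) + (if k (Suc j) < u x then g x * (1 + \<bar>u x\<bar> powr P) else 0)))"
      unfolding eq by (intro Bochner_Integration.integrable_add Bochner_Integration.integrable_sum wi ig)
    show "integrable lborel (\<lambda>x. (\<Sum>i\<in>UNIV. ?B x * (L * 2 ^ j * ?w x) powr p i) + 2 * (8 * 2 ^ j) powr P * (g x * ?f x))"
      by (intro Bochner_Integration.integrable_add Bochner_Integration.integrable_sum wi integrable_mult_right gH(1))
    fix x
    show "?B x * ((\<Sum>i\<in>UNIV. (L * 2 ^ j * ?w x) powr p i) + (if k (Suc j) < u x then g x * (1 + \<bar>u x\<bar> powr P) else 0))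
      \<le> (\<Sum>i\<in>UNIV. ?B x * (L * 2 ^ j * ?w x) powr p i) + 2 * (8 * 2 ^ j) powr P * (g x * ?f x)"
      unfolding eq
    proof (rule add_left_mono)
      show "?B x * (if k (Suc j) < u x then g x * (1 + \<bar>u x\<bar> powr P) else 0) \<le> 2 * (8 * 2 ^ j) powr P * (g x * ?f x)"
      proof -
        have "0 \<le> ?B x" by simp
        from mult_left_mono[OF low[of x] this] show ?thesis by (simp only: mult_ac)
      qed
    qed
  qed
  also have "\<dots> = (\<Sum>i\<in>UNIV. \<integral>x. ?B x * (L * 2 ^ j * ?w x) powr p i \<partial>lborel) + 2 * (8 * 2 ^ j) powr P * (\<integral>x. g x * ?f x \<partial>lborel)"
    by (simp only: Bochner_Integration.integral_add Bochner_Integration.integral_sum integral_mult_right_zero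
        Bochner_Integration.integrable_sum integrable_mult_right wi gH(1))
  also have "\<dots> \<le> (\<Sum>i\<in>(UNIV::'n set). L powr q * (2 ^ j) powr q * (t powr q * ?J)) + 2 * (8 * 2 ^ j) powr P * (g_norm * (t powr q * ?J powr (1 - 1 / \<mu>)))"
    by (intro add_mono sum_mono wle mult_left_mono gle) auto
  also have "\<dots> = N * L powr q * (2 ^ j) powr q * t powr q * ?J + 2 * (8 * 2 ^ j) powr P * g_norm * t powr q * ?J powr (1 - 1 / \<mu>)"
    by (simp add: dim_eq mult_ac)
  also have "\<dots> \<le> N * L powr q * (2 ^ j) powr q * t powr q * ?J powr (1 - 1 / \<mu>) + 2 * (8 * 2 ^ j) powr P * g_norm * t powr q * ?J powr (1 - 1 / \<mu>)"
  proof (intro add_right_mono mult_left_mono)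
    show "?J \<le> ?J powr (1 - 1 / \<mu>)" using powr_mono'[of "1 - 1 / \<mu>" 1 ?J] J0 J inv_mu by simp
    show "0 \<le> N * L powr q * (2 ^ j) powr q * t powr q" using dim by simp
  qed
  also have "\<dots> = (N * L powr q * 2 powr q * ((2 ^ j) powr q * (2 ^ j) powr q) + 2 * 2 powr (3 * P) * g_norm * 2 powr q * ((2 ^ j) powr P * (2 ^ j) powr q)) * ?J powr (1 - 1 / \<mu>)"
  proof -
    have "t powr q = 2 powr q * (2 ^ j) powr q" by (simp add: t2 powr_mult)
    moreover have "(8 * 2 ^ j) powr P = 2 powr (3 * P) * (2 ^ j) powr P"
    proof -
      have "2 powr (3 * P) = (2 powr 3) powr P" by (simp only: powr_powr)
      also have "2 powr 3 = (8 :: real)" by simp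
      finally show ?thesis by (simp add: powr_mult)
    qed
    ultimately show ?thesis by (simp add: algebra_simps)
  qed
  also have "\<dots> \<le> (N * L powr q * 2 powr q * (2 powr (2 * q)) ^ j + 2 * 2 powr (3 * P) * g_norm * 2 powr q * (2 powr (2 * q)) ^ j) * ?J powr (1 - 1 / \<mu>)"
  proof (intro mult_right_mono add_mono mult_left_mono)
    have e: "(2 powr (2 * q)) ^ j = (2 ^ j) powr q * (2 ^ j) powr q"
    proof -
      have "(2 powr (2 * q)) ^ j = 2 powr (2 * q * real j)" by (simp add: powr_realpow[symmetric] powr_powr)
      moreover have "(2 ^ j) powr q = 2 powr (real j * q)" by (simp add: powr_realpow[symmetric] powr_powr)
      ultimately show ?thesis by (simp add: powr_add[symmetric] algebra_simps)
    qed
    then show "(2 ^ j) powr q * (2 ^ j) powr q \<le> (2 powr (2 * q)) ^ j" by simp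
    show "(2 ^ j) powr P * (2 ^ j) powr q \<le> (2 powr (2 * q)) ^ j"
      unfolding e using q_gt_P by (intro mult_right_mono powr_mono) auto
  qed (use dim gn in auto)
  also have "\<dots> = (N * L powr q * 2 powr q + 2 * 2 powr (3 * P) * g_norm * 2 powr q) * (2 powr (2 * q)) ^ j * ?J powr (1 - 1 / \<mu>)"
    by (simp add: algebra_simps)
  finally show ?thesis .
qed

text \<open>
  The recursion has constants independent of the final level \<open>2 K\<close>, and the initial excess
  tends to \<open>0\<close> as \<open>K\<close> grows, by dominated convergence. For a large \<open>K\<close> the excess at level
  \<open>2 K\<close> on the ball of radius \<open>R / 2\<close> is thus \<open>0\<close>.
\<close>

lemma locally_bounded_above: "\<exists>M. AE x in lborel. x \<in> ball x0 (R / 2) \<longrightarrow> u x \<le> M"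
proof -
  obtain m :: nat where m: "m > 1" "\<And>i. p i \<le> real m"
  proof
    let ?s = "\<Sum>i\<in>UNIV. p i"
    show "nat \<lceil>?s\<rceil> + 2 > 1" by simp
    fix i
    have "p i \<le> ?s" using p_pos by (intro member_le_sum) (auto simp: less_imp_le)
    then show "p i \<le> real (nat \<lceil>?s\<rceil> + 2)" by linarith
  qed
  obtain C where C: "C > 0" "\<And>(x0 :: real^'n) r R. 0 < r \<Longrightarrow> r < R \<Longrightarrow> \<exists>\<zeta>. cutoff C m x0 r R \<zeta>"
    using cutoff_exists[OF m(1), where 'n='n] by blast
  define \<rho> where "\<rho> j = R / 2 * (1 + (1 / 2) ^ Suc j)" for j :: nat
  have \<rho>gap: "\<rho> j - \<rho> (Suc j) = R / (8 * 2 ^ j)" for j by (simp add: \<rho>_def power_one_over field_simps)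
  have \<rho>: "R / 2 < \<rho> j" "\<rho> j < R" for j
  proof -
    have "(1 / 2 :: real) ^ Suc j < 1" by (rule power_Suc_less_one) auto
    then show "\<rho> j < R" using R by (simp add: \<rho>_def)
    show "R / 2 < \<rho> j" using R by (simp add: \<rho>_def)
  qed
  define L where "L = max 1 (8 * C / R)"
  have L: "1 \<le> L" by (simp add: L_def)
  define c1 where "c1 = (sob_const * energy_const powr (1 / P)) powr q + 1"
  define c2 where "c2 = N * L powr q * 2 powr q + 2 * 2 powr (3 * P) * g_norm * 2 powr q"
  have gn: "0 \<le> g_norm" by (simp add: g_norm_def)
  have "0 < c1" unfolding c1_def by (rule add_nonneg_pos[OF powr_ge_zero]) simp
  moreover have "0 < c2"
    unfolding c2_def using dim gn L by (intro add_pos_nonneg mult_pos_pos mult_nonneg_nonneg) auto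
  ultimately have c: "0 < c1" "0 < c2" by blast+
  define A where "A = c1 * c2 powr (q / P)"
  define \<Lambda> where "\<Lambda> = (2 powr (2 * q)) powr (q / P)"
  define \<gamma> where "\<gamma> = (1 - 1 / \<mu>) * (q / P) - 1"
  have A: "0 < A" using c by (simp add: A_def)
  have \<Lambda>: "1 < \<Lambda>"
  proof -
    have "0 < 2 * q * (q / P)" using q_pos P_gt1 by simp
    then show ?thesis unfolding \<Lambda>_def powr_powr by (rule gr_one_powr[rotated]) simp
  qed
  have \<gamma>: "0 < \<gamma>" using gain by (simp add: \<gamma>_def)
  \<comment> \<open>the smallness threshold in \<open>fast_geometric_convergence\<close>\<close>
  define \<theta> where "\<theta> = min 1 ((\<Lambda> powr (- (1 / \<gamma>)) / A) powr (1 / \<gamma>))"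
  have \<theta>: "0 < \<theta>" using A \<Lambda> by (simp add: \<theta>_def)
  have step: "excess (\<rho> (Suc j)) (K * (2 - (1 / 2) ^ Suc j)) \<le> A * \<Lambda> ^ j * excess (\<rho> j) (K * (2 - (1 / 2) ^ j)) powr (1 + \<gamma>)"
    if K: "1 \<le> K" and J: "excess (\<rho> j) (K * (2 - (1 / 2) ^ j)) \<le> 1" for K j
  proof -
    let ?k = "\<lambda>j. K * (2 - (1 / 2) ^ j)"
    have k1: "0 \<le> ?k (Suc j)"
    proof -
      have "(1 / 2 :: real) ^ Suc j \<le> 1" by (intro power_le_one) auto
      then show ?thesis using K by (intro mult_nonneg_nonneg) auto
    qed
    have r: "0 < \<rho> (Suc j)" "\<rho> (Suc j) < \<rho> j" 
    proof -
      show "0 < \<rho> (Suc j)" using \<rho>(1)[of "Suc j"] R by simp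
      have "0 < R / (8 * 2 ^ j)" using R by simp
      then show "\<rho> (Suc j) < \<rho> j" using \<rho>gap[of j] by linarith
    qed
    obtain \<zeta> where cut: "cutoff C m x0 (\<rho> (Suc j)) (\<rho> j) \<zeta>" using C(2)[OF r] by blast
    note Z = cutoffD[OF cut]
    have dz: "\<bar>partial_deriv i \<zeta> x\<bar> \<le> (L * 2 ^ j) * \<zeta> x powr (1 - 1 / p i)" for i x
    proof -
      have "\<bar>partial_deriv i \<zeta> x\<bar> \<le> C / (\<rho> j - \<rho> (Suc j)) * \<zeta> x powr (1 - 1 / real m)" by (rule Z(5))
      also have "\<dots> \<le> (L * 2 ^ j) * \<zeta> x powr (1 - 1 / p i)"
      proof (rule mult_mono)
        have "8 * C / R * 2 ^ j \<le> L * 2 ^ j" by (intro mult_right_mono) (auto simp: L_def)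
        then show "C / (\<rho> j - \<rho> (Suc j)) \<le> L * 2 ^ j" by (simp add: \<rho>gap mult_ac)
        have "1 / real m \<le> 1 / p i" using m(2)[of i] p_pos[of i] by (intro divide_left_mono) auto
        then show "\<zeta> x powr (1 - 1 / real m) \<le> \<zeta> x powr (1 - 1 / p i)" using Z(2,3)[of x] by (intro powr_mono') auto
      qed (use L in auto)
      finally show ?thesis .
    qed
    have L2: "0 \<le> L * 2 ^ j" using L by simp
    note En = energy_estimate[OF Z(1,2,3) dz L2 less_trans[OF r] \<rho>(2) k1]
    have "excess (\<rho> (Suc j)) (?k (Suc j)) \<le> (\<integral>x. \<bar>\<zeta> x * max 0 (u x - ?k (Suc j))\<bar> powr q \<partial>lborel)"
      unfolding excess_def
      by (rule integral_mono[OF excess_integrable[OF k1] En(2)]) (auto simp: indicator_def Z(4))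
    also have "\<dots> \<le> (sob_const * energy_const powr (1 / P)) powr q * data_term (\<rho> j) (L * 2 ^ j) (?k (Suc j)) powr (q / P)"
      by (rule En(1))
    also have "\<dots> \<le> c1 * (c2 * (2 powr (2 * q)) ^ j * excess (\<rho> j) (?k j) powr (1 - 1 / \<mu>)) powr (q / P)"
    proof (rule mult_mono)
      have "0 \<le> data_term (\<rho> j) (L * 2 ^ j) (?k (Suc j))"
        unfolding data_term_def using g_nonneg
        by (intro integral_nonneg_AE AE_I2 mult_nonneg_nonneg add_nonneg_nonneg sum_nonneg) (auto intro!: mult_nonneg_nonneg add_nonneg_nonneg)
      then show "data_term (\<rho> j) (L * 2 ^ j) (?k (Suc j)) powr (q / P) \<le> (c2 * (2 powr (2 * q)) ^ j * excess (\<rho> j) (?k j) powr (1 - 1 / \<mu>)) powr (q / P)"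
        using data_term_le[OF K L J] q_pos P_gt1 unfolding c2_def by (intro powr_mono2) auto
    qed (use c in \<open>auto simp: c1_def\<close>)
    also have "\<dots> = A * \<Lambda> ^ j * excess (\<rho> j) (?k j) powr (1 + \<gamma>)"
    proof -
      have "((2 powr (2 * q)) ^ j) powr (q / P) = \<Lambda> ^ j"
        by (simp add: \<Lambda>_def powr_realpow[symmetric] powr_powr mult_ac)
      then show ?thesis using c excess_nonneg[of "\<rho> j" "?k j"]
        by (simp add: powr_mult powr_powr A_def \<gamma>_def mult_ac)
    qed
    finally show ?thesis .
  qed
  have "(\<lambda>n. excess (\<rho> 0) (real n)) \<longlonglongrightarrow> (\<integral>x. 0 \<partial>(lborel :: (real^'n) measure))"
    unfolding excess_def
  proof (rule integral_dominated_convergence[OF _ _ excess_integrable[OF order_refl]])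
    have m: "(\<lambda>x. indicator (ball x0 (\<rho> 0)) x * max 0 (u x - c) powr q) \<in> borel_measurable lborel" if "0 \<le> c" for c
      using excess_integrable[OF that] by (rule borel_measurable_integrable)
    show "(\<lambda>x. indicator (ball x0 (\<rho> 0)) x * max 0 (u x - real n) powr q) \<in> borel_measurable lborel" for n
      by (rule m) simp
    show "AE x in lborel. (\<lambda>n. indicator (ball x0 (\<rho> 0)) x * max 0 (u x - real n) powr q) \<longlonglongrightarrow> 0"
    proof (rule AE_I2)
      fix x
      obtain m where m: "u x \<le> real m" using real_arch_simple by blast
      have "indicator (ball x0 (\<rho> 0)) x * max 0 (u x - real n) powr q = 0" if "n \<ge> m" for n
      proof -
        have "u x - real n \<le> 0" using m that by (simp add: order_trans[OF m])
        then show ?thesis by (simp add: max_def)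
      qed
      then show "(\<lambda>n. indicator (ball x0 (\<rho> 0)) x * max 0 (u x - real n) powr q) \<longlonglongrightarrow> 0"
        by (intro tendsto_eventually) (unfold eventually_sequentially, blast)
    qed
    show "AE x in lborel. norm (indicator (ball x0 (\<rho> 0)) x * max 0 (u x - real n) powr q) \<le> indicator (ball x0 (\<rho> 0)) x * max 0 (u x - 0) powr q" for n
    proof (rule AE_I2)
      fix x
      have "max 0 (u x - real n) powr q \<le> max 0 (u x - 0) powr q" using q_pos by (intro powr_mono2) auto
      then show "norm (indicator (ball x0 (\<rho> 0)) x * max 0 (u x - real n) powr q) \<le> indicator (ball x0 (\<rho> 0)) x * max 0 (u x - 0) powr q"
        by (simp add: indicator_def)
    qed
  qed simp
  then have "\<forall>\<^sub>F n in sequentially. excess (\<rho> 0) (real n) < \<theta>" using \<theta> by (intro order_tendstoD) auto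
  then obtain n0 where n0: "\<And>n. n \<ge> n0 \<Longrightarrow> excess (\<rho> 0) (real n) < \<theta>" by (auto simp: eventually_sequentially)
  define K where "K = real (max 1 n0)"
  have K: "1 \<le> K" "excess (\<rho> 0) K < \<theta>" using n0[of "max 1 n0"] by (auto simp: K_def)
  let ?J = "\<lambda>j. excess (\<rho> j) (K * (2 - (1 / 2) ^ j))"
  have "?J \<longlonglongrightarrow> 0"
  proof (rule fast_geometric_convergence[OF A \<Lambda> \<gamma>])
    show "?J 0 \<le> min 1 ((\<Lambda> powr - (1 / \<gamma>) / A) powr (1 / \<gamma>))" using K(2) by (simp add: \<theta>_def)
  qed (use excess_nonneg step[OF K(1)] in auto)
  moreover have le: "excess (R / 2) (2 * K) \<le> ?J j" for j
    unfolding excess_def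
  proof (rule integral_mono)
    have k0: "0 \<le> K * (2 - (1 / 2) ^ j)"
    proof -
      have "(1 / 2 :: real) ^ j \<le> 1" by (intro power_le_one) auto
      then show ?thesis using K by (intro mult_nonneg_nonneg) auto
    qed
    show "integrable lborel (\<lambda>x. indicator (ball x0 (R / 2)) x * max 0 (u x - 2 * K) powr q)"
      using excess_integrable[of "2 * K"] K by simp
    show "integrable lborel (\<lambda>x. indicator (ball x0 (\<rho> j)) x * max 0 (u x - K * (2 - (1 / 2) ^ j)) powr q)"
      by (rule excess_integrable[OF k0])
    fix x
    have kk: "K * (2 - (1 / 2) ^ j) \<le> 2 * K" using K by (simp add: algebra_simps)
    show "indicator (ball x0 (R / 2)) x * max 0 (u x - 2 * K) powr q \<le> indicator (ball x0 (\<rho> j)) x * max 0 (u x - K * (2 - (1 / 2) ^ j)) powr q"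
    proof (rule mult_mono)
      show "indicator (ball x0 (R / 2)) x \<le> (indicator (ball x0 (\<rho> j)) x :: real)" using \<rho>(1)[of j] by (auto simp: indicator_def)
      show "max 0 (u x - 2 * K) powr q \<le> max 0 (u x - K * (2 - (1 / 2) ^ j)) powr q" using kk q_pos by (intro powr_mono2) auto
    qed auto
  qed
  ultimately have "excess (R / 2) (2 * K) \<le> 0" by (intro LIMSEQ_le_const) auto
  then have "excess (R / 2) (2 * K) = 0" using excess_nonneg[of "R / 2" "2 * K"] by simp
  then have "AE x in lborel. indicator (ball x0 (R / 2)) x * max 0 (u x - 2 * K) powr q = 0"
    unfolding excess_def using K
    by (subst (asm) integral_nonneg_eq_0_iff_AE[OF excess_integrable]) auto
  then have "AE x in lborel. x \<in> ball x0 (R / 2) \<longrightarrow> u x \<le> 2 * K"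
    by eventually_elim (auto simp: indicator_def max_def split: if_splits)
  then show ?thesis by blast
qed

end

section \<open>Passage from Lebesgue to Borel measurable data\<close>

text \<open>
  With \<open>v\<close> approximated by simple functions \<open>F i\<close>, the functions \<open>f x (F i x)\<close> are
  measurable and converge to \<open>f x (v x)\<close> wherever \<open>f x\<close> is continuous. At the exceptional
  points the composition is not controlled, so only a version of it is obtained.
\<close>

lemma Caratheodory_composition_version:
  fixes f :: "real^'n \<Rightarrow> 'b::{metric_space, second_countable_topology} \<Rightarrow> real" and v :: "real^'n \<Rightarrow> 'b"
  assumes f: "caratheodory \<Omega> f" and v: "v \<in> borel_measurable (lebesgue_on \<Omega>)"
  obtains h where "h \<in> borel_measurable (lebesgue_on \<Omega>)" "AE x in lebesgue_on \<Omega>. h x = f x (v x)"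
proof -
  let ?M = "lebesgue_on \<Omega>"
  from borel_measurable_implies_sequence_metric[OF v, of undefined]
  obtain F where F: "\<And>i. simple_function ?M (F i)" "\<And>x. x \<in> space ?M \<Longrightarrow> (\<lambda>i. F i x) \<longlonglongrightarrow> v x"
    by metis
  have Fm: "(\<lambda>x. f x (F i x)) \<in> borel_measurable ?M" for i
  proof -
    have fin: "finite (F i ` space ?M)" using F(1) by (simp add: simple_function_def)
    have "(\<lambda>x. \<Sum>y\<in>F i ` space ?M. indicator (F i -` {y} \<inter> space ?M) x * f x y) \<in> borel_measurable ?M"
    proof (intro borel_measurable_sum borel_measurable_times borel_measurable_indicator)
      fix y assume "y \<in> F i ` space ?M"
      then show "F i -` {y} \<inter> space ?M \<in> sets ?M" using F(1)[of i] unfolding simple_function_def by blast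
      show "(\<lambda>x. f x y) \<in> borel_measurable ?M" using f by (simp add: caratheodory_def)
    qed
    moreover have "(\<Sum>y\<in>F i ` space ?M. indicator (F i -` {y} \<inter> space ?M) x * f x y) = f x (F i x)"
      if x: "x \<in> space ?M" for x
    proof -
      have "(\<Sum>y\<in>F i ` space ?M. indicator (F i -` {y} \<inter> space ?M) x * f x y) = (\<Sum>y\<in>F i ` space ?M. if y = F i x then f x y else 0)"
        using x by (intro sum.cong) (auto simp: indicator_def)
      also have "\<dots> = f x (F i x)" using fin x by simp
      finally show ?thesis .
    qed
    ultimately show ?thesis by (subst measurable_cong[of ?M, symmetric]) auto
  qed
  show thesis
  proof (rule that)
    show "(\<lambda>x. lim (\<lambda>i. f x (F i x))) \<in> borel_measurable ?M"
      by (rule borel_measurable_lim_metric[OF Fm])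
    have "AE x in ?M. continuous_on UNIV (f x)" using f by (simp add: caratheodory_def)
    then show "AE x in ?M. lim (\<lambda>i. f x (F i x)) = f x (v x)"
      using AE_space
    proof eventually_elim
      case (elim x)
      have "(\<lambda>i. f x (F i x)) \<longlonglongrightarrow> f x (v x)"
        by (rule continuous_on_tendsto_compose[OF elim(1) F(2)[OF elim(2)]]) auto
      then show ?case by (rule limI)
    qed
  qed
qed

lemma AE_lebesgue_on_iff:
  assumes "S \<in> sets lebesgue"
  shows "(AE x in lebesgue_on S. Q x) \<longleftrightarrow> (AE x in lborel. x \<in> S \<longrightarrow> Q x)"
  using assms by (simp add: AE_restrict_space_iff AE_completion_iff)

text \<open>
  Finitely many Lebesgue measurable functions coincide with Borel functions off a Borel
  null set, and that set can be enlarged to contain the exceptions to \<open>Q\<close>.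
\<close>

lemma Borel_core:
  fixes F :: "(real^'n \<Rightarrow> real) set"
  assumes B: "B \<in> sets borel" and F: "finite F" "\<And>f. f \<in> F \<Longrightarrow> f \<in> borel_measurable (lebesgue_on B)"
    and Q: "AE x in lborel. x \<in> B \<longrightarrow> Q x"
  obtains S where "S \<in> sets borel" "S \<subseteq> B" "AE x in lborel. x \<in> B \<longrightarrow> x \<in> S" "\<And>x. x \<in> S \<Longrightarrow> Q x"
    "\<And>f. f \<in> F \<Longrightarrow> (\<lambda>x. if x \<in> S then f x else 0) \<in> borel_measurable borel"
proof -
  have Bl: "B \<in> sets lebesgue" using B by simp
  have "\<exists>f'\<in>borel_measurable lborel. AE x in lborel. indicator B x *\<^sub>R f x = f' x" if "f \<in> F" for f
    using F(2)[OF that] Bl by (intro completion_ex_borel_measurable_real) (simp add: borel_measurable_restrict_space_iff)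
  then obtain v where v: "\<And>f. f \<in> F \<Longrightarrow> v f \<in> borel_measurable borel"
      "\<And>f. f \<in> F \<Longrightarrow> AE x in lborel. indicator B x *\<^sub>R f x = v f x"
    by (metis measurable_lborel2)
  have "AE x in lborel. \<forall>f\<in>F. indicator B x *\<^sub>R f x = v f x"
    by (rule AE_finite_allI[OF F(1) v(2)])
  with Q have "AE x in lborel. (x \<in> B \<longrightarrow> Q x) \<and> (\<forall>f\<in>F. indicator B x *\<^sub>R f x = v f x)"
    by eventually_elim auto
  then obtain Z where Z: "Z \<in> null_sets lborel" "\<And>x. x \<notin> Z \<Longrightarrow> (x \<in> B \<longrightarrow> Q x) \<and> (\<forall>f\<in>F. indicator B x *\<^sub>R f x = v f x)"
    unfolding eventually_ae_filter by auto
  have Zb: "Z \<in> sets borel" using Z(1) by auto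
  show thesis
  proof (rule that[of "B - Z"])
    show "B - Z \<in> sets borel" using B Zb by blast
    show "AE x in lborel. x \<in> B \<longrightarrow> x \<in> B - Z" using AE_not_in[OF Z(1)] by eventually_elim auto
    show "Q x" if "x \<in> B - Z" for x using Z(2)[of x] that by blast
    show "(\<lambda>x. if x \<in> B - Z then f x else 0) \<in> borel_measurable borel" if f: "f \<in> F" for f
    proof -
      have "(\<lambda>x. if x \<in> B - Z then f x else 0) = (\<lambda>x. indicator (B - Z) x * v f x)"
      proof
        fix x show "(if x \<in> B - Z then f x else 0) = indicator (B - Z) x * v f x"
          using Z(2)[of x] f by (auto simp: indicator_def)
      qed
      moreover have "(\<lambda>x. indicator (B - Z) x * v f x) \<in> borel_measurable borel"
        using B Zb by (intro borel_measurable_times borel_measurable_indicator v(1)[OF f]) blast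
      ultimately show ?thesis by simp
    qed
  qed blast
qed

lemma borel_measurable_lebesgue_AE:
  fixes f g :: "real^'n \<Rightarrow> real"
  assumes f: "f \<in> borel_measurable lebesgue" and eq: "AE x in lebesgue. f x = g x"
  shows "g \<in> borel_measurable lebesgue"
proof (rule measurableI)
  fix A :: "real set" assume A: "A \<in> sets borel"
  have "AE x in lebesgue. x \<in> f -` A \<inter> space lebesgue \<longleftrightarrow> x \<in> g -` A \<inter> space lebesgue"
    using eq by eventually_elim auto
  then show "g -` A \<inter> space lebesgue \<in> sets lebesgue"
    by (rule completion.in_sets_AE) (use measurable_sets[OF f A] in auto)
qed simp

text \<open>
  The set \<open>S\<close> is a Borel core of \<open>B\<close>, and \<open>f\<close> vanishes on the rest of \<open>\<Omega>\<close>, so both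
  integrands agree almost everywhere.
\<close>

lemma LINT_eq_lborel:
  fixes f :: "real^'n \<Rightarrow> real"
  assumes \<Omega>: "\<Omega> \<in> sets lebesgue" and S: "S \<subseteq> \<Omega>" "AE x in lborel. x \<in> B \<longrightarrow> x \<in> S"
    and z: "\<And>x. x \<in> \<Omega> \<Longrightarrow> x \<notin> B \<Longrightarrow> f x = 0" "\<And>x. x \<in> S \<Longrightarrow> x \<in> B"
    and m: "(\<lambda>x. if x \<in> S then f x else 0) \<in> borel_measurable borel"
  shows "(LINT x|lebesgue_on \<Omega>. f x) = (\<integral>x. (if x \<in> S then f x else 0) \<partial>lborel)"
    and "integrable (lebesgue_on \<Omega>) f \<longleftrightarrow> integrable lborel (\<lambda>x. if x \<in> S then f x else 0)"
proof -
  let ?g = "\<lambda>x. if x \<in> S then f x else 0"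
  have ml: "?g \<in> borel_measurable lebesgue" using m by (intro measurable_completion) simp
  have "AE x in lborel. ?g x = indicator \<Omega> x *\<^sub>R f x"
    using S(2) by eventually_elim (use S(1) z in \<open>auto simp: indicator_def\<close>)
  then have ae: "AE x in lebesgue. ?g x = indicator \<Omega> x *\<^sub>R f x" by (rule AE_completion)
  have mf: "(\<lambda>x. indicator \<Omega> x *\<^sub>R f x) \<in> borel_measurable lebesgue" by (rule borel_measurable_lebesgue_AE[OF ml ae])
  have "(LINT x|lebesgue_on \<Omega>. f x) = (\<integral>x. indicator \<Omega> x *\<^sub>R f x \<partial>lebesgue)"
    using \<Omega> by (intro integral_restrict_space) simp
  also have "\<dots> = (\<integral>x. ?g x \<partial>lebesgue)" using ae by (intro integral_cong_AE mf ml) auto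
  also have "\<dots> = (\<integral>x. ?g x \<partial>lborel)" using m by (intro integral_completion) simp
  finally show "(LINT x|lebesgue_on \<Omega>. f x) = (\<integral>x. ?g x \<partial>lborel)" .
  have "integrable (lebesgue_on \<Omega>) f \<longleftrightarrow> integrable lebesgue (\<lambda>x. indicator \<Omega> x *\<^sub>R f x)"
    using \<Omega> by (intro integrable_restrict_space) simp
  also have "\<dots> \<longleftrightarrow> integrable lebesgue ?g" using ae by (intro integrable_cong_AE mf ml) auto
  also have "\<dots> \<longleftrightarrow> integrable lborel ?g" using m by (intro integrable_completion) simp
  finally show "integrable (lebesgue_on \<Omega>) f \<longleftrightarrow> integrable lborel ?g" .
qed

lemma weak_grad_onD:
  assumes "weak_grad_on B u G" "\<phi> \<in> test_funs B"
  shows "(\<integral>x. u x * partial_deriv i \<phi> x \<partial>lborel) = - (\<integral>x. G x $ i * \<phi> x \<partial>lborel)"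
  using assms unfolding weak_grad_on_def by blast

lemma weak_grad_on_restrict:
  fixes u :: "real^'n \<Rightarrow> real"
  assumes wg: "weak_grad_on B u G" and C: "C \<in> sets borel" "C \<subseteq> B"
  shows "weak_grad_on C (\<lambda>x. if x \<in> C then u x else 0) (\<lambda>x. if x \<in> C then G x else 0)"
  unfolding weak_grad_on_def
proof (intro conjI allI ballI)
  have I: "integrable lborel u" "\<And>i. integrable lborel (\<lambda>x. G x $ i)" using wg by (auto simp: weak_grad_on_def)
  have r: "integrable lborel (\<lambda>x. if x \<in> C then f x else 0)" if "integrable lborel f" for f :: "real^'n \<Rightarrow> real"
  proof -
    have "(\<lambda>x. if x \<in> C then f x else 0) = (\<lambda>x. f x * indicator C x)" by (auto simp: fun_eq_iff)
    then show ?thesis using integrable_real_mult_indicator[OF _ that, of C] C(1) by (simp only:) simp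
  qed
  show "integrable lborel (\<lambda>x. if x \<in> C then u x else 0)" by (rule r[OF I(1)])
  have c: "(if x \<in> C then G x else 0) $ i = (if x \<in> C then G x $ i else 0)" for x i by simp
  show "integrable lborel (\<lambda>x. (if x \<in> C then G x else 0) $ i)" for i unfolding c by (rule r[OF I(2)])
  fix i and \<phi> :: "real^'n \<Rightarrow> real" assume \<phi>: "\<phi> \<in> test_funs C"
  have z: "\<phi> x = 0" "partial_deriv i \<phi> x = 0" if "x \<notin> C" for x i
    using \<phi> that by - (erule test_funsE, blast)+
  have "(\<integral>x. (if x \<in> C then u x else 0) * partial_deriv i \<phi> x \<partial>lborel) = (\<integral>x. u x * partial_deriv i \<phi> x \<partial>lborel)"
    by (intro Bochner_Integration.integral_cong) (auto simp: z)
  also have "\<dots> = - (\<integral>x. G x $ i * \<phi> x \<partial>lborel)"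
    using wg test_funs_mono[OF C(2) \<phi>] by (simp add: weak_grad_on_def)
  also have "(\<integral>x. G x $ i * \<phi> x \<partial>lborel) = (\<integral>x. (if x \<in> C then G x else 0) $ i * \<phi> x \<partial>lborel)"
    by (intro Bochner_Integration.integral_cong) (auto simp: z)
  finally show "(\<integral>x. (if x \<in> C then u x else 0) * partial_deriv i \<phi> x \<partial>lborel) = - (\<integral>x. (if x \<in> C then G x else 0) $ i * \<phi> x \<partial>lborel)" .
qed

lemma weak_grad_on_unique:
  fixes u :: "real^'n \<Rightarrow> real"
  assumes "weak_grad_on (ball x0 R) u G" "weak_grad_on (ball x0 R) u H" "0 < r" "r < R"
  shows "AE x in lborel. x \<in> ball x0 r \<longrightarrow> G x $ i = H x $ i"
proof -
  have I: "integrable lborel (\<lambda>x. G x $ i)" "integrable lborel (\<lambda>x. H x $ i)" using assms(1,2) by (auto simp: weak_grad_on_def)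
  have "AE x in lborel. x \<in> ball x0 r \<longrightarrow> G x $ i - H x $ i = 0"
  proof (rule AE_zero_of_integral_test_funs_zero[OF _ _ assms(3,4)])
    show "integrable lborel (\<lambda>x. G x $ i - H x $ i)" using I by simp
    fix \<phi> assume \<phi>: "\<phi> \<in> test_funs (ball x0 R)"
    have "(\<integral>x. (G x $ i - H x $ i) * \<phi> x \<partial>lborel) = (\<integral>x. G x $ i * \<phi> x \<partial>lborel) - (\<integral>x. H x $ i * \<phi> x \<partial>lborel)"
      unfolding left_diff_distrib by (intro Bochner_Integration.integral_diff integrable_mult_test_funs[OF _ \<phi>] I)
    also have "\<dots> = 0"
    proof -
      have "- (\<integral>x. G x $ i * \<phi> x \<partial>lborel) = - (\<integral>x. H x $ i * \<phi> x \<partial>lborel)"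
        using weak_grad_onD[OF assms(1) \<phi>, of i] weak_grad_onD[OF assms(2) \<phi>, of i] by simp
      then show ?thesis by simp
    qed
    finally show "(\<integral>x. (G x $ i - H x $ i) * \<phi> x \<partial>lborel) = 0" .
  qed
  then show ?thesis by simp
qed

lemma weak_gradient_imp_weak_grad_on:
  fixes u :: "real^'n \<Rightarrow> real"
  assumes wg: "weak_gradient \<Omega> u G" and \<Omega>: "\<Omega> \<in> sets lebesgue" "B \<subseteq> \<Omega>"
    and S: "S \<in> sets borel" "S \<subseteq> B" "AE x in lborel. x \<in> B \<longrightarrow> x \<in> S"
    and u: "(\<lambda>x. if x \<in> S then u x else 0) \<in> borel_measurable borel" "integrable lborel (\<lambda>x. if x \<in> S then u x else 0)"
    and G: "\<And>i. (\<lambda>x. if x \<in> S then G x $ i else 0) \<in> borel_measurable borel" "\<And>i. integrable lborel (\<lambda>x. if x \<in> S then G x $ i else 0)"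
  shows "weak_grad_on B (\<lambda>x. if x \<in> S then u x else 0) (\<lambda>x. if x \<in> S then G x else 0)"
  unfolding weak_grad_on_def
proof (intro conjI allI ballI u(2))
  have c: "(if x \<in> S then G x else 0) $ i = (if x \<in> S then G x $ i else 0)" for x i by simp
  show "integrable lborel (\<lambda>x. (if x \<in> S then G x else 0) $ i)" for i unfolding c by (rule G(2))
  fix i and \<phi> :: "real^'n \<Rightarrow> real" assume \<phi>: "\<phi> \<in> test_funs B"
  have z: "\<phi> x = 0" "partial_deriv i \<phi> x = 0" if "x \<notin> B" for x i
    using \<phi> that by - (erule test_funsE, blast)+
  have mv: "(if x \<in> S then f x * w x else 0) = (if x \<in> S then f x else 0) * w x" for f w :: "real^'n \<Rightarrow> real" and x by simp
  have m: "(\<lambda>x. (if x \<in> S then f x else 0) * w x) \<in> borel_measurable borel"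
    if "(\<lambda>x. if x \<in> S then f x else 0) \<in> borel_measurable borel" "w \<in> borel_measurable borel" for f w :: "real^'n \<Rightarrow> real"
    using that by (rule borel_measurable_times)
  have SO: "S \<subseteq> \<Omega>" using S \<Omega> by blast
  note T = LINT_eq_lborel(1)[OF \<Omega>(1) SO S(3)]
  have "(\<integral>x. (if x \<in> S then u x else 0) * partial_deriv i \<phi> x \<partial>lborel) = (LINT x|lebesgue_on \<Omega>. u x * partial_deriv i \<phi> x)"
    using S(2) by (subst T) (auto simp: z mv intro!: m u test_funs_borel[OF test_funs_pd[OF \<phi>]])
  also have "\<dots> = - (LINT x|lebesgue_on \<Omega>. G x $ i * \<phi> x)"
    using wg test_funs_mono[OF \<Omega>(2) \<phi>] by (simp add: weak_gradient_def)
  also have "(LINT x|lebesgue_on \<Omega>. G x $ i * \<phi> x) = (\<integral>x. (if x \<in> S then G x $ i else 0) * \<phi> x \<partial>lborel)"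
  proof (subst T)
    have "(\<lambda>x. if x \<in> S then G x $ i * \<phi> x else 0) = (\<lambda>x. (if x \<in> S then G x $ i else 0) * \<phi> x)" by auto
    then show "(\<lambda>x. if x \<in> S then G x $ i * \<phi> x else 0) \<in> borel_measurable borel"
      and "(\<integral>x. (if x \<in> S then G x $ i * \<phi> x else 0) \<partial>lborel) = (\<integral>x. (if x \<in> S then G x $ i else 0) * \<phi> x \<partial>lborel)"
      by (simp_all only: m G test_funs_borel[OF \<phi>])
  qed (use S(2) z in auto)
  finally show "(\<integral>x. (if x \<in> S then u x else 0) * partial_deriv i \<phi> x \<partial>lborel) = - (\<integral>x. (if x \<in> S then G x else 0) $ i * \<phi> x \<partial>lborel)"
    by (simp only: c)
qed

section \<open>Local boundedness of local solutions\<close>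

lemma integrable_powr_test_funs:
  assumes "\<phi> \<in> test_funs \<Omega>" "s > 0"
  shows "integrable lborel (\<lambda>x. \<bar>\<phi> x\<bar> powr s)"
proof (rule test_funsE[OF assms(1)])
  fix K assume K: "compact K" "\<And>x. x \<notin> K \<Longrightarrow> \<phi> x = 0"
  have "continuous_on UNIV (\<lambda>x. \<bar>\<phi> x\<bar> powr s)"
    using assms by (intro continuous_on_powr' continuous_intros test_funs_continuous[OF assms(1)]) auto
  then show ?thesis by (rule continuous_compact_support_integrable[OF _ K(1)]) (simp add: K(2))
qed

lemma aniso_data_uminus:
  assumes "aniso_data p N x0 R \<alpha> \<beta> \<mu> u G a e g"
  shows "aniso_data p N x0 R \<alpha> \<beta> \<mu> (\<lambda>x. - u x) (\<lambda>x. - G x) (\<lambda>i x. - a i x) (\<lambda>i x. - e i x) g"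
proof -
  interpret aniso_data p N x0 R \<alpha> \<beta> \<mu> u G a e g by (rule assms)
  show ?thesis
    by unfold_locales
      (use p_less_q R \<alpha> \<beta> \<mu> weak_grad_on_uminus[OF wg] u_q G_p g_nonneg g_supp g_\<mu> a_bound coercive e_bound in auto)
qed

text \<open>
  Reduces lower bounds for \<open>u\<close> to upper bounds: all assumptions are symmetric under a
  change of sign.
\<close>

lemma aniso_equation_uminus:
  assumes "aniso_equation p N x0 R \<alpha> \<beta> \<mu> u G a e g"
  shows "aniso_equation p N x0 R \<alpha> \<beta> \<mu> (\<lambda>x. - u x) (\<lambda>x. - G x) (\<lambda>i x. - a i x) (\<lambda>i x. - e i x) g"
proof -
  interpret aniso_equation p N x0 R \<alpha> \<beta> \<mu> u G a e g by (rule assms)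
  have "(\<Sum>i\<in>UNIV. \<integral>x. partial_deriv i \<phi> x * (- a i x + - e i x) \<partial>lborel) = 0" if "\<phi> \<in> test_funs (ball x0 R)" for \<phi>
  proof -
    have "partial_deriv i \<phi> x * (- a i x + - e i x) = - (partial_deriv i \<phi> x * (a i x + e i x))" for i x
      by (simp add: algebra_simps)
    then show ?thesis using equation[OF that] by (simp only: Bochner_Integration.integral_minus sum_negf minus_zero)
  qed
  with aniso_data_uminus[OF aniso_data_axioms] show ?thesis
    by (intro aniso_equation.intro aniso_equation_axioms.intro)
qed

lemma sum_powr_le:
  fixes y :: "'i::finite \<Rightarrow> real"
  assumes y: "\<And>i. 0 \<le> y i" and s: "0 \<le> s"
  shows "(\<Sum>i\<in>UNIV. y i) powr s \<le> real CARD('i) powr s * (\<Sum>i\<in>UNIV. y i powr s)"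
proof -
  define M where "M = Max (range y)"
  have M: "y i \<le> M" for i by (simp add: M_def)
  have "M \<in> range y" unfolding M_def by (rule Max_in) auto
  then obtain j where j: "M = y j" by blast
  have "(\<Sum>i\<in>UNIV. y i) \<le> (\<Sum>i\<in>(UNIV::'i set). M)" by (intro sum_mono M)
  then have "(\<Sum>i\<in>UNIV. y i) powr s \<le> (real CARD('i) * M) powr s"
    using y s by (intro powr_mono2) (auto intro!: sum_nonneg)
  also have "\<dots> = real CARD('i) powr s * y j powr s" using y by (simp add: j powr_mult)
  also have "\<dots> \<le> real CARD('i) powr s * (\<Sum>i\<in>UNIV. y i powr s)"
    by (intro mult_left_mono member_le_sum) auto
  finally show ?thesis .
qed

lemma Leb_imp_integrable:
  fixes f :: "real^'n \<Rightarrow> real"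
  assumes f: "f \<in> Leb B s" and B: "B \<in> sets borel"
    and S: "S \<subseteq> B" "AE x in lborel. x \<in> B \<longrightarrow> x \<in> S"
    and m: "(\<lambda>x. if x \<in> S then f x else 0) \<in> borel_measurable borel"
  shows "integrable lborel (\<lambda>x. \<bar>if x \<in> S then f x else 0\<bar> powr s)"
proof -
  have eq: "(\<lambda>x. \<bar>if x \<in> S then f x else 0\<bar> powr s) = (\<lambda>x. if x \<in> S then \<bar>f x\<bar> powr s else 0)" by auto
  have "(\<lambda>x. \<bar>if x \<in> S then f x else 0\<bar> powr s) \<in> borel_measurable borel" using m by (rule measurable_abs_powr)
  then have m2: "(\<lambda>x. if x \<in> S then \<bar>f x\<bar> powr s else 0) \<in> borel_measurable borel" unfolding eq .
  have Bl: "B \<in> sets lebesgue" using B by simp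
  have "integrable (lebesgue_on B) (\<lambda>x. \<bar>f x\<bar> powr s)" using f by (simp add: Leb_def)
  then show ?thesis unfolding eq using LINT_eq_lborel(2)[OF Bl S _ _ m2] S(1) by blast
qed

lemma integrable_of_powr_on_ball:
  fixes f :: "real^'n \<Rightarrow> real"
  assumes m: "f \<in> borel_measurable borel" and z: "\<And>x. x \<notin> ball x0 r \<Longrightarrow> f x = 0"
    and s: "0 < t" "t \<le> s" and i: "integrable lborel (\<lambda>x. \<bar>f x\<bar> powr s)"
  shows "integrable lborel (\<lambda>x. \<bar>f x\<bar> powr t)"
proof (rule Bochner_Integration.integrable_bound)
  show "integrable lborel (\<lambda>x. indicator (ball x0 r) x + \<bar>f x\<bar> powr s)"
    by (intro Bochner_Integration.integrable_add i integrable_indicator_ball)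
  have "\<bar>f x\<bar> powr t \<le> indicator (ball x0 r) x + \<bar>f x\<bar> powr s" for x
    using powr_le_one_plus_powr[of "\<bar>f x\<bar>" t s] s z[of x] by (cases "x \<in> ball x0 r") auto
  then show "AE x in lborel. norm (\<bar>f x\<bar> powr t) \<le> norm (indicator (ball x0 r) x + \<bar>f x\<bar> powr s)"
    by (intro AE_I2 norm_mono_nonneg powr_ge_zero)
  show "(\<lambda>x. \<bar>f x\<bar> powr t) \<in> borel_measurable lborel" unfolding measurable_lborel2 by (rule measurable_abs_powr[OF m])
qed

lemma caratheodory_subset:
  assumes "caratheodory \<Omega> f" "\<Omega> \<in> sets lebesgue" "B \<in> sets lebesgue" "B \<subseteq> \<Omega>"
  shows "caratheodory B f"
  unfolding caratheodory_def
proof (intro conjI allI)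
  show "(\<lambda>x. f x \<xi>) \<in> borel_measurable (lebesgue_on B)" for \<xi>
    using assms by (intro measurable_restrict_mono[OF _ assms(4)]) (simp add: caratheodory_def)
  have "AE x in lborel. x \<in> \<Omega> \<longrightarrow> continuous_on UNIV (f x)"
    using assms by (simp add: caratheodory_def AE_lebesgue_on_iff)
  then show "AE x in lebesgue_on B. continuous_on UNIV (f x)"
    unfolding AE_lebesgue_on_iff[OF assms(3)] by eventually_elim (use assms(4) in auto)
qed

lemma borel_measurable_vec_components:
  fixes G :: "'a \<Rightarrow> real^'n"
  assumes "\<And>i. (\<lambda>x. G x $ i) \<in> borel_measurable M"
  shows "G \<in> borel_measurable M"
  using assms by (subst borel_measurable_euclidean_space) (auto simp: Basis_vec_def inner_axis)

lemma flux_of_datum: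
  fixes t p :: real assumes "p > 1"
  shows "\<bar>\<bar>t\<bar> powr (p - 2) * t\<bar> powr conj_exp p = \<bar>t\<bar> powr p"
proof (cases "t = 0")
  case False
  have "\<bar>\<bar>t\<bar> powr (p - 2) * t\<bar> = \<bar>t\<bar> powr (p - 2) * \<bar>t\<bar> powr 1" using False by (simp add: abs_mult)
  also have "\<dots> = \<bar>t\<bar> powr (p - 1)" by (simp only: powr_add[symmetric]) simp
  finally have "\<bar>\<bar>t\<bar> powr (p - 2) * t\<bar> powr conj_exp p = \<bar>t\<bar> powr ((p - 1) * conj_exp p)" by (simp add: powr_powr)
  also have "(p - 1) * conj_exp p = p" using assms by (simp add: conj_exp_def)
  finally show ?thesis .
qed (use assms in simp)

text \<open>
  Three concentric balls are used. On the largest one \<open>u\<close> has the gradient \<open>G\<close> occurring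
  in the equation, which is only known to be integrable, and a gradient \<open>G'\<close> with
  components in \<open>L^p\<^sub>i\<close>; by uniqueness they agree almost everywhere on the middle ball. On
  the smallest ball \<open>u\<close> is in addition in \<open>L^q\<close>, and the data can be assembled for the
  iteration.
\<close>

lemma local_solution_bounded_near:
  fixes \<Omega> :: "(real^'n) set"
    and p \<beta> r :: "'n \<Rightarrow> real"
    and \<alpha> :: real
    and A :: "'n \<Rightarrow> real^'n \<Rightarrow> real^'n \<Rightarrow> real"
    and B :: "'n \<Rightarrow> real^'n \<Rightarrow> real \<Rightarrow> real"
    and b F :: "'n \<Rightarrow> real^'n \<Rightarrow> real"
    and u :: "real^'n \<Rightarrow> real"
  assumes dim: "CARD('n) > 1" and \<Omega>: "open \<Omega>" and p: "\<And>i. p i > 1"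
    and A: "structure_A \<Omega> p \<alpha> \<beta> A" and B: "structure_B \<Omega> p b B"
    and mean: "harmonic_mean p < real CARD('n)" and pmax: "sobolev_conj p > (MAX i. p i)"
    and b: "\<And>i. b i \<in> Leb_loc \<Omega> (r i / (p i - 1))" and F: "\<And>i. F i \<in> Leb_loc \<Omega> (r i)"
    and r: "(MIN i. r i / p i) > real CARD('n) / harmonic_mean p"
    and sol: "local_solution \<Omega> p A B F u" and x0: "x0 \<in> \<Omega>"
  shows "\<exists>\<rho>>0. \<exists>M. AE x in lborel. x \<in> ball x0 \<rho> \<longrightarrow> \<bar>u x\<bar> \<le> M"
proof -
  define N where "N = real CARD('n)"
  interpret aniso_exponents p N
    using p dim mean by unfold_locales (auto simp: N_def)
  have p_less_q: "p i < sobolev_conj p" for i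
    using pmax Max_ge[of "range p" "p i"] by simp
  define \<mu> where "\<mu> = (MIN i. r i / p i)"
  have \<mu>: "N / harmonic_mean p < \<mu>" using r by (simp add: \<mu>_def N_def)
  have \<mu>1: "1 < \<mu>"
  proof -
    have "1 < N / harmonic_mean p" using mean_less_dim P_gt1 by (simp add: less_divide_eq)
    then show ?thesis using \<mu> by simp
  qed
  have \<mu>r: "\<mu> \<le> r i / p i" for i unfolding \<mu>_def by (rule Min_le) auto
  \<comment> \<open>These two inequalities place \<open>|F i|^p\<^sub>i\<close> and the \<open>conj_exp (p i)\<close>-th power of \<open>b i\<close> in
    \<open>L^\<mu>\<close> locally.\<close>
  have \<mu>F: "\<mu> * p i \<le> r i" for i using \<mu>r[of i] p_pos[of i] by (simp add: pos_le_divide_eq)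
  have \<mu>b: "conj_exp (p i) * \<mu> \<le> r i / (p i - 1)" for i
    using \<mu>F[of i] p[of i] by (simp add: conj_exp_def divide_right_mono mult.commute)
  have cexp: "1 < conj_exp (p i)" "harmonic_mean p / conj_exp (p i) * conj_exp (p i) = harmonic_mean p" for i
    using p[of i] by (auto simp: conj_exp_def)
  obtain R0 where R0: "R0 > 0" "cball x0 R0 \<subseteq> \<Omega>" using \<Omega> x0 open_contains_cball by blast
  let ?B0 = "ball x0 R0"
  have B0: "open ?B0" "?B0 \<subset>\<subset> \<Omega>" "?B0 \<subseteq> \<Omega>" "?B0 \<in> sets borel" "?B0 \<in> sets lebesgue"
    using R0 by (auto simp: compactly_inside_def)
  have \<Omega>l: "\<Omega> \<in> sets lebesgue" using \<Omega> by simp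
  have FLp: "F i \<in> Leb ?B0 (p i)" for i using sol B0 by (auto simp: local_solution_def Leb_loc_def)
  have FLr: "F i \<in> Leb ?B0 (r i)" for i using F[of i] B0 by (auto simp: Leb_loc_def)
  have bL: "b i \<in> Leb ?B0 (r i / (p i - 1))" for i using b[of i] B0 by (auto simp: Leb_loc_def)
  obtain G where wG: "weak_gradient \<Omega> u G" and eq: "\<And>\<phi>. \<phi> \<in> test_funs \<Omega> \<Longrightarrow>
      (\<Sum>i\<in>UNIV. LINT x|lebesgue_on \<Omega>. (A i x (G x) + B i x (u x)) * partial_deriv i \<phi> x) =
      (\<Sum>i\<in>UNIV. LINT x|lebesgue_on \<Omega>. \<bar>F i x\<bar> powr (p i - 2) * F i x * partial_deriv i \<phi> x)"
    using sol unfolding local_solution_def by blast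
  have "u \<in> aniso_sobolev ?B0 p" using sol B0(1,2) by (simp add: local_solution_def aniso_sobolev_loc_def)
  then obtain G' where wG': "weak_gradient ?B0 u G'" and G'L: "\<And>i. (\<lambda>x. G' x $ i) \<in> Leb ?B0 (p i)" and uL: "u \<in> Leb ?B0 1"
    by (auto simp: aniso_sobolev_def sobolev_W11_def)
  have GL: "(\<lambda>x. G x $ i) \<in> Leb ?B0 1" for i
    using wG B0(1,2) by (simp add: weak_gradient_def Leb_loc_def)
  have LebM: "f \<in> borel_measurable (lebesgue_on ?B0)" if "f \<in> Leb ?B0 s" for f s using that by (simp add: Leb_def)
  have GM: "G \<in> borel_measurable (lebesgue_on ?B0)" by (rule borel_measurable_vec_components[OF LebM[OF GL]])
  have cA: "caratheodory ?B0 (A i)" and cB: "caratheodory ?B0 (B i)" for i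
    using A B \<Omega>l B0 by (auto simp: structure_A_def structure_B_def intro: caratheodory_subset)
  have "\<exists>h. h \<in> borel_measurable (lebesgue_on ?B0) \<and> (AE x in lebesgue_on ?B0. h x = A i x (G x))" for i
    by (rule Caratheodory_composition_version[OF cA GM]) blast
  then obtain hA where hA: "\<And>i. hA i \<in> borel_measurable (lebesgue_on ?B0)" "\<And>i. AE x in lebesgue_on ?B0. hA i x = A i x (G x)"
    by metis
  have "\<exists>h. h \<in> borel_measurable (lebesgue_on ?B0) \<and> (AE x in lebesgue_on ?B0. h x = B i x (u x))" for i
    by (rule Caratheodory_composition_version[OF cB LebM[OF uL]]) blast
  then obtain hB where hB: "\<And>i. hB i \<in> borel_measurable (lebesgue_on ?B0)" "\<And>i. AE x in lebesgue_on ?B0. hB i x = B i x (u x)"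
    by metis
  \<comment> \<open>All pointwise conditions are collected, so that a single Borel set carries them.\<close>
  define Q where "Q x \<longleftrightarrow> (\<forall>i. hA i x = A i x (G x)) \<and> (\<forall>i. hB i x = B i x (u x)) \<and>
     (\<forall>i. \<forall>\<xi>. \<bar>A i x \<xi>\<bar> \<le> \<beta> i * \<bar>\<xi> $ i\<bar> powr (p i - 1)) \<and>
     (\<forall>\<xi>. \<alpha> * (\<Sum>i\<in>UNIV. \<bar>\<xi> $ i\<bar> powr p i) \<le> (\<Sum>i\<in>UNIV. A i x \<xi> * \<xi> $ i)) \<and>
     (\<forall>i. \<forall>s. \<bar>B i x s\<bar> \<le> b i x * \<bar>s\<bar> powr (harmonic_mean p / conj_exp (p i))) \<and> (\<forall>i. 0 \<le> b i x)" for x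
  have Q: "AE x in lborel. x \<in> ?B0 \<longrightarrow> Q x"
  proof -
    have all: "AE x in lborel. \<forall>i. x \<in> ?B0 \<longrightarrow> R i x"
      if "\<And>i. AE x in lborel. x \<in> ?B0 \<longrightarrow> R i x" for R :: "'n \<Rightarrow> real^'n \<Rightarrow> bool"
      using AE_finite_allI[of UNIV "\<lambda>i x. x \<in> ?B0 \<longrightarrow> R i x"] that by simp
    have sub: "AE x in lborel. x \<in> ?B0 \<longrightarrow> R x" if "AE x in lebesgue_on \<Omega>. R x" for R
      using that unfolding AE_lebesgue_on_iff[OF \<Omega>l] by eventually_elim (use B0(3) in blast)
    have 1: "AE x in lborel. \<forall>i. x \<in> ?B0 \<longrightarrow> hA i x = A i x (G x)"
      using hA(2) unfolding AE_lebesgue_on_iff[OF B0(5)] by (rule all)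
    have 2: "AE x in lborel. \<forall>i. x \<in> ?B0 \<longrightarrow> hB i x = B i x (u x)"
      using hB(2) unfolding AE_lebesgue_on_iff[OF B0(5)] by (rule all)
    have 3: "AE x in lborel. \<forall>i. x \<in> ?B0 \<longrightarrow> (\<forall>\<xi>. \<bar>A i x \<xi>\<bar> \<le> \<beta> i * \<bar>\<xi> $ i\<bar> powr (p i - 1))"
      using A unfolding structure_A_def by (intro all sub) blast
    have 4: "AE x in lborel. x \<in> ?B0 \<longrightarrow> (\<forall>\<xi>. \<alpha> * (\<Sum>i\<in>UNIV. \<bar>\<xi> $ i\<bar> powr p i) \<le> (\<Sum>i\<in>UNIV. A i x \<xi> * \<xi> $ i))"
      using A unfolding structure_A_def by (intro sub) blast
    have 5: "AE x in lborel. \<forall>i. x \<in> ?B0 \<longrightarrow> (\<forall>s. \<bar>B i x s\<bar> \<le> b i x * \<bar>s\<bar> powr (harmonic_mean p / conj_exp (p i)))"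
      using B unfolding structure_B_def by (intro all sub) blast
    have 6: "AE x in lborel. \<forall>i. x \<in> ?B0 \<longrightarrow> 0 \<le> b i x"
      using B unfolding structure_B_def by (intro all sub) blast
    show ?thesis using 1 2 3 4 5 6 by eventually_elim (simp add: Q_def)
  qed
  let ?F = "{u} \<union> range (\<lambda>i x. G x $ i) \<union> range (\<lambda>i x. G' x $ i) \<union> range hA \<union> range hB \<union> range b \<union> range F"
  have Ffin: "finite ?F" by simp
  have Fmeas: "f \<in> borel_measurable (lebesgue_on ?B0)" if "f \<in> ?F" for f
    using that LebM[OF uL] LebM[OF GL] LebM[OF G'L] hA(1) hB(1) LebM[OF bL] LebM[OF FLr] by blast
  obtain S where S: "S \<in> sets borel" "S \<subseteq> ?B0" "AE x in lborel. x \<in> ?B0 \<longrightarrow> x \<in> S" "\<And>x. x \<in> S \<Longrightarrow> Q x"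
    and Sm: "\<And>f. f \<in> ?F \<Longrightarrow> (\<lambda>x. if x \<in> S then f x else 0) \<in> borel_measurable borel"
  proof (rule Borel_core[OF B0(4) Ffin Fmeas Q], goal_cases)
    case (2 S)
    show ?case by (rule that[of S]) (fact 2)+
  qed
  have Smu: "(\<lambda>x. if x \<in> S then u x else 0) \<in> borel_measurable borel"
    and SmG: "(\<lambda>x. if x \<in> S then G x $ i else 0) \<in> borel_measurable borel"
    and SmG': "(\<lambda>x. if x \<in> S then G' x $ i else 0) \<in> borel_measurable borel"
    and SmA: "(\<lambda>x. if x \<in> S then hA i x else 0) \<in> borel_measurable borel"
    and SmB: "(\<lambda>x. if x \<in> S then hB i x else 0) \<in> borel_measurable borel"
    and Smb: "(\<lambda>x. if x \<in> S then b i x else 0) \<in> borel_measurable borel"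
    and SmF: "(\<lambda>x. if x \<in> S then F i x else 0) \<in> borel_measurable borel" for i
    by (rule Sm; blast)+
  note LI = Leb_imp_integrable[OF _ B0(4) S(2,3)]
  have iabs: "integrable lborel f" if "integrable lborel (\<lambda>x. \<bar>f x\<bar> powr 1)" "f \<in> borel_measurable borel" for f :: "real^'n \<Rightarrow> real"
  proof -
    have "integrable lborel (\<lambda>x. \<bar>f x\<bar>)" using that(1) by simp
    then show ?thesis by (rule integrable_abs_cancel) (use that(2) in simp)
  qed
  have wg0: "weak_grad_on ?B0 (\<lambda>x. if x \<in> S then u x else 0) (\<lambda>x. if x \<in> S then G x else 0)"
    by (rule weak_gradient_imp_weak_grad_on[OF wG \<Omega>l B0(3) S(1,2,3) Smu _ SmG])
      (rule iabs[OF LI[OF uL Smu] Smu], rule iabs[OF LI[OF GL SmG] SmG])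
  have G'p: "integrable lborel (\<lambda>x. \<bar>if x \<in> S then G' x $ i else 0\<bar> powr p i)" for i by (rule LI[OF G'L SmG'])
  have wg0': "weak_grad_on ?B0 (\<lambda>x. if x \<in> S then u x else 0) (\<lambda>x. if x \<in> S then G' x else 0)"
  proof (rule weak_gradient_imp_weak_grad_on[OF wG' B0(5) order_refl S(1,2,3) Smu _ SmG'])
    show "integrable lborel (\<lambda>x. if x \<in> S then u x else 0)" by (rule iabs[OF LI[OF uL Smu] Smu])
    show "integrable lborel (\<lambda>x. if x \<in> S then G' x $ i else 0)" for i
    proof (rule iabs[OF _ SmG'])
      show "integrable lborel (\<lambda>x. \<bar>if x \<in> S then G' x $ i else 0\<bar> powr 1)"
      proof (rule integrable_of_powr_on_ball[OF SmG' _ _ _ G'p])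
        show "(if x \<in> S then G' x $ i else 0) = 0" if "x \<notin> ?B0" for x using that S(2) by auto
      qed (use p[of i] in auto)
    qed
  qed
  define R1 where "R1 = R0 / 2"
  define R2 where "R2 = R0 / 4"
  have R12: "0 < R2" "R2 < R1" "0 < R1" "R1 < R0" using R0 by (auto simp: R1_def R2_def)
  let ?C1 = "ball x0 R1" and ?C2 = "ball x0 R2"
  have C12: "?C2 \<subseteq> ?C1" "?C1 \<subseteq> ?B0" "?C1 \<in> sets borel" "?C2 \<in> sets borel" using R12 by auto
  define S1 where "S1 = S \<inter> ?C1"
  define S2 where "S2 = S \<inter> ?C2"
  have S12b: "S1 \<in> sets borel" "S2 \<in> sets borel" unfolding S1_def S2_def using S(1) C12 by blast+
  have wg1: "weak_grad_on ?C1 (\<lambda>x. if x \<in> S1 then u x else 0) (\<lambda>x. if x \<in> S1 then G x else 0)"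
  proof -
    have e: "(if x \<in> ?C1 then if x \<in> S then f x else 0 else 0) = (if x \<in> S1 then f x else 0)" for f :: "real^'n \<Rightarrow> 'z::zero" and x
      by (simp add: S1_def)
    show ?thesis using weak_grad_on_restrict[OF wg0 C12(3,2)] unfolding e .
  qed
  have wg2: "weak_grad_on ?C2 (\<lambda>x. if x \<in> S2 then u x else 0) (\<lambda>x. if x \<in> S2 then G x else 0)"
  proof -
    have e: "(if x \<in> ?C2 then if x \<in> S1 then f x else 0 else 0) = (if x \<in> S2 then f x else 0)" for f :: "real^'n \<Rightarrow> 'z::zero" and x
      using C12(1) by (auto simp: S1_def S2_def)
    show ?thesis using weak_grad_on_restrict[OF wg1 C12(4,1)] unfolding e .
  qed
  have comp: "(if x \<in> T then H x else 0) $ i = (if x \<in> T then H x $ i else 0)" for H :: "real^'n \<Rightarrow> real^'n" and x i T by simp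
  have Gp1: "integrable lborel (\<lambda>x. \<bar>(if x \<in> S1 then G x else 0) $ i\<bar> powr p i)" for i
  proof -
    have "AE x in lborel. x \<in> ?C1 \<longrightarrow> (if x \<in> S then G x else 0) $ i = (if x \<in> S then G' x else 0) $ i"
      by (rule weak_grad_on_unique[OF wg0 wg0' R12(3,4)])
    then have "AE x in lborel. norm (\<bar>(if x \<in> S1 then G x else 0) $ i\<bar> powr p i) \<le> norm (\<bar>if x \<in> S then G' x $ i else 0\<bar> powr p i)"
      by eventually_elim (auto simp: S1_def)
    moreover have "(\<lambda>x. \<bar>(if x \<in> S1 then G x else 0) $ i\<bar> powr p i) \<in> borel_measurable lborel"
      unfolding measurable_lborel2 by (rule measurable_abs_powr[OF weak_grad_on_borel(2)[OF wg1]])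
    ultimately show ?thesis by (intro Bochner_Integration.integrable_bound[OF G'p[of i]])
  qed
  have uq1: "integrable lborel (\<lambda>x. indicator ?C2 x * \<bar>if x \<in> S1 then u x else 0\<bar> powr sobolev_conj p)"
    by (rule local_Lq[OF wg1 Gp1 p_less_q R12(1,2)])
  have S2B: "S2 \<subseteq> ?C2" "S2 \<subseteq> S1" "S2 \<subseteq> \<Omega>" "S2 \<subseteq> S" using C12 B0 by (auto simp: S1_def S2_def)
  have S2ae: "AE x in lborel. x \<in> ?C2 \<longrightarrow> x \<in> S2" using S(3) by eventually_elim (use R12 in \<open>auto simp: S2_def\<close>)
  have m2: "(\<lambda>x. if x \<in> S2 then f x else 0) \<in> borel_measurable borel" if "(\<lambda>x. if x \<in> S then f x else 0) \<in> borel_measurable borel" for f :: "real^'n \<Rightarrow> real"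
  proof -
    have "(\<lambda>x. if x \<in> S2 then f x else 0) = (\<lambda>x. indicator S2 x * (if x \<in> S then f x else 0))" using S2B by (auto simp: fun_eq_iff)
    then show ?thesis using that S12b(2) by simp
  qed
  have i2: "integrable lborel (\<lambda>x. \<bar>if x \<in> S2 then f x else 0\<bar> powr s)" if "integrable lborel (\<lambda>x. \<bar>if x \<in> S then f x else 0\<bar> powr s)"
    "(\<lambda>x. if x \<in> S then f x else 0) \<in> borel_measurable borel" for f :: "real^'n \<Rightarrow> real" and s
  proof (rule Bochner_Integration.integrable_bound[OF that(1)])
    show "(\<lambda>x. \<bar>if x \<in> S2 then f x else 0\<bar> powr s) \<in> borel_measurable lborel"
      unfolding measurable_lborel2 by (rule measurable_abs_powr[OF m2[OF that(2)]])
    show "AE x in lborel. norm (\<bar>if x \<in> S2 then f x else 0\<bar> powr s) \<le> norm (\<bar>if x \<in> S then f x else 0\<bar> powr s)"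
      using S2B by (intro AE_I2) auto
  qed
  define u2 where "u2 x = (if x \<in> S2 then u x else 0)" for x
  define G2 where "G2 x = (if x \<in> S2 then G x else 0)" for x
  define a2 where "a2 i x = (if x \<in> S2 then hA i x else 0)" for i x
  define hB2 where "hB2 i x = (if x \<in> S2 then hB i x else 0)" for i x
  define b2 where "b2 i x = (if x \<in> S2 then b i x else 0)" for i x
  define F2 where "F2 i x = (if x \<in> S2 then F i x else 0)" for i x
  define f2 where "f2 i x = \<bar>F2 i x\<bar> powr (p i - 2) * F2 i x" for i x
  define e2 where "e2 i x = hB2 i x - f2 i x" for i x
  define g2 where "g2 x = (\<Sum>i\<in>UNIV. 2 powr conj_exp (p i) * (b2 i x powr conj_exp (p i) + \<bar>F2 i x\<bar> powr p i))" for x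
  have a2m: "a2 i \<in> borel_measurable borel" and hB2m: "hB2 i \<in> borel_measurable borel"
    and b2m: "b2 i \<in> borel_measurable borel" and F2m: "F2 i \<in> borel_measurable borel" for i
    unfolding a2_def hB2_def b2_def F2_def by (intro m2 SmA SmB Smb SmF)+
  have f2m: "f2 i \<in> borel_measurable borel" for i
    unfolding f2_def by (intro borel_measurable_times measurable_abs_powr F2m)
  have e2m: "e2 i \<in> borel_measurable borel" for i
    unfolding e2_def by (intro borel_measurable_diff hB2m f2m)
  have g2m: "g2 \<in> borel_measurable borel"
    unfolding g2_def by (intro borel_measurable_sum borel_measurable_times borel_measurable_add borel_measurable_const
      powr_real_measurable b2m measurable_abs_powr F2m)
  have QS: "Q x" if "x \<in> S2" for x using S(4) S2B that by blast
  have b20: "0 \<le> b2 i x" for i x using QS[of x] by (simp add: b2_def Q_def)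
  have g20: "0 \<le> g2 x" for x unfolding g2_def by (intro sum_nonneg mult_nonneg_nonneg add_nonneg_nonneg) auto
  have off: "F2 i x = 0" "b2 i x = 0" "hB2 i x = 0" "u2 x = 0" "G2 x = 0" "a2 i x = 0" if "x \<notin> S2" for i x
    using that by (auto simp: F2_def b2_def hB2_def u2_def G2_def a2_def)
  have \<alpha>: "0 < \<alpha>" and \<beta>0: "0 \<le> \<beta> i" for i using A by (auto simp: structure_A_def intro: order_trans[of 0 \<alpha>])
  have data: "aniso_data p N x0 R2 \<alpha> (\<Sum>i\<in>UNIV. \<beta> i) \<mu> u2 G2 a2 e2 g2"
  proof unfold_locales
    show "p i < sobolev_conj p" for i by (rule p_less_q)
    show "0 < R2" by (rule R12)
    show "0 < \<alpha>" by (rule \<alpha>)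
    show "0 \<le> (\<Sum>i\<in>UNIV. \<beta> i)" by (intro sum_nonneg \<beta>0)
    show "N / harmonic_mean p < \<mu>" by (rule \<mu>)
    show "weak_grad_on ?C2 u2 G2" using wg2 unfolding u2_def[abs_def] G2_def[abs_def] .
    have "(\<lambda>x. \<bar>u2 x\<bar> powr sobolev_conj p) = (\<lambda>x. indicator ?C2 x * \<bar>if x \<in> S1 then u x else 0\<bar> powr sobolev_conj p)"
      unfolding u2_def S1_def S2_def using C12(1) by (intro ext) (auto simp: indicator_def)
    then show "integrable lborel (\<lambda>x. \<bar>u2 x\<bar> powr sobolev_conj p)" using uq1 by simp
    show "integrable lborel (\<lambda>x. \<bar>G2 x $ i\<bar> powr p i)" for i
    proof (rule Bochner_Integration.integrable_bound[OF Gp1[of i]])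
      show "(\<lambda>x. \<bar>G2 x $ i\<bar> powr p i) \<in> borel_measurable lborel"
        unfolding measurable_lborel2 G2_def by (rule measurable_abs_powr[OF weak_grad_on_borel(2)[OF wg2]])
      show "AE x in lborel. norm (\<bar>G2 x $ i\<bar> powr p i) \<le> norm (\<bar>(if x \<in> S1 then G x else 0) $ i\<bar> powr p i)"
        using S2B by (intro AE_I2) (auto simp: G2_def)
    qed
    show "a2 i \<in> borel_measurable borel" "e2 i \<in> borel_measurable borel" for i by (rule a2m, rule e2m)
    show "g2 \<in> borel_measurable borel" by (rule g2m)
    show "0 \<le> g2 x" for x by (rule g20)
    show "g2 x = 0" if "x \<notin> ?C2" for x
    proof -
      have "x \<notin> S2" using that S2B(1) by blast
      from off[OF this] show ?thesis by (simp add: g2_def)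
    qed
    show "integrable lborel (\<lambda>x. g2 x powr \<mu>)"
    proof (rule Bochner_Integration.integrable_bound)
      let ?c = "\<lambda>i. (2 powr conj_exp (p i)) powr \<mu> * 2 powr \<mu>"
      have ib: "integrable lborel (\<lambda>x. \<bar>b2 i x\<bar> powr (conj_exp (p i) * \<mu>))" for i
      proof (rule integrable_of_powr_on_ball[OF b2m _ _ \<mu>b])
        show "b2 i x = 0" if "x \<notin> ?C2" for x using off that S2B(1) by blast
        show "integrable lborel (\<lambda>x. \<bar>b2 i x\<bar> powr (r i / (p i - 1)))"
          unfolding b2_def by (rule i2[OF LI[OF bL Smb] Smb])
      qed (use cexp[of i] \<mu>1 in simp)
      have iF: "integrable lborel (\<lambda>x. \<bar>F2 i x\<bar> powr (\<mu> * p i))" for i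
      proof (rule integrable_of_powr_on_ball[OF F2m _ _ \<mu>F])
        show "F2 i x = 0" if "x \<notin> ?C2" for x using off that S2B(1) by blast
        show "integrable lborel (\<lambda>x. \<bar>F2 i x\<bar> powr r i)"
          unfolding F2_def by (rule i2[OF LI[OF FLr SmF] SmF])
      qed (use p_pos[of i] \<mu>1 in simp)
      show "integrable lborel (\<lambda>x. real CARD('n) powr \<mu> * (\<Sum>i\<in>UNIV. ?c i * (\<bar>b2 i x\<bar> powr (conj_exp (p i) * \<mu>) + \<bar>F2 i x\<bar> powr (\<mu> * p i))))"
        by (intro integrable_mult_right Bochner_Integration.integrable_sum Bochner_Integration.integrable_add ib iF)
      have le: "g2 x powr \<mu> \<le> real CARD('n) powr \<mu> * (\<Sum>i\<in>UNIV. ?c i * (\<bar>b2 i x\<bar> powr (conj_exp (p i) * \<mu>) + \<bar>F2 i x\<bar> powr (\<mu> * p i)))" for x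
      proof -
        let ?y = "\<lambda>i. 2 powr conj_exp (p i) * (b2 i x powr conj_exp (p i) + \<bar>F2 i x\<bar> powr p i)"
        have "g2 x powr \<mu> \<le> real CARD('n) powr \<mu> * (\<Sum>i\<in>UNIV. ?y i powr \<mu>)"
          unfolding g2_def using \<mu>1 by (intro sum_powr_le mult_nonneg_nonneg add_nonneg_nonneg) auto
        also have "\<dots> \<le> real CARD('n) powr \<mu> * (\<Sum>i\<in>UNIV. ?c i * (\<bar>b2 i x\<bar> powr (conj_exp (p i) * \<mu>) + \<bar>F2 i x\<bar> powr (\<mu> * p i)))"
        proof (intro mult_left_mono sum_mono)
          fix i
          have "?y i powr \<mu> = (2 powr conj_exp (p i)) powr \<mu> * (b2 i x powr conj_exp (p i) + \<bar>F2 i x\<bar> powr p i) powr \<mu>"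
            by (rule powr_mult)
          also have "\<dots> \<le> (2 powr conj_exp (p i)) powr \<mu> * (2 powr \<mu> * ((b2 i x powr conj_exp (p i)) powr \<mu> + (\<bar>F2 i x\<bar> powr p i) powr \<mu>))"
            using \<mu>1 by (intro mult_left_mono powr_add_le) auto
          finally show "?y i powr \<mu> \<le> ?c i * (\<bar>b2 i x\<bar> powr (conj_exp (p i) * \<mu>) + \<bar>F2 i x\<bar> powr (\<mu> * p i))"
            using b20[of i x] by (simp add: powr_powr mult.assoc mult.commute[of \<mu> "p i"])
        qed auto
        finally show ?thesis .
      qed
      show "AE x in lborel. norm (g2 x powr \<mu>) \<le> norm (real CARD('n) powr \<mu> * (\<Sum>i\<in>UNIV. ?c i * (\<bar>b2 i x\<bar> powr (conj_exp (p i) * \<mu>) + \<bar>F2 i x\<bar> powr (\<mu> * p i))))"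
        by (intro AE_I2 norm_mono_nonneg powr_ge_zero le)
      show "(\<lambda>x. g2 x powr \<mu>) \<in> borel_measurable lborel"
        unfolding measurable_lborel2 by (intro powr_real_measurable g2m borel_measurable_const)
    qed
    fix x
    show "\<bar>a2 i x\<bar> \<le> (\<Sum>i\<in>UNIV. \<beta> i) * \<bar>G2 x $ i\<bar> powr (p i - 1)" for i
    proof (cases "x \<in> S2")
      case True
      then have "\<bar>a2 i x\<bar> \<le> \<beta> i * \<bar>G2 x $ i\<bar> powr (p i - 1)" using QS[OF True] by (simp add: a2_def G2_def Q_def)
      also have "\<dots> \<le> (\<Sum>i\<in>UNIV. \<beta> i) * \<bar>G2 x $ i\<bar> powr (p i - 1)"
        by (intro mult_right_mono member_le_sum \<beta>0) auto
      finally show ?thesis .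
    qed (simp add: off)
    show "\<alpha> * (\<Sum>i\<in>UNIV. \<bar>G2 x $ i\<bar> powr p i) \<le> (\<Sum>i\<in>UNIV. a2 i x * G2 x $ i)"
    proof (cases "x \<in> S2")
      case True
      then show ?thesis using QS[OF True] by (simp add: a2_def G2_def Q_def)
    qed (simp add: off)
    show "\<bar>e2 i x\<bar> powr conj_exp (p i) \<le> g2 x * (1 + \<bar>u2 x\<bar> powr harmonic_mean p)" for i
    proof -
      let ?c = "conj_exp (p i)" and ?U = "\<bar>u2 x\<bar> powr harmonic_mean p"
      have hb: "\<bar>hB2 i x\<bar> powr ?c \<le> b2 i x powr ?c * ?U"
      proof -
        have "\<bar>hB2 i x\<bar> \<le> b2 i x * \<bar>u2 x\<bar> powr (harmonic_mean p / ?c)"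
          using QS[of x] by (cases "x \<in> S2") (auto simp: off Q_def hB2_def b2_def u2_def)
        then have "\<bar>hB2 i x\<bar> powr ?c \<le> (b2 i x * \<bar>u2 x\<bar> powr (harmonic_mean p / ?c)) powr ?c"
          using cexp[of i] by (intro powr_mono2) auto
        also have "\<dots> = b2 i x powr ?c * ?U" using b20[of i x] cexp(1)[of i] by (simp add: powr_mult powr_powr)
        finally show ?thesis .
      qed
      have "\<bar>e2 i x\<bar> powr ?c \<le> (\<bar>hB2 i x\<bar> + \<bar>f2 i x\<bar>) powr ?c"
        unfolding e2_def using cexp[of i] by (intro powr_mono2 abs_triangle_ineq4) auto
      also have "\<dots> \<le> 2 powr ?c * (\<bar>hB2 i x\<bar> powr ?c + \<bar>f2 i x\<bar> powr ?c)"
        using cexp[of i] by (intro powr_add_le) auto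
      also have "\<dots> \<le> 2 powr ?c * (b2 i x powr ?c * ?U + \<bar>F2 i x\<bar> powr p i)"
        unfolding f2_def flux_of_datum[OF p] by (intro mult_left_mono add_right_mono hb) auto
      also have "\<dots> \<le> 2 powr ?c * ((b2 i x powr ?c + \<bar>F2 i x\<bar> powr p i) * (1 + ?U))"
        by (intro mult_left_mono) (auto simp: algebra_simps)
      also have "\<dots> \<le> g2 x * (1 + ?U)"
        unfolding g2_def mult.assoc[symmetric]
        by (intro mult_right_mono member_le_sum[of i UNIV "\<lambda>i. 2 powr conj_exp (p i) * (b2 i x powr conj_exp (p i) + \<bar>F2 i x\<bar> powr p i)"])
          (auto intro!: mult_nonneg_nonneg add_nonneg_nonneg)
      finally show ?thesis .
    qed
  qed
  interpret D: aniso_data p N x0 R2 \<alpha> "\<Sum>i\<in>UNIV. \<beta> i" \<mu> u2 G2 a2 e2 g2 by (rule data)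
  have equation: "(\<Sum>i\<in>UNIV. \<integral>x. partial_deriv i \<phi> x * (a2 i x + e2 i x) \<partial>lborel) = 0" if \<phi>: "\<phi> \<in> test_funs ?C2" for \<phi>
  proof -
    have \<phi>\<Omega>: "\<phi> \<in> test_funs \<Omega>" using C12 B0 by (intro test_funs_mono[OF _ \<phi>]) auto
    have z: "partial_deriv i \<phi> x = 0" if "x \<notin> ?C2" for x i
      using \<phi> that by - (erule test_funsE, blast)
    have pm: "partial_deriv i \<phi> \<in> borel_measurable borel" for i by (rule test_funs_borel[OF test_funs_pd[OF \<phi>]])
    have pp: "integrable lborel (\<lambda>x. \<bar>partial_deriv i \<phi> x\<bar> powr p i)" for i
      by (rule integrable_powr_test_funs[OF test_funs_pd[OF \<phi>] p_pos])
    have if2: "integrable lborel (\<lambda>x. partial_deriv i \<phi> x * f2 i x)" for i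
    proof (rule Hoelder_conj(1)[OF p _ _ pp])
      have "integrable lborel (\<lambda>x. \<bar>F2 i x\<bar> powr p i)" unfolding F2_def by (rule i2[OF LI[OF FLp SmF] SmF])
      then show "integrable lborel (\<lambda>x. \<bar>f2 i x\<bar> powr conj_exp (p i))" unfolding f2_def flux_of_datum[OF p] .
    qed (use pm f2m in simp_all)
    have iae: "integrable lborel (\<lambda>x. partial_deriv i \<phi> x * (a2 i x + e2 i x))" for i
      by (rule Hoelder_conj(1)[OF p _ _ pp D.flux_integrable]) (use pm a2m e2m in simp_all)
    note T = LINT_eq_lborel(1)[OF \<Omega>l S2B(3) S2ae]
    have lhs: "(LINT x|lebesgue_on \<Omega>. (A i x (G x) + B i x (u x)) * partial_deriv i \<phi> x)
       = (\<integral>x. partial_deriv i \<phi> x * (a2 i x + e2 i x) \<partial>lborel) + (\<integral>x. partial_deriv i \<phi> x * f2 i x \<partial>lborel)" for i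
    proof -
      have e: "(\<lambda>x. if x \<in> S2 then (A i x (G x) + B i x (u x)) * partial_deriv i \<phi> x else 0)
         = (\<lambda>x. partial_deriv i \<phi> x * (a2 i x + hB2 i x))"
        using QS by (intro ext) (auto simp: a2_def hB2_def Q_def)
      have m: "(\<lambda>x. partial_deriv i \<phi> x * (a2 i x + hB2 i x)) \<in> borel_measurable borel"
        by (intro borel_measurable_times borel_measurable_add pm a2m hB2m)
      have "(LINT x|lebesgue_on \<Omega>. (A i x (G x) + B i x (u x)) * partial_deriv i \<phi> x)
        = (\<integral>x. (if x \<in> S2 then (A i x (G x) + B i x (u x)) * partial_deriv i \<phi> x else 0) \<partial>lborel)"
      proof (rule T)
        show "(A i x (G x) + B i x (u x)) * partial_deriv i \<phi> x = 0" if "x \<notin> ?C2" for x using z[OF that] by simp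
        show "x \<in> ?C2" if "x \<in> S2" for x using that S2B(1) by blast
      qed (simp only: e m)
      also have "\<dots> = (\<integral>x. partial_deriv i \<phi> x * (a2 i x + e2 i x) + partial_deriv i \<phi> x * f2 i x \<partial>lborel)"
        unfolding e by (intro Bochner_Integration.integral_cong) (auto simp: e2_def algebra_simps)
      also have "\<dots> = (\<integral>x. partial_deriv i \<phi> x * (a2 i x + e2 i x) \<partial>lborel) + (\<integral>x. partial_deriv i \<phi> x * f2 i x \<partial>lborel)"
        by (rule Bochner_Integration.integral_add[OF iae if2])
      finally show ?thesis .
    qed
    have rhs: "(LINT x|lebesgue_on \<Omega>. \<bar>F i x\<bar> powr (p i - 2) * F i x * partial_deriv i \<phi> x) = (\<integral>x. partial_deriv i \<phi> x * f2 i x \<partial>lborel)" for i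
    proof -
      have e: "(\<lambda>x. if x \<in> S2 then \<bar>F i x\<bar> powr (p i - 2) * F i x * partial_deriv i \<phi> x else 0) = (\<lambda>x. partial_deriv i \<phi> x * f2 i x)"
        by (intro ext) (auto simp: f2_def F2_def)
      have m: "(\<lambda>x. partial_deriv i \<phi> x * f2 i x) \<in> borel_measurable borel"
        by (intro borel_measurable_times pm f2m)
      have "(LINT x|lebesgue_on \<Omega>. \<bar>F i x\<bar> powr (p i - 2) * F i x * partial_deriv i \<phi> x)
         = (\<integral>x. (if x \<in> S2 then \<bar>F i x\<bar> powr (p i - 2) * F i x * partial_deriv i \<phi> x else 0) \<partial>lborel)"
      proof (rule T)
        show "\<bar>F i x\<bar> powr (p i - 2) * F i x * partial_deriv i \<phi> x = 0" if "x \<notin> ?C2" for x using z[OF that] by simp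
        show "x \<in> ?C2" if "x \<in> S2" for x using that S2B(1) by blast
      qed (simp only: e m)
      then show ?thesis unfolding e .
    qed
    from eq[OF \<phi>\<Omega>] show ?thesis unfolding lhs rhs by (simp add: sum.distrib)
  qed
  have E: "aniso_equation p N x0 R2 \<alpha> (\<Sum>i\<in>UNIV. \<beta> i) \<mu> u2 G2 a2 e2 g2"
    by (intro aniso_equation.intro aniso_equation_axioms.intro data equation)
  obtain M1 where M1: "AE x in lborel. x \<in> ball x0 (R2 / 2) \<longrightarrow> u2 x \<le> M1"
    using aniso_equation.locally_bounded_above[OF E] by blast
  obtain M2 where M2: "AE x in lborel. x \<in> ball x0 (R2 / 2) \<longrightarrow> - u2 x \<le> M2"
    using aniso_equation.locally_bounded_above[OF aniso_equation_uminus[OF E]] by blast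
  have "AE x in lborel. x \<in> ball x0 (R2 / 2) \<longrightarrow> \<bar>u x\<bar> \<le> max M1 M2"
    using M1 M2 S2ae
  proof eventually_elim
    case (elim x)
    show ?case
    proof
      assume x: "x \<in> ball x0 (R2 / 2)"
      then have "x \<in> S2" using elim(3) R12 by auto
      then show "\<bar>u x\<bar> \<le> max M1 M2" using elim(1,2) x by (auto simp: u2_def)
    qed
  qed
  then show ?thesis using R12(1) by (intro exI[of _ "R2 / 2"]) auto
qed

theorem theorem2p4:
  fixes \<Omega> :: "(real^'n) set"
    and p \<beta> r :: "'n \<Rightarrow> real"
    and \<alpha> :: real
    and A :: "'n \<Rightarrow> real^'n \<Rightarrow> real^'n \<Rightarrow> real"
    and B :: "'n \<Rightarrow> real^'n \<Rightarrow> real \<Rightarrow> real"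
    and b F :: "'n \<Rightarrow> real^'n \<Rightarrow> real"
    and u :: "real^'n \<Rightarrow> real"
  assumes "CARD('n) > 2"
    and "open \<Omega>" and "connected \<Omega>" and "\<Omega> \<noteq> {}"
    and "\<And>i. p i > 1"
    and "structure_A \<Omega> p \<alpha> \<beta> A"
    and "structure_B \<Omega> p b B"
    and "1 < harmonic_mean p" and "harmonic_mean p < real CARD('n)"
    and "sobolev_conj p > (MAX i. p i)"
    and "\<And>i. b i \<in> Leb_loc \<Omega> (r i / (p i - 1))"
    and "\<And>i. F i \<in> Leb_loc \<Omega> (r i)"
    and "(MIN i. r i / p i) > real CARD('n) / harmonic_mean p"
    and "local_solution \<Omega> p A B F u"
  shows "loc_bounded \<Omega> u"
  unfolding loc_bounded_def
proof (intro allI impI)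
  fix U :: "(real^'n) set"
  assume U: "open U \<and> U \<subset>\<subset> \<Omega>"
  have dim: "CARD('n) > 1" using assms(1) by simp
  note near = local_solution_bounded_near[OF dim assms(2,5,6,7,9-14)]
  obtain \<rho> where \<rho>1: "\<forall>y\<in>\<Omega>. 0 < \<rho> y \<and> (\<exists>M. AE x in lborel. x \<in> ball y (\<rho> y) \<longrightarrow> \<bar>u x\<bar> \<le> M)"
    using bchoice[of \<Omega> "\<lambda>y \<rho>. 0 < \<rho> \<and> (\<exists>M. AE x in lborel. x \<in> ball y \<rho> \<longrightarrow> \<bar>u x\<bar> \<le> M)"] near by blast
  obtain M where M: "\<forall>y\<in>\<Omega>. AE x in lborel. x \<in> ball y (\<rho> y) \<longrightarrow> \<bar>u x\<bar> \<le> M y"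
    using bchoice[of \<Omega> "\<lambda>y M. AE x in lborel. x \<in> ball y (\<rho> y) \<longrightarrow> \<bar>u x\<bar> \<le> M"] \<rho>1 by blast
  have \<rho>: "\<And>y. y \<in> \<Omega> \<Longrightarrow> 0 < \<rho> y" "\<And>y. y \<in> \<Omega> \<Longrightarrow> AE x in lborel. x \<in> ball y (\<rho> y) \<longrightarrow> \<bar>u x\<bar> \<le> M y"
    using \<rho>1 M by auto
  have K: "compact (closure U)" "closure U \<subseteq> \<Omega>" using U by (auto simp: compactly_inside_def)
  have cov: "closure U \<subseteq> (\<Union>y\<in>closure U. ball y (\<rho> y))" using \<rho>(1) K(2) centre_in_ball by blast
  obtain D where D: "D \<subseteq> closure U" "finite D" "closure U \<subseteq> (\<Union>y\<in>D. ball y (\<rho> y))"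
    by (rule compactE_image[OF K(1) _ cov]) auto
  have "AE x in lborel. \<forall>y\<in>D. x \<in> ball y (\<rho> y) \<longrightarrow> \<bar>u x\<bar> \<le> M y"
    using D(1) K(2) by (intro AE_finite_allI[OF D(2)] \<rho>(2)) blast
  then have "AE x in lborel. x \<in> U \<longrightarrow> \<bar>u x\<bar> \<le> Max (insert 0 (M ` D))"
  proof eventually_elim
    case (elim x)
    show ?case
    proof
      assume "x \<in> U"
      then obtain y where y: "y \<in> D" "x \<in> ball y (\<rho> y)" using D(3) closure_subset by blast
      then have "\<bar>u x\<bar> \<le> M y" using elim by blast
      also have "\<dots> \<le> Max (insert 0 (M ` D))" using y(1) D(2) by (intro Max_ge) auto
      finally show "\<bar>u x\<bar> \<le> Max (insert 0 (M ` D))" .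
    qed
  qed
  moreover have "U \<in> sets lebesgue" using U by simp
  ultimately show "\<exists>M. AE x in lebesgue_on U. \<bar>u x\<bar> \<le> M"
    using AE_lebesgue_on_iff by blast
qed

end
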